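(* Let $d>1$ be an integer and let $f:\mathbb{C}\times\mathbb{P}^1\ni(\lambda,z)\mapsto z^d+\lambda=:f_\lambda(z)\in\mathbb{P}^1$ be the monic and centered unicritical polynomials family of degree $d$. Then for every $\eta>1$, there is a polar subset $E=E_{f,\eta}$ in $\mathbb{C}$ such that for every $a\in\mathbb{C}\setminus E$ and every $C^2$ test function $\phi$ on $\mathbb{P}^1$, $$\int_{\mathbb{P}^1}\phi(\lambda)\,\mathrm{d}\left(\frac{((f_\lambda^n)'(\lambda))^*\delta_a}{d^n-1}-\mu_{C_d}\right)(\lambda)=O((\eta/d)^n)\quad\text{as }n\to\infty.$$
   Context: $\mathbb{P}^1=\mathbb{C}\cup\{\infty\}$ is the Riemann sphere. $f_\lambda^n$ is the $n$-th iterate of $f_\lambda$ in $z$, and $(f_\lambda^n)'(\lambda)$ is its $z$-derivative evaluated at the critical value $z=\lambda$; as a function of $\lambda$ it is a polynomial in $\mathbb{C}[\lambda]$ of degree $d^n-1$, regarded as a rational map $\mathbb{P}^1\to\mathbb{P}^1$. $\delta_z$ is the Dirac measure at $z\in\mathbb{P}^1$. For a rational function $h$ of degree $>0$, $h^*\delta_a=\sum_{w\in h^{-1}(a)}(\deg_w h)\,\delta_w$, where $\deg_w h$ is the local degree of $h$ at $w$. $K(f_\lambda)=\{z\in\mathbb{C}:\limsup_{n\to\infty}|f_\lambda^n(z)|<\infty\}$ is the filled-in Julia set, $C_d:=\{\lambda\in\mathbb{C}:\lambda\in K(f_\lambda)\}$ is the connectedness locus of the family (a compact subset of $\mathbb{C}$),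 and $\mu_{C_d}$ is the harmonic measure on $C_d$ with pole $\infty$ (i.e. the harmonic measure of the domain $\mathbb{P}^1\setminus C_d$ with respect to $\infty$), a probability measure on $\mathbb{P}^1$. "Polar" is in the sense of classical logarithmic potential theory. *)

theory Defs
  imports
    "HOL-Analysis.Analysis"
    "HOL-Probability.Probability"
    "HOL-Library.Landau_Symbols"
begin

section \<open>The Riemann sphere\<close>

datatype sphere = Fin complex | Infty

definition chart_infty :: "complex \<Rightarrow> sphere" where
  "chart_infty w = (if w = 0 then Infty else Fin (1 / w))"

text \<open>The topology is the final one for the two charts \<^const>\<open>Fin\<close> and \<^const>\<open>chart_infty\<close>,
  each of which is a homeomorphism of the plane onto an open subset of the sphere.\<close>

instantiation sphere :: topological_space
begin

definition open_sphere :: "sphere set \<Rightarrow> bool" where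
  "open_sphere U \<longleftrightarrow> open (Fin -` U) \<and> open (chart_infty -` U)"

instance
  by standard (auto simp: open_sphere_def vimage_Union)

end

definition C2 :: "(complex \<Rightarrow> real) \<Rightarrow> bool" where
  "C2 g \<longleftrightarrow>
     (\<exists>(g' :: complex \<Rightarrow> complex \<Rightarrow>\<^sub>L real) (g'' :: complex \<Rightarrow> complex \<Rightarrow>\<^sub>L complex \<Rightarrow>\<^sub>L real).
        (\<forall>z. (g has_derivative blinfun_apply (g' z)) (at z)) \<and>
        (\<forall>z. (g' has_derivative blinfun_apply (g'' z)) (at z)) \<and>
        continuous_on UNIV g'')"

definition C2_sphere :: "(sphere \<Rightarrow> real) \<Rightarrow> bool" where
  "C2_sphere \<phi> \<longleftrightarrow> C2 (\<phi> \<circ> Fin) \<and> C2 (\<phi> \<circ> chart_infty)"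

section \<open>Subharmonic functions and polar sets\<close>

text \<open>The Lebesgue integral of an extended real function whose positive part has finite
  integral; the value \<open>-\<infinity>\<close> is possible.\<close>

definition ereal_integral :: "'a measure \<Rightarrow> ('a \<Rightarrow> ereal) \<Rightarrow> ereal" where
  "ereal_integral M u =
     enn2ereal (\<integral>\<^sup>+ x. e2ennreal (u x) \<partial>M) - enn2ereal (\<integral>\<^sup>+ x. e2ennreal (- u x) \<partial>M)"

definition circle_mean :: "(complex \<Rightarrow> ereal) \<Rightarrow> complex \<Rightarrow> real \<Rightarrow> ereal" where
  "circle_mean u z r =
     ereal_integral (uniform_measure lborel {0..2 * pi}) (\<lambda>t. u (z + of_real r * cis t))"

text \<open>Upper semicontinuity, values in \<open>[-\<infinity>, \<infinity>)\<close>, and the local submean inequality. The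
  function that is identically \<open>-\<infinity>\<close> is admitted. The set \<open>U\<close> is automatically open.\<close>

definition subharmonic_on :: "complex set \<Rightarrow> (complex \<Rightarrow> ereal) \<Rightarrow> bool" where
  "subharmonic_on U u \<longleftrightarrow>
     (\<forall>z\<in>U. u z < \<infinity>) \<and>
     (\<forall>z\<in>U. Limsup (at z) u \<le> u z) \<and>
     (\<forall>z\<in>U. \<exists>\<rho>>0. ball z \<rho> \<subseteq> U \<and> (\<forall>r. 0 \<le> r \<and> r < \<rho> \<longrightarrow> u z \<le> circle_mean u z r))"

definition subharmonic_on_sphere :: "sphere set \<Rightarrow> (sphere \<Rightarrow> ereal) \<Rightarrow> bool" where
  "subharmonic_on_sphere D u \<longleftrightarrow>
     subharmonic_on (Fin -` D) (u \<circ> Fin) \<and> subharmonic_on (chart_infty -` D) (u \<circ> chart_infty)"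

definition polar :: "complex set \<Rightarrow> bool" where
  "polar E \<longleftrightarrow>
     (\<exists>u. subharmonic_on UNIV u \<and> (\<exists>z. u z \<noteq> -\<infinity>) \<and> (\<forall>z\<in>E. u z = -\<infinity>))"

section \<open>Harmonic measure\<close>

definition perron :: "sphere set \<Rightarrow> (sphere \<Rightarrow> real) \<Rightarrow> sphere \<Rightarrow> ereal" where
  "perron D \<phi> z =
     (SUP u \<in> {u. subharmonic_on_sphere D u \<and>
                  (\<forall>\<zeta>\<in>frontier D. Limsup (at \<zeta> within D) u \<le> ereal (\<phi> \<zeta>))}. u z)"

definition is_harmonic_measure :: "sphere set \<Rightarrow> sphere \<Rightarrow> sphere measure \<Rightarrow> bool" where
  "is_harmonic_measure D z \<mu> \<longleftrightarrow>
     sets \<mu> = sets borel \<and> prob_space \<mu> \<and> emeasure \<mu> (- frontier D) = 0 \<and>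
     (\<forall>\<phi>. continuous_on (frontier D) \<phi> \<longrightarrow>
        perron D \<phi> z = ereal (LINT \<zeta>:frontier D|\<mu>. \<phi> \<zeta>))"

definition harmonic_measure :: "sphere set \<Rightarrow> sphere \<Rightarrow> sphere measure" where
  "harmonic_measure D z = (THE \<mu>. is_harmonic_measure D z \<mu>)"

section \<open>Pullback of Dirac measures\<close>

text \<open>A polynomial as a self-map of the sphere.\<close>

definition sphere_map :: "complex poly \<Rightarrow> sphere \<Rightarrow> sphere" where
  "sphere_map p w =
     (case w of Fin z \<Rightarrow> Fin (poly p z)
              | Infty \<Rightarrow> if degree p = 0 then Fin (coeff p 0) else Infty)"

definition local_degree :: "complex poly \<Rightarrow> sphere \<Rightarrow> nat" where
  "local_degree p w =
     (case w of Fin z \<Rightarrow> order z (p - [:poly p z:]) | Infty \<Rightarrow> degree p)"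

text \<open>Meaningful for \<open>degree p > 0\<close>. The \<^const>\<open>distr\<close> only restricts the sigma-algebra to the
  Borel sets.\<close>

definition pullback_dirac :: "complex poly \<Rightarrow> sphere \<Rightarrow> sphere measure" where
  "pullback_dirac p a =
     distr (density (count_space UNIV)
              (\<lambda>w. if sphere_map p w = a then of_nat (local_degree p w) else 0))
       borel (\<lambda>w. w)"

section \<open>The unicritical family\<close>

definition unicritical :: "nat \<Rightarrow> complex \<Rightarrow> complex \<Rightarrow> complex" where
  "unicritical d c z = z ^ d + c"

definition filled_julia :: "(complex \<Rightarrow> complex) \<Rightarrow> complex set" where
  "filled_julia f = {z. limsup (\<lambda>n. ereal (cmod ((f ^^ n) z))) < \<infinity>}"

definition connectedness_locus :: "nat \<Rightarrow> complex set" where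
  "connectedness_locus d = {c. c \<in> filled_julia (unicritical d c)}"

definition deriv_at_critical_value :: "nat \<Rightarrow> nat \<Rightarrow> complex poly" where
  "deriv_at_critical_value d n = (THE p. \<forall>c. poly p c = deriv (unicritical d c ^^ n) c)"

text \<open>The following lemmas show that the description is proper: the polynomial exists, is unique,
  and has degree \<open>d ^ n - 1\<close>.\<close>

primrec critical_value_poly :: "nat \<Rightarrow> nat \<Rightarrow> complex poly" where
  "critical_value_poly d 0 = [:0, 1:]"
| "critical_value_poly d (Suc n) = critical_value_poly d n ^ d + [:0, 1:]"

lemma poly_critical_value_poly:
  "poly (critical_value_poly d n) c = (unicritical d c ^^ n) c"
  by (induction n) (auto simp: unicritical_def)

lemma degree_critical_value_poly:
  assumes "d > 1"
  shows "degree (critical_value_poly d n) = d ^ n"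
proof (induction n)
  case (Suc n)
  have deg: "degree (critical_value_poly d n ^ d) = d ^ Suc n"
    by (cases "critical_value_poly d n = 0")
       (use Suc assms in \<open>auto simp: degree_power_eq\<close>)
  have "1 < d ^ Suc n"
    using assms by (intro one_less_power) auto
  then have "degree [:0, 1 :: complex:] < degree (critical_value_poly d n ^ d)"
    using deg by simp
  then show ?case
    using deg by (simp only: critical_value_poly.simps degree_add_eq_left)
qed auto

lemma has_derivative_unicritical_iterate:
  "((unicritical d c ^^ n) has_field_derivative
      (\<Prod>k<n. of_nat d * (unicritical d c ^^ k) z ^ (d - 1))) (at z)"
proof (induction n)
  case 0
  show ?case by (simp add: id_def)
next
  case (Suc n)
  have "unicritical d c ^^ Suc n = (\<lambda>w. (unicritical d c ^^ n) w ^ d + c)"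
    by (auto simp: unicritical_def)
  then show ?case
    by (auto intro!: derivative_eq_intros Suc simp: mult_ac)
qed

lemma deriv_at_critical_value_eq:
  "deriv_at_critical_value d n = (\<Prod>k<n. of_nat d * critical_value_poly d k ^ (d - 1))"
proof -
  let ?q = "\<Prod>k<n. of_nat d * critical_value_poly d k ^ (d - 1) :: complex poly"
  have q: "poly ?q c = deriv (unicritical d c ^^ n) c" for c
    using DERIV_imp_deriv[OF has_derivative_unicritical_iterate[where z = c]]
    by (simp add: poly_prod poly_critical_value_poly)
  show ?thesis
    unfolding deriv_at_critical_value_def
  proof (rule the_equality)
    show "p = ?q" if "\<forall>c. poly p c = deriv (unicritical d c ^^ n) c" for p
      using that q by (simp flip: poly_eq_poly_eq_iff add: fun_eq_iff)
  qed (use q in blast)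
qed

lemma poly_deriv_at_critical_value:
  "poly (deriv_at_critical_value d n) c = deriv (unicritical d c ^^ n) c"
  using DERIV_imp_deriv[OF has_derivative_unicritical_iterate[where z = c]]
  by (simp add: deriv_at_critical_value_eq poly_prod poly_critical_value_poly)

lemma degree_deriv_at_critical_value:
  assumes "d > 1"
  shows "degree (deriv_at_critical_value d n) = d ^ n - 1"
proof -
  have nz: "critical_value_poly d k \<noteq> 0" for k
    using degree_critical_value_poly[OF assms, of k] assms by auto
  have "degree (deriv_at_critical_value d n) =
      (\<Sum>k<n. degree (of_nat d * critical_value_poly d k ^ (d - 1)))"
    unfolding deriv_at_critical_value_eq using nz assms
    by (intro degree_prod_eq_sum_degree) auto
  also have "\<dots> = (\<Sum>k<n. (d - 1) * d ^ k)"
    using nz assms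
    by (intro sum.cong) (auto simp: degree_mult_eq degree_power_eq degree_critical_value_poly)
  also have "\<dots> = d ^ n - 1"
  proof (induction n)
    case (Suc n)
    have "1 \<le> d ^ n" using assms by simp
    then show ?case using Suc assms by (simp add: algebra_simps)
  qed auto
  finally show ?thesis .
qed

end

(* The function ln |P_n - a|, where P_n(c) is the derivative of the n-th iterate at the critical value,
   is compared with (d^n - 1) times the Green function of the connectedness locus M.

   By the escape estimates ln max(1, |P_n|) differs from (d^n - 1) times the Green function by
   O(n^2 ln(2 + |c|)), the expansion of the iterates controlling how close a critical orbit can come to 0.
   The difference of ln |P_n - a| and ln max(1, |P_n|) is small on average for most a: with nu a finite
   measure equivalent to area measure, the logarithmic potential of the measure
   sum_n eta^-n (P_n)_* nu is finite off a polar set, and where it is finite the nu-integral of that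
   difference is O(eta^n). Integrating against the Laplacian of a C^2 function on the sphere, which is
   bounded by a multiple of the density of nu, turns both comparisons into the claim, because
   the Laplacian of ln |P_n - a| is the sum over the roots of P_n = a, and that of
   the Green function is the harmonic measure (up to the same constant).

   The harmonic measure is obtained as a limit of the smoothed equilibrium measures on level
   curves of the Green function. They integrate harmonic functions on the complement of M, which
   solve the Dirichlet problem because the Green function is a barrier, to the value at infinity. *)

theory Submission
  imports Defs
    "HOL-Complex_Analysis.Complex_Analysis"
    "HOL-Real_Asymp.Real_Asymp"
    "HOL-Computational_Algebra.Fundamental_Theorem_Algebra"
begin

section \<open>Circle means\<close>

text \<open>The truncation at 1 makes the escape estimate hold at every parameter.
  \<open>P n\<close> vanishes where the critical value lands on 0 before time n, so
  \<open>ln\<close> of its modulus has no lower bound there; but at parameters in M the Green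
  function is 0 and \<open>logp\<close> is nonnegative, and outside M the orbit stays away from 0.
  By the chain rule \<open>P n\<close> is a product over k < n, and the geometric sum of (d - 1) d^k
  produces the coefficient d^n - 1. Each of the n factors loses a logarithm of order n at most; this
  n^2 disappears in \<eta>^n because \<eta> > 1. The bad values a are the poles of one potential,
  hence the exceptional set serves all test functions at once. No distributional Laplacian occurs:
  logarithms of polynomials are cut off near their zeros to C^2 functions, whose Laplacian has total
  mass proportional to the degree. The Dirichlet problem lives in the coordinate 1/z, where the
  escape region is bounded. The Green function tends to 0 at every finite boundary point, so it is a
  weak barrier without a positive lower bound away from the point under study. This is why the
  boundary argument needs a second function, a Poisson integral.\<close>

lemma ereal_integral_mono:
  assumes "\<And>x. x \<in> space M \<Longrightarrow> u x \<le> v x"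
  shows "ereal_integral M u \<le> ereal_integral M v"
  unfolding ereal_integral_def
proof (rule ereal_minus_mono)
  show "enn2ereal (\<integral>\<^sup>+ x. e2ennreal (u x) \<partial>M) \<le> enn2ereal (\<integral>\<^sup>+ x. e2ennreal (v x) \<partial>M)"
    unfolding less_eq_ennreal.rep_eq[symmetric]
    by (intro nn_integral_mono e2ennreal_mono assms)
  show "enn2ereal (\<integral>\<^sup>+ x. e2ennreal (- v x) \<partial>M) \<le> enn2ereal (\<integral>\<^sup>+ x. e2ennreal (- u x) \<partial>M)"
    unfolding less_eq_ennreal.rep_eq[symmetric]
    by (intro nn_integral_mono e2ennreal_mono) (simp add: assms)
qed

lemma ereal_integral_ereal:
  assumes "integrable M f"
  shows "ereal_integral M (\<lambda>x. ereal (f x)) = ereal (\<integral>x. f x \<partial>M)"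
proof -
  have e: "e2ennreal (ereal x) = ennreal x" for x
    by (simp add: ennreal.abs_eq e2ennreal_def max_def ennreal_def)
  have "(\<integral>\<^sup>+ x. ennreal (f x) \<partial>M) < \<infinity>" "(\<integral>\<^sup>+ x. ennreal (- f x) \<partial>M) < \<infinity>"
    using assms unfolding real_integrable_def by (auto simp: top.not_eq_extremum)
  then show ?thesis
    unfolding ereal_integral_def real_lebesgue_integral_def[OF assms] uminus_ereal.simps e
    by (cases "\<integral>\<^sup>+ x. ennreal (f x) \<partial>M"; cases "\<integral>\<^sup>+ x. ennreal (- f x) \<partial>M")
       (auto simp: enn2ereal_ennreal)
qed

definition circ :: "real measure" where
  "circ = uniform_measure lborel {0..2 * pi}"

lemma sets_circ [simp, measurable_cong]: "sets circ = sets borel"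
  by (simp add: circ_def)

lemma space_circ [simp]: "space circ = UNIV"
  by (simp add: circ_def)

lemma emeasure_Icc_pi: "emeasure lborel {0..2 * pi} = ennreal (2 * pi)"
  by (simp add: emeasure_lborel_Icc)

interpretation circ: prob_space circ
  unfolding circ_def
  by (rule prob_space_uniform_measure) (auto simp: emeasure_lborel_Icc_eq)

lemma AE_circ: "AE t in circ. t \<in> {0..2 * pi}"
  unfolding circ_def by (rule AE_uniform_measureI) auto

lemma circle_mean_circ: "circle_mean u z r = ereal_integral circ (\<lambda>t. u (z + of_real r * cis t))"
  by (simp add: circle_mean_def circ_def)

lemma circ_density:
  "circ = density lborel (\<lambda>t. ennreal (indicator {0..2 * pi} t / (2 * pi)))"
  unfolding circ_def uniform_measure_def emeasure_Icc_pi
  by (intro arg_cong[where f = "density lborel"] ext)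
     (auto simp: indicator_def divide_ennreal[symmetric] ennreal_1[symmetric] simp del: ennreal_1)

lemma circ_integral:
  fixes f :: "real \<Rightarrow> 'b :: {banach, second_countable_topology}"
  assumes [measurable]: "f \<in> borel_measurable borel"
  shows "(\<integral>t. f t \<partial>circ) = (1 / (2 * pi)) *\<^sub>R (LINT t:{0..2 * pi}|lborel. f t)"
proof -
  have "(\<integral>t. f t \<partial>circ) = (\<integral>t. (indicator {0..2 * pi} t / (2 * pi)) *\<^sub>R f t \<partial>lborel)"
    unfolding circ_density by (rule integral_density) auto
  also have "\<dots> = (\<integral>t. (1 / (2 * pi)) *\<^sub>R (indicator {0..2 * pi} t *\<^sub>R f t) \<partial>lborel)"
    by simp
  finally show ?thesis
    unfolding set_lebesgue_integral_def by (simp only: integral_scaleR_right)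
qed

lemma circ_integrable:
  fixes f :: "real \<Rightarrow> 'b :: {banach, second_countable_topology}"
  assumes [measurable]: "f \<in> borel_measurable borel" and "\<And>t. norm (f t) \<le> B"
  shows "integrable circ f"
  by (rule circ.integrable_const_bound[where B = B]) (use assms in auto)

lemma circ_integrable_continuous:
  fixes f :: "real \<Rightarrow> 'b :: {banach, second_countable_topology}"
  assumes "continuous_on UNIV f"
  shows "integrable circ f"
proof -
  have "compact (f ` {0..2 * pi})"
    using assms by (intro compact_continuous_image) (auto intro: continuous_on_subset)
  then obtain B where "\<And>t. t \<in> {0..2 * pi} \<Longrightarrow> norm (f t) \<le> B"
    using compact_imp_bounded bounded_iff by (metis image_eqI)
  then have "AE t in circ. norm (f t) \<le> B"
    using AE_circ by (rule eventually_mono[rotated])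
  moreover have "f \<in> borel_measurable circ"
    using borel_measurable_continuous_onI[OF assms] by simp
  ultimately show ?thesis
    by (intro circ.integrable_const_bound[where B = B])
qed

lemma continuous_on_circle:
  assumes "continuous_on (sphere z \<bar>r\<bar>) f"
  shows "continuous_on UNIV (\<lambda>t. f (z + of_real r * cis t))"
  by (rule continuous_on_compose2[OF assms])
     (auto intro!: continuous_intros simp: dist_norm norm_mult)

text \<open>Cauchy's formula at the centre of the circle; the path derivative contributes the factor
  \<open>\<i>\<close>, which is divided out.\<close>

lemma holomorphic_mean_value:
  assumes "continuous_on (cball z r) f" "f holomorphic_on ball z r" "r > 0"
  shows "(\<integral>t. f (z + of_real r * cis t) \<partial>circ) = f z"
proof -
  have c: "continuous_on UNIV (\<lambda>t. f (z + of_real r * cis t))"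
    using assms by (intro continuous_on_circle) (auto elim: continuous_on_subset)
  have "((\<lambda>u. f u / (u - z)) has_contour_integral (2 * of_real pi * \<i> * f z))
          (part_circlepath z r 0 (2 * pi))"
    using Cauchy_integral_circlepath[OF assms(1,2), of z] assms(3) by (simp add: circlepath_def)
  then have "((\<lambda>t. f (z + r * cis t) / (z + r * cis t - z) * r * \<i> * cis t) has_integral
      (2 * of_real pi * \<i> * f z)) {0..2 * pi}"
    by (subst (asm) has_contour_integral_part_circlepath_iff) auto
  then have "((\<lambda>t. f (z + r * cis t) * \<i>) has_integral (2 * of_real pi * \<i> * f z)) {0..2 * pi}"
    using assms(3) by (simp add: mult.assoc divide_simps cong: has_integral_cong)
  then have "((\<lambda>t. (f (z + r * cis t) * \<i>) * (- \<i>)) has_integral (2 * of_real pi * \<i> * f z) * (-\<i>)) {0..2 * pi}"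
    by (rule has_integral_mult_left)
  then have 1: "((\<lambda>t. f (z + r * cis t)) has_integral (2 * of_real pi * f z)) {0..2 * pi}"
    by (simp add: mult_ac)
  have "set_integrable lborel {0..2 * pi} (\<lambda>t. f (z + r * cis t))"
    by (intro borel_integrable_atLeastAtMost') (use c in \<open>auto intro: continuous_on_subset\<close>)
  from has_integral_set_lebesgue[OF set_integrable_restrict_space] this 1
  have "(LINT t:{0..2 * pi}|lborel. f (z + r * cis t)) = 2 * of_real pi * f z"
    using set_borel_integral_eq_integral(2)[of "{0..2 * pi}" "\<lambda>t. f (z + r * cis t)"]
    by (simp add: integral_unique)
  then show ?thesis
    using c by (subst circ_integral)
      (auto intro!: borel_measurable_continuous_onI simp: scaleR_conv_of_real)
qed

text \<open>Locally the real part of a holomorphic function. This form yields mean values from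
  Cauchy's formula, smoothness from complex derivatives and stability under holomorphic
  substitution; it also forces S to be open.\<close>

definition harmonic_on :: "complex set \<Rightarrow> (complex \<Rightarrow> real) \<Rightarrow> bool" where
  "harmonic_on S h \<longleftrightarrow>
     (\<forall>z\<in>S. \<exists>r>0. \<exists>F. ball z r \<subseteq> S \<and> F holomorphic_on ball z r \<and> (\<forall>w\<in>ball z r. h w = Re (F w)))"

text \<open>A separate notion, because mean values over small circles survive limits: the Green
  function obtains them by dominated convergence, and they suffice for the maximum
  principle.\<close>

definition mean_value_on :: "complex set \<Rightarrow> (complex \<Rightarrow> real) \<Rightarrow> bool" where
  "mean_value_on S h \<longleftrightarrow> continuous_on S h \<and>
     (\<forall>z\<in>S. \<exists>\<rho>>0. ball z \<rho> \<subseteq> S \<and> (\<forall>r. 0 < r \<and> r < \<rho> \<longrightarrow> (\<integral>t. h (z + of_real r * cis t) \<partial>circ) = h z))"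

lemma Re_holomorphic_mean_value:
  assumes "F holomorphic_on ball z \<rho>" "0 < r" "r < \<rho>" "\<And>w. w \<in> ball z \<rho> \<Longrightarrow> h w = Re (F w)"
  shows "(\<integral>t. h (z + of_real r * cis t) \<partial>circ) = h z"
proof -
  have *: "continuous_on (cball z r) F"
    using assms by (intro holomorphic_on_imp_continuous_on holomorphic_on_subset[OF assms(1)]) auto
  then have int: "integrable circ (\<lambda>t. F (z + of_real r * cis t))"
    using assms by (intro circ_integrable_continuous continuous_on_circle) (auto elim: continuous_on_subset)
  have "(\<integral>t. h (z + of_real r * cis t) \<partial>circ) = (\<integral>t. Re (F (z + of_real r * cis t)) \<partial>circ)"
    using assms by (intro Bochner_Integration.integral_cong refl) (auto simp: dist_norm norm_mult)
  also have "\<dots> = Re (\<integral>t. F (z + of_real r * cis t) \<partial>circ)"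
    using int by simp
  also have "\<dots> = Re (F z)"
    using assms * by (subst holomorphic_mean_value) (auto intro: holomorphic_on_subset)
  finally show ?thesis using assms by auto
qed

lemma harmonic_on_continuous: "harmonic_on S h \<Longrightarrow> continuous_on S h"
  unfolding continuous_on_def
proof
  fix z assume *: "harmonic_on S h" "z \<in> S"
  then obtain r F where r: "r > 0" "ball z r \<subseteq> S" "F holomorphic_on ball z r" "\<And>w. w \<in> ball z r \<Longrightarrow> h w = Re (F w)"
    unfolding harmonic_on_def by blast
  have "continuous_on (ball z r) (\<lambda>w. Re (F w))"
    using r by (intro continuous_intros holomorphic_on_imp_continuous_on)
  then have "continuous_on (ball z r) h"
    by (rule continuous_on_eq) (use r(4) in auto)
  then have "isCont h z" using r by (simp add: continuous_on_eq_continuous_at)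
  then show "(h \<longlongrightarrow> h z) (at z within S)"
    unfolding isCont_def by (rule filterlim_mono) (auto simp: at_le)
qed

lemma harmonic_on_imp_mean_value: "harmonic_on S h \<Longrightarrow> mean_value_on S h"
  unfolding mean_value_on_def
proof (intro conjI ballI)
  fix z assume *: "harmonic_on S h" "z \<in> S"
  then obtain r F where r: "r > 0" "ball z r \<subseteq> S" "F holomorphic_on ball z r" "\<And>w. w \<in> ball z r \<Longrightarrow> h w = Re (F w)"
    unfolding harmonic_on_def by blast
  have "(\<integral>t. h (z + of_real r' * cis t) \<partial>circ) = h z" if "0 < r'" "r' < r" for r'
    by (rule Re_holomorphic_mean_value[OF r(3) that]) (rule r(4))
  with r(1,2) show "\<exists>\<rho>>0. ball z \<rho> \<subseteq> S \<and> (\<forall>r. 0 < r \<and> r < \<rho> \<longrightarrow> (\<integral>t. h (z + of_real r * cis t) \<partial>circ) = h z)"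
    by (intro exI[of _ r] conjI allI impI) auto
qed (rule harmonic_on_continuous)

lemma harmonic_on_open: "harmonic_on S h \<Longrightarrow> open S"
  unfolding harmonic_on_def open_contains_ball by metis

lemma harmonic_on_diff: "harmonic_on S h \<Longrightarrow> harmonic_on S k \<Longrightarrow> harmonic_on S (\<lambda>z. h z - k z)"
  unfolding harmonic_on_def
proof
  fix z assume h: "\<forall>z\<in>S. \<exists>r>0. \<exists>F. ball z r \<subseteq> S \<and> F holomorphic_on ball z r \<and> (\<forall>w\<in>ball z r. h w = Re (F w))"
    and k: "\<forall>z\<in>S. \<exists>r>0. \<exists>F. ball z r \<subseteq> S \<and> F holomorphic_on ball z r \<and> (\<forall>w\<in>ball z r. k w = Re (F w))"
    and z: "z \<in> S"
  obtain r F where r: "r > 0" "ball z r \<subseteq> S" "F holomorphic_on ball z r" "\<And>w. w \<in> ball z r \<Longrightarrow> h w = Re (F w)"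
    using h z by metis
  obtain r' F' where r': "r' > 0" "ball z r' \<subseteq> S" "F' holomorphic_on ball z r'" "\<And>w. w \<in> ball z r' \<Longrightarrow> k w = Re (F' w)"
    using k z by metis
  show "\<exists>r>0. \<exists>F. ball z r \<subseteq> S \<and> F holomorphic_on ball z r \<and> (\<forall>w\<in>ball z r. h w - k w = Re (F w))"
    using r r' by (intro exI[of _ "min r r'"] conjI exI[of _ "\<lambda>w. F w - F' w"] holomorphic_on_diff)
      (auto intro: holomorphic_on_subset)
qed

lemma harmonic_on_compose:
  assumes "harmonic_on T h" "f holomorphic_on S" "open S" "f ` S \<subseteq> T"
  shows "harmonic_on S (\<lambda>z. h (f z))"
  unfolding harmonic_on_def
proof
  fix z assume z: "z \<in> S"
  then obtain r F where r: "r > 0" "ball (f z) r \<subseteq> T" "F holomorphic_on ball (f z) r" "\<And>w. w \<in> ball (f z) r \<Longrightarrow> h w = Re (F w)"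
    using assms unfolding harmonic_on_def by (metis image_subset_iff)
  have "open (S \<inter> f -` ball (f z) r)"
    using assms by (intro continuous_open_preimage holomorphic_on_imp_continuous_on) auto
  then obtain e where e: "e > 0" "ball z e \<subseteq> S \<inter> f -` ball (f z) r"
    using z r(1) by (metis IntI centre_in_ball open_contains_ball vimageI)
  have "(F \<circ> f) holomorphic_on ball z e"
    using e by (intro holomorphic_on_compose_gen[OF holomorphic_on_subset[OF assms(2)] r(3)]) auto
  then show "\<exists>r>0. \<exists>F. ball z r \<subseteq> S \<and> F holomorphic_on ball z r \<and> (\<forall>w\<in>ball z r. h (f w) = Re (F w))"
    using e r(4) by (intro exI[of _ e] conjI exI[of _ "F \<circ> f"]) auto
qed

lemma harmonic_on_ln_norm:
  assumes "f holomorphic_on S" "open S" "\<And>z. z \<in> S \<Longrightarrow> f z \<noteq> 0"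
  shows "harmonic_on S (\<lambda>z. ln (cmod (f z)))"
  unfolding harmonic_on_def
proof
  fix z assume "z \<in> S"
  then obtain e where e: "e > 0" "ball z e \<subseteq> S"
    using assms open_contains_ball by metis
  obtain g where "g holomorphic_on ball z e" "\<And>w. w \<in> ball z e \<Longrightarrow> f w = exp (g w)"
    using contractible_imp_holomorphic_log[of f "ball z e"] assms e
    by (metis convex_ball convex_imp_contractible holomorphic_on_subset subsetD)
  then show "\<exists>r>0. \<exists>F. ball z r \<subseteq> S \<and> F holomorphic_on ball z r \<and> (\<forall>w\<in>ball z r. ln (cmod (f w)) = Re (F w))"
    using e by (intro exI[of _ e] conjI exI[of _ g]) auto
qed

section \<open>The maximum principle\<close>

text \<open>If u exceeded s somewhere, u - s would attain a positive maximum on a compact subset of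
  S. At the rightmost point of the set of maxima, a small circle contains a point further to the
  right, hence an arc on which u - s is definitely smaller, and the mean inequalities contradict
  each other. Taking the rightmost point makes the argument work for disconnected S.\<close>

lemma maximum_principle:
  fixes u :: "complex \<Rightarrow> ereal" and s :: "complex \<Rightarrow> real"
  assumes S: "bounded S" "open S"
    and fin: "\<And>z. z \<in> S \<Longrightarrow> u z < \<infinity>"
    and usc: "\<And>z. z \<in> S \<Longrightarrow> Limsup (at z) u \<le> u z"
    and sub: "\<And>z. z \<in> S \<Longrightarrow> \<exists>\<rho>>0. \<forall>r. 0 < r \<and> r < \<rho> \<longrightarrow> u z \<le> circle_mean u z r"
    and s: "continuous_on S s"
    and sup: "\<And>z. z \<in> S \<Longrightarrow> \<exists>\<rho>>0. \<forall>r. 0 < r \<and> r < \<rho> \<longrightarrow> (\<integral>t. s (z + of_real r * cis t) \<partial>circ) \<le> s z"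
    and bdry: "\<And>\<zeta> \<epsilon>. \<zeta> \<in> frontier S \<Longrightarrow> \<epsilon> > 0 \<Longrightarrow> eventually (\<lambda>z. u z \<le> ereal (s z + \<epsilon>)) (at \<zeta> within S)"
    and z: "z \<in> S"
  shows "u z \<le> ereal (s z)"
proof (rule ccontr)
  assume neg: "\<not> u z \<le> ereal (s z)"
  \<comment> \<open>The sets where u - s is at least c. For c > 0 they are closed in the plane:
    semicontinuity handles limits in S, the boundary condition excludes limits on the
    frontier.\<close>
  define K where "K c = {z\<in>S. ereal (s z + c) \<le> u z}" for c
  have ev: "eventually (\<lambda>y. u y < ereal (s y + b')) (nhds x)"
    if x: "x \<in> S" and b: "u x < ereal (s x + b)" "b < b'" for x b b'
  proof -
    have "Limsup (at x) u < ereal (s x + b)"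
      using usc[OF x] b(1) by simp
    then have 1: "eventually (\<lambda>y. u y < ereal (s x + b)) (at x)"
      by (rule Limsup_lessD)
    have "isCont s x"
      using s S x by (simp add: continuous_on_eq_continuous_at)
    then have "(s \<longlongrightarrow> s x) (at x)" by (simp add: isCont_def)
    then have "eventually (\<lambda>y. s y > s x - (b' - b)) (at x)"
      using b by (intro order_tendstoD) auto
    with 1 have "eventually (\<lambda>y. u y < ereal (s y + b')) (at x)"
    proof eventually_elim
      case (elim y)
      have "ereal (s x + b) \<le> ereal (s y + b')" using elim by simp
      then show ?case using elim by (meson less_le_trans)
    qed
    moreover have "u x < ereal (s x + b')"
      using b by (meson add_strict_left_mono ereal_less(2) ereal_less_eq(3) less_imp_le less_le_trans)
    ultimately show ?thesis
      by (simp add: eventually_nhds_conv_at)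
  qed
  have comp: "compact (K c)" if c: "c > 0" for c
    unfolding compact_eq_bounded_closed
  proof
    show "bounded (K c)" by (rule bounded_subset[OF S(1)]) (auto simp: K_def)
    show "closed (K c)"
      unfolding closed_sequential_limits
    proof safe
      fix x l assume x: "\<forall>n. x n \<in> K c" "x \<longlonglongrightarrow> l"
      then have xS: "x n \<in> S" for n by (auto simp: K_def)
      show "l \<in> K c"
      proof (cases "l \<in> S")
        case True
        have "ereal (s l + c) \<le> u l"
        proof (rule ccontr)
          assume "\<not> ?thesis"
          then obtain e where e: "u l < ereal e" "ereal e < ereal (s l + c)"
            using ereal_dense2[of "u l" "ereal (s l + c)"] by (auto simp: not_le)
          have "eventually (\<lambda>y. u y < ereal (s y + c)) (nhds l)"
            by (rule ev[OF True, of "e - s l"]) (use e in auto)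
          then have "eventually (\<lambda>n. u (x n) < ereal (s (x n) + c)) sequentially"
            using x(2) unfolding filterlim_iff by blast
          then show False
            using x(1) by (auto simp: K_def eventually_sequentially not_le[symmetric])
        qed
        then show ?thesis using True by (simp add: K_def)
      next
        case False
        have "l \<in> closure S" using xS x(2) closure_sequential by blast
        then have "l \<in> frontier S"
          using False S by (simp add: frontier_def interior_open)
        from bdry[OF this, of "c/2"] c
        have "eventually (\<lambda>z. u z \<le> ereal (s z + c/2)) (at l within S)" by simp
        moreover have "filterlim x (at l within S) sequentially"
          unfolding filterlim_at using x(2) xS False by (auto intro!: always_eventually)
        ultimately have "eventually (\<lambda>n. u (x n) \<le> ereal (s (x n) + c/2)) sequentially"
          unfolding filterlim_iff by blast
        then obtain n where n: "u (x n) \<le> ereal (s (x n) + c/2)" by (auto simp: eventually_sequentially)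
        have "ereal (s (x n) + c) \<le> u (x n)" using x(1) by (simp add: K_def)
        with n have "ereal (s (x n) + c) \<le> ereal (s (x n) + c/2)" by (rule order_trans[rotated])
        then show ?thesis using c by simp
      qed
    qed
  qed
  define I where "I = {c. c > 0 \<and> K c \<noteq> {}}"
  have "\<exists>c>0. ereal (s z + c) \<le> u z"
  proof -
    obtain e where "ereal (s z) < ereal e" "ereal e < u z"
      using neg ereal_dense2[of "ereal (s z)" "u z"] by (auto simp: not_le)
    then show ?thesis by (intro exI[of _ "e - s z"]) auto
  qed
  then have I: "I \<noteq> {}" using z by (auto simp: I_def K_def)
  have mono: "K c' \<subseteq> K c" if "c \<le> c'" for c c'
  proof
    fix x assume "x \<in> K c'"
    then show "x \<in> K c"
      using that unfolding K_def by (smt (verit) ereal_less_eq(3) mem_Collect_eq order_trans)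
  qed
  obtain c0 where c0: "c0 \<in> I" using I by auto
  \<comment> \<open>The sets K c shrink as c grows, so compactness gives a point that lies in every
    nonempty one; there u - s takes its largest value.\<close>
  have "K c0 \<inter> (\<Inter>c\<in>I. K c) \<noteq> {}"
  proof (rule compact_imp_fip_image)
    show "compact (K c0)" using c0 comp by (auto simp: I_def)
    show "closed (K c)" if "c \<in> I" for c using that comp compact_imp_closed by (auto simp: I_def)
    fix J assume J: "finite J" "J \<subseteq> I"
    define c where "c = Max (insert c0 J)"
    have "c \<in> insert c0 J" unfolding c_def using J by (intro Max_in) auto
    then have "K c \<noteq> {}" using J c0 by (auto simp: I_def)
    moreover have "K c \<subseteq> K c'" if "c' \<in> insert c0 J" for c'
      using that J by (intro mono) (auto simp: c_def)
    ultimately show "K c0 \<inter> (\<Inter>c\<in>J. K c) \<noteq> {}" by blast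
  qed
  then obtain x where x: "x \<in> S" "\<And>c. c \<in> I \<Longrightarrow> ereal (s x + c) \<le> u x"
    using c0 by (auto simp: K_def)
  have ux: "u x \<noteq> \<infinity>" "u x \<noteq> -\<infinity>" using fin[OF x(1)] x(2)[OF c0] by auto
  then obtain ur where ur: "u x = ereal ur" by (cases "u x") auto
  have bdd: "bdd_above I" using x(2) ur by (intro bdd_aboveI[of _ "ur - s x"]) (fastforce simp: algebra_simps)
  define M where "M = Sup I"
  have M: "M > 0" using less_le_trans[OF _ cSup_upper[OF c0 bdd], of 0] c0 by (simp add: M_def I_def)
  have "M \<le> ur - s x" unfolding M_def using I x(2) ur by (intro cSup_least) (auto simp: algebra_simps)
  then have xM: "x \<in> K M" using x ur by (simp add: K_def)
  have le: "u y \<le> ereal (s y + M)" if y: "y \<in> S" for y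
  proof (rule ccontr)
    assume "\<not> ?thesis"
    then obtain e where e: "ereal (s y + M) < ereal e" "ereal e < u y"
      using ereal_dense2[of "ereal (s y + M)" "u y"] by (auto simp: not_le)
    then have "e - s y \<in> I" using y M by (auto simp: I_def K_def intro!: exI[of _ y])
    then have "e - s y \<le> M" unfolding M_def using bdd by (rule cSup_upper)
    then show False using e by simp
  qed
  have "continuous_on (K M) Re" by (intro continuous_intros)
  then obtain p where p: "p \<in> K M" "\<And>y. y \<in> K M \<Longrightarrow> Re y \<le> Re p"
    using continuous_attains_sup[of "K M" Re] comp[OF M] xM by auto
  have pS: "p \<in> S" using p by (simp add: K_def)
  obtain \<rho>0 where \<rho>0: "\<rho>0 > 0" "ball p \<rho>0 \<subseteq> S" using S pS open_contains_ball by metis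
  obtain \<rho>1 where \<rho>1: "\<rho>1 > 0" "\<And>r. 0 < r \<Longrightarrow> r < \<rho>1 \<Longrightarrow> u p \<le> circle_mean u p r"
    using sub[OF pS] by blast
  obtain \<rho>2 where \<rho>2: "\<rho>2 > 0" "\<And>r. 0 < r \<Longrightarrow> r < \<rho>2 \<Longrightarrow> (\<integral>t. s (p + of_real r * cis t) \<partial>circ) \<le> s p"
    using sup[OF pS] by blast
  define r where "r = min \<rho>0 (min \<rho>1 \<rho>2) / 2"
  have r: "r > 0" "r < \<rho>0" "r < \<rho>1" "r < \<rho>2" using \<rho>0 \<rho>1 \<rho>2 by (auto simp: r_def min_def)
  define c where "c t = p + of_real r * cis t" for t
  have cS: "c t \<in> S" for t
    using r \<rho>0 by (auto simp: c_def dist_norm norm_mult intro!: subsetD[OF \<rho>0(2)])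
  \<comment> \<open>\<open>c 0\<close> is the point of the circle that lies r to the right of
    p.\<close>
  have "c 0 \<notin> K M" using p(2)[of "c 0"] r by (auto simp: c_def)
  then have "u (c 0) < ereal (s (c 0) + M)" using cS[of 0] by (auto simp: K_def not_le)
  then obtain e where e: "u (c 0) < ereal e" "ereal e < ereal (s (c 0) + M)"
    using ereal_dense2[of "u (c 0)" "ereal (s (c 0) + M)"] by auto
  define b where "b = ((e - s (c 0)) + M) / 2"
  have b: "b < M" using e by (simp add: b_def)
  have "eventually (\<lambda>y. u y < ereal (s y + b)) (nhds (c 0))"
    using e by (intro ev[of _ "e - s (c 0)"] cS) (auto simp: b_def)
  then obtain U where U: "open U" "c 0 \<in> U" "\<And>y. y \<in> U \<Longrightarrow> u y < ereal (s y + b)"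
    by (auto simp: eventually_nhds)
  define A where "A = c -` U"
  have contc: "continuous_on UNIV c" unfolding c_def by (intro continuous_intros)
  have oA: "open A" unfolding A_def using contc U(1) by (simp add: continuous_on_open_vimage)
  have [measurable]: "A \<in> sets borel" using oA by simp
  have "0 \<in> A" using U by (simp add: A_def)
  then obtain \<tau> where \<tau>: "\<tau> > 0" "ball 0 \<tau> \<subseteq> A" using oA open_contains_ball by metis
  have posA: "circ.prob A > 0"
  proof -
    define \<tau>' where "\<tau>' = min (\<tau>/2) 1"
    have t': "0 < \<tau>'" "\<tau>' < \<tau>" "\<tau>' \<le> 2 * pi" using \<tau> pi_gt3 by (auto simp: \<tau>'_def min_def)
    have "{0..\<tau>'} \<subseteq> A" using \<tau> t' by (auto simp: dist_real_def intro!: subsetD[OF \<tau>(2)])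
    then have "circ.prob {0..\<tau>'} \<le> circ.prob A" by (intro circ.finite_measure_mono) auto
    moreover have "circ.prob {0..\<tau>'} = \<tau>' / (2 * pi)"
      using t' by (simp add: circ_def measure_uniform_measure emeasure_lborel_Icc_eq)
    ultimately show ?thesis using t' by (smt (verit) divide_pos_pos pi_gt_zero)
  qed
  have ints: "integrable circ (\<lambda>t. s (c t))"
    using cS by (intro circ_integrable_continuous continuous_on_compose2[OF s contc]) auto
  have intA: "integrable circ (indicator A :: real \<Rightarrow> real)"
    by (intro integrable_real_indicator) (auto simp: circ.emeasure_eq_measure)
  have "circle_mean u p r \<le> ereal_integral circ (\<lambda>t. ereal (s (c t) + M - (M - b) * indicator A t))"
    unfolding circle_mean_circ c_def[symmetric]
  proof (rule ereal_integral_mono)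
    fix t
    show "u (c t) \<le> ereal (s (c t) + M - (M - b) * indicator A t)"
      using le[OF cS, of t] U(3)[of "c t"] by (cases "t \<in> A") (auto simp: A_def)
  qed
  also have "\<dots> = ereal (\<integral>t. (s (c t) + M - (M - b) * indicator A t) \<partial>circ)"
    by (intro ereal_integral_ereal Bochner_Integration.integrable_diff Bochner_Integration.integrable_add
        ints integrable_mult_right intA) simp
  also have "(\<integral>t. (s (c t) + M - (M - b) * indicator A t) \<partial>circ) = (\<integral>t. s (c t) \<partial>circ) + M - (M - b) * circ.prob A"
    using Bochner_Integration.integral_diff[OF Bochner_Integration.integrable_add[OF ints
        circ.integrable_const[of M]] integrable_mult_right[OF intA, of "M - b"]]
      Bochner_Integration.integral_add[OF ints circ.integrable_const[of M]]
    using circ.prob_space by simp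
  also have "\<dots> < s p + M"
    using \<rho>2(2)[OF r(1,4)] mult_pos_pos[of "M - b" "circ.prob A"] posA b unfolding c_def by linarith
  also have "ereal (s p + M) \<le> u p" using p(1) by (simp add: K_def)
  finally show False using \<rho>1(2)[OF r(1,3)] by simp
qed

section \<open>The Poisson integral\<close>

text \<open>The kernel is kept as the real part of (e + w) / (e - w): this is holomorphic in w and
  has an explicit power series, while \<open>poisson_kernel_eq\<close> recovers the usual quotient
  for estimates.\<close>

definition poisson :: "complex \<Rightarrow> real \<Rightarrow> (complex \<Rightarrow> real) \<Rightarrow> complex \<Rightarrow> real" where
  "poisson c R b z =
     (\<integral>t. Re ((of_real R * cis t + (z - c)) / (of_real R * cis t - (z - c))) * b (c + of_real R * cis t) \<partial>circ)"

lemma poisson_kernel_eq: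
  assumes "cmod e = R"
  shows "Re ((e + w) / (e - w)) = (R\<^sup>2 - (cmod w)\<^sup>2) / (cmod (e - w))\<^sup>2"
proof -
  have "R\<^sup>2 = (Re e)\<^sup>2 + (Im e)\<^sup>2" using assms cmod_power2 by metis
  then show ?thesis
    by (simp add: Re_divide cmod_power2) (simp add: power2_eq_square algebra_simps)
qed

lemma poisson_kernel_nonneg:
  assumes "cmod w < R"
  shows "Re ((of_real R * cis t + w) / (of_real R * cis t - w)) \<ge> 0"
proof -
  have R: "R > 0" using assms norm_ge_zero[of w] by linarith
  have "(cmod w)\<^sup>2 \<le> R\<^sup>2" using assms by (intro power_mono) auto
  then show ?thesis
    using R by (subst poisson_kernel_eq[where R = R]) (auto simp: norm_mult intro!: divide_nonneg_nonneg)
qed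

lemma circle_diff_lower:
  assumes "cmod w < R" shows "cmod (of_real R * cis t - w) \<ge> R - cmod w"
  using norm_triangle_ineq2[of "of_real R * cis t" w] assms norm_ge_zero[of w]
  by (simp add: norm_mult)

lemma poisson_kernel_continuous:
  assumes "cmod w < R"
  shows "continuous_on UNIV (\<lambda>t. (of_real R * cis t + w) / (of_real R * cis t - w))"
proof -
  have "of_real R * cis t - w \<noteq> 0" for t
    using circle_diff_lower[OF assms, of t] assms by auto
  then show ?thesis by (intro continuous_intros) auto
qed

text \<open>On the circle e * cnj e = R^2, so the conjugate of the kernel extends, as a function of
  e, to F, which is holomorphic on the disc. The mean value of F is F 0 = 1.\<close>

lemma poisson_kernel_integral:
  assumes w: "cmod w < R"
  shows "(\<integral>t. Re ((of_real R * cis t + w) / (of_real R * cis t - w)) \<partial>circ) = 1"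
proof -
  have R: "R > 0" using w norm_ge_zero[of w] by linarith
  define F where "F u = (of_real (R\<^sup>2) + cnj w * u) / (of_real (R\<^sup>2) - cnj w * u)" for u :: complex
  have nz: "of_real (R\<^sup>2) - cnj w * u \<noteq> 0" if "u \<in> cball 0 R" for u
  proof
    assume "of_real (R\<^sup>2) - cnj w * u = 0"
    then have "cmod (of_real (R\<^sup>2)) = cmod (cnj w * u)" by simp
    then have "R * R = cmod w * cmod u" using R by (simp add: norm_mult power2_eq_square)
    moreover have "cmod w * cmod u \<le> cmod w * R" using that by (intro mult_left_mono) auto
    moreover have "cmod w * R < R * R" using w R by simp
    ultimately show False by linarith
  qed
  have holo: "F holomorphic_on ball 0 R" and cont: "continuous_on (cball 0 R) F"
    unfolding F_def using nz by (auto intro!: holomorphic_intros continuous_intros simp del: of_real_power)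
  have int: "integrable circ (\<lambda>t. F (0 + of_real R * cis t))"
    by (intro circ_integrable_continuous continuous_on_circle continuous_on_subset[OF cont]) (use R in auto)
  have eq: "Re ((of_real R * cis t + w) / (of_real R * cis t - w)) = Re (F (0 + of_real R * cis t))" for t
  proof -
    define e where "e = of_real R * cis t"
    have e: "cmod e = R" using R by (simp add: e_def norm_mult)
    have "of_real (R\<^sup>2) = e * cnj e" by (simp only: complex_norm_square[symmetric] e)
    then have "F e = (e * (cnj e + cnj w)) / (e * (cnj e - cnj w))" unfolding F_def by (simp add: algebra_simps)
    also have "\<dots> = cnj ((e + w) / (e - w))" using e R by auto
    finally have "Re (F e) = Re (cnj ((e + w) / (e - w)))" by (rule arg_cong)
    then show ?thesis by (simp only: cnj.simps e_def add_0)
  qed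
  have "(\<integral>t. Re ((of_real R * cis t + w) / (of_real R * cis t - w)) \<partial>circ) = Re (\<integral>t. F (0 + of_real R * cis t) \<partial>circ)"
    unfolding eq using int by (rule integral_Re)
  also have "\<dots> = 1"
    by (subst holomorphic_mean_value[OF cont holo R]) (use R in \<open>simp add: F_def\<close>)
  finally show ?thesis .
qed

lemma poisson_center: "R > 0 \<Longrightarrow> poisson c R b c = (\<integral>t. b (c + of_real R * cis t) \<partial>circ)"
  by (simp add: poisson_def)

context
  fixes c :: complex and R M :: real and b :: "complex \<Rightarrow> real"
  assumes b [measurable]: "(\<lambda>t. b (c + of_real R * cis t)) \<in> borel_measurable borel"
    and bM: "\<And>t. \<bar>b (c + of_real R * cis t)\<bar> \<le> M"
begin

lemma poisson_cplx_integrable: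
  assumes w: "cmod w < R"
  shows "integrable circ (\<lambda>t. (of_real R * cis t + w) / (of_real R * cis t - w) * of_real (b (c + of_real R * cis t)))"
proof (rule circ_integrable)
  have [measurable]: "(\<lambda>t. (of_real R * cis t + w) / (of_real R * cis t - w)) \<in> borel_measurable borel"
    by (intro borel_measurable_continuous_onI poisson_kernel_continuous w)
  show "(\<lambda>t. (of_real R * cis t + w) / (of_real R * cis t - w) * of_real (b (c + of_real R * cis t))) \<in> borel_measurable borel"
    by measurable
  fix t
  have M: "M \<ge> 0" using bM[of 0] by linarith
  have R: "R > 0" using w norm_ge_zero[of w] by linarith
  have "norm ((of_real R * cis t + w) / (of_real R * cis t - w)) \<le> (R + cmod w) / (R - cmod w)"
    unfolding norm_divide using w norm_triangle_ineq[of "of_real R * cis t" w] R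
    by (intro frac_le circle_diff_lower) (auto simp: norm_mult intro!: add_nonneg_nonneg)
  then show "norm ((of_real R * cis t + w) / (of_real R * cis t - w) * of_real (b (c + of_real R * cis t))) \<le> (R + cmod w) / (R - cmod w) * M"
    unfolding norm_mult using bM[of t] M R w by (intro mult_mono divide_nonneg_nonneg add_nonneg_nonneg) auto
qed

lemma poisson_integrable:
  assumes w: "cmod w < R"
  shows "integrable circ (\<lambda>t. Re ((of_real R * cis t + w) / (of_real R * cis t - w)) * b (c + of_real R * cis t))"
proof -
  have "Re (k * of_real r) = Re k * r" for k r by simp
  then show ?thesis using integrable_Re[OF poisson_cplx_integrable[OF w]] by (simp only:)
qed

text \<open>Expanding the kernel in powers of w and integrating termwise exhibits the integral as
  the real part of a power series about c.\<close>

lemma poisson_harmonic: "harmonic_on (ball c R) (poisson c R b)"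
proof -
  define a where "a k = (\<integral>t. (if k = 0 then 1 else 2) * of_real (b (c + of_real R * cis t)) / (of_real R * cis t) ^ k \<partial>circ)" for k
  define G where "G z = (\<integral>t. (of_real R * cis t + (z - c)) / (of_real R * cis t - (z - c)) * of_real (b (c + of_real R * cis t)) \<partial>circ)" for z
  have M: "M \<ge> 0" using bM[of 0] by linarith
  have "G holomorphic_on ball c R"
  proof (rule power_series_holomorphic)
    fix z assume "z \<in> ball c R"
    define w where "w = z - c"
    have w: "cmod w < R" using \<open>z \<in> ball c R\<close> by (simp add: w_def dist_norm norm_minus_commute)
    have R: "R > 0" using w norm_ge_zero[of w] by linarith
    define q where "q = cmod w / R"
    have q: "0 \<le> q" "q < 1" using w R by (auto simp: q_def)
    define f where "f k t = (if k = 0 then 1 else 2) * of_real (b (c + of_real R * cis t)) / (of_real R * cis t) ^ k * w ^ k" for k :: nat and t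
    have fb: "norm (f k t) \<le> 2 * M * q ^ k" for k t
    proof -
      have "norm (f k t) = (if k = 0 then 1 else 2) * \<bar>b (c + of_real R * cis t)\<bar> * q ^ k"
        using R by (auto simp: f_def norm_mult norm_divide norm_power q_def power_divide)
      also have "\<dots> \<le> 2 * M * q ^ k"
        using bM[of t] q M by (intro mult_right_mono mult_mono) auto
      finally show ?thesis .
    qed
    have im: "(\<lambda>t. 1 / (of_real R * cis t) ^ k) \<in> borel_measurable borel" for k
      using R by (intro borel_measurable_continuous_onI continuous_intros) auto
    have fm: "f k \<in> borel_measurable borel" for k
    proof -
      have "f k = (\<lambda>t. (if k = 0 then 1 else 2) * of_real (b (c + of_real R * cis t)) * (1 / (of_real R * cis t) ^ k) * w ^ k)"
        by (rule ext) (simp add: f_def)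
      moreover have "(\<lambda>t. complex_of_real (b (c + of_real R * cis t))) \<in> borel_measurable borel"
        by (rule measurable_compose[OF b]) simp
      ultimately show ?thesis
        by (simp only:) (intro borel_measurable_times borel_measurable_const im)
    qed
    have fi: "integrable circ (f k)" for k by (rule circ_integrable[OF fm fb])
    have sq: "summable (\<lambda>k. 2 * M * q ^ k)" using q by (intro summable_mult summable_geometric) auto
    have fs: "summable (\<lambda>k. norm (f k t))" for t
      by (rule summable_comparison_test[OF _ sq]) (intro exI[of _ 0], simp add: fb)
    have "summable (\<lambda>k. \<integral>t. norm (f k t) \<partial>circ)"
    proof (rule summable_comparison_test[OF _ sq])
      have "(\<integral>t. norm (f k t) \<partial>circ) \<le> 2 * M * q ^ k" for k
        by (intro circ.integral_le_const integrable_norm fi always_eventually allI fb)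
      moreover have "(\<integral>t. norm (f k t) \<partial>circ) \<ge> 0" for k by simp
      ultimately show "\<exists>N. \<forall>n\<ge>N. norm (\<integral>t. norm (f n t) \<partial>circ) \<le> 2 * M * q ^ n"
        by (intro exI[of _ 0] allI impI) (simp only: real_norm_def abs_of_nonneg)
    qed
    then have "(\<lambda>k. \<integral>t. f k t \<partial>circ) sums (\<integral>t. (\<Sum>k. f k t) \<partial>circ)"
      using fi fs by (intro sums_integral) auto
    moreover have "(\<integral>t. f k t \<partial>circ) = a k * (z - c) ^ k" for k
      unfolding f_def a_def w_def by (rule integral_mult_left_zero)
    moreover have "(\<Sum>k. f k t) = (of_real R * cis t + w) / (of_real R * cis t - w) * of_real (b (c + of_real R * cis t))" for t
    proof -
      define e where "e = of_real R * cis t"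
      have e: "e \<noteq> 0" "cmod e = R" using R by (auto simp: e_def norm_mult)
      then have we: "cmod (w / e) < 1" using w R by (simp add: norm_divide)
      have ne: "e - w \<noteq> 0" using w e by auto
      \<comment> \<open>(e + w) / (e - w) is 2 / (1 - w/e) - 1, which explains the coefficient 1 for
        k = 0 and 2 for the others.\<close>
      have "(\<lambda>k. 2 * (w / e) ^ k) sums (2 * (1 / (1 - w / e)))"
        by (intro sums_mult geometric_sums we)
      then have "(\<lambda>k. 2 * (w / e) ^ k - (if k = 0 then 1 else 0)) sums (2 * (1 / (1 - w / e)) - 1)"
        by (intro sums_diff sums_single[of 0 "\<lambda>_. 1"])
      then have "(\<lambda>k. (2 * (w / e) ^ k - (if k = 0 then 1 else 0)) * of_real (b (c + e))) sums ((2 * (1 / (1 - w / e)) - 1) * of_real (b (c + e)))"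
        by (rule sums_mult2)
      moreover have "2 * (1 / (1 - w / e)) - 1 = (e + w) / (e - w)"
        using e ne by (simp add: field_simps)
      moreover have "(\<lambda>k. (2 * (w / e) ^ k - (if k = 0 then 1 else 0)) * of_real (b (c + e))) = (\<lambda>k. f k t)"
        by (auto simp: f_def e_def[symmetric] power_divide)
      ultimately show ?thesis by (simp add: sums_iff e_def)
    qed
    ultimately show "(\<lambda>n. a n * (z - c) ^ n) sums G z" by (simp add: G_def w_def)
  qed
  moreover have "poisson c R b z = Re (G z)" if "z \<in> ball c R" for z
  proof -
    have "cmod (z - c) < R" using that by (simp add: dist_norm norm_minus_commute)
    note * = integral_Re[OF poisson_cplx_integrable[OF this]]
    have "Re (k * of_real r) = Re k * r" for k r by simp
    then show ?thesis using * unfolding G_def poisson_def by (simp only:)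
  qed
  moreover have "\<exists>r>0. ball z r \<subseteq> ball c R" if "z \<in> ball c R" for z
    using that open_contains_ball[of "ball c R"] by auto
  ultimately show ?thesis
    unfolding harmonic_on_def by (meson holomorphic_on_subset subsetD)
qed

text \<open>Continuity of the data is asked at the one point \<xi>, since the lemma is later applied
  to the indicator function of an open set. Near \<xi> the data vary by at most \<epsilon>/2; at
  distance \<delta> or more from \<xi> the kernel is at most 4 (R^2 - |w|^2) / \<delta>^2, which
  tends to 0.\<close>

lemma poisson_boundary:
  assumes R: "R > 0" and \<xi>: "\<xi> \<in> sphere c R" and cont: "(b \<longlongrightarrow> b \<xi>) (at \<xi> within sphere c R)"
  shows "(poisson c R b \<longlongrightarrow> b \<xi>) (at \<xi> within ball c R)"
proof (rule tendstoI)
  fix \<epsilon> :: real assume \<epsilon>: "\<epsilon> > 0"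
  have M: "M \<ge> 0" using bM[of 0] by linarith
  obtain \<delta> where \<delta>: "\<delta> > 0" "\<And>y. y \<in> sphere c R \<Longrightarrow> y \<noteq> \<xi> \<Longrightarrow> dist y \<xi> < \<delta> \<Longrightarrow> dist (b y) (b \<xi>) < \<epsilon> / 2"
    using tendstoD[OF cont, of "\<epsilon>/2"] \<epsilon> unfolding eventually_at by auto
  obtain t0 where t0: "\<xi> = c + of_real R * cis t0"
  proof -
    have "cmod (\<xi> - c) = R" using \<xi> by (simp add: dist_norm norm_minus_commute)
    then have "\<xi> = c + of_real R * cis (Arg (\<xi> - c))"
      using rcis_cmod_Arg[of "\<xi> - c"] by (simp add: rcis_def)
    then show ?thesis by (rule that)
  qed
  have b\<xi>: "\<bar>b \<xi>\<bar> \<le> M" using bM t0 by simp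
  have "((\<lambda>z. 2 * M * ((R\<^sup>2 - (cmod (z - c))\<^sup>2) * 4 / \<delta>\<^sup>2)) \<longlongrightarrow> 2 * M * ((R\<^sup>2 - (cmod (\<xi> - c))\<^sup>2) * 4 / \<delta>\<^sup>2)) (at \<xi> within ball c R)"
    using \<delta> by (intro tendsto_intros) auto
  moreover have "2 * M * ((R\<^sup>2 - (cmod (\<xi> - c))\<^sup>2) * 4 / \<delta>\<^sup>2) = 0"
    using \<xi> by (simp add: dist_norm norm_minus_commute)
  ultimately have "eventually (\<lambda>z. 2 * M * ((R\<^sup>2 - (cmod (z - c))\<^sup>2) * 4 / \<delta>\<^sup>2) < \<epsilon> / 2) (at \<xi> within ball c R)"
    using \<epsilon> by (intro order_tendstoD) auto
  moreover have "eventually (\<lambda>z. z \<in> ball c R \<and> dist z \<xi> < \<delta> / 2) (at \<xi> within ball c R)"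
    unfolding eventually_at using \<delta> by (intro exI[of _ "\<delta>/2"]) auto
  ultimately show "eventually (\<lambda>z. dist (poisson c R b z) (b \<xi>) < \<epsilon>) (at \<xi> within ball c R)"
  proof eventually_elim
    case (elim z)
    define w where "w = z - c"
    have w: "cmod w < R" using elim by (simp add: w_def dist_norm norm_minus_commute)
    define K where "K t = Re ((of_real R * cis t + w) / (of_real R * cis t - w))" for t
    have K0: "K t \<ge> 0" for t unfolding K_def by (rule poisson_kernel_nonneg[OF w])
    have Ki: "integrable circ K"
      unfolding K_def by (intro integrable_Re circ_integrable_continuous poisson_kernel_continuous w)
    have K1: "(\<integral>t. K t \<partial>circ) = 1" unfolding K_def by (rule poisson_kernel_integral[OF w])
    have Kb: "integrable circ (\<lambda>t. K t * b (c + of_real R * cis t))"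
      unfolding K_def by (rule poisson_integrable[OF w])
    define D where "D = (R\<^sup>2 - (cmod w)\<^sup>2) * 4 / \<delta>\<^sup>2"
    have D0: "D \<ge> 0" unfolding D_def using w by (auto intro!: divide_nonneg_nonneg mult_nonneg_nonneg power_mono)
    have pt: "\<bar>K t * b (c + of_real R * cis t) - K t * b \<xi>\<bar> \<le> \<epsilon> / 2 * K t + 2 * M * D" for t
    proof (cases "dist (c + of_real R * cis t) \<xi> < \<delta>")
      case True
      have "\<bar>b (c + of_real R * cis t) - b \<xi>\<bar> \<le> \<epsilon> / 2"
      proof (cases "c + of_real R * cis t = \<xi>")
        case False
        with True \<delta>(2)[of "c + of_real R * cis t"] R show ?thesis
          by (simp add: dist_norm norm_mult)
      qed (use \<epsilon> in auto)
      then have "\<bar>K t\<bar> * \<bar>b (c + of_real R * cis t) - b \<xi>\<bar> \<le> K t * (\<epsilon> / 2)"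
        using K0[of t] by (intro mult_mono) auto
      then have "\<bar>K t * b (c + of_real R * cis t) - K t * b \<xi>\<bar> \<le> K t * (\<epsilon> / 2)"
        by (simp add: abs_mult[symmetric] right_diff_distrib)
      moreover have "2 * M * D \<ge> 0" using M D0 by simp
      ultimately show ?thesis by (simp add: mult.commute)
    next
      case False
      have "dist (c + of_real R * cis t) \<xi> \<le> dist (c + of_real R * cis t) z + dist z \<xi>" by (rule dist_triangle)
      then have "dist (c + of_real R * cis t) z \<ge> \<delta> / 2" using False elim by linarith
      then have d: "cmod (of_real R * cis t - w) \<ge> \<delta> / 2" by (simp add: w_def dist_norm algebra_simps)
      have "K t = (R\<^sup>2 - (cmod w)\<^sup>2) / (cmod (of_real R * cis t - w))\<^sup>2"
        unfolding K_def by (rule poisson_kernel_eq) (use R in \<open>simp add: norm_mult\<close>)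
      also have "\<dots> \<le> (R\<^sup>2 - (cmod w)\<^sup>2) / (\<delta> / 2)\<^sup>2"
        using w d \<delta> by (intro divide_left_mono power_mono mult_pos_pos) (auto intro!: power_mono)
      also have "\<dots> = D" by (simp add: D_def field_simps power2_eq_square)
      finally have KD: "K t \<le> D" .
      have "\<bar>b (c + of_real R * cis t) - b \<xi>\<bar> \<le> 2 * M" using bM[of t] b\<xi> by linarith
      then have "\<bar>K t\<bar> * \<bar>b (c + of_real R * cis t) - b \<xi>\<bar> \<le> D * (2 * M)"
        using K0[of t] KD D0 by (intro mult_mono) auto
      then have "\<bar>K t * b (c + of_real R * cis t) - K t * b \<xi>\<bar> \<le> D * (2 * M)"
        by (simp add: abs_mult[symmetric] right_diff_distrib)
      moreover have "\<epsilon> / 2 * K t \<ge> 0" using \<epsilon> K0[of t] by simp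
      ultimately show ?thesis by (simp add: mult_ac)
    qed
    have Kd: "integrable circ (\<lambda>t. K t * b (c + of_real R * cis t) - K t * b \<xi>)"
      using Kb Ki by auto
    have "poisson c R b z - b \<xi> = (\<integral>t. (K t * b (c + of_real R * cis t) - K t * b \<xi>) \<partial>circ)"
      using Kb Ki K1 by (simp add: poisson_def K_def[symmetric] w_def[symmetric])
    also have "\<bar>\<dots>\<bar> \<le> (\<integral>t. \<bar>K t * b (c + of_real R * cis t) - K t * b \<xi>\<bar> \<partial>circ)"
      by (rule integral_abs_bound)
    also have "\<dots> \<le> (\<integral>t. (\<epsilon> / 2 * K t + 2 * M * D) \<partial>circ)"
      using Kd Ki pt by (intro integral_mono) auto
    also have "\<dots> = \<epsilon> / 2 + 2 * M * D"
      using Ki K1 circ.prob_space by simp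
    also have "\<dots> < \<epsilon>" using elim by (simp add: D_def w_def)
    finally show ?case by (simp add: dist_real_def)
  qed
qed

end

section \<open>The Dirichlet problem\<close>

definition submean_on :: "complex set \<Rightarrow> (complex \<Rightarrow> real) \<Rightarrow> bool" where
  "submean_on S f \<longleftrightarrow>
     (\<forall>z\<in>S. \<exists>\<rho>>0. \<forall>r. 0 < r \<and> r < \<rho> \<longrightarrow> f z \<le> (\<integral>t. f (z + of_real r * cis t) \<partial>circ))"

lemma mean_value_on_linear:
  assumes f: "mean_value_on S f" and g: "mean_value_on S g"
  shows "mean_value_on S (\<lambda>z. a + b * f z + c * g z)"
  unfolding mean_value_on_def
proof (intro conjI ballI)
  have cf: "continuous_on S f" and cg: "continuous_on S g" using f g by (auto simp: mean_value_on_def)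
  then show "continuous_on S (\<lambda>z. a + b * f z + c * g z)" by (intro continuous_intros)
  fix z assume z: "z \<in> S"
  obtain \<rho> where \<rho>: "\<rho> > 0" "ball z \<rho> \<subseteq> S" "\<And>r. 0 < r \<Longrightarrow> r < \<rho> \<Longrightarrow> (\<integral>t. f (z + of_real r * cis t) \<partial>circ) = f z"
    using f z unfolding mean_value_on_def by blast
  obtain \<sigma> where \<sigma>: "\<sigma> > 0" "\<And>r. 0 < r \<Longrightarrow> r < \<sigma> \<Longrightarrow> (\<integral>t. g (z + of_real r * cis t) \<partial>circ) = g z"
    using g z unfolding mean_value_on_def by blast
  have "(\<integral>t. a + b * f (z + of_real r * cis t) + c * g (z + of_real r * cis t) \<partial>circ) = a + b * f z + c * g z"
    if r: "0 < r" "r < min \<rho> \<sigma>" for r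
  proof -
    have sub: "sphere z \<bar>r\<bar> \<subseteq> S" using \<rho>(2) r by auto
    have i: "integrable circ (\<lambda>t. f (z + of_real r * cis t))" "integrable circ (\<lambda>t. g (z + of_real r * cis t))"
      using sub cf cg by (auto intro!: circ_integrable_continuous continuous_on_circle intro: continuous_on_subset)
    then show ?thesis using \<rho>(3)[of r] \<sigma>(2)[of r] r circ.prob_space by simp
  qed
  then show "\<exists>\<rho>>0. ball z \<rho> \<subseteq> S \<and> (\<forall>r. 0 < r \<and> r < \<rho> \<longrightarrow>
      (\<integral>t. a + b * f (z + of_real r * cis t) + c * g (z + of_real r * cis t) \<partial>circ) = a + b * f z + c * g z)"
    using \<rho>(1,2) \<sigma>(1) by (intro exI[of _ "min \<rho> \<sigma>"]) auto
qed

lemma mean_value_on_subset: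
  assumes "mean_value_on S f" "T \<subseteq> S" "open T"
  shows "mean_value_on T f"
  unfolding mean_value_on_def
proof (intro conjI ballI)
  show "continuous_on T f" using assms continuous_on_subset by (auto simp: mean_value_on_def)
  fix z assume z: "z \<in> T"
  obtain \<rho> where \<rho>: "\<rho> > 0" "\<And>r. 0 < r \<Longrightarrow> r < \<rho> \<Longrightarrow> (\<integral>t. f (z + of_real r * cis t) \<partial>circ) = f z"
    using assms z unfolding mean_value_on_def by blast
  obtain \<sigma> where "\<sigma> > 0" "ball z \<sigma> \<subseteq> T" using assms(3) z open_contains_ball by metis
  then show "\<exists>\<rho>>0. ball z \<rho> \<subseteq> T \<and> (\<forall>r. 0 < r \<and> r < \<rho> \<longrightarrow> (\<integral>t. f (z + of_real r * cis t) \<partial>circ) = f z)"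
    using \<rho> by (intro exI[of _ "min \<rho> \<sigma>"]) auto
qed

lemma circle_mean_ereal:
  assumes "continuous_on (sphere z \<bar>r\<bar>) f"
  shows "circle_mean (\<lambda>w. ereal (f w)) z r = ereal (\<integral>t. f (z + of_real r * cis t) \<partial>circ)"
  unfolding circle_mean_circ
  by (rule ereal_integral_ereal) (intro circ_integrable_continuous continuous_on_circle assms)

lemma Limsup_at_ereal:
  fixes f :: "complex \<Rightarrow> real"
  assumes "isCont f z" shows "Limsup (at z) (\<lambda>w. ereal (f w)) \<le> ereal (f z)"
proof -
  have "((\<lambda>w. ereal (f w)) \<longlongrightarrow> ereal (f z)) (at z)"
    using assms by (intro tendsto_intros) (simp add: isCont_def)
  from lim_imp_Limsup[OF _ this] show ?thesis by simp
qed

lemma maximum_principle_real: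
  assumes S: "bounded S" "open S"
    and f: "continuous_on S f" "submean_on S f"
    and s: "mean_value_on S s"
    and bdry: "\<And>\<zeta> \<epsilon>. \<zeta> \<in> frontier S \<Longrightarrow> \<epsilon> > 0 \<Longrightarrow> eventually (\<lambda>z. f z \<le> s z + \<epsilon>) (at \<zeta> within S)"
    and z: "z \<in> S"
  shows "f z \<le> s z"
proof -
  have "ereal (f z) \<le> ereal (s z)"
  proof (rule maximum_principle[OF S, where u = "\<lambda>z. ereal (f z)" and s = s])
    fix y assume y: "y \<in> S"
    have "isCont f y" using f S y by (simp add: continuous_on_eq_continuous_at)
    then show "Limsup (at y) (\<lambda>z. ereal (f z)) \<le> ereal (f y)" by (rule Limsup_at_ereal)
    obtain \<rho> where \<rho>: "\<rho> > 0" "\<And>r. 0 < r \<Longrightarrow> r < \<rho> \<Longrightarrow> f y \<le> (\<integral>t. f (y + of_real r * cis t) \<partial>circ)"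
      using f(2) y unfolding submean_on_def by blast
    obtain \<sigma> where \<sigma>: "\<sigma> > 0" "ball y \<sigma> \<subseteq> S" using S(2) y open_contains_ball by metis
    have "ereal (f y) \<le> circle_mean (\<lambda>z. ereal (f z)) y r" if r: "0 < r" "r < min \<rho> \<sigma>" for r
    proof -
      have "sphere y \<bar>r\<bar> \<subseteq> S" using \<sigma>(2) r by auto
      then show ?thesis
        using \<rho>(2)[of r] r continuous_on_subset[OF f(1)] by (simp add: circle_mean_ereal)
    qed
    then show "\<exists>\<rho>>0. \<forall>r. 0 < r \<and> r < \<rho> \<longrightarrow> ereal (f y) \<le> circle_mean (\<lambda>z. ereal (f z)) y r"
      using \<rho> \<sigma> by (intro exI[of _ "min \<rho> \<sigma>"]) auto
    obtain \<tau> where "\<tau> > 0" "\<And>r. 0 < r \<Longrightarrow> r < \<tau> \<Longrightarrow> (\<integral>t. s (y + of_real r * cis t) \<partial>circ) = s y"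
      using s y unfolding mean_value_on_def by blast
    then show "\<exists>\<rho>>0. \<forall>r. 0 < r \<and> r < \<rho> \<longrightarrow> (\<integral>t. s (y + of_real r * cis t) \<partial>circ) \<le> s y"
      by (intro exI[of _ \<tau>]) auto
  next
    show "continuous_on S s" using s by (simp add: mean_value_on_def)
    show "eventually (\<lambda>z. ereal (f z) \<le> ereal (s z + \<epsilon>)) (at \<zeta> within S)" if "\<zeta> \<in> frontier S" "\<epsilon> > 0" for \<zeta> \<epsilon>
      using bdry[OF that] by simp
  qed (use z in auto)
  then show ?thesis by simp
qed

lemma poisson_mono:
  assumes "(\<lambda>t. b (c + of_real R * cis t)) \<in> borel_measurable borel" "\<And>t. \<bar>b (c + of_real R * cis t)\<bar> \<le> M"
    and "(\<lambda>t. b' (c + of_real R * cis t)) \<in> borel_measurable borel" "\<And>t. \<bar>b' (c + of_real R * cis t)\<bar> \<le> M'"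
    and "\<And>t. b (c + of_real R * cis t) \<le> b' (c + of_real R * cis t)" "z \<in> ball c R"
  shows "poisson c R b z \<le> poisson c R b' z"
proof -
  have w: "cmod (z - c) < R" using assms by (simp add: dist_norm norm_minus_commute)
  show ?thesis unfolding poisson_def
    by (intro integral_mono poisson_integrable[OF assms(1,2) w] poisson_integrable[OF assms(3,4) w]
        mult_left_mono assms(5) poisson_kernel_nonneg w)
qed

lemma poisson_const:
  assumes "z \<in> ball c R" shows "poisson c R (\<lambda>_. k) z = k"
proof -
  have w: "cmod (z - c) < R" using assms by (simp add: dist_norm norm_minus_commute)
  show ?thesis unfolding poisson_def by (simp add: poisson_kernel_integral[OF w])
qed

definition poisson_modification :: "complex \<Rightarrow> real \<Rightarrow> (complex \<Rightarrow> real) \<Rightarrow> complex \<Rightarrow> real" where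
  "poisson_modification c R f z = (if z \<in> ball c R then poisson c R f z else f z)"

context
  fixes c :: complex and R :: real and f :: "complex \<Rightarrow> real"
  assumes R: "R > 0" and f: "continuous_on UNIV f"
begin

lemma circle_data:
  shows "(\<lambda>t. f (c + of_real R * cis t)) \<in> borel_measurable borel"
    and "\<exists>M. \<forall>t. \<bar>f (c + of_real R * cis t)\<bar> \<le> M"
proof -
  show "(\<lambda>t. f (c + of_real R * cis t)) \<in> borel_measurable borel"
    by (intro borel_measurable_continuous_onI continuous_on_circle continuous_on_subset[OF f]) auto
  have "compact (f ` sphere c R)" by (intro compact_continuous_image continuous_on_subset[OF f]) auto
  then have "bounded (f ` sphere c R)" by (rule compact_imp_bounded)
  then obtain B where B: "\<And>y. y \<in> sphere c R \<Longrightarrow> \<bar>f y\<bar> \<le> B"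
    unfolding bounded_iff by (metis imageI real_norm_def)
  have "\<bar>f (c + of_real R * cis t)\<bar> \<le> B" for t
    by (rule B) (use R in \<open>simp add: dist_norm norm_mult\<close>)
  then show "\<exists>M. \<forall>t. \<bar>f (c + of_real R * cis t)\<bar> \<le> M" by blast
qed

lemma poisson_harmonic': "harmonic_on (ball c R) (poisson c R f)"
  using circle_data(2) poisson_harmonic[OF circle_data(1)] by blast

lemma poisson_boundary':
  assumes "\<xi> \<in> sphere c R" shows "(poisson c R f \<longlongrightarrow> f \<xi>) (at \<xi> within ball c R)"
proof -
  obtain M where M: "\<And>t. \<bar>f (c + of_real R * cis t)\<bar> \<le> M" using circle_data(2) by blast
  have "(f \<longlongrightarrow> f \<xi>) (at \<xi> within sphere c R)"
    using f unfolding continuous_on_def by (meson UNIV_I tendsto_within_subset subset_UNIV)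
  then show ?thesis by (intro poisson_boundary[OF circle_data(1) M R assms])
qed

lemma poisson_modification_continuous: "continuous_on UNIV (poisson_modification c R f)"
proof -
  let ?g = "poisson_modification c R f"
  have "isCont ?g z" for z
  proof -
    consider "z \<in> ball c R" | "z \<in> sphere c R" | "z \<in> - cball c R" by force
    then show ?thesis
    proof cases
      case 1
      have "isCont (poisson c R f) z"
        using harmonic_on_continuous[OF poisson_harmonic'] 1 by (simp add: continuous_on_eq_continuous_at)
      moreover have "eventually (\<lambda>y. ?g y = poisson c R f y) (nhds z)"
        using 1 eventually_nhds_in_open[of "ball c R" z]
        by (auto elim!: eventually_mono simp: poisson_modification_def)
      ultimately show ?thesis using isCont_cong by blast
    next
      case 2
      have "(?g \<longlongrightarrow> f z) (at z within ball c R)"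
        by (rule Lim_transform_within[OF poisson_boundary'[OF 2] zero_less_one])
           (auto simp: poisson_modification_def)
      moreover have "(?g \<longlongrightarrow> f z) (at z within - ball c R)"
      proof (rule Lim_transform_within[OF _ zero_less_one])
        show "(f \<longlongrightarrow> f z) (at z within - ball c R)"
          using f unfolding continuous_on_def by (meson UNIV_I tendsto_within_subset subset_UNIV)
      qed (auto simp: poisson_modification_def)
      ultimately have "(?g \<longlongrightarrow> f z) (at z within (ball c R \<union> - ball c R))"
        by (simp only: Lim_within_Un)
      moreover have "?g z = f z" using 2 by (simp add: poisson_modification_def)
      ultimately show ?thesis by (simp add: isCont_def)
    next
      case 3
      have "isCont f z" using f by (simp add: continuous_on_eq_continuous_at)
      moreover have "eventually (\<lambda>y. ?g y = f y) (nhds z)"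
      proof (rule eventually_mono[OF eventually_nhds_in_open[of "- cball c R" z]])
        show "open (- cball c R)" by (intro open_Compl closed_cball)
      qed (use 3 in \<open>auto simp: poisson_modification_def\<close>)
      ultimately show ?thesis using isCont_cong by blast
    qed
  qed
  then show ?thesis by (simp add: continuous_at_imp_continuous_on)
qed

lemma poisson_modification_ge:
  assumes S: "cball c R \<subseteq> S" and sub: "submean_on S f"
  shows "f z \<le> poisson_modification c R f z"
proof (cases "z \<in> ball c R")
  case True
  have "f z \<le> poisson c R f z"
  proof (rule maximum_principle_real[of "ball c R"])
    show "continuous_on (ball c R) f" using f continuous_on_subset by blast
    show "submean_on (ball c R) f" using sub S unfolding submean_on_def by (meson ball_subset_cball subsetD)
    show "mean_value_on (ball c R) (poisson c R f)"
      by (rule harmonic_on_imp_mean_value[OF poisson_harmonic'])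
    fix \<zeta> \<epsilon> assume "\<zeta> \<in> frontier (ball c R)" "(\<epsilon> :: real) > 0"
    then have \<zeta>: "\<zeta> \<in> sphere c R" using R by (simp add: frontier_ball)
    have "(f \<longlongrightarrow> f \<zeta>) (at \<zeta> within ball c R)"
      using f unfolding continuous_on_def by (meson UNIV_I tendsto_within_subset subset_UNIV)
    then have "((\<lambda>z. f z - poisson c R f z) \<longlongrightarrow> f \<zeta> - f \<zeta>) (at \<zeta> within ball c R)"
      by (intro tendsto_diff poisson_boundary' \<zeta>)
    then have "eventually (\<lambda>z. f z - poisson c R f z < \<epsilon>) (at \<zeta> within ball c R)"
      using \<open>\<epsilon> > 0\<close> by (intro order_tendstoD(2)) auto
    then show "eventually (\<lambda>z. f z \<le> poisson c R f z + \<epsilon>) (at \<zeta> within ball c R)"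
      by (rule eventually_mono) simp
  qed (use True in auto)
  then show ?thesis using True by (simp add: poisson_modification_def)
qed (simp add: poisson_modification_def)

text \<open>A centre outside the open disc keeps its value while the values around it can only grow;
  a centre inside it sees a harmonic function.\<close>

lemma poisson_modification_submean:
  assumes S: "cball c R \<subseteq> S" and sub: "submean_on S f"
  shows "submean_on S (poisson_modification c R f)"
  unfolding submean_on_def
proof
  fix z assume z: "z \<in> S"
  let ?g = "poisson_modification c R f"
  show "\<exists>\<rho>>0. \<forall>r. 0 < r \<and> r < \<rho> \<longrightarrow> ?g z \<le> (\<integral>t. ?g (z + of_real r * cis t) \<partial>circ)"
  proof (cases "z \<in> ball c R")
    case True
    obtain \<rho> where \<rho>: "\<rho> > 0" "ball z \<rho> \<subseteq> ball c R"
      "\<And>r. 0 < r \<Longrightarrow> r < \<rho> \<Longrightarrow> (\<integral>t. poisson c R f (z + of_real r * cis t) \<partial>circ) = poisson c R f z"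
      using harmonic_on_imp_mean_value[OF poisson_harmonic'] True unfolding mean_value_on_def by blast
    have "?g z \<le> (\<integral>t. ?g (z + of_real r * cis t) \<partial>circ)" if r: "0 < r" "r < \<rho>" for r
    proof -
      have "z + of_real r * cis t \<in> ball c R" for t
        by (rule subsetD[OF \<rho>(2)]) (use r in \<open>simp add: dist_norm norm_mult\<close>)
      then have "?g (z + of_real r * cis t) = poisson c R f (z + of_real r * cis t)" for t
        by (simp add: poisson_modification_def)
      then show ?thesis using \<rho>(3)[OF r] True by (simp add: poisson_modification_def)
    qed
    then show ?thesis using \<rho>(1) by blast
  next
    case False
    obtain \<rho> where \<rho>: "\<rho> > 0" "\<And>r. 0 < r \<Longrightarrow> r < \<rho> \<Longrightarrow> f z \<le> (\<integral>t. f (z + of_real r * cis t) \<partial>circ)"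
      using sub z unfolding submean_on_def by blast
    have "?g z \<le> (\<integral>t. ?g (z + of_real r * cis t) \<partial>circ)" if r: "0 < r" "r < \<rho>" for r
    proof -
      have "?g z \<le> (\<integral>t. f (z + of_real r * cis t) \<partial>circ)"
        using False \<rho>(2)[OF r] by (simp add: poisson_modification_def)
      also have "\<dots> \<le> (\<integral>t. ?g (z + of_real r * cis t) \<partial>circ)"
        by (intro integral_mono circ_integrable_continuous continuous_on_circle poisson_modification_ge[OF S sub]
            continuous_on_subset[OF f] continuous_on_subset[OF poisson_modification_continuous]) auto
      finally show ?thesis .
    qed
    then show ?thesis using \<rho>(1) by blast
  qed
qed

end

text \<open>Countability allows a single sequence of modifications to return to every disc.\<close>

lemma disc_cover:
  fixes S :: "complex set"
  assumes "open S" "S \<noteq> {}"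
  obtains e :: "nat \<Rightarrow> complex \<times> real"
  where "\<And>n. snd (e n) > 0" "\<And>n. cball (fst (e n)) (snd (e n)) \<subseteq> S"
    "\<And>z. z \<in> S \<Longrightarrow> \<exists>n. z \<in> ball (fst (e n)) (snd (e n))"
proof -
  define P where "P = {p :: complex \<times> real. snd p > 0 \<and> cball (fst p) (snd p) \<subseteq> S}"
  define \<B> where "\<B> = (\<lambda>p. ball (fst p) (snd p)) ` P"
  have "\<Union>\<B> = S"
  proof
    show "\<Union>\<B> \<subseteq> S" by (force simp: \<B>_def P_def)
    show "S \<subseteq> \<Union>\<B>"
    proof
      fix z assume "z \<in> S"
      then obtain r where "r > 0" "cball z r \<subseteq> S" using assms(1) open_contains_cball by metis
      then show "z \<in> \<Union>\<B>" unfolding \<B>_def P_def by (intro UnionI[of "ball z r"] image_eqI[of _ _ "(z, r)"]) auto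
    qed
  qed
  moreover obtain \<B>' where \<B>': "\<B>' \<subseteq> \<B>" "countable \<B>'" "\<Union>\<B>' = \<Union>\<B>"
    by (rule Lindelof[of \<B>]) (auto simp: \<B>_def)
  ultimately have ne: "\<B>' \<noteq> {}" using assms(2) by auto
  have "\<exists>p. p \<in> P \<and> ball (fst p) (snd p) = from_nat_into \<B>' n" for n
  proof -
    have "from_nat_into \<B>' n \<in> \<B>" using from_nat_into[OF ne, of n] \<B>'(1) by blast
    then show ?thesis unfolding \<B>_def by blast
  qed
  then obtain e where e: "\<And>n. e n \<in> P" "\<And>n. ball (fst (e n)) (snd (e n)) = from_nat_into \<B>' n"
    by metis
  show ?thesis
  proof (rule that[of e])
    show "snd (e n) > 0" "cball (fst (e n)) (snd (e n)) \<subseteq> S" for n using e(1)[of n] by (auto simp: P_def)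
    fix z assume "z \<in> S"
    then obtain B where "B \<in> \<B>'" "z \<in> B" using \<open>\<Union>\<B> = S\<close> \<B>'(3) by blast
    then show "\<exists>n. z \<in> ball (fst (e n)) (snd (e n))" using e(2) from_nat_into_surj[OF \<B>'(2)] by metis
  qed
qed


section \<open>Poincare's sweeping-out construction\<close>

locale dirichlet_data =
  fixes S :: "complex set" and F :: "complex \<Rightarrow> real" and e :: "nat \<Rightarrow> complex \<times> real" and M :: real
  assumes S: "bounded S" "open S"
    and F: "continuous_on UNIV F" "submean_on S F"
    and M: "\<And>z. z \<in> closure S \<Longrightarrow> \<bar>F z\<bar> \<le> M"
    and e: "\<And>n. snd (e n) > 0" "\<And>n. cball (fst (e n)) (snd (e n)) \<subseteq> S"
      "\<And>z. z \<in> S \<Longrightarrow> \<exists>n. z \<in> ball (fst (e n)) (snd (e n))"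
begin

text \<open>Decoding k as a pair and dropping the second component makes every disc recur infinitely
  often.\<close>

definition disc :: "nat \<Rightarrow> complex \<times> real" where
  "disc k = e (fst (prod_decode k))"

primrec sweep :: "nat \<Rightarrow> complex \<Rightarrow> real" where
  "sweep 0 = F"
| "sweep (Suc k) = poisson_modification (fst (disc k)) (snd (disc k)) (sweep k)"

lemma disc_pos: "snd (disc k) > 0" and disc_sub: "cball (fst (disc k)) (snd (disc k)) \<subseteq> S"
  using e by (auto simp: disc_def)

lemma sweep_continuous: "continuous_on UNIV (sweep k)"
  by (induction k) (auto intro: F poisson_modification_continuous disc_pos)

lemma sweep_submean: "submean_on S (sweep k)"
proof (induction k)
  case (Suc k)
  then show ?case
    using poisson_modification_submean[OF disc_pos sweep_continuous disc_sub] by simp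
qed (simp add: F)

lemma sweep_Suc: "sweep k z \<le> sweep (Suc k) z"
  using poisson_modification_ge[OF disc_pos sweep_continuous disc_sub sweep_submean] by simp

lemma sweep_mono: "k \<le> l \<Longrightarrow> sweep k z \<le> sweep l z"
  using sweep_Suc by (rule lift_Suc_mono_le)

lemma sweep_outside: "z \<notin> S \<Longrightarrow> sweep k z = F z"
proof (induction k)
  case (Suc k)
  have "z \<notin> ball (fst (disc k)) (snd (disc k))"
    using Suc.prems disc_sub[of k] ball_subset_cball by blast
  then show ?case using Suc by (simp add: poisson_modification_def)
qed simp

lemma disc_point: "fst (disc k) + of_real (snd (disc k)) * cis t \<in> S"
  using disc_sub[of k] disc_pos[of k] by (auto simp: dist_norm norm_mult intro!: subsetD[OF disc_sub[of k]])

lemma sweep_le: "z \<in> closure S \<Longrightarrow> sweep k z \<le> M"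
proof (induction k arbitrary: z)
  case 0 then show ?case using M[of z] by simp
next
  case (Suc k)
  show ?case
  proof (cases "z \<in> ball (fst (disc k)) (snd (disc k))")
    case True
    obtain B where B: "\<And>t. \<bar>sweep k (fst (disc k) + of_real (snd (disc k)) * cis t)\<bar> \<le> B"
      using circle_data(2)[OF disc_pos[of k] sweep_continuous[of k], of "fst (disc k)"] by blast
    have "poisson (fst (disc k)) (snd (disc k)) (sweep k) z \<le> poisson (fst (disc k)) (snd (disc k)) (\<lambda>_. M) z"
      by (rule poisson_mono[where M = B and M' = "\<bar>M\<bar>"])
         (use True B Suc.IH[OF subsetD[OF closure_subset disc_point]] circle_data(1)[OF disc_pos sweep_continuous] in auto)
    then show ?thesis using True by (simp add: poisson_modification_def poisson_const)
  next
    case False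
    then show ?thesis using Suc by (simp add: poisson_modification_def)
  qed
qed

lemma sweep_ge: "z \<in> closure S \<Longrightarrow> - M \<le> sweep k z"
  using sweep_mono[of 0 k z] M[of z] by simp

definition solution :: "complex \<Rightarrow> real" where
  "solution z = lim (\<lambda>k. sweep k z)"

lemma sweep_tendsto: "z \<in> closure S \<Longrightarrow> (\<lambda>k. sweep k z) \<longlonglongrightarrow> solution z"
proof -
  assume z: "z \<in> closure S"
  obtain L where "(\<lambda>k. sweep k z) \<longlonglongrightarrow> L"
    using sweep_mono sweep_le[OF z] incseq_convergent[of "\<lambda>k. sweep k z" M] by (metis incseq_def)
  then show ?thesis unfolding solution_def using limI by metis
qed

lemma sweep_le_solution: "z \<in> closure S \<Longrightarrow> sweep k z \<le> solution z"
  using sweep_tendsto sweep_mono by (intro incseq_le) (auto simp: incseq_def)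

lemma solution_bound: "z \<in> closure S \<Longrightarrow> \<bar>solution z\<bar> \<le> M"
proof -
  assume z: "z \<in> closure S"
  have "solution z \<le> M" using sweep_tendsto[OF z] sweep_le[OF z] by (intro LIMSEQ_le_const2) auto
  moreover have "- M \<le> solution z" using sweep_ge[OF z, of 0] sweep_le_solution[OF z, of 0] by linarith
  ultimately show ?thesis by linarith
qed

text \<open>At infinitely many times the sweep on disc n has just been replaced by the Poisson
  integral of its predecessor. By monotonicity the limits of the sweeps and of their Poisson
  integrals bound each other, and dominated convergence identifies the latter limit.\<close>

lemma solution_poisson:
  assumes z: "z \<in> ball (fst (e n)) (snd (e n))"
  shows "solution z = poisson (fst (e n)) (snd (e n)) solution z"
    and "(\<lambda>t. solution (fst (e n) + of_real (snd (e n)) * cis t)) \<in> borel_measurable borel"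
    and "\<bar>solution (fst (e n) + of_real (snd (e n)) * cis t)\<bar> \<le> M"
proof -
  define c R where "c = fst (e n)" and "R = snd (e n)"
  have R: "R > 0" and cS: "cball c R \<subseteq> S" using e by (auto simp: c_def R_def)
  have pS: "c + of_real R * cis t \<in> closure S" for t
    by (rule subsetD[OF closure_subset], rule subsetD[OF cS]) (use R in \<open>simp add: dist_norm norm_mult\<close>)
  have zS: "z \<in> closure S"
    by (rule subsetD[OF closure_subset], rule subsetD[OF cS]) (use z in \<open>simp add: c_def R_def\<close>)
  have m: "(\<lambda>t. sweep k (c + of_real R * cis t)) \<in> borel_measurable borel" for k
    by (rule circle_data(1)[OF R sweep_continuous])
  show ms: "(\<lambda>t. solution (fst (e n) + of_real (snd (e n)) * cis t)) \<in> borel_measurable borel"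
    unfolding c_def[symmetric] R_def[symmetric]
    by (rule borel_measurable_LIMSEQ_real[OF _ m]) (rule sweep_tendsto[OF pS])
  show "\<bar>solution (fst (e n) + of_real (snd (e n)) * cis t)\<bar> \<le> M" for t
    unfolding c_def[symmetric] R_def[symmetric] by (rule solution_bound[OF pS])
  note msb = ms this
  have ab: "\<bar>sweep k (c + of_real R * cis t)\<bar> \<le> M" for k t
    using sweep_le[OF pS[of t], of k] sweep_ge[OF pS[of t], of k] by linarith
  have zb: "z \<in> ball c R" using z by (simp add: c_def R_def)
  then have w: "cmod (z - c) < R" by (simp add: dist_norm norm_minus_commute)
  \<comment> \<open>\<open>prod_encode (n, k)\<close> is a time not before k at which disc n is
    treated.\<close>
  have step: "\<exists>k'\<ge>k. sweep (Suc k') z = poisson c R (sweep k') z" for k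
  proof (intro exI[of _ "prod_encode (n, k)"] conjI)
    show "k \<le> prod_encode (n, k)" by (rule le_prod_encode_2)
    show "sweep (Suc (prod_encode (n, k))) z = poisson c R (sweep (prod_encode (n, k))) z"
      using zb by (simp add: poisson_modification_def disc_def c_def R_def)
  qed
  have "(\<lambda>k. poisson c R (sweep k) z) \<longlonglongrightarrow> poisson c R solution z"
    unfolding poisson_def
  proof (rule integral_dominated_convergence)
    let ?K = "\<lambda>t. Re ((of_real R * cis t + (z - c)) / (of_real R * cis t - (z - c)))"
    have Kc: "continuous_on UNIV ?K" by (intro continuous_on_Re poisson_kernel_continuous w)
    have Km: "?K \<in> borel_measurable borel" by (rule borel_measurable_continuous_onI[OF Kc])
    show "(\<lambda>t. ?K t * solution (c + of_real R * cis t)) \<in> borel_measurable circ"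
      using borel_measurable_times[OF Km ms[folded c_def R_def]] by simp
    show "(\<lambda>t. ?K t * sweep k (c + of_real R * cis t)) \<in> borel_measurable circ" for k
      using borel_measurable_times[OF Km m] by simp
    show "integrable circ (\<lambda>t. ?K t * M)"
      by (intro integrable_mult_left circ_integrable_continuous Kc)
    show "AE t in circ. (\<lambda>k. ?K t * sweep k (c + of_real R * cis t)) \<longlonglongrightarrow> ?K t * solution (c + of_real R * cis t)"
      by (intro always_eventually allI tendsto_mult_left sweep_tendsto pS)
    show "AE t in circ. norm (?K t * sweep k (c + of_real R * cis t)) \<le> ?K t * M" for k
      using poisson_kernel_nonneg[OF w] ab
      by (intro always_eventually allI) (simp only: real_norm_def abs_mult abs_of_nonneg mult_left_mono)
  qed
  moreover have "poisson c R (sweep k) z \<le> solution z" for k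
  proof -
    obtain k' where k': "k' \<ge> k" "sweep (Suc k') z = poisson c R (sweep k') z" using step by blast
    have "poisson c R (sweep k) z \<le> poisson c R (sweep k') z"
      by (intro poisson_mono[OF m ab m ab] sweep_mono k' zb)
    then show ?thesis using k' sweep_le_solution[OF zS, of "Suc k'"] by linarith
  qed
  ultimately have 1: "poisson c R solution z \<le> solution z"
    by (intro LIMSEQ_le_const2) auto
  have "sweep k z \<le> poisson c R solution z" for k
  proof -
    obtain k' where k': "k' \<ge> k" "sweep (Suc k') z = poisson c R (sweep k') z" using step by blast
    have "poisson c R (sweep k') z \<le> poisson c R solution z"
      by (intro poisson_mono[OF m ab msb[folded c_def R_def]] sweep_le_solution pS zb)
    then show ?thesis using k' sweep_mono[of k k' z] sweep_Suc[of k' z] by linarith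
  qed
  then have "solution z \<le> poisson c R solution z"
    using sweep_tendsto[OF zS] by (intro LIMSEQ_le_const2) auto
  with 1 show "solution z = poisson (fst (e n)) (snd (e n)) solution z" by (simp add: c_def R_def)
qed

lemma solution_harmonic: "harmonic_on S solution"
  unfolding harmonic_on_def
proof
  fix z assume "z \<in> S"
  then obtain n where n: "z \<in> ball (fst (e n)) (snd (e n))" using e(3) by blast
  obtain r G where r: "r > 0" "ball z r \<subseteq> ball (fst (e n)) (snd (e n))" "G holomorphic_on ball z r"
    "\<And>w. w \<in> ball z r \<Longrightarrow> poisson (fst (e n)) (snd (e n)) solution w = Re (G w)"
    using poisson_harmonic[OF solution_poisson(2,3)[OF n]] n unfolding harmonic_on_def by blast
  have "solution w = Re (G w)" if "w \<in> ball z r" for w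
    using solution_poisson(1)[of w n] r(2) r(4)[OF that] that by auto
  moreover have "ball z r \<subseteq> S" using r(2) e(2)[of n] ball_subset_cball by blast
  ultimately show "\<exists>r>0. \<exists>F. ball z r \<subseteq> S \<and> F holomorphic_on ball z r \<and> (\<forall>w\<in>ball z r. solution w = Re (F w))"
    using r by blast
qed

text \<open>On a small circle around \<open>\<zeta>\<close> the weak barrier \<open>q\<close> may be tiny only on a set of small
  measure; there the Poisson integral of its indicator function takes over.\<close>

lemma solution_boundary:
  assumes \<zeta>: "\<zeta> \<in> frontier S" and r0: "r0 > 0" and q: "mean_value_on (S \<inter> ball \<zeta> r0) q"
    "\<And>z. z \<in> S \<inter> ball \<zeta> r0 \<Longrightarrow> q z > 0" "(q \<longlongrightarrow> 0) (at \<zeta> within S)"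
  shows "(solution \<longlongrightarrow> F \<zeta>) (at \<zeta> within S)"
proof (rule tendstoI)
  fix \<epsilon>' :: real assume "\<epsilon>' > 0"
  define \<epsilon> where "\<epsilon> = \<epsilon>' / 4"
  have \<epsilon>: "\<epsilon> > 0" using \<open>\<epsilon>' > 0\<close> by (simp add: \<epsilon>_def)
  have \<zeta>c: "\<zeta> \<in> closure S" using \<zeta> by (simp add: frontier_def)
  have M0: "M \<ge> 0" using M[OF \<zeta>c] by linarith
  have "isCont F \<zeta>" using F(1) by (simp add: continuous_on_eq_continuous_at)
  then obtain \<delta> where \<delta>: "\<delta> > 0" "\<And>y. dist y \<zeta> < \<delta> \<Longrightarrow> dist (F y) (F \<zeta>) < \<epsilon>"
    using \<epsilon> unfolding continuous_at_eps_delta by blast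
  define r where "r = min \<delta> r0 / 2"
  have r: "r > 0" "r < \<delta>" "r < r0" using \<delta>(1) r0 by (auto simp: r_def)
  have Fr: "\<bar>F y - F \<zeta>\<bar> < \<epsilon>" if "dist y \<zeta> \<le> r" for y using \<delta>(2)[of y] that r by (auto simp: dist_real_def)
  \<comment> \<open>Large enough that F \<zeta> + C exceeds M, the bound on all sweeps, by at least
    1.\<close>
  define C where "C = 2 * M + 1"
  have C: "C > 0" "F \<zeta> + C \<ge> M + 1" using M[OF \<zeta>c] M0 by (auto simp: C_def)
  define T where "T = S \<inter> ball \<zeta> r0"
  have T: "open T" using S by (simp add: T_def open_Int)
  have qT: "continuous_on T q" using q(1) by (simp add: mean_value_on_def T_def)
  define V where "V m = T \<inter> q -` {..<m}" for m
  have V: "open (V m)" for m unfolding V_def using qT T by (intro continuous_open_preimage) auto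
  define c where "c t = \<zeta> + of_real r * cis t" for t
  have contc: "continuous_on UNIV c" unfolding c_def by (intro continuous_intros)
  have oI: "open (c -` V m)" for m using V contc by (simp add: continuous_on_open_vimage)
  \<comment> \<open>On the part of the circle inside S the function q is positive, so the sets where
    q < 1/(j+1) decrease to the empty set and their measure tends to 0. This fixes the threshold
    m.\<close>
  have "(\<lambda>j. circ.prob (c -` V (1 / Suc j))) \<longlonglongrightarrow> circ.prob (\<Inter>j. c -` V (1 / Suc j))"
  proof (rule circ.finite_Lim_measure_decseq)
    show "range (\<lambda>j. c -` V (1 / Suc j)) \<subseteq> circ.events" using oI by auto
    have "V (1 / Suc k) \<subseteq> V (1 / Suc j)" if "j \<le> k" for j k
    proof -
      have "1 / real (Suc k) \<le> 1 / real (Suc j)" using that by (simp add: frac_le)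
      then show ?thesis by (auto simp: V_def)
    qed
    then show "decseq (\<lambda>j. c -` V (1 / Suc j))" unfolding decseq_def by blast
  qed
  moreover have "(\<Inter>j. c -` V (1 / Suc j)) = {}"
  proof (rule ccontr)
    assume "\<not> ?thesis"
    then obtain t where t: "\<And>j. c t \<in> V (1 / Suc j)" by auto
    then have "q (c t) > 0" using q(2)[of "c t"] by (auto simp: V_def T_def)
    then obtain j where "1 / real (Suc j) < q (c t)" using nat_approx_posE by metis
    then show False using t[of j] by (auto simp: V_def)
  qed
  ultimately have "(\<lambda>j. circ.prob (c -` V (1 / Suc j))) \<longlonglongrightarrow> 0" by simp
  then have "eventually (\<lambda>j. circ.prob (c -` V (1 / Suc j)) < \<epsilon> / C) sequentially"
    using \<epsilon> C by (intro order_tendstoD(2)) auto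
  then obtain j where j: "circ.prob (c -` V (1 / Suc j)) < \<epsilon> / C" by (auto simp: eventually_sequentially)
  define m where "m = 1 / real (Suc j)"
  have m: "m > 0" "circ.prob (c -` V m) < \<epsilon> / C" using j by (auto simp: m_def)
  define b where "b = (indicator (V m) :: complex \<Rightarrow> real)"
  have bm: "(\<lambda>t. b (\<zeta> + of_real r * cis t)) \<in> borel_measurable borel"
  proof -
    have "(\<lambda>t. b (\<zeta> + of_real r * cis t)) = indicator (c -` V m)"
      by (auto simp: b_def c_def indicator_def)
    then show ?thesis using borel_measurable_indicator[OF borel_open[OF oI]] by simp
  qed
  have b1: "\<bar>b (\<zeta> + of_real r * cis t)\<bar> \<le> 1" for t by (simp add: b_def indicator_def)
  define P where "P = poisson \<zeta> r b"
  have Ph: "harmonic_on (ball \<zeta> r) P" unfolding P_def by (rule poisson_harmonic[OF bm b1])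
  have P0: "P z \<ge> 0" if "z \<in> ball \<zeta> r" for z
    using poisson_mono[of "\<lambda>_. 0" \<zeta> r 0 b 1 z] bm b1 that poisson_const[of z \<zeta> r 0]
    by (simp add: P_def b_def)
  have P\<zeta>: "P \<zeta> < \<epsilon> / C"
  proof -
    have "P \<zeta> = (\<integral>t. indicator (c -` V m) t \<partial>circ)"
      unfolding P_def using r by (simp add: poisson_center b_def c_def indicator_def)
    then show ?thesis using m by simp
  qed
  define U where "U = S \<inter> ball \<zeta> r"
  have U: "open U" "bounded U" "U \<subseteq> T" "U \<subseteq> S" "U \<subseteq> ball \<zeta> r"
    using S r by (auto simp: U_def T_def)
  \<comment> \<open>The majorant of all sweeps on U. Where q is at least m the second term reaches
    C; on the rest of the circle the third one does. At \<zeta> the second term vanishes and the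
    third is below \<epsilon>, since P \<zeta> is the measure of the bad set.\<close>
  define s where "s z = (F \<zeta> + \<epsilon>) + (C / m) * q z + C * P z" for z
  have smv: "mean_value_on U s"
    unfolding s_def
    by (intro mean_value_on_linear mean_value_on_subset[OF q(1)[folded T_def]]
        mean_value_on_subset[OF harmonic_on_imp_mean_value[OF Ph]] U)
  have s_ge: "s z \<ge> F \<zeta> + \<epsilon>" if "z \<in> U" for z
  proof -
    have "q z > 0" "P z \<ge> 0" using that q(2)[of z] P0[of z] r by (auto simp: U_def)
    then have "(C / m) * q z \<ge> 0" "C * P z \<ge> 0" using C m by auto
    then show ?thesis by (simp add: s_def)
  qed
  have sweep_s: "sweep k z \<le> s z" if "z \<in> U" for k z
  proof (rule maximum_principle_real[OF U(2,1) _ _ smv _ that])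
    show "continuous_on U (sweep k)" using sweep_continuous continuous_on_subset by blast
    show "submean_on U (sweep k)" using sweep_submean U(4) unfolding submean_on_def by (meson subsetD)
    fix \<xi> and \<delta> :: real assume \<xi>: "\<xi> \<in> frontier U" and "\<delta> > 0"
    have UU: "eventually (\<lambda>z. z \<in> U) (at \<xi> within U)" by (simp add: eventually_at_filter)
    have \<xi>cl: "\<xi> \<in> closure U" and \<xi>U: "\<xi> \<notin> U" using \<xi> U(1) by (auto simp: frontier_def interior_open)
    have \<xi>r: "dist \<xi> \<zeta> \<le> r"
    proof -
      have "closure U \<subseteq> cball \<zeta> r" using U(5) by (intro closure_minimal) auto
      then show ?thesis using \<xi>cl by (auto simp: dist_commute)
    qed
    show "eventually (\<lambda>z. sweep k z \<le> s z + \<delta>) (at \<xi> within U)"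
    proof (cases "\<xi> \<in> S")
      case False
      have "sweep k \<xi> < F \<zeta> + \<epsilon>" using sweep_outside[OF False, of k] Fr[OF \<xi>r] by (auto simp: abs_less_iff)
      moreover have "(sweep k \<longlongrightarrow> sweep k \<xi>) (at \<xi> within U)"
        using sweep_continuous[of k] unfolding continuous_on_def by (meson UNIV_I tendsto_within_subset subset_UNIV)
      ultimately have "eventually (\<lambda>z. sweep k z < F \<zeta> + \<epsilon>) (at \<xi> within U)" by (intro order_tendstoD(2))
      with UU show ?thesis
      proof eventually_elim
        case (elim z) then show ?case using s_ge[of z] \<open>\<delta> > 0\<close> by linarith
      qed
    next
      case True
      then have "dist \<xi> \<zeta> = r" using \<xi>U \<xi>r by (auto simp: U_def dist_commute)
      then have \<xi>T: "\<xi> \<in> T" and \<xi>s: "\<xi> \<in> sphere \<zeta> r" using True r by (auto simp: T_def dist_commute)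
      have "isCont q \<xi>" using qT T \<xi>T by (simp add: continuous_on_eq_continuous_at)
      then have qlim: "(q \<longlongrightarrow> q \<xi>) (at \<xi> within U)"
        unfolding isCont_def by (rule tendsto_within_subset) simp
      have "1 - 1 / C < 1" using C by simp
      \<comment> \<open>The sum need not reach 1 exactly: after multiplication by C the loss is at
        most 1, which is the margin built into C.\<close>
      have "eventually (\<lambda>z. q z / m + P z > 1 - 1 / C) (at \<xi> within U)"
      proof (cases "q \<xi> \<ge> m")
        case True
        have "((\<lambda>z. q z / m) \<longlongrightarrow> q \<xi> / m) (at \<xi> within U)" using qlim m by (intro tendsto_intros) auto
        moreover have "q \<xi> / m \<ge> 1" using True m by simp
        ultimately have "eventually (\<lambda>z. q z / m > 1 - 1 / C) (at \<xi> within U)"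
          using \<open>1 - 1 / C < 1\<close> less_le_trans order_tendstoD(1) by metis
        with UU show ?thesis
        proof eventually_elim
          case (elim z)
          then have "P z \<ge> 0" using P0 U(5) by auto
          then show ?case using elim by linarith
        qed
      next
        case False
        then have \<xi>V: "\<xi> \<in> V m" using \<xi>T by (auto simp: V_def)
        have "(b \<longlongrightarrow> b \<xi>) (at \<xi> within sphere \<zeta> r)"
        proof (rule tendsto_eventually)
          show "eventually (\<lambda>y. b y = b \<xi>) (at \<xi> within sphere \<zeta> r)"
            unfolding eventually_at_filter
            by (rule eventually_mono[OF eventually_nhds_in_open[OF V \<xi>V]]) (use \<xi>V in \<open>simp add: b_def\<close>)
        qed
        then have "(P \<longlongrightarrow> b \<xi>) (at \<xi> within ball \<zeta> r)"
          unfolding P_def by (rule poisson_boundary[OF bm b1 r(1) \<xi>s])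
        then have "(P \<longlongrightarrow> 1) (at \<xi> within U)" using \<xi>V tendsto_within_subset[OF _ U(5)] by (simp add: b_def)
        then have "eventually (\<lambda>z. P z > 1 - 1 / C) (at \<xi> within U)"
          using \<open>1 - 1 / C < 1\<close> by (intro order_tendstoD(1)) auto
        with UU show ?thesis
        proof eventually_elim
          case (elim z)
          then have "q z > 0" using q(2)[of z] U(3) unfolding T_def by blast
          then have "q z / m > 0" using m by simp
          then show ?case using elim by linarith
        qed
      qed
      with UU show ?thesis
      proof eventually_elim
        case (elim z)
        have "C * (1 - 1 / C) < C * (q z / m + P z)" using elim C by (intro mult_strict_left_mono) auto
        then have "C - 1 < (C / m) * q z + C * P z" using C by (simp add: algebra_simps)
        then have "s z > M" using C \<epsilon> by (simp add: s_def)
        moreover have "sweep k z \<le> M" using elim U(4) closure_subset sweep_le by blast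
        ultimately show ?case using \<open>\<delta> > 0\<close> by linarith
      qed
    qed
  qed
  have "(P \<longlongrightarrow> P \<zeta>) (at \<zeta> within S)"
  proof -
    have "isCont P \<zeta>" using harmonic_on_continuous[OF Ph] r by (simp add: continuous_on_eq_continuous_at)
    then show ?thesis unfolding isCont_def by (rule tendsto_within_subset) simp
  qed
  then have "(s \<longlongrightarrow> (F \<zeta> + \<epsilon>) + (C / m) * 0 + C * P \<zeta>) (at \<zeta> within S)"
    unfolding s_def using q(3) by (intro tendsto_intros)
  moreover have "(F \<zeta> + \<epsilon>) + (C / m) * 0 + C * P \<zeta> < F \<zeta> + \<epsilon>'"
    using P\<zeta> C \<epsilon> by (simp add: field_simps \<epsilon>_def)
  ultimately have s_ev: "eventually (\<lambda>z. s z < F \<zeta> + \<epsilon>') (at \<zeta> within S)" by (intro order_tendstoD(2)) auto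
  have "(F \<longlongrightarrow> F \<zeta>) (at \<zeta> within S)" using F(1) unfolding continuous_on_def by (meson UNIV_I tendsto_within_subset subset_UNIV)
  then have F_ev: "eventually (\<lambda>z. F z > F \<zeta> - \<epsilon>') (at \<zeta> within S)"
    using \<open>\<epsilon>' > 0\<close> by (intro order_tendstoD(1)) auto
  have "eventually (\<lambda>z. z \<in> U) (at \<zeta> within S)"
    unfolding eventually_at U_def using r by (intro exI[of _ r]) (auto simp: dist_commute)
  with s_ev F_ev show "eventually (\<lambda>z. dist (solution z) (F \<zeta>) < \<epsilon>') (at \<zeta> within S)"
  proof eventually_elim
    case (elim z)
    then have zc: "z \<in> closure S" using U(4) closure_subset by blast
    have "solution z \<le> s z" using sweep_tendsto[OF zc] sweep_s elim by (intro LIMSEQ_le_const2) auto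
    moreover have "F z \<le> solution z" using sweep_le_solution[OF zc, of 0] by simp
    ultimately show ?case using elim by (auto simp: dist_real_def)
  qed
qed

end

text \<open>Positivity is demanded pointwise near \<zeta>, with no positive lower bound away from
  \<zeta>. A function that vanishes along the whole boundary, as the Green function does, therefore
  qualifies.\<close>

definition weak_barrier :: "complex set \<Rightarrow> complex \<Rightarrow> bool" where
  "weak_barrier S \<zeta> \<longleftrightarrow>
     (\<exists>r>0. \<exists>q. mean_value_on (S \<inter> ball \<zeta> r) q \<and> (\<forall>z\<in>S \<inter> ball \<zeta> r. q z > 0) \<and> (q \<longlongrightarrow> 0) (at \<zeta> within S))"

text \<open>F is boundary data and starting function at once: being submean, it can only increase
  under sweeping, so the limit exists. More general data arise as differences of such F, up to
  uniform approximation.\<close>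

theorem dirichlet_problem:
  assumes S: "bounded S" "open S" and F: "continuous_on UNIV F" "submean_on S F"
    and reg: "\<And>\<zeta>. \<zeta> \<in> frontier S \<Longrightarrow> weak_barrier S \<zeta>"
  shows "\<exists>h. harmonic_on S h \<and> (\<forall>\<zeta>\<in>frontier S. (h \<longlongrightarrow> F \<zeta>) (at \<zeta> within S))"
proof (cases "S = {}")
  case True
  then show ?thesis by (auto simp: harmonic_on_def)
next
  case False
  obtain e :: "nat \<Rightarrow> complex \<times> real" where e: "\<And>n. snd (e n) > 0" "\<And>n. cball (fst (e n)) (snd (e n)) \<subseteq> S"
    "\<And>z. z \<in> S \<Longrightarrow> \<exists>n. z \<in> ball (fst (e n)) (snd (e n))"
    by (rule disc_cover[OF S(2) False]) blast
  have "compact (F ` closure S)"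
    using S F by (intro compact_continuous_image continuous_on_subset[OF F(1)]) (auto simp: compact_closure)
  then have "bounded (F ` closure S)" by (rule compact_imp_bounded)
  then obtain M where M: "\<And>z. z \<in> closure S \<Longrightarrow> \<bar>F z\<bar> \<le> M"
    unfolding bounded_iff by (metis imageI real_norm_def)
  interpret dirichlet_data S F e M by unfold_locales (use S F M e in auto)
  show ?thesis
  proof (intro exI[of _ solution] conjI ballI solution_harmonic)
    fix \<zeta> assume "\<zeta> \<in> frontier S"
    then show "(solution \<longlongrightarrow> F \<zeta>) (at \<zeta> within S)"
      using reg[of \<zeta>] solution_boundary[of \<zeta>] unfolding weak_barrier_def by blast
  qed
qed

section \<open>Integration over the plane\<close>

text \<open>Lebesgue measure of the plane in the form of a product, so that integrals can be taken
  coordinatewise in either order.\<close>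

definition area :: "complex measure" where
  "area = distr (lborel \<Otimes>\<^sub>M lborel) borel (\<lambda>p. Complex (fst p) (snd p))"

lemma sets_area [simp, measurable_cong]: "sets area = sets borel"
  by (simp add: area_def)

lemma space_area [simp]: "space area = UNIV"
  by (simp add: area_def)

lemma measurable_Complex [measurable]:
  "(\<lambda>p. Complex (fst p) (snd p)) \<in> borel_measurable (lborel \<Otimes>\<^sub>M (lborel :: real measure))"
proof -
  have "(\<lambda>p :: real \<times> real. Complex (fst p) (snd p)) \<in> borel_measurable borel"
    by (intro borel_measurable_continuous_onI) (simp add: Complex_eq, intro continuous_intros)
  then show ?thesis by (simp add: lborel_prod)
qed

lemma area_integrable_iff:
  fixes f :: "complex \<Rightarrow> 'b :: {banach, second_countable_topology}"
  assumes "f \<in> borel_measurable borel"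
  shows "integrable area f \<longleftrightarrow> integrable (lborel \<Otimes>\<^sub>M lborel) (\<lambda>p. f (Complex (fst p) (snd p)))"
  unfolding area_def by (rule integrable_distr_eq[OF measurable_Complex assms])

lemma area_integral:
  fixes f :: "complex \<Rightarrow> 'b :: {banach, second_countable_topology}"
  assumes "f \<in> borel_measurable borel"
  shows "(\<integral>z. f z \<partial>area) = (\<integral>p. f (Complex (fst p) (snd p)) \<partial>(lborel \<Otimes>\<^sub>M lborel))"
  unfolding area_def by (rule integral_distr[OF measurable_Complex assms])

lemma area_integral_xy:
  fixes f :: "complex \<Rightarrow> real"
  assumes "integrable area f"
  shows "(\<integral>z. f z \<partial>area) = (\<integral>x. \<integral>y. f (Complex x y) \<partial>lborel \<partial>lborel)"
    and "(\<integral>z. f z \<partial>area) = (\<integral>y. \<integral>x. f (Complex x y) \<partial>lborel \<partial>lborel)"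
proof -
  have m: "f \<in> borel_measurable borel" using borel_measurable_integrable[OF assms] by simp
  have i: "integrable (lborel \<Otimes>\<^sub>M lborel) (\<lambda>(x, y). f (Complex x y))"
    using assms area_integrable_iff[OF m] by (simp add: case_prod_beta')
  show "(\<integral>z. f z \<partial>area) = (\<integral>x. \<integral>y. f (Complex x y) \<partial>lborel \<partial>lborel)"
    using lborel_pair.integral_fst[OF i] area_integral[OF m] by (simp add: case_prod_beta')
  show "(\<integral>z. f z \<partial>area) = (\<integral>y. \<integral>x. f (Complex x y) \<partial>lborel \<partial>lborel)"
    using lborel_pair.integral_snd[OF i] area_integral[OF m] by (simp add: case_prod_beta')
qed

lemma area_integrable_product:
  fixes f g :: "real \<Rightarrow> real"
  assumes "integrable lborel f" "integrable lborel g"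
  shows "integrable area (\<lambda>z. f (Re z) * g (Im z))"
proof -
  have [measurable]: "f \<in> borel_measurable borel" "g \<in> borel_measurable borel"
    using assms borel_measurable_integrable by (auto simp: measurable_lborel1)
  have "integrable (lborel \<Otimes>\<^sub>M lborel) (\<lambda>p. f (fst p) * g (snd p))"
    using assms
    by (intro lborel_pair.Fubini_integrable) (auto simp: abs_mult)
  then show ?thesis by (subst area_integrable_iff) auto
qed

definition square :: "real \<Rightarrow> complex set" where
  "square R = {z. \<bar>Re z\<bar> \<le> R \<and> \<bar>Im z\<bar> \<le> R}"

lemma closed_square: "closed (square R)"
proof -
  have "square R = {z. \<bar>Re z\<bar> \<le> R} \<inter> {z. \<bar>Im z\<bar> \<le> R}" by (auto simp: square_def)
  then show ?thesis by (simp only:) (intro closed_Int closed_Collect_le continuous_intros)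
qed

lemma area_integrable_square:
  fixes f :: "complex \<Rightarrow> real"
  assumes "continuous_on UNIV f"
  shows "integrable area (\<lambda>z. indicator (square R) z * f z)"
proof -
  have m: "f \<in> borel_measurable borel" by (rule borel_measurable_continuous_onI[OF assms])
  have ms: "square R \<in> sets borel" using closed_square by simp
  have c: "continuous_on ({-R..R} \<times> {-R..R}) (\<lambda>p. f (Complex (fst p) (snd p)))"
    by (rule continuous_on_compose2[OF assms]) (auto simp: Complex_eq intro!: continuous_intros)
  have "integrable lborel (\<lambda>p :: real \<times> real. indicator ({-R..R} \<times> {-R..R}) p *\<^sub>R f (Complex (fst p) (snd p)))"
    by (rule borel_integrable_compact[OF compact_Times[OF compact_Icc compact_Icc] c])
  moreover have "indicator ({-R..R} \<times> {-R..R}) p *\<^sub>R f (Complex (fst p) (snd p)) =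
      indicator (square R) (Complex (fst p) (snd p)) * f (Complex (fst p) (snd p))" for p :: "real \<times> real"
    by (cases p) (auto simp: indicator_def square_def abs_le_iff)
  ultimately have "integrable lborel (\<lambda>p. indicator (square R) (Complex (fst p) (snd p)) * f (Complex (fst p) (snd p)))"
    by (simp only:)
  then show ?thesis
    using area_integrable_iff[of "\<lambda>z. indicator (square R) z * f z"] m ms
    by (simp add: lborel_prod)
qed

lemma area_integrable_compact_support:
  fixes f :: "complex \<Rightarrow> real"
  assumes "continuous_on UNIV f" "\<And>z. cmod z > R \<Longrightarrow> f z = 0"
  shows "integrable area f"
proof -
  have "f z = indicator (square R) z * f z" for z
  proof (cases "z \<in> square R")
    case False
    then have "cmod z > R" using abs_Re_le_cmod[of z] abs_Im_le_cmod[of z] by (auto simp: square_def)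
    then show ?thesis using assms(2) by simp
  qed simp
  then show ?thesis using area_integrable_square[OF assms(1), of R] by (metis (no_types, lifting) Bochner_Integration.integrable_cong)
qed

text \<open>A one-variable derivative along the line through z in direction v. Together with
  continuity of the derivatives, the directions 1 and \<open>\<i>\<close> are all that integration
  by parts on squares uses.\<close>

definition dird :: "(complex \<Rightarrow> real) \<Rightarrow> complex \<Rightarrow> real \<Rightarrow> complex \<Rightarrow> bool" where
  "dird f v d z \<longleftrightarrow> ((\<lambda>t::real. f (z + of_real t * v)) has_real_derivative d) (at 0)"

lemma dird_x: "dird f 1 d (Complex x y) \<longleftrightarrow> ((\<lambda>x. f (Complex x y)) has_real_derivative d) (at x)"
proof -
  have "Complex x y + of_real t * 1 = Complex (x + t) y" for t by (simp add: complex_eq_iff)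
  then show ?thesis unfolding dird_def
    using DERIV_shift[of "\<lambda>x. f (Complex x y)" d 0 x] by (simp add: add.commute)
qed

lemma dird_y: "dird f \<i> d (Complex x y) \<longleftrightarrow> ((\<lambda>y. f (Complex x y)) has_real_derivative d) (at y)"
proof -
  have "Complex x y + of_real t * \<i> = Complex x (y + t)" for t by (simp add: complex_eq_iff)
  then show ?thesis unfolding dird_def
    using DERIV_shift[of "\<lambda>y. f (Complex x y)" d 0 y] by (simp add: add.commute)
qed

text \<open>Integrating out s leaves the fluxes through two opposite sides, each of length 2
  R.\<close>

lemma flux_bound:
  fixes g :: "real \<Rightarrow> real \<Rightarrow> real"
  assumes R: "R \<ge> 0" and d: "\<And>s t. ((\<lambda>s. a s t) has_real_derivative g s t) (at s)"
    and c: "\<And>t. continuous_on UNIV (\<lambda>s. g s t)"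
    and b: "\<And>t. \<bar>a R t\<bar> \<le> \<epsilon>" "\<And>t. \<bar>a (-R) t\<bar> \<le> \<epsilon>"
  shows "\<bar>\<integral>t. \<integral>s. indicator {-R..R} s * indicator {-R..R} t * g s t \<partial>lborel \<partial>lborel\<bar> \<le> 4 * R * \<epsilon>"
proof -
  have e0: "\<epsilon> \<ge> 0" using b(1)[of 0] by linarith
  have "(\<integral>s. indicator {-R..R} s *\<^sub>R g s t \<partial>lborel) = a R t - a (-R) t" for t
    using R by (intro integral_FTC_atLeastAtMost continuous_on_subset[OF c])
      (auto intro!: has_field_derivative_subset[OF d, THEN has_real_derivative_iff_has_vector_derivative[THEN iffD1]])
  then have "(\<integral>s. indicator {-R..R} s * indicator {-R..R} t * g s t \<partial>lborel) = indicator {-R..R} t * (a R t - a (-R) t)" for t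
    by (simp add: indicator_def)
  then have "\<bar>\<integral>t. \<integral>s. indicator {-R..R} s * indicator {-R..R} t * g s t \<partial>lborel \<partial>lborel\<bar>
      = \<bar>\<integral>t. indicator {-R..R} t * (a R t - a (-R) t) \<partial>lborel\<bar>" by simp
  also have "\<dots> \<le> (\<integral>t. indicator {-R..R} t * (2 * \<epsilon>) \<partial>lborel)"
  proof (rule order_trans[OF integral_abs_bound], rule integral_mono')
    show "integrable lborel (\<lambda>t. indicator {-R..R} t * (2 * \<epsilon>) :: real)"
      by (intro integrable_mult_left integrable_real_indicator) (auto simp: emeasure_lborel_Icc_eq)
    fix t :: real
    show "0 \<le> indicator {-R..R} t * (2 * \<epsilon>)" using e0 by simp
    have "\<bar>a R t - a (-R) t\<bar> \<le> 2 * \<epsilon>" using b[of t] by linarith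
    then show "\<bar>indicator {-R..R} t * (a R t - a (-R) t)\<bar> \<le> indicator {-R..R} t * (2 * \<epsilon>)"
      by (simp add: indicator_def)
  qed
  also have "\<dots> = 4 * R * \<epsilon>" using R by simp
  finally show ?thesis .
qed

text \<open>On the square of half-side n the flux is at most 8 n times the supremum of the field on
  its sides, and this tends to 0 by the decay condition.\<close>

lemma divergence_theorem:
  fixes a b a' b' :: "complex \<Rightarrow> real"
  assumes da: "\<And>z. dird a 1 (a' z) z" and db: "\<And>z. dird b \<i> (b' z) z"
    and ca: "continuous_on UNIV a'" and cb: "continuous_on UNIV b'"
    and la: "((\<lambda>z. cmod z * a z) \<longlongrightarrow> 0) at_infinity" and lb: "((\<lambda>z. cmod z * b z) \<longlongrightarrow> 0) at_infinity"
    and int: "integrable area (\<lambda>z. a' z + b' z)"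
  shows "(\<integral>z. a' z + b' z \<partial>area) = 0"
proof -
  let ?I = "\<lambda>n::nat. \<integral>z. indicator (square (real n)) z * (a' z + b' z) \<partial>area"
  have "?I \<longlonglongrightarrow> (\<integral>z. a' z + b' z \<partial>area)"
  proof (rule integral_dominated_convergence)
    show "(\<lambda>z. a' z + b' z) \<in> borel_measurable area" using int by auto
    have "square (real n) \<in> sets area" for n using closed_square by simp
    then show "(\<lambda>z. indicator (square (real n)) z * (a' z + b' z)) \<in> borel_measurable area" for n
      using int by (intro borel_measurable_times borel_measurable_indicator) auto
    show "integrable area (\<lambda>z. norm (a' z + b' z))" using int by (rule integrable_norm)
    show "AE z in area. norm (indicator (square (real n)) z * (a' z + b' z)) \<le> norm (a' z + b' z)" for n
      by (intro always_eventually allI) (auto simp: indicator_def)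
    have "(\<lambda>n. indicator (square (real n)) z * (a' z + b' z)) \<longlonglongrightarrow> a' z + b' z" for z
    proof (rule tendsto_eventually)
      obtain N :: nat where N: "\<bar>Re z\<bar> + \<bar>Im z\<bar> \<le> N" using real_arch_simple by blast
      have "z \<in> square (real n)" if "n \<ge> N" for n
      proof -
        have "real N \<le> real n" using that by simp
        then show ?thesis using N by (auto simp: square_def)
      qed
      then show "eventually (\<lambda>n. indicator (square (real n)) z * (a' z + b' z) = a' z + b' z) sequentially"
        unfolding eventually_sequentially by (intro exI[of _ N]) auto
    qed
    then show "AE z in area. (\<lambda>n. indicator (square (real n)) z * (a' z + b' z)) \<longlonglongrightarrow> a' z + b' z" by simp
  qed
  moreover have "?I \<longlonglongrightarrow> 0"
  proof (rule LIMSEQ_I)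
    fix r :: real assume r: "r > 0"
    \<comment> \<open>The four sides together contribute at most 8 \<delta>, which is less than
      r.\<close>
    define \<delta> where "\<delta> = r / 9"
    have \<delta>: "\<delta> > 0" using r by (simp add: \<delta>_def)
    have "eventually (\<lambda>z. \<bar>cmod z * a z\<bar> < \<delta> \<and> \<bar>cmod z * b z\<bar> < \<delta>) at_infinity"
      using tendstoD[OF la \<delta>] tendstoD[OF lb \<delta>] by (simp add: eventually_conj dist_real_def)
    then obtain B where B: "\<And>z. cmod z \<ge> B \<Longrightarrow> \<bar>cmod z * a z\<bar> < \<delta> \<and> \<bar>cmod z * b z\<bar> < \<delta>"
      unfolding eventually_at_infinity by blast
    obtain N :: nat where N: "max B 1 \<le> N" using real_arch_simple by blast
    have "\<bar>?I n\<bar> < r" if n: "n \<ge> N" for n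
    proof -
      define x where "x = real n"
      have n1: "x \<ge> 1" "x \<ge> B" unfolding x_def using n N by (auto intro: order_trans[of _ "real N"])
      have bd: "\<bar>a z\<bar> \<le> \<delta> / x" "\<bar>b z\<bar> \<le> \<delta> / x" if "cmod z \<ge> x" for z
      proof -
        have "x * \<bar>a z\<bar> \<le> \<bar>cmod z * a z\<bar>" "x * \<bar>b z\<bar> \<le> \<bar>cmod z * b z\<bar>"
          using that by (auto simp: abs_mult intro!: mult_right_mono)
        then have "x * \<bar>a z\<bar> \<le> \<delta>" "x * \<bar>b z\<bar> \<le> \<delta>" using B[of z] n1 that by auto
        then show "\<bar>a z\<bar> \<le> \<delta> / x" "\<bar>b z\<bar> \<le> \<delta> / x" using n1 by (auto simp: field_simps)
      qed
      have big: "cmod (Complex x t) \<ge> x" "cmod (Complex (-x) t) \<ge> x" "cmod (Complex t x) \<ge> x" "cmod (Complex t (-x)) \<ge> x" for t :: real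
        using abs_Re_le_cmod[of "Complex x t"] abs_Re_le_cmod[of "Complex (-x) t"]
          abs_Im_le_cmod[of "Complex t x"] abs_Im_le_cmod[of "Complex t (-x)"] by auto
      have ia: "integrable area (\<lambda>z. indicator (square x) z * a' z)" and ib: "integrable area (\<lambda>z. indicator (square x) z * b' z)"
        by (intro area_integrable_square ca cb)+
      have ind: "indicator (square x) (Complex u v) = indicator {-x..x} u * (indicator {-x..x} v :: real)" for u v :: real
        by (auto simp: indicator_def square_def abs_le_iff)
      have slice: "continuous_on UNIV (\<lambda>s. a' (Complex s t))" "continuous_on UNIV (\<lambda>s. b' (Complex t s))" for t
        by (rule continuous_on_compose2[OF ca] continuous_on_compose2[OF cb]; auto simp: Complex_eq intro!: continuous_intros)+
      have "\<bar>\<integral>t. \<integral>s. indicator {-x..x} s * indicator {-x..x} t * a' (Complex s t) \<partial>lborel \<partial>lborel\<bar> \<le> 4 * x * (\<delta> / x)"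
        by (rule flux_bound[where a = "\<lambda>s t. a (Complex s t)"])
           (use da[of "Complex _ _", unfolded dird_x] slice bd big n1 in auto)
      then have 1: "\<bar>\<integral>z. indicator (square x) z * a' z \<partial>area\<bar> \<le> 4 * x * (\<delta> / x)"
        unfolding area_integral_xy(2)[OF ia] ind .
      have "\<bar>\<integral>t. \<integral>s. indicator {-x..x} s * indicator {-x..x} t * b' (Complex t s) \<partial>lborel \<partial>lborel\<bar> \<le> 4 * x * (\<delta> / x)"
        by (rule flux_bound[where a = "\<lambda>s t. b (Complex t s)"])
           (use db[of "Complex _ _", unfolded dird_y] slice bd big n1 in auto)
      then have 2: "\<bar>\<integral>z. indicator (square x) z * b' z \<partial>area\<bar> \<le> 4 * x * (\<delta> / x)"
        unfolding area_integral_xy(1)[OF ib] ind by (simp add: mult_ac)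
      have "?I n = (\<integral>z. indicator (square x) z * a' z \<partial>area) + (\<integral>z. indicator (square x) z * b' z \<partial>area)"
        using ia ib by (simp add: distrib_left x_def)
      then have "\<bar>?I n\<bar> \<le> 8 * \<delta>" using 1 2 n1 by simp
      then show ?thesis using r by (simp add: \<delta>_def)
    qed
    then show "\<exists>no. \<forall>n\<ge>no. norm (?I n - 0) < r" by auto
  qed
  ultimately show ?thesis by (rule LIMSEQ_unique)
qed

lemma area_integral_affine:
  fixes f :: "complex \<Rightarrow> real"
  assumes c: "continuous_on UNIV f" and supp: "\<And>z. cmod z > R \<Longrightarrow> f z = 0" and s: "s > 0"
  shows "(\<integral>z. f (w + of_real s * z) \<partial>area) = (\<integral>z. f z \<partial>area) / s\<^sup>2"
proof -
  have i: "integrable area f" by (rule area_integrable_compact_support[OF c supp])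
  have i': "integrable area (\<lambda>z. f (w + of_real s * z))"
  proof (rule area_integrable_compact_support)
    show "continuous_on UNIV (\<lambda>z. f (w + of_real s * z))"
      by (rule continuous_on_compose2[OF c]) (auto intro!: continuous_intros)
    fix z assume "cmod z > (\<bar>R\<bar> + cmod w) / s"
    then have "s * cmod z > \<bar>R\<bar> + cmod w" using s by (simp add: field_simps)
    moreover have "cmod (of_real s * z) \<le> cmod (w + of_real s * z) + cmod w"
      using norm_triangle_ineq4[of "w + of_real s * z" w] by simp
    ultimately show "f (w + of_real s * z) = 0" using s by (intro supp) (simp add: norm_mult)
  qed
  have e: "w + of_real s * Complex x y = Complex (Re w + s * x) (Im w + s * y)" for x y
    by (simp add: complex_eq_iff)
  have "(\<integral>z. f z \<partial>area) = (\<integral>x. \<integral>y. f (Complex x y) \<partial>lborel \<partial>lborel)" by (rule area_integral_xy(1)[OF i])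
  also have "\<dots> = s * (\<integral>x. (\<integral>y. f (Complex (Re w + s * x) y) \<partial>lborel) \<partial>lborel)"
    using lborel_integral_real_affine[of s "\<lambda>x. \<integral>y. f (Complex x y) \<partial>lborel" "Re w"] s by simp
  also have "\<dots> = s * (\<integral>x. s * (\<integral>y. f (Complex (Re w + s * x) (Im w + s * y)) \<partial>lborel) \<partial>lborel)"
    using lborel_integral_real_affine[of s "\<lambda>y. f (Complex (Re w + s * x) y)" "Im w" for x] s by simp
  also have "\<dots> = s\<^sup>2 * (\<integral>z. f (w + of_real s * z) \<partial>area)"
    unfolding area_integral_xy(1)[OF i'] e by (simp add: power2_eq_square)
  finally show ?thesis using s by simp
qed

section \<open>Smoothed logarithms of polynomials and Green's formula\<close>

text \<open>At the corner the difference quotient is at most |h|^(n+1). Truncated powers thus give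
  piecewise polynomial cut-offs of prescribed smoothness.\<close>

lemma DERIV_ramp_power:
  "((\<lambda>x::real. max 0 (x - c) ^ (n + 2)) has_real_derivative real (n + 2) * max 0 (x - c) ^ (n + 1)) (at x)"
proof -
  consider "x > c" | "x < c" | "x = c" by linarith
  then show ?thesis
  proof cases
    case 1
    have "((\<lambda>x::real. (x - c) ^ (n + 2)) has_real_derivative real (n + 2) * max 0 (x - c) ^ (n + 1)) (at x)"
    proof -
      have "((\<lambda>x. x - c) has_real_derivative 1) (at x)" by (auto intro!: derivative_eq_intros)
      from DERIV_power[OF this, of "n + 2"] show ?thesis using 1 by simp
    qed
    then show ?thesis
      by (rule has_field_derivative_transform_within_open[of _ _ _ "{c<..}"]) (use 1 in auto)
  next
    case 2
    have "((\<lambda>x::real. 0) has_real_derivative real (n + 2) * max 0 (x - c) ^ (n + 1)) (at x)"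
      using 2 by (auto intro!: derivative_eq_intros)
    then show ?thesis
      by (rule has_field_derivative_transform_within_open[of _ _ _ "{..<c}"]) (use 2 in auto)
  next
    case 3
    have "((\<lambda>h. max 0 h ^ (n + 2) / h) \<longlongrightarrow> 0) (at (0::real))"
    proof (rule Lim_null_comparison)
      show "eventually (\<lambda>h. norm (max 0 h ^ (n + 2) / h) \<le> \<bar>h\<bar> ^ (n + 1)) (at (0::real))"
      proof (intro always_eventually allI)
        fix h :: real
        show "norm (max 0 h ^ (n + 2) / h) \<le> \<bar>h\<bar> ^ (n + 1)"
        proof (cases "h > 0")
          case False
          then have "max 0 h = 0" by simp
          then have "norm (max 0 h ^ (n + 2) / h) = 0" by simp
          then show ?thesis using zero_le_power_abs[of h "n + 1"] by linarith
        qed (auto simp: max_def)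
      qed
      have "((\<lambda>h. \<bar>h\<bar> ^ (n + 1)) \<longlongrightarrow> \<bar>0\<bar> ^ (n + 1)) (at (0::real))" by (intro tendsto_intros)
      then show "((\<lambda>h. \<bar>h\<bar> ^ (n + 1)) \<longlongrightarrow> 0) (at (0::real))" by simp
    qed
    then show ?thesis using 3 by (simp add: DERIV_def)
  qed
qed

text \<open>The second antiderivative of the tent \<open>omega2\<close>, which lives on [0, 1], has
  height 2 and hence area 1. So \<open>omega1\<close> climbs from 0 to 1, and \<open>omega0\<close>
  is a C^2 cubic spline that joins 0 to the line x - 1/2.\<close>

definition omega0 :: "real \<Rightarrow> real" where
  "omega0 x = 2 / 3 * (max 0 (x - 0) ^ 3 - 2 * max 0 (x - 1/2) ^ 3 + max 0 (x - 1) ^ 3)"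

definition omega1 :: "real \<Rightarrow> real" where
  "omega1 x = 2 * (max 0 (x - 0) ^ 2 - 2 * max 0 (x - 1/2) ^ 2 + max 0 (x - 1) ^ 2)"

definition omega2 :: "real \<Rightarrow> real" where
  "omega2 x = 4 * (max 0 (x - 0) - 2 * max 0 (x - 1/2) + max 0 (x - 1))"

lemma DERIV_omega0: "(omega0 has_real_derivative omega1 x) (at x)"
proof -
  have 3: "((\<lambda>x::real. max 0 (x - c) ^ 3) has_real_derivative 3 * max 0 (x - c) ^ 2) (at x)" for c
    using DERIV_ramp_power[of c 1 x] by (simp add: numeral_3_eq_3 numeral_2_eq_2)
  have "((\<lambda>x. 2 / 3 * (max 0 (x - 0) ^ 3 - 2 * max 0 (x - 1/2) ^ 3 + max 0 (x - 1) ^ 3)) has_real_derivative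
      2 / 3 * (3 * max 0 (x - 0) ^ 2 - 2 * (3 * max 0 (x - 1/2) ^ 2) + 3 * max 0 (x - 1) ^ 2)) (at x)"
    by (intro DERIV_cmult DERIV_add DERIV_diff 3)
  then show ?thesis unfolding omega0_def[abs_def] omega1_def by (simp add: algebra_simps)
qed

lemma DERIV_omega1: "(omega1 has_real_derivative omega2 x) (at x)"
proof -
  have 2: "((\<lambda>x::real. max 0 (x - c) ^ 2) has_real_derivative 2 * max 0 (x - c)) (at x)" for c
    using DERIV_ramp_power[of c 0 x] by (simp add: numeral_2_eq_2)
  have "((\<lambda>x. 2 * (max 0 (x - 0) ^ 2 - 2 * max 0 (x - 1/2) ^ 2 + max 0 (x - 1) ^ 2)) has_real_derivative
      2 * (2 * max 0 (x - 0) - 2 * (2 * max 0 (x - 1/2)) + 2 * max 0 (x - 1))) (at x)"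
    by (intro DERIV_cmult DERIV_add DERIV_diff 2)
  then show ?thesis unfolding omega1_def[abs_def] omega2_def by (simp add: algebra_simps)
qed

lemma omega_continuous: "isCont omega0 x" "isCont omega1 x" "isCont omega2 x"
  using DERIV_omega0 DERIV_omega1 by (auto intro: DERIV_isCont simp: omega2_def[abs_def] intro!: continuous_intros)

lemma omega_neg: "x \<le> 0 \<Longrightarrow> omega0 x = 0" "x \<le> 0 \<Longrightarrow> omega1 x = 0" "x \<le> 0 \<Longrightarrow> omega2 x = 0"
  by (auto simp: omega0_def omega1_def omega2_def)

lemma omega_ge_1: "x \<ge> 1 \<Longrightarrow> omega0 x = x - 1/2" "x \<ge> 1 \<Longrightarrow> omega1 x = 1" "x \<ge> 1 \<Longrightarrow> omega2 x = 0"
  by (auto simp: omega0_def omega1_def omega2_def power2_eq_square power3_eq_cube max_def field_simps)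

lemma omega2_nonneg: "omega2 x \<ge> 0"
  by (auto simp: omega2_def max_def)

lemma omega1_bounds: "0 \<le> omega1 x" "omega1 x \<le> 1"
proof -
  have mono: "omega1 x \<le> omega1 y" if "x \<le> y" for x y
    by (rule DERIV_nonneg_imp_nondecreasing[OF that]) (use DERIV_omega1 omega2_nonneg in blast)
  show "0 \<le> omega1 x" using mono[of "min x 0" x] omega_neg(2)[of "min x 0"] by simp
  show "omega1 x \<le> 1" using mono[of x "max x 1"] omega_ge_1(2)[of "max x 1"] by simp
qed

lemma omega0_bounds: "0 \<le> omega0 x" "omega0 x \<le> max 0 x" "omega0 x \<ge> x - 1/2"
proof -
  have mono: "omega0 x \<le> omega0 y" if "x \<le> y" for x y
    by (rule DERIV_nonneg_imp_nondecreasing[OF that]) (use DERIV_omega0 omega1_bounds in blast)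
  show "0 \<le> omega0 x" using mono[of "min x 0" x] omega_neg(1)[of "min x 0"] by simp
  have mono': "x - omega0 x \<le> y - omega0 y" if "x \<le> y" for x y
  proof (rule DERIV_nonneg_imp_nondecreasing[OF that])
    fix t have "((\<lambda>x. x - omega0 x) has_real_derivative 1 - omega1 t) (at t)"
      by (intro DERIV_diff DERIV_ident DERIV_omega0)
    then show "\<exists>l. ((\<lambda>x. x - omega0 x) has_real_derivative l) (at t) \<and> 0 \<le> l"
      using omega1_bounds[of t] by auto
  qed
  show "omega0 x \<le> max 0 x"
    using mono'[of 0 x] omega_neg(1)[of 0] omega_neg(1)[of x] by (cases "x \<ge> 0") auto
  show "omega0 x \<ge> x - 1/2"
    using mono'[of x "max x 1"] omega_ge_1(1)[of "max x 1"] by simp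
qed

lemma dird_Re:
  assumes "(h has_field_derivative h') (at z)"
  shows "dird (\<lambda>z. Re (h z)) v (Re (v * h')) z" "dird (\<lambda>z. Im (h z)) v (Im (v * h')) z"
proof -
  have "((\<lambda>t::real. z + of_real t * v) has_vector_derivative v) (at 0)"
    by (auto intro!: derivative_eq_intros simp: has_vector_derivative_def scaleR_conv_of_real)
  from field_vector_diff_chain_at[OF this, of h h'] assms
  have *: "((h \<circ> (\<lambda>t. z + of_real t * v)) has_vector_derivative v * h') (at 0)" by simp
  show "dird (\<lambda>z. Re (h z)) v (Re (v * h')) z"
    unfolding dird_def has_real_derivative_iff_has_vector_derivative
    using bounded_linear.has_vector_derivative[OF bounded_linear_Re *] by (simp add: o_def)
  show "dird (\<lambda>z. Im (h z)) v (Im (v * h')) z"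
    unfolding dird_def has_real_derivative_iff_has_vector_derivative
    using bounded_linear.has_vector_derivative[OF bounded_linear_Im *] by (simp add: o_def)
qed

lemma dird_local:
  assumes "dird f v d z" "eventually (\<lambda>w. f w = g w) (nhds z)"
  shows "dird g v d z"
proof -
  obtain U where U: "open U" "z \<in> U" "\<And>w. w \<in> U \<Longrightarrow> f w = g w"
    using assms(2) by (auto simp: eventually_nhds)
  have "continuous_on UNIV (\<lambda>t::real. z + of_real t * v)" by (intro continuous_intros)
  then have "open ((\<lambda>t::real. z + of_real t * v) -` U)" using U(1) by (simp add: continuous_on_open_vimage)
  then have "eventually (\<lambda>t. t \<in> (\<lambda>t::real. z + of_real t * v) -` U) (nhds 0)"
    using U(2) by (intro eventually_nhds_in_open) auto
  then have "eventually (\<lambda>t::real. f (z + of_real t * v) = g (z + of_real t * v)) (nhds 0)"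
    by (rule eventually_mono) (use U(3) in auto)
  then show ?thesis using assms(1) unfolding dird_def by (subst (asm) DERIV_cong_ev) auto
qed

lemma dird_const: "dird (\<lambda>z. c) v 0 z"
  by (simp add: dird_def)

lemma dird_mult: "dird f v a z \<Longrightarrow> dird g v b z \<Longrightarrow> dird (\<lambda>z. f z * g z) v (a * g z + b * f z) z"
  unfolding dird_def using DERIV_mult[of "\<lambda>t. f (z + of_real t * v)" a 0 UNIV "\<lambda>t. g (z + of_real t * v)" b] by simp

lemma dird_diff: "dird f v a z \<Longrightarrow> dird g v b z \<Longrightarrow> dird (\<lambda>z. f z - g z) v (a - b) z"
  unfolding dird_def by (rule DERIV_diff)

lemma dird_add: "dird f v a z \<Longrightarrow> dird g v b z \<Longrightarrow> dird (\<lambda>z. f z + g z) v (a + b) z"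
  unfolding dird_def by (rule DERIV_add)

lemma dird_cmult: "dird f v a z \<Longrightarrow> dird (\<lambda>z. c * f z) v (c * a) z"
  unfolding dird_def by (rule DERIV_cmult)

lemma dird_comp: "(F has_real_derivative d) (at (f z)) \<Longrightarrow> dird f v a z \<Longrightarrow> dird (\<lambda>z. F (f z)) v (d * a) z"
  unfolding dird_def using DERIV_chain2[of F d "\<lambda>t. f (z + of_real t * v)" 0 a UNIV] by simp

section \<open>The C^2 truncation of ln |A|\<close>

definition logder :: "complex poly \<Rightarrow> complex \<Rightarrow> complex" where
  "logder A z = poly (pderiv A) z / poly A z"

definition logder' :: "complex poly \<Rightarrow> complex \<Rightarrow> complex" where
  "logder' A z = (poly (pderiv (pderiv A)) z * poly A z - (poly (pderiv A) z)\<^sup>2) / (poly A z)\<^sup>2"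

text \<open>At a zero of A the convention \<open>ln 0\<close> = 0 gives level 0, where the cut-offs
  vanish, so the formulas below hold there as well.\<close>

definition level :: "complex poly \<Rightarrow> real \<Rightarrow> complex \<Rightarrow> real" where
  "level A a z = ln ((cmod (poly A z))\<^sup>2 / a)"

text \<open>\<open>gam A a\<close> is a \<open>C\<^sup>2\<close> function that vanishes where \<open>\<bar>A\<bar>\<^sup>2 \<le> a\<close> and
  equals \<open>ln \<bar>A\<bar>\<close> up to a constant where \<open>\<bar>A\<bar>\<^sup>2 \<ge> e a\<close>.\<close>

definition gam :: "complex poly \<Rightarrow> real \<Rightarrow> complex \<Rightarrow> real" where
  "gam A a z = omega0 (level A a z) / 2"

text \<open>The gradient of ln |A| is (Re, - Im) of A'/A; the factor 2 in the derivative of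
  \<open>level\<close> cancels the 1/2 in \<open>gam\<close>.\<close>

definition gamx :: "complex poly \<Rightarrow> real \<Rightarrow> complex \<Rightarrow> real" where
  "gamx A a z = omega1 (level A a z) * Re (logder A z)"

definition gamy :: "complex poly \<Rightarrow> real \<Rightarrow> complex \<Rightarrow> real" where
  "gamy A a z = omega1 (level A a z) * (- Im (logder A z))"

definition gamxx :: "complex poly \<Rightarrow> real \<Rightarrow> complex \<Rightarrow> real" where
  "gamxx A a z = omega2 (level A a z) * (2 * (Re (logder A z))\<^sup>2) + omega1 (level A a z) * Re (logder' A z)"

definition gamyy :: "complex poly \<Rightarrow> real \<Rightarrow> complex \<Rightarrow> real" where
  "gamyy A a z = omega2 (level A a z) * (2 * (Im (logder A z))\<^sup>2) + omega1 (level A a z) * (- Re (logder' A z))"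

text \<open>The Laplacian of \<open>gam\<close>: the \<open>logder'\<close> terms cancel because ln
  |A| is harmonic off the zeros. What is left is nonnegative and sits in the shell where the cut-off
  bends.\<close>

definition lap :: "complex poly \<Rightarrow> real \<Rightarrow> complex \<Rightarrow> real" where
  "lap A a z = omega2 (level A a z) * (2 * (cmod (logder A z))\<^sup>2)"

lemma gam_lap: "gamxx A a z + gamyy A a z = lap A a z"
  by (simp add: gamxx_def gamyy_def lap_def cmod_power2 algebra_simps)

lemma level_le_0: "a > 0 \<Longrightarrow> (cmod (poly A z))\<^sup>2 \<le> a \<Longrightarrow> level A a z \<le> 0"
  by (cases "poly A z = 0") (auto simp: level_def ln_le_zero_iff)

lemma level_zero_ev:
  assumes "a > 0" "(cmod (poly A z))\<^sup>2 < a"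
  shows "eventually (\<lambda>w. level A a w \<le> 0) (nhds z)"
proof -
  have "open {w. (cmod (poly A w))\<^sup>2 < a}" by (intro open_Collect_less continuous_intros)
  then have "eventually (\<lambda>w. w \<in> {w. (cmod (poly A w))\<^sup>2 < a}) (nhds z)"
    using assms by (intro eventually_nhds_in_open) auto
  then show ?thesis by (rule eventually_mono) (use assms level_le_0 in auto)
qed

lemma level_cont: "a > 0 \<Longrightarrow> poly A z \<noteq> 0 \<Longrightarrow> isCont (level A a) z"
  unfolding level_def[abs_def] by (intro continuous_intros) auto

lemma level_dird:
  assumes "a > 0" "poly A z \<noteq> 0"
  shows "dird (level A a) v (2 * Re (v * logder A z)) z"
proof -
  have d: "(poly A has_field_derivative poly (pderiv A) z) (at z)" by (rule poly_DERIV)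
  have "dird (\<lambda>z. Re (poly A z) * Re (poly A z)) v (Re (v * poly (pderiv A) z) * Re (poly A z) + Re (v * poly (pderiv A) z) * Re (poly A z)) z"
    "dird (\<lambda>z. Im (poly A z) * Im (poly A z)) v (Im (v * poly (pderiv A) z) * Im (poly A z) + Im (v * poly (pderiv A) z) * Im (poly A z)) z"
    by (intro dird_mult dird_Re d)+
  from dird_cmult[OF dird_add[OF this], of "1 / a"]
  have "dird (\<lambda>z. 1 / a * (Re (poly A z) * Re (poly A z) + Im (poly A z) * Im (poly A z))) v
     (1 / a * (2 * (Re (v * poly (pderiv A) z) * Re (poly A z) + Im (v * poly (pderiv A) z) * Im (poly A z)))) z" (is "dird ?q v ?q' z")
    by (simp add: algebra_simps)
  moreover have q: "?q w = (cmod (poly A w))\<^sup>2 / a" for w by (simp add: cmod_power2) (simp add: power2_eq_square)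
  moreover have "?q z > 0" by (subst q) (use assms in auto)
  ultimately have "dird (\<lambda>z. ln (?q z)) v (1 / ?q z * ?q') z"
    by (intro dird_comp[where F = ln]) (auto intro!: derivative_eq_intros)
  moreover have "1 / ?q z * ?q' = 2 * Re (v * logder A z)"
  proof -
    have "Re (v * poly (pderiv A) z / poly A z) = (Re (v * poly (pderiv A) z) * Re (poly A z) + Im (v * poly (pderiv A) z) * Im (poly A z)) / ((Re (poly A z))\<^sup>2 + (Im (poly A z))\<^sup>2)"
      by (rule Re_divide)
    then show ?thesis using assms by (simp add: logder_def power2_eq_square)
  qed
  ultimately show ?thesis unfolding q by (simp add: level_def[abs_def])
qed

lemma logder_deriv:
  assumes "poly A z \<noteq> 0"
  shows "(logder A has_field_derivative logder' A z) (at z)"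
  unfolding logder_def[abs_def] logder'_def
  by (rule DERIV_cong[OF DERIV_divide[OF poly_DERIV poly_DERIV assms]]) (use assms in \<open>simp add: power2_eq_square\<close>)

lemma logder_cont: "poly A z \<noteq> 0 \<Longrightarrow> isCont (logder A) z" "poly A z \<noteq> 0 \<Longrightarrow> isCont (logder' A) z"
  unfolding logder_def[abs_def] logder'_def[abs_def] by (intro continuous_intros; simp)+

text \<open>The singularities of K are zeros of A, and near those the cut-off factor vanishes
  identically.\<close>

lemma cut_continuous:
  fixes om :: "real \<Rightarrow> real" and K :: "complex \<Rightarrow> real"
  assumes a: "a > 0" and om: "\<And>x. isCont om x" "\<And>x. x \<le> 0 \<Longrightarrow> om x = 0"
    and K: "\<And>z. poly A z \<noteq> 0 \<Longrightarrow> isCont K z"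
  shows "continuous_on UNIV (\<lambda>z. om (level A a z) * K z)"
proof -
  have "isCont (\<lambda>z. om (level A a z) * K z) z" for z
  proof (cases "poly A z = 0")
    case True
    then have "eventually (\<lambda>w. om (level A a w) * K w = 0) (nhds z)"
      using level_zero_ev[OF a, of A z] a om(2) by (auto elim!: eventually_mono)
    then have "isCont (\<lambda>z. om (level A a z) * K z) z \<longleftrightarrow> isCont (\<lambda>_. 0 :: real) z" by (rule isCont_cong)
    then show ?thesis by simp
  next
    case False
    then show ?thesis
      using isCont_o2[OF level_cont[OF a False] om(1)] K by (intro continuous_intros) auto
  qed
  then show ?thesis by (simp add: continuous_at_imp_continuous_on)
qed

lemma gam_continuous:
  assumes "a > 0"
  shows "continuous_on UNIV (gam A a)" "continuous_on UNIV (gamx A a)" "continuous_on UNIV (gamy A a)"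
    "continuous_on UNIV (gamxx A a)" "continuous_on UNIV (gamyy A a)" "continuous_on UNIV (lap A a)"
proof -
  have cut: "continuous_on UNIV (\<lambda>z. omega0 (level A a z) * K z)" "continuous_on UNIV (\<lambda>z. omega1 (level A a z) * K z)"
    "continuous_on UNIV (\<lambda>z. omega2 (level A a z) * K z)" if "\<And>z. poly A z \<noteq> 0 \<Longrightarrow> isCont K z" for K
    using cut_continuous[OF assms _ _ that] omega_continuous omega_neg by auto
  show "continuous_on UNIV (gam A a)"
    using cut(1)[of "\<lambda>_. 1/2"] by (simp add: gam_def[abs_def])
  have K: "isCont (\<lambda>z. Re (logder A z)) z" "isCont (\<lambda>z. - Im (logder A z)) z"
    "isCont (\<lambda>z. 2 * (cmod (logder A z))\<^sup>2) z" "isCont (\<lambda>z. 2 * (Re (logder A z))\<^sup>2) z"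
    "isCont (\<lambda>z. 2 * (Im (logder A z))\<^sup>2) z" "isCont (\<lambda>z. Re (logder' A z)) z"
    "isCont (\<lambda>z. - Re (logder' A z)) z" if "poly A z \<noteq> 0" for z
    using logder_cont[OF that] by (auto intro!: continuous_intros)
  show "continuous_on UNIV (gamx A a)" unfolding gamx_def[abs_def] by (rule cut(2)[OF K(1)])
  show "continuous_on UNIV (gamy A a)" unfolding gamy_def[abs_def] by (rule cut(2)[OF K(2)])
  show "continuous_on UNIV (lap A a)" unfolding lap_def[abs_def] by (rule cut(3)[OF K(3)])
  show "continuous_on UNIV (gamxx A a)" unfolding gamxx_def[abs_def]
    by (rule continuous_on_add[OF cut(3)[OF K(4)] cut(2)[OF K(6)]])
  show "continuous_on UNIV (gamyy A a)" unfolding gamyy_def[abs_def]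
    by (rule continuous_on_add[OF cut(3)[OF K(5)] cut(2)[OF K(7)]])
qed

lemma gam_dird:
  assumes a: "a > 0"
  shows "dird (gam A a) 1 (gamx A a z) z" "dird (gam A a) \<i> (gamy A a z) z"
    "dird (gamx A a) 1 (gamxx A a z) z" "dird (gamy A a) \<i> (gamyy A a z) z"
proof -
  have "dird (gam A a) 1 (gamx A a z) z \<and> dird (gam A a) \<i> (gamy A a z) z \<and>
    dird (gamx A a) 1 (gamxx A a z) z \<and> dird (gamy A a) \<i> (gamyy A a z) z"
  proof (cases "poly A z = 0")
    case True
    then have ev: "eventually (\<lambda>w. level A a w \<le> 0) (nhds z)" using level_zero_ev[OF a] a by simp
    then have z: "level A a z \<le> 0" by (rule eventually_nhds_x_imp_x)
    have "eventually (\<lambda>w. 0 = gam A a w) (nhds z)" "eventually (\<lambda>w. 0 = gamx A a w) (nhds z)" "eventually (\<lambda>w. 0 = gamy A a w) (nhds z)"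
      using ev by (auto elim!: eventually_mono simp: gam_def gamx_def gamy_def omega_neg)
    note ev0 = this
    have "dird (gam A a) v 0 z" "dird (gamx A a) v 0 z" "dird (gamy A a) v 0 z" for v
      using dird_local[OF dird_const ev0(1)] dird_local[OF dird_const ev0(2)] dird_local[OF dird_const ev0(3)] by auto
    then show ?thesis
      using z by (simp add: gamx_def[of A a z] gamy_def[of A a z] gamxx_def gamyy_def omega_neg)
  next
    case False
    note L = level_dird[OF a False]
    have om0: "dird (\<lambda>z. omega0 (level A a z)) v (omega1 (level A a z) * (2 * Re (v * logder A z))) z" for v
      by (intro dird_comp[OF DERIV_omega0 L])
    have om1: "dird (\<lambda>z. omega1 (level A a z)) v (omega2 (level A a z) * (2 * Re (v * logder A z))) z" for v
      by (intro dird_comp[OF DERIV_omega1 L])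
    have 1: "dird (gam A a) v (omega1 (level A a z) * Re (v * logder A z)) z" for v
    proof -
      have "1 / 2 * (k * (2 * r)) = k * r" for k r :: real by simp
      moreover have "gam A a = (\<lambda>z. 1 / 2 * omega0 (level A a z))" by (simp add: gam_def fun_eq_iff)
      ultimately show ?thesis using dird_cmult[OF om0, of "1/2"] by (simp only:)
    qed
    have 2: "dird (gamx A a) 1 (omega2 (level A a z) * (2 * Re (1 * logder A z)) * Re (logder A z) + Re (1 * logder' A z) * omega1 (level A a z)) z"
      unfolding gamx_def[abs_def] by (intro dird_mult om1 dird_Re logder_deriv False)
    have 3: "dird (gamy A a) \<i> (omega2 (level A a z) * (2 * Re (\<i> * logder A z)) * (- 1 * Im (logder A z)) + (- 1 * Im (\<i> * logder' A z)) * omega1 (level A a z)) z"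
      unfolding gamy_def[abs_def] using dird_mult[OF om1[of \<i>] dird_cmult[OF dird_Re(2)[OF logder_deriv[OF False], of \<i>], of "-1"]] by simp
    show ?thesis
      using 1[of 1] 1[of \<i>] 2 3
      by (simp add: gamx_def gamy_def gamxx_def gamyy_def power2_eq_square algebra_simps)
  qed
  then show "dird (gam A a) 1 (gamx A a z) z" "dird (gam A a) \<i> (gamy A a z) z"
    "dird (gamx A a) 1 (gamxx A a z) z" "dird (gamy A a) \<i> (gamyy A a z) z" by auto
qed

lemma gam_support:
  assumes "a > 0" "(cmod (poly A z))\<^sup>2 < a"
  shows "eventually (\<lambda>w. gam A a w = 0 \<and> gamx A a w = 0 \<and> gamy A a w = 0 \<and> gamxx A a w = 0 \<and> gamyy A a w = 0 \<and> lap A a w = 0) (nhds z)"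
  using level_zero_ev[OF assms]
  by (rule eventually_mono) (simp add: gam_def gamx_def gamy_def gamxx_def gamyy_def lap_def omega_neg)

lemma lap_nonneg: "lap A a z \<ge> 0"
  by (simp add: lap_def omega2_nonneg)

lemma lap_support: "a > 0 \<Longrightarrow> lap A a z \<noteq> 0 \<Longrightarrow> a \<le> (cmod (poly A z))\<^sup>2 \<and> (cmod (poly A z))\<^sup>2 \<le> exp 1 * a"
proof -
  assume a: "a > 0" and nz: "lap A a z \<noteq> 0"
  then have 0: "\<not> level A a z \<le> 0" "\<not> level A a z \<ge> 1" by (auto simp: lap_def omega_neg omega_ge_1)
  then have 1: "(cmod (poly A z))\<^sup>2 > a" using level_le_0[OF a, of A z] by linarith
  then have "(cmod (poly A z))\<^sup>2 / a > 0" using a by (intro divide_pos_pos) auto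
  then have "(cmod (poly A z))\<^sup>2 / a < exp 1"
    using 0(2) unfolding level_def by (metis exp_ln exp_less_cancel_iff not_le)
  then show ?thesis using 1 a by (simp add: field_simps)
qed

lemma poly_large:
  fixes A :: "complex poly"
  assumes "degree A > 0" shows "eventually (\<lambda>z. B < cmod (poly A z)) at_infinity"
proof -
  have "filterlim (\<lambda>z. norm (poly A z)) at_top at_infinity"
    using filterlim_poly_at_infinity[OF assms] by (simp add: filterlim_at_infinity_conv_norm_at_top)
  then show ?thesis unfolding filterlim_at_top_dense by blast
qed

lemma level_large:
  assumes "a > 0" "degree A > 0" shows "eventually (\<lambda>z. level A a z \<ge> 1) at_infinity"
  using poly_large[OF assms(2), of "exp 1 * a + 1"]
proof eventually_elim
  case (elim z)
  then have c1: "cmod (poly A z) \<ge> 1" using assms(1) by (smt (verit) exp_gt_zero mult_pos_pos)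
  then have "cmod (poly A z) \<le> (cmod (poly A z))\<^sup>2"
    using mult_left_mono[OF c1, of "cmod (poly A z)"] by (simp add: power2_eq_square)
  then have "exp 1 \<le> (cmod (poly A z))\<^sup>2 / a" using elim assms(1) by (simp add: field_simps)
  moreover have "(cmod (poly A z))\<^sup>2 / a > 0"
    using c1 assms(1) by (intro divide_pos_pos zero_less_power) linarith+
  ultimately show ?case unfolding level_def by (simp add: ln_ge_iff)
qed

lemma gam_at_infinity:
  assumes "a > 0" "A \<noteq> 0"
  shows "eventually (\<lambda>z. poly A z \<noteq> 0 \<and> gamx A a z = Re (logder A z) \<and> gamy A a z = - Im (logder A z) \<and> lap A a z = 0) at_infinity"
proof (cases "degree A = 0")
  case True
  then obtain c where "A = [:c:]" by (meson degree_eq_zeroE)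
  then show ?thesis using assms by (simp add: gamx_def gamy_def lap_def logder_def)
next
  case False
  then have "degree A > 0" by simp
  from level_large[OF assms(1) this] poly_large[OF this, of 0]
  show ?thesis by eventually_elim (auto simp: gamx_def gamy_def lap_def omega_ge_1)
qed

lemma lap_compact:
  assumes "a > 0" "A \<noteq> 0" obtains R where "\<And>z. cmod z > R \<Longrightarrow> lap A a z = 0"
  using gam_at_infinity[OF assms] unfolding eventually_at_infinity by (meson less_imp_le)

lemma lap_integrable: "a > 0 \<Longrightarrow> A \<noteq> 0 \<Longrightarrow> integrable area (lap A a)"
  by (metis area_integrable_compact_support gam_continuous(6) lap_compact)

lemma logder_tendsto_0: "A \<noteq> 0 \<Longrightarrow> (logder A \<longlongrightarrow> 0) at_infinity"
proof (cases "degree A = 0")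
  case True
  then obtain c where "A = [:c:]" by (meson degree_eq_zeroE)
  then show ?thesis by (simp add: logder_def[abs_def])
next
  case False
  then show ?thesis unfolding logder_def[abs_def]
    by (intro poly_divide_tendsto_0_at_infinity) (simp add: degree_pderiv)
qed

lemma gamx_tendsto_0:
  assumes "a > 0" "A \<noteq> 0" shows "(gamx A a \<longlongrightarrow> 0) at_infinity" "(gamy A a \<longlongrightarrow> 0) at_infinity"
proof -
  have "((\<lambda>z. Re (logder A z)) \<longlongrightarrow> Re 0) at_infinity" "((\<lambda>z. - Im (logder A z)) \<longlongrightarrow> - Im 0) at_infinity"
    by (intro tendsto_intros logder_tendsto_0 assms)+
  moreover have "eventually (\<lambda>z. Re (logder A z) = gamx A a z) at_infinity" "eventually (\<lambda>z. - Im (logder A z) = gamy A a z) at_infinity"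
    using gam_at_infinity[OF assms] by (auto elim!: eventually_mono)
  ultimately show "(gamx A a \<longlongrightarrow> 0) at_infinity" "(gamy A a \<longlongrightarrow> 0) at_infinity"
    using Lim_transform_eventually by fastforce+
qed

text \<open>\<open>gam\<close> grows logarithmically. This sublinear growth is what the second term
  of the flux in Green's identity tolerates.\<close>

lemma gam_growth:
  assumes "a > 0" "A \<noteq> 0" shows "((\<lambda>z. gam A a z / cmod z) \<longlongrightarrow> 0) at_infinity"
proof -
  define N where "N = degree A"
  define K where "K = cmod (lead_coeff A) + 1"
  have K: "K > 1" using assms by (simp add: K_def)
  have "((\<lambda>z. cmod (poly A z / z ^ N)) \<longlongrightarrow> cmod (lead_coeff A)) at_infinity"
    unfolding N_def by (intro tendsto_norm poly_divide_tendsto_aux)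
  then have 1: "eventually (\<lambda>z. cmod (poly A z / z ^ N) < K) at_infinity"
    by (rule order_tendstoD(2)) (simp add: K_def)
  have 2: "eventually (\<lambda>z::complex. cmod z > 1) at_infinity"
    using filterlim_norm_at_top filterlim_at_top_dense by blast
  have gr: "((\<lambda>r::real. (2 * \<bar>ln K\<bar> + 2 * real N * ln r + \<bar>ln a\<bar>) / r) \<longlongrightarrow> 0) at_top"
    by real_asymp
  have lim: "((\<lambda>z::complex. (2 * \<bar>ln K\<bar> + 2 * real N * ln (cmod z) + \<bar>ln a\<bar>) / cmod z) \<longlongrightarrow> 0) at_infinity"
    by (rule filterlim_compose[OF gr filterlim_norm_at_top])
  show ?thesis
  proof (rule Lim_null_comparison[OF _ lim])
    from 1 2 show "eventually (\<lambda>z. norm (gam A a z / cmod z) \<le> (2 * \<bar>ln K\<bar> + 2 * real N * ln (cmod z) + \<bar>ln a\<bar>) / cmod z) at_infinity"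
    proof eventually_elim
      case (elim z)
      have "level A a z \<le> 2 * \<bar>ln K\<bar> + 2 * real N * ln (cmod z) + \<bar>ln a\<bar>"
      proof (cases "poly A z = 0")
        case True
        then show ?thesis using elim by (simp add: level_def)
      next
        case False
        have "cmod z ^ N > 0" using elim by (intro zero_less_power) linarith
        then have "cmod (poly A z) \<le> K * cmod z ^ N"
          using elim by (simp add: norm_divide norm_power pos_divide_less_eq)
        then have "ln (cmod (poly A z)) \<le> ln (K * cmod z ^ N)" using False K elim by (intro ln_mono) auto
        also have "\<dots> = ln K + real N * ln (cmod z)" using K elim by (subst ln_mult) (auto simp: ln_realpow)
        finally have "ln (cmod (poly A z)) \<le> ln K + real N * ln (cmod z)" .
        then show ?thesis using False assms(1) by (simp add: level_def ln_div ln_realpow)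
      qed
      moreover have "0 \<le> 2 * \<bar>ln K\<bar> + 2 * real N * ln (cmod z) + \<bar>ln a\<bar>" using elim by simp
      ultimately have "\<bar>gam A a z\<bar> \<le> 2 * \<bar>ln K\<bar> + 2 * real N * ln (cmod z) + \<bar>ln a\<bar>"
        using omega0_bounds[of "level A a z"] by (simp add: gam_def)
      then show ?case using elim by (simp add: abs_divide divide_right_mono)
    qed
  qed
qed

section \<open>Green's second identity\<close>

definition C2_on :: "complex set \<Rightarrow> (complex \<Rightarrow> real) \<Rightarrow> (complex \<Rightarrow> real) \<Rightarrow> (complex \<Rightarrow> real) \<Rightarrow> (complex \<Rightarrow> real) \<Rightarrow> (complex \<Rightarrow> real) \<Rightarrow> bool" where
  "C2_on S f fx fy fxx fyy \<longleftrightarrow>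
     continuous_on S f \<and> continuous_on S fx \<and> continuous_on S fy \<and> continuous_on S fxx \<and> continuous_on S fyy \<and>
     (\<forall>z\<in>S. dird f 1 (fx z) z \<and> dird f \<i> (fy z) z \<and> dird fx 1 (fxx z) z \<and> dird fy \<i> (fyy z) z)"

text \<open>The decay, in the plane, of a function that is C^1 at the point at infinity of the
  sphere with value L there: differences of order 1/|z|, gradient of order 1/|z|^2.\<close>

definition flat_at_infinity :: "(complex \<Rightarrow> real) \<Rightarrow> real \<Rightarrow> (complex \<Rightarrow> real) \<Rightarrow> (complex \<Rightarrow> real) \<Rightarrow> bool" where
  "flat_at_infinity f L fx fy \<longleftrightarrow>
     (\<exists>C. eventually (\<lambda>z. cmod z * \<bar>f z - L\<bar> \<le> C \<and> (cmod z)\<^sup>2 * \<bar>fx z\<bar> \<le> C \<and> (cmod z)\<^sup>2 * \<bar>fy z\<bar> \<le> C) at_infinity)"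

lemma flux_tendsto_0:
  assumes g: "(gx \<longlongrightarrow> 0) at_infinity" "((\<lambda>z. g z / cmod z) \<longlongrightarrow> 0) at_infinity"
    and f: "eventually (\<lambda>z. cmod z * \<bar>f z - L\<bar> \<le> C \<and> (cmod z)\<^sup>2 * \<bar>fx z\<bar> \<le> C) at_infinity"
  shows "((\<lambda>z::complex. cmod z * ((f z - L) * gx z - g z * fx z)) \<longlongrightarrow> 0) at_infinity"
proof (rule Lim_null_comparison)
  have "((\<lambda>z. C * \<bar>gx z\<bar> + C * \<bar>g z / cmod z\<bar>) \<longlongrightarrow> C * \<bar>0\<bar> + C * \<bar>0\<bar>) at_infinity"
    by (intro tendsto_intros g)
  then show "((\<lambda>z. C * \<bar>gx z\<bar> + C * \<bar>g z / cmod z\<bar>) \<longlongrightarrow> 0) at_infinity" by simp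
  have "eventually (\<lambda>z::complex. cmod z > 1) at_infinity"
    using filterlim_norm_at_top filterlim_at_top_dense by blast
  with f show "eventually (\<lambda>z. norm (cmod z * ((f z - L) * gx z - g z * fx z)) \<le> C * \<bar>gx z\<bar> + C * \<bar>g z / cmod z\<bar>) at_infinity"
  proof eventually_elim
    case (elim z)
    have e: "cmod z * ((f z - L) * gx z - g z * fx z) = (cmod z * (f z - L)) * gx z - ((cmod z)\<^sup>2 * fx z) * (g z / cmod z)"
      using elim by (simp add: field_simps power2_eq_square)
    have b: "\<bar>cmod z * (f z - L)\<bar> \<le> C" "\<bar>(cmod z)\<^sup>2 * fx z\<bar> \<le> C"
      using elim by (auto simp: abs_mult)
    have "\<bar>(cmod z * (f z - L)) * gx z\<bar> \<le> C * \<bar>gx z\<bar>" "\<bar>((cmod z)\<^sup>2 * fx z) * (g z / cmod z)\<bar> \<le> C * \<bar>g z / cmod z\<bar>"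
      using mult_right_mono[OF b(1) abs_ge_zero[of "gx z"]] mult_right_mono[OF b(2) abs_ge_zero[of "g z / cmod z"]]
      by (simp_all only: abs_mult)
    then show ?case unfolding e real_norm_def by linarith
  qed
qed

text \<open>The divergence theorem for the field (f - L) grad gam - gam grad f. Subtracting L
  removes the flux of grad gam at infinity, which does not tend to 0 for nonconstant A. The set S
  admits functions f that are harmonic off the connectedness locus alone, provided
  \<open>gam\<close> vanishes near the complement of S.\<close>

lemma green_formula:
  assumes a: "a > 0" and A: "A \<noteq> 0" and S: "open S"
    and out: "\<And>z. z \<notin> S \<Longrightarrow> (cmod (poly A z))\<^sup>2 < a"
    and f: "C2_on S f fx fy fxx fyy" and flat: "flat_at_infinity f L fx fy"
    and int: "integrable area (\<lambda>z. gam A a z * (fxx z + fyy z))"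
  shows "(\<integral>z. (f z - L) * lap A a z \<partial>area) = (\<integral>z. gam A a z * (fxx z + fyy z) \<partial>area)"
    and "integrable area (\<lambda>z. (f z - L) * lap A a z)"
proof -
  have cut: "continuous_on UNIV (\<lambda>z. p z * q z)"
    if p: "continuous_on S p" and q: "continuous_on UNIV q" and q0: "\<And>z. z \<notin> S \<Longrightarrow> eventually (\<lambda>w. q w = 0) (nhds z)" for p q :: "complex \<Rightarrow> real"
  proof -
    have "isCont (\<lambda>z. p z * q z) z" for z
    proof (cases "z \<in> S")
      case True
      then show ?thesis using p q S by (auto intro!: continuous_intros simp: continuous_on_eq_continuous_at)
    next
      case False
      then have "eventually (\<lambda>w. p w * q w = 0) (nhds z)" by (intro eventually_mono[OF q0]) auto
      then have "isCont (\<lambda>z. p z * q z) z \<longleftrightarrow> isCont (\<lambda>_. 0 :: real) z" by (rule isCont_cong)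
      then show ?thesis by simp
    qed
    then show ?thesis by (simp add: continuous_at_imp_continuous_on)
  qed
  note supp = gam_support[OF a out]
  have supps: "z \<notin> S \<Longrightarrow> eventually (\<lambda>w. gam A a w = 0) (nhds z)" "z \<notin> S \<Longrightarrow> eventually (\<lambda>w. gamx A a w = 0) (nhds z)"
    "z \<notin> S \<Longrightarrow> eventually (\<lambda>w. gamy A a w = 0) (nhds z)" "z \<notin> S \<Longrightarrow> eventually (\<lambda>w. gamxx A a w = 0) (nhds z)"
    "z \<notin> S \<Longrightarrow> eventually (\<lambda>w. gamyy A a w = 0) (nhds z)" "z \<notin> S \<Longrightarrow> eventually (\<lambda>w. lap A a w = 0) (nhds z)" for z
    using supp[of z] by (auto elim!: eventually_mono)
  note gc = gam_continuous[OF a]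
  have fc: "continuous_on S (\<lambda>z. f z - L)" "continuous_on S fx" "continuous_on S fy" "continuous_on S fxx" "continuous_on S fyy"
    and fd: "\<And>z. z \<in> S \<Longrightarrow> dird f 1 (fx z) z" "\<And>z. z \<in> S \<Longrightarrow> dird f \<i> (fy z) z"
      "\<And>z. z \<in> S \<Longrightarrow> dird fx 1 (fxx z) z" "\<And>z. z \<in> S \<Longrightarrow> dird fy \<i> (fyy z) z"
    using f by (auto simp: C2_on_def intro!: continuous_intros)
  define p where "p z = (f z - L) * gamx A a z - gam A a z * fx z" for z
  define q where "q z = (f z - L) * gamy A a z - gam A a z * fy z" for z
  define p' where "p' z = (f z - L) * gamxx A a z - fxx z * gam A a z" for z
  define q' where "q' z = (f z - L) * gamyy A a z - fyy z * gam A a z" for z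
  have fL: "dird (\<lambda>z. f z - L) v d z" if "dird f v d z" for v d z
    using dird_diff[OF that dird_const[of L]] by simp
  have dp: "dird p 1 (p' z) z" for z
  proof (cases "z \<in> S")
    case True
    have "dird p 1 ((fx z * gamx A a z + gamxx A a z * (f z - L)) - (gamx A a z * fx z + fxx z * gam A a z)) z"
      unfolding p_def by (intro dird_diff dird_mult gam_dird a fd True fL)
    then show ?thesis by (simp add: p'_def algebra_simps)
  next
    case False
    from supps(1,2)[OF False] have "eventually (\<lambda>w. 0 = p w) (nhds z)"
      by eventually_elim (simp add: p_def)
    moreover have "p' z = 0"
      using supps(1,4)[OF False, THEN eventually_nhds_x_imp_x] by (simp add: p'_def)
    ultimately show ?thesis using dird_local[OF dird_const, of 0 p z] by simp
  qed
  have dq: "dird q \<i> (q' z) z" for z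
  proof (cases "z \<in> S")
    case True
    have "dird q \<i> ((fy z * gamy A a z + gamyy A a z * (f z - L)) - (gamy A a z * fy z + fyy z * gam A a z)) z"
      unfolding q_def by (intro dird_diff dird_mult gam_dird a fd True fL)
    then show ?thesis by (simp add: q'_def algebra_simps)
  next
    case False
    from supps(1,3)[OF False] have "eventually (\<lambda>w. 0 = q w) (nhds z)"
      by eventually_elim (simp add: q_def)
    moreover have "q' z = 0"
      using supps(1,5)[OF False, THEN eventually_nhds_x_imp_x] by (simp add: q'_def)
    ultimately show ?thesis using dird_local[OF dird_const, of 0 q z] by simp
  qed
  have cp: "continuous_on UNIV p'" "continuous_on UNIV q'"
    unfolding p'_def[abs_def] q'_def[abs_def] by (intro continuous_on_diff cut fc gc supps; assumption)+
  obtain C where C: "eventually (\<lambda>z. cmod z * \<bar>f z - L\<bar> \<le> C \<and> (cmod z)\<^sup>2 * \<bar>fx z\<bar> \<le> C \<and> (cmod z)\<^sup>2 * \<bar>fy z\<bar> \<le> C) at_infinity"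
    using flat unfolding flat_at_infinity_def by blast
  have lp: "((\<lambda>z. cmod z * p z) \<longlongrightarrow> 0) at_infinity" "((\<lambda>z. cmod z * q z) \<longlongrightarrow> 0) at_infinity"
    unfolding p_def q_def
    by (rule flux_tendsto_0[where C = C], (rule gamx_tendsto_0 gam_growth, rule a, rule A)+,
        rule eventually_mono[OF C], simp)+
  have cl: "continuous_on UNIV (\<lambda>z. (f z - L) * lap A a z)" by (intro cut fc gc supps)
  obtain R where R: "\<And>z. cmod z > R \<Longrightarrow> lap A a z = 0" using lap_compact[OF a A] by blast
  show i: "integrable area (\<lambda>z. (f z - L) * lap A a z)"
    by (rule area_integrable_compact_support[OF cl, of R]) (simp add: R)
  have e: "p' z + q' z = (f z - L) * lap A a z - gam A a z * (fxx z + fyy z)" for z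
    unfolding p'_def q'_def gam_lap[symmetric] by (simp add: algebra_simps)
  have "(\<integral>z. p' z + q' z \<partial>area) = 0"
    by (rule divergence_theorem[OF dp dq cp lp]) (unfold e, intro Bochner_Integration.integrable_diff i int)
  then show "(\<integral>z. (f z - L) * lap A a z \<partial>area) = (\<integral>z. gam A a z * (fxx z + fyy z) \<partial>area)"
    unfolding e using i int by simp
qed

lemma laplacian_integral_zero:
  assumes f: "C2_on UNIV f fx fy fxx fyy" and flat: "flat_at_infinity f L fx fy"
    and int: "integrable area (\<lambda>z. fxx z + fyy z)"
  shows "(\<integral>z. fxx z + fyy z \<partial>area) = 0"
proof (rule divergence_theorem[of fx fxx fy fyy])
  obtain C where C: "eventually (\<lambda>z. cmod z * \<bar>f z - L\<bar> \<le> C \<and> (cmod z)\<^sup>2 * \<bar>fx z\<bar> \<le> C \<and> (cmod z)\<^sup>2 * \<bar>fy z\<bar> \<le> C) at_infinity"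
    using flat unfolding flat_at_infinity_def by blast
  have l: "((\<lambda>r::real. C / r) \<longlongrightarrow> 0) at_top" by real_asymp
  have lim: "((\<lambda>z::complex. C / cmod z) \<longlongrightarrow> 0) at_infinity"
    by (rule filterlim_compose[OF l filterlim_norm_at_top])
  have 1: "eventually (\<lambda>z::complex. cmod z > 1) at_infinity"
    using filterlim_norm_at_top filterlim_at_top_dense by blast
  show "((\<lambda>z. cmod z * fx z) \<longlongrightarrow> 0) at_infinity"
  proof (rule Lim_null_comparison[OF _ lim])
    from C 1 show "eventually (\<lambda>z. norm (cmod z * fx z) \<le> C / cmod z) at_infinity"
    proof eventually_elim
      case (elim z)
      then have "cmod z > 0" by linarith
      then show ?case using elim by (simp only: pos_le_divide_eq) (simp add: abs_mult power2_eq_square mult_ac)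
    qed
  qed
  show "((\<lambda>z. cmod z * fy z) \<longlongrightarrow> 0) at_infinity"
  proof (rule Lim_null_comparison[OF _ lim])
    from C 1 show "eventually (\<lambda>z. norm (cmod z * fy z) \<le> C / cmod z) at_infinity"
    proof eventually_elim
      case (elim z)
      then have "cmod z > 0" by linarith
      then show ?case using elim by (simp only: pos_le_divide_eq) (simp add: abs_mult power2_eq_square mult_ac)
    qed
  qed
qed (use f int in \<open>auto simp: C2_on_def\<close>)

text \<open>Far out the cut-offs are inactive and logarithmic derivatives add, so the difference of
  the gradients has bounded support and zero total divergence.\<close>

lemma lap_mult:
  assumes A: "A \<noteq> 0" "a > 0" and B: "B \<noteq> 0" "b > 0" and c: "c > 0"
  shows "(\<integral>z. lap (A * B) c z \<partial>area) = (\<integral>z. lap A a z \<partial>area) + (\<integral>z. lap B b z \<partial>area)"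
proof -
  have AB: "A * B \<noteq> 0" using A B by simp
  define p where "p z = (gamx (A * B) c z - gamx A a z) - gamx B b z" for z
  define q where "q z = (gamy (A * B) c z - gamy A a z) - gamy B b z" for z
  define p' where "p' z = (gamxx (A * B) c z - gamxx A a z) - gamxx B b z" for z
  define q' where "q' z = (gamyy (A * B) c z - gamyy A a z) - gamyy B b z" for z
  have e: "p' z + q' z = (lap (A * B) c z - lap A a z) - lap B b z" for z
    unfolding p'_def q'_def gam_lap[symmetric] by simp
  have i: "integrable area (lap (A * B) c)" "integrable area (lap A a)" "integrable area (lap B b)"
    using A B AB c by (auto intro: lap_integrable)
  have "eventually (\<lambda>z. 0 = cmod z * p z \<and> 0 = cmod z * q z) at_infinity"
    using gam_at_infinity[OF c AB] gam_at_infinity[OF A(2,1)] gam_at_infinity[OF B(2,1)]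
  proof eventually_elim
    case (elim z)
    then have "logder (A * B) z = logder A z + logder B z"
      by (simp add: logder_def pderiv_mult field_simps)
    then show ?case using elim by (simp add: p_def q_def)
  qed
  then have "((\<lambda>z. cmod z * p z) \<longlongrightarrow> 0) at_infinity" "((\<lambda>z. cmod z * q z) \<longlongrightarrow> 0) at_infinity"
    by (auto intro!: Lim_transform_eventually[OF tendsto_const] elim: eventually_mono)
  note lim = this
  have d: "dird p 1 (p' z) z" "dird q \<i> (q' z) z" for z
    unfolding p_def[abs_def] p'_def q_def[abs_def] q'_def by (intro dird_diff gam_dird A B c)+
  have cont: "continuous_on UNIV p'" "continuous_on UNIV q'"
    unfolding p'_def[abs_def] q'_def[abs_def] by (intro continuous_on_diff gam_continuous A B c)+
  have "integrable area (\<lambda>z. p' z + q' z)"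
    unfolding e by (intro Bochner_Integration.integrable_diff i)
  from divergence_theorem[OF d cont lim this] have "(\<integral>z. p' z + q' z \<partial>area) = 0" .
  then show ?thesis unfolding e using i by simp
qed

text \<open>This number is 2 pi, the flux of grad ln |z| through a large circle. It enters as a
  common factor of all the mass formulas and is divided out by means of
  \<open>lap_mass_pos\<close>.\<close>

definition lap_mass :: real where
  "lap_mass = (\<integral>z. lap [:0, 1:] 1 z \<partial>area)"

lemma lap_linear_scaling:
  assumes s: "s > 0"
  shows "lap [:-w, 1:] (s\<^sup>2) (w + of_real s * z) = lap [:0, 1:] 1 z / s\<^sup>2"
proof (cases "z = 0")
  case False
  have "(cmod (of_real s * z))\<^sup>2 / s\<^sup>2 = (cmod z)\<^sup>2" using s by (simp add: norm_mult power_mult_distrib)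
  moreover have "(cmod (1 / (of_real s * z)))\<^sup>2 = (cmod (1 / z))\<^sup>2 / s\<^sup>2"
    using s False by (simp add: norm_divide norm_mult power_mult_distrib power_divide)
  ultimately show ?thesis
    unfolding lap_def level_def logder_def by (simp add: pderiv_pCons)
qed (auto simp: lap_def logder_def pderiv_pCons)

text \<open>The substitution z to w + s z with s^2 = a carries the shell around w to the standard
  shell around 0.\<close>

lemma lap_linear:
  assumes a: "a > 0"
  shows "(\<integral>z. lap [:-w, 1:] a z \<partial>area) = lap_mass"
proof -
  define s where "s = sqrt a"
  have s: "s > 0" "s\<^sup>2 = a" using a by (auto simp: s_def)
  obtain R where R: "\<And>z. cmod z > R \<Longrightarrow> lap [:-w, 1:] a z = 0" using lap_compact[OF a, of "[:-w, 1:]"] by auto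
  have "(\<integral>z. lap [:-w, 1:] a (w + of_real s * z) \<partial>area) = (\<integral>z. lap [:-w, 1:] a z \<partial>area) / s\<^sup>2"
    by (rule area_integral_affine[OF gam_continuous(6)[OF a] R s(1)])
  moreover have "lap [:-w, 1:] a (w + of_real s * z) = lap [:0, 1:] 1 z / s\<^sup>2" for z
    using lap_linear_scaling[OF s(1), of w z] s(2) by simp
  ultimately show ?thesis using s(1) by (simp add: lap_mass_def)
qed

theorem lap_total_mass:
  assumes "A \<noteq> 0" "a > 0"
  shows "(\<integral>z. lap A a z \<partial>area) = real (degree A) * lap_mass"
  using assms
proof (induction "degree A" arbitrary: A a)
  case 0
  then obtain c where "A = [:c:]" by (metis degree_eq_zeroE)
  then have "lap A a z = 0" for z by (simp add: lap_def logder_def)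
  then show ?case using 0 by simp
next
  case (Suc n)
  have "\<not> constant (poly A)" using Suc(2) by (metis Fundamental_Theorem_Algebra.constant_degree nat.distinct(1))
  then obtain w where "poly A w = 0" using Fundamental_Theorem_Algebra.fundamental_theorem_of_algebra by blast
  then obtain B where B: "A = [:-w, 1:] * B" by (auto simp: poly_eq_0_iff_dvd)
  then have B0: "B \<noteq> 0" using Suc by auto
  have "degree A = Suc (degree B)" unfolding B using B0 by (subst degree_mult_eq) auto
  then have "(\<integral>z. lap B 1 z \<partial>area) = real n * lap_mass" using Suc B0 by simp
  moreover have "(\<integral>z. lap A a z \<partial>area) = (\<integral>z. lap [:-w, 1:] 1 z \<partial>area) + (\<integral>z. lap B 1 z \<partial>area)"
    unfolding B by (rule lap_mult) (use B0 Suc in auto)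
  ultimately show ?case using Suc(2)[symmetric] by (simp add: lap_linear algebra_simps)
qed

lemma lap_mass_pos: "lap_mass > 0"
proof -
  have i: "integrable area (lap [:0, 1:] 1)" by (rule lap_integrable) auto
  have "lap_mass \<ge> 0" unfolding lap_mass_def by (intro integral_nonneg_AE) (simp add: lap_nonneg)
  moreover have "lap_mass \<noteq> 0"
  proof
    assume "lap_mass = 0"
    then have "AE z in area. lap [:0, 1:] 1 z = 0"
      unfolding lap_mass_def using integral_nonneg_eq_0_iff_AE[OF i] by (simp add: lap_nonneg)
    then have AE: "AE p in lborel \<Otimes>\<^sub>M lborel. lap [:0, 1:] 1 (Complex (fst p) (snd p)) = 0"
      unfolding area_def
      by (subst (asm) AE_distr_iff[OF measurable_Complex])
         (use borel_measurable_continuous_onI[OF gam_continuous(6)[of 1 "[:0, 1:]"]] in \<open>auto intro: borel_measurable_eq\<close>)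
    \<comment> \<open>On this rectangle |z|^2 lies between 1 and 2 < e, so the level is in (0, 1)
      and the density is positive; the rectangle itself has positive area.\<close>
    define D where "D = {11/10<..<6/5::real} \<times> {0<..<1/10::real}"
    have pos: "lap [:0, 1:] 1 (Complex x y) \<noteq> 0" if "(x, y) \<in> D" for x y
    proof -
      have x: "11/10 < x" "x < 6/5" and y: "0 < y" "y < 1/10" using that by (auto simp: D_def)
      have n: "(cmod (Complex x y))\<^sup>2 = x\<^sup>2 + y\<^sup>2" by (simp add: cmod_power2)
      have "1 * 1 < x * x" by (rule mult_strict_mono) (use x in auto)
      moreover have "x * x \<le> 6/5 * (6/5)" "y * y \<le> 1/10 * (1/10)" using x y by (intro mult_mono; simp)+
      moreover have "0 \<le> y * y" by simp
      ultimately have b: "1 < x\<^sup>2 + y\<^sup>2" "x\<^sup>2 + y\<^sup>2 < 2" unfolding power2_eq_square by linarith+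
      then have "x\<^sup>2 + y\<^sup>2 < exp 1" using exp_ge_add_one_self[of 1] by linarith
      then have "ln (x\<^sup>2 + y\<^sup>2) < ln (exp 1)" using b by (subst ln_less_cancel_iff) auto
      then have "0 < ln (x\<^sup>2 + y\<^sup>2)" "ln (x\<^sup>2 + y\<^sup>2) < 1" using b by (auto simp: ln_gt_zero)
      then have "omega2 (ln (x\<^sup>2 + y\<^sup>2)) \<noteq> 0" by (auto simp: omega2_def max_def)
      moreover have "Complex x y \<noteq> 0" using x by (simp add: complex_eq_iff)
      ultimately show ?thesis by (simp add: lap_def level_def logder_def pderiv_pCons n)
    qed
    have "AE p in lborel \<Otimes>\<^sub>M lborel. p \<notin> D"
      using AE by (rule eventually_mono) (use pos in \<open>force simp: split_paired_all\<close>)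
    moreover have Dm: "D \<in> sets (lborel \<Otimes>\<^sub>M lborel)" by (simp add: D_def)
    ultimately have "emeasure (lborel \<Otimes>\<^sub>M lborel) D = 0"
      by (simp add: AE_iff_measurable[OF Dm] space_pair_measure)
    then have "emeasure lborel {11/10<..<6/5::real} * emeasure lborel {0<..<1/10::real} = 0"
      unfolding D_def by (subst (asm) lborel.emeasure_pair_measure_Times) auto
    then show False by simp
  qed
  ultimately show ?thesis by simp
qed

section \<open>The logarithmic potential representation\<close>

lemma integrable_even:
  fixes f :: "real \<Rightarrow> real"
  assumes "set_integrable lborel {0<..} f" "\<And>x. f (- x) = f x" and [measurable]: "f \<in> borel_measurable borel"
  shows "integrable lborel f"
proof -
  let ?g = "\<lambda>x. indicator {0<..} x *\<^sub>R f x"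
  have g: "integrable lborel ?g" using assms(1) by (simp add: set_integrable_def)
  have g': "integrable lborel (\<lambda>x. ?g (0 + (-1) * x))" by (rule lborel_integrable_real_affine[OF g]) simp
  have "integrable lborel (\<lambda>x. ?g x + ?g (0 + (-1) * x))" using g g' by (rule Bochner_Integration.integrable_add)
  moreover have "AE x in lborel. ?g x + ?g (0 + (-1) * x) = f x"
    using AE_lborel_singleton[of 0] by eventually_elim (auto simp: indicator_def assms(2))
  ultimately show ?thesis by (subst (asm) integrable_cong_AE[where g = f]) (auto intro: borel_measurable_integrable)
qed

lemma integrable_cauchy: "integrable lborel (\<lambda>x::real. 1 / (1 + x\<^sup>2))"
  using integrable_inverse_1_plus_square by (simp add: set_integrable_def inverse_eq_divide)

text \<open>Since (1 + x)^2 is at most 2 (1 + x^2), the integrand is dominated by \<open>?f\<close>,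
  which has the elementary antiderivative \<open>?F\<close>.\<close>

lemma integrable_log_cauchy: "integrable lborel (\<lambda>x::real. ln (1 + \<bar>x\<bar>) / (1 + x\<^sup>2))"
proof -
  let ?f = "\<lambda>x::real. 2 * ln (1 + x) / (1 + x)\<^sup>2"
  let ?F = "\<lambda>x::real. - 2 * (ln (1 + x) + 1) / (1 + x)"
  have "set_integrable lborel (einterval (ereal 0) \<infinity>) ?f"
  proof (rule interval_integral_FTC_nonneg(1)[where F = ?F and A = "-2" and B = 0])
    fix x assume "ereal 0 < ereal x"
    then have x: "x > 0" by simp
    show "(?F has_real_derivative ?f x) (at x)"
    proof -
      have "(?F has_real_derivative ((- 2 * (1 / (1 + x))) * (1 + x) - (- 2 * (ln (1 + x) + 1)) * 1) / ((1 + x) * (1 + x))) (at x)"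
        using x by (auto intro!: derivative_eq_intros)
      moreover have "(- 2 * (1 / (1 + x))) * (1 + x) = - 2" using x by (simp add: divide_simps)
      ultimately show ?thesis by (simp add: power2_eq_square algebra_simps)
    qed
    show "isCont ?f x" using x by (auto intro!: continuous_intros)
  next
    show "AE x in lborel. ereal 0 < ereal x \<longrightarrow> ereal x < \<infinity> \<longrightarrow> 0 \<le> ?f x" by auto
    have "isCont ?F 0" by (auto intro!: continuous_intros)
    then have "(?F \<longlongrightarrow> -2) (at_right 0)"
      unfolding isCont_def by (rule tendsto_eq_rhs[OF filterlim_mono]) (auto simp: at_le)
    then show "((?F \<circ> real_of_ereal) \<longlongrightarrow> -2) (at_right (ereal 0))"
      by (subst ereal_tendsto_simps) simp
    have "(?F \<longlongrightarrow> 0) at_top" by real_asymp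
    then show "((?F \<circ> real_of_ereal) \<longlongrightarrow> 0) (at_left \<infinity>)"
      by (subst ereal_tendsto_simps) simp
  qed simp
  then have i: "set_integrable lborel {0<..} ?f" by simp
  have "set_integrable lborel {0<..} (\<lambda>x::real. ln (1 + \<bar>x\<bar>) / (1 + x\<^sup>2))"
  proof (rule set_integrable_bound[OF i])
    show "set_borel_measurable lborel {0<..} (\<lambda>x::real. ln (1 + \<bar>x\<bar>) / (1 + x\<^sup>2))"
      unfolding set_borel_measurable_def by simp
    have "norm (ln (1 + \<bar>x\<bar>) / (1 + x\<^sup>2)) \<le> norm (?f x)" if "x > 0" for x :: real
    proof -
      have "(1 + x)\<^sup>2 \<le> 2 * (1 + x\<^sup>2)" using zero_le_power2[of "x - 1"] by (simp add: power2_eq_square algebra_simps)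
      moreover have "0 < (1 + x)\<^sup>2" "0 < 1 + x\<^sup>2" using that by (auto intro: add_pos_nonneg)
      ultimately have "ln (1 + x) * (1 / (1 + x\<^sup>2)) \<le> ln (1 + x) * (2 / (1 + x)\<^sup>2)"
        using that by (intro mult_left_mono) (auto simp: field_simps)
      then show ?thesis using that by (simp add: mult.commute)
    qed
    then show "AE x in lborel. x \<in> {0<..} \<longrightarrow> norm (ln (1 + \<bar>x\<bar>) / (1 + x\<^sup>2)) \<le> norm (?f x)" by auto
  qed
  then show ?thesis by (rule integrable_even) auto
qed

lemma integrable_log_neg: "integrable lborel (\<lambda>x::real. max 0 (- ln \<bar>x\<bar>))"
proof -
  let ?F = "\<lambda>x::real. x - x * ln x"
  have "set_integrable lborel (einterval (ereal 0) (ereal 1)) (\<lambda>x. - ln x)"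
  proof (rule interval_integral_FTC_nonneg(1)[where F = ?F and A = 0 and B = 1])
    fix x assume "ereal 0 < ereal x"
    then have x: "x > 0" by simp
    show "(?F has_real_derivative - ln x) (at x)"
      using x by (auto intro!: derivative_eq_intros)
    show "isCont (\<lambda>x. - ln x) x" using x by (auto intro!: continuous_intros)
  next
    show "AE x in lborel. ereal 0 < ereal x \<longrightarrow> ereal x < ereal 1 \<longrightarrow> 0 \<le> - ln x" by (simp add: ln_le_zero_iff)
    have "(?F \<longlongrightarrow> 0) (at_right 0)" by real_asymp
    then show "((?F \<circ> real_of_ereal) \<longlongrightarrow> 0) (at_right (ereal 0))"
      by (subst ereal_tendsto_simps) simp
    have "isCont ?F 1" by (auto intro!: continuous_intros)
    then have "(?F \<longlongrightarrow> 1) (at_left 1)"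
      unfolding isCont_def by (rule tendsto_eq_rhs[OF filterlim_mono]) (auto simp: at_le)
    then show "((?F \<circ> real_of_ereal) \<longlongrightarrow> 1) (at_left (ereal 1))"
      by (subst ereal_tendsto_simps) simp
  qed simp
  then have "set_integrable lborel {0<..<1} (\<lambda>x::real. - ln x)" by simp
  then have "integrable lborel (\<lambda>x::real. indicator {0<..<1} x *\<^sub>R (- ln x))" by (simp only: set_integrable_def)
  moreover have "indicator {0<..<1} x *\<^sub>R (- ln x) = indicator {0<..} x *\<^sub>R max 0 (- ln \<bar>x\<bar>)" for x :: real
    by (auto simp: indicator_def max_def not_less intro: ln_ge_zero antisym)
  ultimately have "set_integrable lborel {0<..} (\<lambda>x::real. max 0 (- ln \<bar>x\<bar>))" by (simp only: set_integrable_def)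
  then show ?thesis by (rule integrable_even) auto
qed

text \<open>The density of the overview's measure nu. The product form reduces integrability to one
  variable, and \<open>cauchy_ge\<close> shows that it dominates 1 / (1 + |z|^2)^2, up to a constant
  the spherical area density.\<close>

definition cauchy :: "complex \<Rightarrow> real" where
  "cauchy z = 1 / ((1 + (Re z)\<^sup>2) * (1 + (Im z)\<^sup>2))"

lemma cauchy_pos: "cauchy z > 0"
  unfolding cauchy_def by (intro divide_pos_pos mult_pos_pos add_pos_nonneg) auto

lemma cauchy_measurable [measurable]: "cauchy \<in> borel_measurable borel"
  unfolding cauchy_def[abs_def] by measurable

lemma cauchy_integrable: "integrable area cauchy"
  using area_integrable_product[OF integrable_cauchy integrable_cauchy] by (simp add: cauchy_def[abs_def])

lemma cauchy_ge: "1 / (1 + (cmod z)\<^sup>2)\<^sup>2 \<le> cauchy z"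
proof -
  have "(1 + (Re z)\<^sup>2) * (1 + (Im z)\<^sup>2) \<le> (1 + (cmod z)\<^sup>2) * (1 + (cmod z)\<^sup>2)"
    by (intro mult_mono) (auto simp: cmod_power2)
  then show ?thesis unfolding cauchy_def
    by (intro divide_left_mono) (auto simp: power2_eq_square intro!: mult_pos_pos add_pos_nonneg)
qed

lemma AE_area_Re: "AE z in area. Re z \<noteq> c"
proof -
  have "emeasure area {z. Re z = c} = emeasure (lborel \<Otimes>\<^sub>M lborel) ({c} \<times> (UNIV :: real set))"
    unfolding area_def
    by (subst emeasure_distr) (auto intro!: arg_cong2[where f = emeasure] simp: space_pair_measure)
  also have "\<dots> = emeasure lborel {c} * emeasure lborel (UNIV :: real set)"
    by (rule lborel.emeasure_pair_measure_Times) auto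
  also have "\<dots> = 0" by simp
  finally show ?thesis by (intro AE_I[where N = "{z. Re z = c}"]) auto
qed

lemma ln_one_plus_cmod_le: "ln (1 + cmod z) \<le> ln (1 + \<bar>Re z\<bar>) + ln (1 + \<bar>Im z\<bar>)"
proof -
  have "1 + cmod z \<le> (1 + \<bar>Re z\<bar>) * (1 + \<bar>Im z\<bar>)"
  proof -
    have "0 \<le> \<bar>Re z\<bar> * \<bar>Im z\<bar>" by simp
    moreover have "(1 + \<bar>Re z\<bar>) * (1 + \<bar>Im z\<bar>) = 1 + \<bar>Re z\<bar> + \<bar>Im z\<bar> + \<bar>Re z\<bar> * \<bar>Im z\<bar>"
      by (simp add: algebra_simps)
    ultimately show ?thesis using cmod_le[of z] by linarith
  qed
  then have "ln (1 + cmod z) \<le> ln ((1 + \<bar>Re z\<bar>) * (1 + \<bar>Im z\<bar>))"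
    by (intro ln_mono) (auto intro: add_pos_nonneg)
  also have "\<dots> = ln (1 + \<bar>Re z\<bar>) + ln (1 + \<bar>Im z\<bar>)" by (intro ln_mult_pos) (auto intro: add_pos_nonneg)
  finally show ?thesis .
qed

lemma cauchy_log_integrable: "integrable area (\<lambda>z. cauchy z * ln (1 + cmod z))"
proof (rule Bochner_Integration.integrable_bound)
  show "integrable area (\<lambda>z. (ln (1 + \<bar>Re z\<bar>) / (1 + (Re z)\<^sup>2)) * (1 / (1 + (Im z)\<^sup>2)) +
      (1 / (1 + (Re z)\<^sup>2)) * (ln (1 + \<bar>Im z\<bar>) / (1 + (Im z)\<^sup>2)))"
    by (intro Bochner_Integration.integrable_add area_integrable_product[OF integrable_log_cauchy integrable_cauchy]
        area_integrable_product[OF integrable_cauchy integrable_log_cauchy])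
  have "norm (cauchy z * ln (1 + cmod z)) \<le> norm ((ln (1 + \<bar>Re z\<bar>) / (1 + (Re z)\<^sup>2)) * (1 / (1 + (Im z)\<^sup>2)) +
      (1 / (1 + (Re z)\<^sup>2)) * (ln (1 + \<bar>Im z\<bar>) / (1 + (Im z)\<^sup>2)))" for z
  proof -
    have "cauchy z * ln (1 + cmod z) \<le> cauchy z * (ln (1 + \<bar>Re z\<bar>) + ln (1 + \<bar>Im z\<bar>))"
      using cauchy_pos[of z] ln_one_plus_cmod_le by (intro mult_left_mono) auto
    also have "\<dots> = (ln (1 + \<bar>Re z\<bar>) / (1 + (Re z)\<^sup>2)) * (1 / (1 + (Im z)\<^sup>2)) +
      (1 / (1 + (Re z)\<^sup>2)) * (ln (1 + \<bar>Im z\<bar>) / (1 + (Im z)\<^sup>2))"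
      by (simp add: cauchy_def add_divide_distrib distrib_left)
    finally show ?thesis using cauchy_pos[of z] by simp
  qed
  then show "AE z in area. norm (cauchy z * ln (1 + cmod z)) \<le> norm ((ln (1 + \<bar>Re z\<bar>) / (1 + (Re z)\<^sup>2)) * (1 / (1 + (Im z)\<^sup>2)) +
      (1 / (1 + (Re z)\<^sup>2)) * (ln (1 + \<bar>Im z\<bar>) / (1 + (Im z)\<^sup>2)))" by simp
qed simp

text \<open>Replacing |z - w| by the distance of the real parts in the negative part of the
  logarithm turns the planar singularity into a one-variable one, which is integrable against the
  product weight.\<close>

lemma abs_ln_dist_le:
  assumes "Re z \<noteq> Re w"
  shows "\<bar>ln (cmod (z - w))\<bar> \<le> max 0 (- ln \<bar>Re z - Re w\<bar>) + ln (1 + cmod z) + ln (1 + cmod w)"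
proof -
  have p: "cmod (z - w) > 0" using assms by auto
  have "\<bar>Re z - Re w\<bar> \<le> cmod (z - w)" using abs_Re_le_cmod[of "z - w"] by simp
  then have "ln \<bar>Re z - Re w\<bar> \<le> ln (cmod (z - w))" using assms p by (intro ln_mono) auto
  moreover have "ln (cmod (z - w)) \<le> ln (1 + cmod z) + ln (1 + cmod w)"
  proof -
    have "cmod (z - w) \<le> (1 + cmod z) * (1 + cmod w)"
    proof -
      have "0 \<le> cmod z * cmod w" by simp
      moreover have "(1 + cmod z) * (1 + cmod w) = 1 + cmod z + cmod w + cmod z * cmod w"
        by (simp add: algebra_simps)
      ultimately show ?thesis using norm_triangle_ineq4[of z w] by linarith
    qed
    then have "ln (cmod (z - w)) \<le> ln ((1 + cmod z) * (1 + cmod w))" using p by (intro ln_mono) auto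
    also have "\<dots> = ln (1 + cmod z) + ln (1 + cmod w)" by (intro ln_mult_pos) (auto intro: add_pos_nonneg)
    finally show ?thesis .
  qed
  moreover have "ln (1 + cmod z) \<ge> 0" "ln (1 + cmod w) \<ge> 0" by auto
  moreover have "- ln \<bar>Re z - Re w\<bar> \<le> max 0 (- ln \<bar>Re z - Re w\<bar>)" "0 \<le> max 0 (- ln \<bar>Re z - Re w\<bar>)"
    by simp_all
  ultimately show ?thesis by linarith
qed

lemma cauchy_log_dist_integrable: "integrable area (\<lambda>z. cauchy z * \<bar>ln (cmod (z - w))\<bar>)"
proof (rule Bochner_Integration.integrable_bound)
  have ln': "integrable lborel (\<lambda>x::real. max 0 (- ln \<bar>x - Re w\<bar>))"
    using lborel_integrable_real_affine[OF integrable_log_neg, of 1 "- Re w"] by simp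
  show "integrable area (\<lambda>z. max 0 (- ln \<bar>Re z - Re w\<bar>) * (1 / (1 + (Im z)\<^sup>2)) + cauchy z * ln (1 + cmod z) + cauchy z * ln (1 + cmod w))"
    by (intro Bochner_Integration.integrable_add area_integrable_product[OF ln' integrable_cauchy]
        cauchy_log_integrable integrable_mult_left cauchy_integrable)
  show "AE z in area. norm (cauchy z * \<bar>ln (cmod (z - w))\<bar>) \<le> norm (max 0 (- ln \<bar>Re z - Re w\<bar>) * (1 / (1 + (Im z)\<^sup>2)) + cauchy z * ln (1 + cmod z) + cauchy z * ln (1 + cmod w))"
    using AE_area_Re[of "Re w"]
  proof eventually_elim
    case (elim z)
    define m where "m = max 0 (- ln \<bar>Re z - Re w\<bar>)"
    have m: "m \<ge> 0" by (simp add: m_def)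
    have "cauchy z * \<bar>ln (cmod (z - w))\<bar> \<le> cauchy z * (m + ln (1 + cmod z) + ln (1 + cmod w))"
      using cauchy_pos[of z] abs_ln_dist_le[OF elim] unfolding m_def by (intro mult_left_mono) auto
    moreover have "cauchy z * m \<le> m * (1 / (1 + (Im z)\<^sup>2))"
    proof -
      have "1 * (1 + (Im z)\<^sup>2) \<le> (1 + (Re z)\<^sup>2) * (1 + (Im z)\<^sup>2)" by (intro mult_right_mono) auto
      then have "cauchy z \<le> 1 / (1 + (Im z)\<^sup>2)" unfolding cauchy_def
        by (intro divide_left_mono) (auto intro!: mult_pos_pos add_pos_nonneg)
      then have "m * cauchy z \<le> m * (1 / (1 + (Im z)\<^sup>2))" using m by (intro mult_left_mono)
      then show ?thesis by (simp add: mult.commute)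
    qed
    ultimately have "cauchy z * \<bar>ln (cmod (z - w))\<bar> \<le> m * (1 / (1 + (Im z)\<^sup>2)) + cauchy z * ln (1 + cmod z) + cauchy z * ln (1 + cmod w)"
      by (simp add: distrib_left)
    moreover have "0 \<le> cauchy z * \<bar>ln (cmod (z - w))\<bar>" using cauchy_pos[of z] by simp
    ultimately show ?case by (simp only: m_def[symmetric] real_norm_def abs_of_nonneg)
  qed
qed simp

text \<open>Green's identity for A = z - w with cut-off radius s: as s tends to 0, the normalised
  \<open>gam\<close> becomes ln |z - w|, while its Laplacian keeps the mass \<open>lap_mass\<close>
  and concentrates at w.\<close>

theorem logarithmic_representation:
  assumes f: "C2_on UNIV f fx fy fxx fyy" and flat: "flat_at_infinity f L fx fy"
    and C: "\<And>z. \<bar>fxx z + fyy z\<bar> \<le> C * cauchy z"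
  shows "lap_mass * (f w - L) = (\<integral>z. ln (cmod (z - w)) * (fxx z + fyy z) \<partial>area)"
proof -
  have C0: "C \<ge> 0" using C[of 0] cauchy_pos[of 0] by (meson abs_ge_zero order_trans zero_le_mult_iff not_le less_le_not_le)
  define D where "D z = fxx z + fyy z" for z
  define A where "A = [:-w, 1:]"
  have A: "A \<noteq> 0" "poly A z = z - w" for z by (auto simp: A_def)
  have fc: "continuous_on UNIV f" "continuous_on UNIV D" using f by (auto simp: C2_on_def D_def[abs_def] intro!: continuous_intros)
  have Dm [measurable]: "D \<in> borel_measurable borel" by (rule borel_measurable_continuous_onI[OF fc(2)])
  have Di: "integrable area D"
    by (rule Bochner_Integration.integrable_bound[of _ "\<lambda>z. C * cauchy z"])
       (use C C0 cauchy_pos in \<open>auto intro!: cauchy_integrable always_eventually simp: D_def abs_mult less_imp_le\<close>)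
  \<comment> \<open>The vanishing total Laplacian permits adding constants to \<open>gam\<close>
    under the integral.\<close>
  have D0: "(\<integral>z. D z \<partial>area) = 0"
    using laplacian_integral_zero[OF f flat] Di by (simp add: D_def[abs_def])
  define s where "s k = 1 / real (Suc k)" for k
  have s: "s k > 0" "s k \<le> 1" for k by (auto simp: s_def)
  have s0: "s \<longlonglongrightarrow> 0" unfolding s_def[abs_def] using LIMSEQ_inverse_real_of_nat by (simp add: inverse_eq_divide)
  \<comment> \<open>Beyond the cut-off, gam is x/2 - 1/4 with x = 2 (ln |z - w| - ln s); the two
    added constants restore ln |z - w| exactly.\<close>
  define G where "G k z = gam A ((s k)\<^sup>2) z + ln (s k) + 1/4" for k z
  have Gb: "\<bar>G k z\<bar> \<le> \<bar>ln (cmod (z - w))\<bar> + 1" if "z \<noteq> w" for k z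
  proof -
    have r: "cmod (z - w) > 0" using that by simp
    define x where "x = level A ((s k)\<^sup>2) z"
    have x: "x = 2 * (ln (cmod (z - w)) - ln (s k))"
      using r s[of k] by (simp add: x_def level_def A ln_div ln_realpow)
    have "ln (s k) \<le> 0" using s[of k] by (simp add: ln_le_zero_iff)
    then show ?thesis using omega0_bounds[of x] unfolding G_def gam_def x_def[symmetric]
      by (auto simp: abs_le_iff max_def x split: if_splits)
  qed
  have Glim: "(\<lambda>k. G k z) \<longlonglongrightarrow> ln (cmod (z - w))" if "z \<noteq> w" for z
  proof (rule tendsto_eventually)
    have r: "cmod (z - w) > 0" using that by simp
    have "eventually (\<lambda>k. s k < cmod (z - w) / exp 1) sequentially"
      using s0 r by (intro order_tendstoD(2)) auto
    then show "eventually (\<lambda>k. G k z = ln (cmod (z - w))) sequentially"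
    proof eventually_elim
      case (elim k)
      define x where "x = level A ((s k)\<^sup>2) z"
      have x: "x = 2 * (ln (cmod (z - w)) - ln (s k))"
        using r s[of k] by (simp add: x_def level_def A ln_div ln_realpow)
      have "ln (s k) \<le> ln (cmod (z - w) / exp 1)" using elim s[of k] by (intro ln_mono) auto
      also have "\<dots> = ln (cmod (z - w)) - 1" using r by (simp add: ln_div)
      finally have "x \<ge> 1" using x by simp
      then have "omega0 x = x - 1/2" by (rule omega_ge_1)
      moreover have "p / 2 + b + 1 / 4 = a" if "p = y - 1/2" "y = 2 * (a - b)" for a b p y :: real
        using that by (simp add: field_simps)
      ultimately show ?case unfolding G_def gam_def x_def[symmetric] using x by blast
    qed
  qed
  have gm [measurable]: "gam A ((s k)\<^sup>2) \<in> borel_measurable borel" for k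
    using s[of k] by (intro borel_measurable_continuous_onI gam_continuous) auto
  have AEw: "AE z in area. z \<noteq> w" using AE_area_Re[of "Re w"] by eventually_elim auto
  have dom: "integrable area (\<lambda>z. C * (cauchy z * \<bar>ln (cmod (z - w))\<bar> + cauchy z))"
    by (intro integrable_mult_right Bochner_Integration.integrable_add cauchy_log_dist_integrable cauchy_integrable)
  have bd: "AE z in area. norm (G k z * D z) \<le> C * (cauchy z * \<bar>ln (cmod (z - w))\<bar> + cauchy z)" for k
    using AEw
  proof eventually_elim
    case (elim z)
    have "\<bar>G k z\<bar> * \<bar>D z\<bar> \<le> (\<bar>ln (cmod (z - w))\<bar> + 1) * (C * cauchy z)"
      using Gb[OF elim] C by (intro mult_mono) (auto simp: D_def)
    then show ?case by (simp add: abs_mult algebra_simps)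
  qed
  have lim1: "(\<lambda>k. \<integral>z. G k z * D z \<partial>area) \<longlonglongrightarrow> (\<integral>z. ln (cmod (z - w)) * D z \<partial>area)"
  proof (rule integral_dominated_convergence[OF _ _ dom _ bd])
    show "(\<lambda>z. ln (cmod (z - w)) * D z) \<in> borel_measurable area" "(\<lambda>z. G k z * D z) \<in> borel_measurable area" for k
      unfolding G_def by measurable
    show "AE z in area. (\<lambda>k. G k z * D z) \<longlonglongrightarrow> ln (cmod (z - w)) * D z"
      using AEw by eventually_elim (intro tendsto_mult tendsto_const Glim)
  qed
  have GD: "integrable area (\<lambda>z. G k z * D z)" for k
    by (rule Bochner_Integration.integrable_bound[OF dom])
       (use bd[of k] cauchy_pos C0 in \<open>auto simp: G_def less_imp_le elim!: eventually_mono\<close>)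
  have gD: "integrable area (\<lambda>z. gam A ((s k)\<^sup>2) z * D z)" for k
  proof -
    have "gam A ((s k)\<^sup>2) z * D z = G k z * D z - (ln (s k) + 1/4) * D z" for z
      by (simp add: G_def algebra_simps)
    then show ?thesis using GD[of k] Di by simp
  qed
  have step: "(\<integral>z. G k z * D z \<partial>area) = (\<integral>z. (f (w + of_real (s k) * z) - L) * lap [:0, 1:] 1 z \<partial>area)" for k
  proof -
    define a where "a = (s k)\<^sup>2"
    have a: "a > 0" using s[of k] by (simp add: a_def)
    have "(\<integral>z. G k z * D z \<partial>area) = (\<integral>z. gam A a z * D z + (ln (s k) + 1/4) * D z \<partial>area)"
      by (simp add: G_def a_def algebra_simps)
    also have "\<dots> = (\<integral>z. gam A a z * D z \<partial>area)"
      using gD[of k] Di by (simp add: D0 a_def)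
    also have "\<dots> = (\<integral>z. (f z - L) * lap A a z \<partial>area)"
      using green_formula(1)[OF a A(1) open_UNIV _ f flat] gD[of k] by (simp add: D_def a_def)
    finally have 1: "(\<integral>z. G k z * D z \<partial>area) = (\<integral>z. (f z - L) * lap A a z \<partial>area)" .
    obtain R where R: "\<And>z. cmod z > R \<Longrightarrow> lap A a z = 0" using lap_compact[OF a A(1)] by blast
    have "(\<integral>z. (f (w + of_real (s k) * z) - L) * lap A a (w + of_real (s k) * z) \<partial>area) = (\<integral>z. (f z - L) * lap A a z \<partial>area) / (s k)\<^sup>2"
      by (rule area_integral_affine[where R = R and f = "\<lambda>z. (f z - L) * lap A a z"])
         (use fc gam_continuous(6)[OF a] R s in \<open>auto intro!: continuous_intros\<close>)
    then show ?thesis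
      using s[of k] lap_linear_scaling[OF s(1), of w k] by (simp add: 1 a_def A_def)
  qed
  \<comment> \<open>The standard shell is contained in |z|^2 \<le> e, and e < 4.\<close>
  have b0: "lap [:0, 1:] 1 z = 0" if "cmod z > 2" for z
  proof (rule ccontr)
    assume "lap [:0, 1:] 1 z \<noteq> 0"
    from lap_support[OF _ this] have "(cmod z)\<^sup>2 \<le> exp 1" by simp
    also have "\<dots> \<le> 3" by (rule exp_le)
    finally have "(cmod z)\<^sup>2 < 2\<^sup>2" by simp
    then have "cmod z < 2" by (rule power2_less_imp_less) simp
    then show False using that by simp
  qed
  have "bounded (f ` cball w 2)"
    by (intro compact_imp_bounded compact_continuous_image continuous_on_subset[OF fc(1)]) auto
  then obtain B where B: "\<And>z. z \<in> cball w 2 \<Longrightarrow> \<bar>f z\<bar> \<le> B" unfolding bounded_iff by (metis imageI real_norm_def)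
  have li: "integrable area (lap [:0, 1:] 1)" by (rule lap_integrable) auto
  have lm [measurable]: "lap [:0, 1:] 1 \<in> borel_measurable borel" using borel_measurable_integrable[OF li] by simp
  have "(\<lambda>k. \<integral>z. (f (w + of_real (s k) * z) - L) * lap [:0, 1:] 1 z \<partial>area) \<longlonglongrightarrow> (\<integral>z. (f w - L) * lap [:0, 1:] 1 z \<partial>area)"
  proof (rule integral_dominated_convergence)
    have [measurable]: "f \<in> borel_measurable borel" by (rule borel_measurable_continuous_onI[OF fc(1)])
    show "(\<lambda>z. (f w - L) * lap [:0, 1:] 1 z) \<in> borel_measurable area" "(\<lambda>z. (f (w + of_real (s k) * z) - L) * lap [:0, 1:] 1 z) \<in> borel_measurable area" for k
      by measurable
    show "integrable area (\<lambda>z. (B + \<bar>L\<bar>) * lap [:0, 1:] 1 z)" using li by (rule integrable_mult_right)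
    have "norm ((f (w + of_real (s k) * z) - L) * lap [:0, 1:] 1 z) \<le> (B + \<bar>L\<bar>) * lap [:0, 1:] 1 z" for k z
    proof (cases "cmod z > 2")
      case False
      have "s k * cmod z \<le> 1 * 2" using s[of k] False by (intro mult_mono) auto
      then have "w + of_real (s k) * z \<in> cball w 2" using s[of k] by (simp add: dist_norm norm_mult)
      from B[OF this] have "\<bar>f (w + of_real (s k) * z) - L\<bar> \<le> B + \<bar>L\<bar>" by linarith
      then show ?thesis using lap_nonneg[of "[:0,1:]" 1 z] by (simp add: abs_mult mult_right_mono)
    qed (simp add: b0)
    then show "AE z in area. norm ((f (w + of_real (s k) * z) - L) * lap [:0, 1:] 1 z) \<le> (B + \<bar>L\<bar>) * lap [:0, 1:] 1 z" for k by simp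
    have "(\<lambda>k. f (w + of_real (s k) * z)) \<longlonglongrightarrow> f w" for z
    proof -
      have "(\<lambda>k. w + of_real (s k) * z) \<longlonglongrightarrow> w + of_real 0 * z" by (intro tendsto_intros s0)
      moreover have "isCont f (w + of_real 0 * z)" using fc(1) by (simp add: continuous_on_eq_continuous_at)
      ultimately show ?thesis using isCont_tendsto_compose by fastforce
    qed
    then show "AE z in area. (\<lambda>k. (f (w + of_real (s k) * z) - L) * lap [:0, 1:] 1 z) \<longlonglongrightarrow> (f w - L) * lap [:0, 1:] 1 z"
      by (intro always_eventually allI tendsto_intros)
  qed
  then have "(\<lambda>k. \<integral>z. G k z * D z \<partial>area) \<longlonglongrightarrow> (f w - L) * lap_mass"
    unfolding step by (simp add: lap_mass_def)
  from LIMSEQ_unique[OF this lim1] show ?thesis by (simp add: D_def mult.commute)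
qed

section \<open>Polar sets from logarithmic potentials\<close>

text \<open>For b outside the circle ln |b - u| is harmonic on the disc. For b inside, multiplying
  the conjugate of b - u by u/r turns the modulus on the circle into that of r - cnj b * u / r,
  which has no zero in the closed disc and equals r at the centre.\<close>

lemma ln_dist_circle_mean:
  assumes r: "r > 0" and b: "cmod b \<noteq> r"
  shows "(\<integral>t. ln (cmod (b - of_real r * cis t)) \<partial>circ) = ln (max (cmod b) r)"
proof (cases "cmod b > r")
  case True
  have nz: "b - u \<noteq> 0" if "u \<in> ball 0 (cmod b)" for u using that by auto
  have holo: "(\<lambda>u. b - u) holomorphic_on ball 0 (cmod b)" by (intro holomorphic_intros)
  have contr: "contractible (ball (0 :: complex) (cmod b))" by (intro convex_imp_contractible convex_ball)
  obtain g where g: "g holomorphic_on ball 0 (cmod b)" "\<And>u. u \<in> ball 0 (cmod b) \<Longrightarrow> b - u = exp (g u)"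
    using contractible_imp_holomorphic_log[OF holo contr nz] by blast
  have "(\<integral>t. ln (cmod (b - (0 + of_real r * cis t))) \<partial>circ) = ln (cmod (b - 0))"
    by (rule Re_holomorphic_mean_value[OF g(1) r True, where h = "\<lambda>u. ln (cmod (b - u))"]) (simp add: g(2))
  then show ?thesis using True by (simp add: max_def)
next
  case False
  then have lt: "cmod b < r" using b by simp
  \<comment> \<open>For nonzero b the reflected point has modulus r^2/|b|, so the reflected function
    is zero-free on a disc larger than the circle.\<close>
  define \<rho> where "\<rho> = (if b = 0 then 2 * r else r * r / cmod b)"
  have \<rho>: "r < \<rho>" using lt r by (auto simp: \<rho>_def field_simps)
  have nz: "of_real r - cnj b / of_real r * u \<noteq> 0" if "u \<in> ball 0 \<rho>" for u
  proof
    assume "of_real r - cnj b / of_real r * u = 0"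
    then have "cmod (of_real r) = cmod (cnj b / of_real r * u)" by simp
    then have "r = cmod b * cmod u / r" using r by (simp add: norm_mult norm_divide)
    then have e: "r * r = cmod b * cmod u" using r by (simp add: field_simps)
    then have "b \<noteq> 0" using r by auto
    then have "cmod b * cmod u < cmod b * (r * r / cmod b)" using that by (intro mult_strict_left_mono) (auto simp: \<rho>_def)
    then show False using e \<open>b \<noteq> 0\<close> by simp
  qed
  have holo: "(\<lambda>u. of_real r - cnj b / of_real r * u) holomorphic_on ball 0 \<rho>" by (intro holomorphic_intros)
  have contr: "contractible (ball (0 :: complex) \<rho>)" by (intro convex_imp_contractible convex_ball)
  obtain g where g: "g holomorphic_on ball 0 \<rho>" "\<And>u. u \<in> ball 0 \<rho> \<Longrightarrow> of_real r - cnj b / of_real r * u = exp (g u)"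
    using contractible_imp_holomorphic_log[OF holo contr nz] by blast
  have m: "(\<integral>t. ln (cmod (of_real r - cnj b / of_real r * (0 + of_real r * cis t))) \<partial>circ) = ln (cmod (of_real r - cnj b / of_real r * 0))"
    by (rule Re_holomorphic_mean_value[OF g(1) r \<rho>, where h = "\<lambda>u. ln (cmod (of_real r - cnj b / of_real r * u))"]) (simp only: g(2) norm_exp_eq_Re ln_exp)
  have e: "cmod (of_real r - cnj b / of_real r * (0 + of_real r * cis t)) = cmod (b - of_real r * cis t)" for t
  proof -
    have "cmod (b - of_real r * cis t) = cmod (cnj (b - of_real r * cis t) * cis t)"
      by (simp only: norm_mult complex_mod_cnj norm_cis mult_1_right)
    also have "cnj (b - of_real r * cis t) * cis t = - (of_real r - cnj b * cis t)"
      by (simp add: algebra_simps cis_cnj cis_mult)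
    also have "cmod \<dots> = cmod (of_real r - cnj b * cis t)" by (rule norm_minus_cancel)
    finally show ?thesis using r by simp
  qed
  show ?thesis using m lt r unfolding e by simp
qed

text \<open>Minus the logarithm of |\<zeta> - a| / ((1 + |a|) max(1, |\<zeta>|)), a quantity
  comparable to the chordal distance. Being nonnegative with value infinity on the diagonal, it can
  be integrated in \<open>ennreal\<close> by Tonelli and Fatou.\<close>

definition log_defect :: "complex \<Rightarrow> complex \<Rightarrow> ennreal" where
  "log_defect \<zeta> a = (if \<zeta> = a then \<infinity> else ennreal (ln (1 + cmod a) + ln (max 1 (cmod \<zeta>)) - ln (cmod (\<zeta> - a))))"

lemma log_defect_nonneg:
  assumes "\<zeta> \<noteq> a" shows "0 \<le> ln (1 + cmod a) + ln (max 1 (cmod \<zeta>)) - ln (cmod (\<zeta> - a))"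
proof -
  have "cmod a * 1 \<le> cmod a * max 1 (cmod \<zeta>)" by (intro mult_left_mono) auto
  then have "cmod (\<zeta> - a) \<le> (1 + cmod a) * max 1 (cmod \<zeta>)"
    using norm_triangle_ineq4[of \<zeta> a] by (simp add: distrib_right max_def split: if_splits)
  then have "ln (cmod (\<zeta> - a)) \<le> ln ((1 + cmod a) * max 1 (cmod \<zeta>))"
    using assms by (intro ln_mono) (auto intro!: mult_pos_pos add_pos_nonneg)
  also have "\<dots> = ln (1 + cmod a) + ln (max 1 (cmod \<zeta>))" by (intro ln_mult_pos) (auto intro: add_pos_nonneg)
  finally show ?thesis by simp
qed

lemma log_defect_measurable [measurable]:
  "(\<lambda>p. log_defect (fst p) (snd p)) \<in> borel_measurable (borel \<Otimes>\<^sub>M borel)"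
  unfolding log_defect_def by measurable

text \<open>Joint continuity, including the pole on the diagonal; it feeds the Fatou arguments for
  circle means and for semicontinuity.\<close>

lemma log_defect_tendsto:
  assumes "(\<zeta>s \<longlongrightarrow> \<zeta>) F" "(as \<longlongrightarrow> a) F"
  shows "((\<lambda>k. log_defect (\<zeta>s k) (as k)) \<longlongrightarrow> log_defect \<zeta> a) F"
proof (cases "\<zeta> = a")
  case False
  have d: "((\<lambda>k. \<zeta>s k - as k) \<longlongrightarrow> \<zeta> - a) F" by (intro tendsto_intros assms)
  have "((\<lambda>k. ennreal (ln (1 + cmod (as k)) + ln (max 1 (cmod (\<zeta>s k))) - ln (cmod (\<zeta>s k - as k)))) \<longlongrightarrow> log_defect \<zeta> a) F"
  proof -
    have n: "1 + cmod a \<noteq> 0" "max 1 (cmod \<zeta>) \<noteq> 0" "cmod (\<zeta> - a) \<noteq> 0"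
      using False by (auto simp: add_nonneg_eq_0_iff max_def)
    have "log_defect \<zeta> a = ennreal (ln (1 + cmod a) + ln (max 1 (cmod \<zeta>)) - ln (cmod (\<zeta> - a)))"
      using False by (simp add: log_defect_def)
    then show ?thesis
      by (simp only:) (intro tendsto_ennrealI tendsto_add tendsto_diff tendsto_ln tendsto_max tendsto_norm
          tendsto_const assms d n)
  qed
  moreover have "eventually (\<lambda>k. \<zeta>s k - as k \<noteq> 0) F" using d False by (intro tendsto_imp_eventually_ne) auto
  then have "eventually (\<lambda>k. ennreal (ln (1 + cmod (as k)) + ln (max 1 (cmod (\<zeta>s k))) - ln (cmod (\<zeta>s k - as k))) = log_defect (\<zeta>s k) (as k)) F"
    by (rule eventually_mono) (auto simp: log_defect_def)
  ultimately show ?thesis by (rule Lim_transform_eventually)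
next
  case True
  have "eventually (\<lambda>k. ennreal l < log_defect (\<zeta>s k) (as k)) F" if "l \<ge> 0" for l
  proof -
    have "((\<lambda>k. \<zeta>s k - as k) \<longlongrightarrow> \<zeta> - a) F" by (intro tendsto_intros assms)
    then have "eventually (\<lambda>k. cmod (\<zeta>s k - as k) < exp (- l - 1)) F"
      using True tendstoD[of "\<lambda>k. \<zeta>s k - as k" 0 F "exp (- l - 1)"] by simp
    then show ?thesis
    proof eventually_elim
      case (elim k)
      show ?case
      proof (cases "\<zeta>s k = as k")
        case False
        then have "ln (cmod (\<zeta>s k - as k)) < ln (exp (- l - 1))" using elim by (subst ln_less_cancel_iff) auto
        then have "l < ln (1 + cmod (as k)) + ln (max 1 (cmod (\<zeta>s k))) - ln (cmod (\<zeta>s k - as k))"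
        proof -
          have "l < p + q - x" if "x < - l - 1" "0 \<le> p" "0 \<le> q" for p q x :: real using that by linarith
          moreover have "0 \<le> ln (1 + cmod (as k))" "0 \<le> ln (max 1 (cmod (\<zeta>s k)))" by (auto intro: ln_ge_zero)
          ultimately show ?thesis using \<open>ln (cmod (\<zeta>s k - as k)) < ln (exp (- l - 1))\<close> by (simp only: ln_exp)
        qed
        then show ?thesis using False that by (simp add: log_defect_def ennreal_less_iff)
      qed (simp add: log_defect_def)
    qed
  qed
  then show ?thesis using True by (simp add: log_defect_def tendsto_top_iff_ennreal)
qed

text \<open>If \<zeta> is off the circle this is an equality by \<open>ln_dist_circle_mean\<close>.
  On the circle, \<zeta> is approached radially from outside by points off the circle, and Fatou's
  lemma keeps the upper bound.\<close>

lemma log_defect_circle_mean: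
  fixes \<zeta> z :: complex
  assumes r: "r > 0"
  defines "K \<equiv> (\<integral>t. ln (1 + cmod (z + of_real r * cis t)) \<partial>circ)"
  shows "0 \<le> K + ln (max 1 (cmod \<zeta>)) - ln (max (cmod (\<zeta> - z)) r)" (is "0 \<le> ?x \<zeta>")
    and "(\<integral>\<^sup>+ t. log_defect \<zeta> (z + of_real r * cis t) \<partial>circ) \<le> ennreal (K + ln (max 1 (cmod \<zeta>)) - ln (max (cmod (\<zeta> - z)) r))"
proof -
  have ci: "integrable circ (\<lambda>t. ln (1 + cmod (z + of_real r * cis t)))"
    by (intro circ_integrable_continuous continuous_intros) (auto simp: add_nonneg_eq_0_iff)
  have main: "0 \<le> ?x \<zeta> \<and> (\<integral>\<^sup>+ t. log_defect \<zeta> (z + of_real r * cis t) \<partial>circ) = ennreal (?x \<zeta>)"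
    if ne: "cmod (\<zeta> - z) \<noteq> r" for \<zeta>
  proof -
    have d: "\<zeta> \<noteq> z + of_real r * cis t" for t using ne r by (auto simp: norm_mult)
    have d': "\<zeta> - (z + of_real r * cis t) = (\<zeta> - z) - of_real r * cis t" for t by simp
    define h where "h t = ln (1 + cmod (z + of_real r * cis t)) + ln (max 1 (cmod \<zeta>)) - ln (cmod ((\<zeta> - z) - of_real r * cis t))" for t
    have h0: "0 \<le> h t" for t using log_defect_nonneg[OF d] unfolding h_def d' .
    have li: "integrable circ (\<lambda>t. ln (cmod ((\<zeta> - z) - of_real r * cis t)))"
      using d by (intro circ_integrable_continuous continuous_intros) (auto simp: algebra_simps)
    have hi: "integrable circ h" unfolding h_def using ci li by auto
    have "(\<integral>t. h t \<partial>circ) = ?x \<zeta>"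
      unfolding h_def K_def using ci li circ.prob_space ln_dist_circle_mean[OF r ne] by simp
    moreover have "(\<integral>\<^sup>+ t. log_defect \<zeta> (z + of_real r * cis t) \<partial>circ) = (\<integral>\<^sup>+ t. ennreal (h t) \<partial>circ)"
      unfolding h_def using d by (simp add: log_defect_def d')
    ultimately show ?thesis
      using nn_integral_eq_integral[OF hi] h0 integral_nonneg_AE[of h circ] by simp
  qed
  have "0 \<le> ?x \<zeta> \<and> (\<integral>\<^sup>+ t. log_defect \<zeta> (z + of_real r * cis t) \<partial>circ) \<le> ennreal (?x \<zeta>)"
  proof (cases "cmod (\<zeta> - z) = r")
    case True
    define s where "s k = z + of_real (1 + 1 / real (Suc k)) * (\<zeta> - z)" for k
    have "cmod (s k - z) = (1 + 1 / real (Suc k)) * r" for k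
      unfolding s_def using True by (simp only: add_diff_cancel_left' norm_mult norm_of_real) simp
    moreover have "(1 + 1 / real (Suc k)) * r > r" for k using r by (simp add: field_simps)
    ultimately have sr: "cmod (s k - z) \<noteq> r" for k by (metis less_irrefl)
    have "(\<lambda>k. 1 / real (Suc k)) \<longlonglongrightarrow> 0" using LIMSEQ_inverse_real_of_nat by (simp add: inverse_eq_divide)
    then have "s \<longlonglongrightarrow> z + of_real (1 + 0) * (\<zeta> - z)" unfolding s_def by (intro tendsto_intros)
    then have s: "s \<longlonglongrightarrow> \<zeta>" by simp
    have x: "(\<lambda>k. ?x (s k)) \<longlonglongrightarrow> ?x \<zeta>"
      using r by (intro tendsto_intros s) (auto simp: max_def)
    have 1: "0 \<le> ?x \<zeta>" using main[OF sr] by (intro LIMSEQ_le_const[OF x]) auto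
    have "(\<integral>\<^sup>+ t. log_defect \<zeta> (z + of_real r * cis t) \<partial>circ) = (\<integral>\<^sup>+ t. liminf (\<lambda>k. log_defect (s k) (z + of_real r * cis t)) \<partial>circ)"
      by (intro nn_integral_cong lim_imp_Liminf[symmetric] log_defect_tendsto s) auto
    also have "\<dots> \<le> liminf (\<lambda>k. \<integral>\<^sup>+ t. log_defect (s k) (z + of_real r * cis t) \<partial>circ)"
    proof (rule nn_integral_liminf)
      fix k
      have "(\<lambda>t. (s k, z + of_real r * cis t)) \<in> circ \<rightarrow>\<^sub>M borel \<Otimes>\<^sub>M borel"
        by (intro measurable_Pair) (auto intro!: borel_measurable_continuous_onI continuous_intros simp: measurable_cong_sets[OF sets_circ refl])
      from measurable_compose[OF this log_defect_measurable]
      show "(\<lambda>t. log_defect (s k) (z + of_real r * cis t)) \<in> borel_measurable circ" by simp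
    qed
    also have "\<dots> = liminf (\<lambda>k. ennreal (?x (s k)))" using main[OF sr] by simp
    also have "\<dots> = ennreal (?x \<zeta>)" by (intro lim_imp_Liminf tendsto_ennrealI x) auto
    finally show ?thesis using 1 by simp
  qed (use main in auto)
  then show "0 \<le> ?x \<zeta>" "(\<integral>\<^sup>+ t. log_defect \<zeta> (z + of_real r * cis t) \<partial>circ) \<le> ennreal (?x \<zeta>)" by auto
qed

lemma ereal_integral_cong_AE:
  assumes "AE x in M. u x = v x"
  shows "ereal_integral M u = ereal_integral M v"
proof -
  have "(\<integral>\<^sup>+ x. e2ennreal (u x) \<partial>M) = (\<integral>\<^sup>+ x. e2ennreal (v x) \<partial>M)"
    "(\<integral>\<^sup>+ x. e2ennreal (- u x) \<partial>M) = (\<integral>\<^sup>+ x. e2ennreal (- v x) \<partial>M)"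
    using assms by (auto intro!: nn_integral_cong_AE)
  then show ?thesis by (simp add: ereal_integral_def)
qed

lemma ereal_integral_const_circ: "ereal_integral circ (\<lambda>_. c) = c"
proof (cases c)
  case (real x)
  then show ?thesis using ereal_integral_ereal[of circ "\<lambda>_. x"] circ.prob_space by simp
next
  case PInf
  then show ?thesis using circ.emeasure_space_1 by (simp add: ereal_integral_def e2ennreal_neg)
next
  case MInf
  then show ?thesis using circ.emeasure_space_1
    by (simp add: ereal_integral_def e2ennreal_neg zero_ennreal.rep_eq)
qed

definition log_pot :: "complex measure \<Rightarrow> complex \<Rightarrow> ennreal" where
  "log_pot \<tau> a = (\<integral>\<^sup>+ \<zeta>. log_defect \<zeta> a \<partial>\<tau>)"

text \<open>Up to a constant, minus the defect potential is the ordinary logarithmic potential, so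
  it is subharmonic: Fatou gives semicontinuity, Tonelli and the circle means give the submean
  inequality. Finite mass of \<tau> makes it not identically -\<infinity>.\<close>

theorem polar_log_pot:
  assumes "finite_measure \<tau>" and sets: "sets \<tau> = sets borel"
  shows "polar {a. log_pot \<tau> a = \<infinity>}"
proof -
  interpret finite_measure \<tau> by fact
  have sp: "space \<tau> = UNIV" using sets_eq_imp_space_eq[OF sets] by simp
  define m where "m = measure \<tau> UNIV"
  have m: "m \<ge> 0" "emeasure \<tau> (space \<tau>) = ennreal m" by (simp_all add: m_def sp emeasure_eq_measure)
  define L where "L a = ln (1 + cmod a)" for a :: complex
  have L0: "L a \<ge> 0" for a by (simp add: L_def)
  \<comment> \<open>Where finite, this is the \<tau>-integral of ln |\<zeta> - a| - ln max(1,
    |\<zeta>|): the term \<open>L a\<close> of the defect, which has no place in a subharmonic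
    function of this kind, is removed.\<close>
  define u where "u a = ereal (L a * m) - enn2ereal (log_pot \<tau> a)" for a
  have meas: "(\<lambda>\<zeta>. log_defect \<zeta> a) \<in> borel_measurable \<tau>" for a
    unfolding measurable_cong_sets[OF sets refl]
    using measurable_compose[of "\<lambda>\<zeta>. (\<zeta>, a)" borel "borel \<Otimes>\<^sub>M borel", OF _ log_defect_measurable] by simp
  have u_top: "u a < \<infinity>" for a
    unfolding u_def by (cases "log_pot \<tau> a") (auto simp: enn2ereal_ennreal)
  have u_inf: "u a = -\<infinity> \<longleftrightarrow> log_pot \<tau> a = \<infinity>" for a
    unfolding u_def by (cases "log_pot \<tau> a") (auto simp: enn2ereal_ennreal)
  have usc: "Limsup (at z) u \<le> u z" for z
    unfolding Limsup_le_iff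
  proof (intro allI impI)
    fix y assume y: "u z < y"
    show "eventually (\<lambda>x. u x < y) (at z)"
    proof (cases y)
      case PInf then show ?thesis using u_top by simp
    next
      case MInf then show ?thesis using y by simp
    next
      case (real yr)
      have "ereal (L z * m - yr) < enn2ereal (log_pot \<tau> z)"
        using y real m(1) L0[of z] unfolding u_def by (cases "log_pot \<tau> z") (auto simp: enn2ereal_ennreal)
      then obtain c where c: "L z * m - yr < c" "ereal c < enn2ereal (log_pot \<tau> z)"
        using ereal_dense2 by (metis ereal_less(2) less_ereal.simps(1))
      show ?thesis
      proof (rule sequentially_imp_eventually_at, intro allI impI, elim conjE)
        fix a :: "nat \<Rightarrow> complex" assume a: "\<forall>n. a n \<noteq> z" "a \<longlonglongrightarrow> z"
        have "log_pot \<tau> z = (\<integral>\<^sup>+ \<zeta>. liminf (\<lambda>k. log_defect \<zeta> (a k)) \<partial>\<tau>)" unfolding log_pot_def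
          by (intro nn_integral_cong lim_imp_Liminf[symmetric] log_defect_tendsto a tendsto_const) auto
        also have "\<dots> \<le> liminf (\<lambda>k. log_pot \<tau> (a k))" unfolding log_pot_def
          by (rule nn_integral_liminf) (rule meas)
        finally have fatou: "log_pot \<tau> z \<le> liminf (\<lambda>k. log_pot \<tau> (a k))" .
        have "eventually (\<lambda>k. ereal c < enn2ereal (log_pot \<tau> (a k))) sequentially"
        proof (cases "c < 0")
          case True
          then have "ereal c < enn2ereal x" for x using enn2ereal_nonneg[of x] by (metis ereal_less(1) less_le_trans zero_ereal_def less_ereal.simps(1))
          then show ?thesis by simp
        next
          case False
          then have "ennreal c < log_pot \<tau> z" using c(2) by (simp add: less_ennreal.rep_eq enn2ereal_ennreal)
          then have "ennreal c < liminf (\<lambda>k. log_pot \<tau> (a k))" using fatou by (rule less_le_trans)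
          then have "eventually (\<lambda>k. ennreal c < log_pot \<tau> (a k)) sequentially" by (rule less_LiminfD)
          then show ?thesis by (rule eventually_mono) (use False in \<open>simp add: less_ennreal.rep_eq enn2ereal_ennreal\<close>)
        qed
        moreover have "(\<lambda>k. L (a k) * m) \<longlonglongrightarrow> L z * m"
          unfolding L_def by (intro tendsto_intros a) (auto simp: add_nonneg_eq_0_iff)
        then have "eventually (\<lambda>k. L (a k) * m < yr + c) sequentially" using c by (intro order_tendstoD(2)) auto
        ultimately show "eventually (\<lambda>n. u (a n) < y) sequentially"
        proof eventually_elim
          case (elim k)
          then show ?case unfolding u_def real by (cases "log_pot \<tau> (a k)") (auto simp: enn2ereal_ennreal)
        qed
      qed
    qed
  qed
  define K where "K z r = (\<integral>t. L (z + of_real r * cis t) \<partial>circ)" for z r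
  define P where "P z r = (\<integral>\<^sup>+ t. log_pot \<tau> (z + of_real r * cis t) \<partial>circ)" for z r
  have joint: "(\<lambda>p. log_defect (fst p) (z + of_real r * cis (snd p))) \<in> borel_measurable (\<tau> \<Otimes>\<^sub>M circ)" for z r
  proof -
    have "(\<lambda>p :: complex \<times> real. (fst p, z + of_real r * cis (snd p))) \<in> (borel \<Otimes>\<^sub>M borel) \<rightarrow>\<^sub>M (borel \<Otimes>\<^sub>M borel)"
    proof (intro measurable_Pair)
      have "(\<lambda>t. z + of_real r * cis t) \<in> borel_measurable borel"
        by (intro borel_measurable_continuous_onI continuous_intros)
      then show "(\<lambda>p :: complex \<times> real. z + of_real r * cis (snd p)) \<in> borel_measurable (borel \<Otimes>\<^sub>M borel)"
        by (rule measurable_compose[OF measurable_snd])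
    qed simp
    from measurable_compose[OF this log_defect_measurable] show ?thesis
      unfolding measurable_cong_sets[OF sets_pair_measure_cong[OF sets sets_circ] refl] by simp
  qed
  have pairs: "pair_sigma_finite \<tau> circ"
    by (intro pair_sigma_finite.intro sigma_finite_measure_axioms circ.sigma_finite_measure_axioms)
  have P_eq: "P z r = (\<integral>\<^sup>+ \<zeta>. (\<integral>\<^sup>+ t. log_defect \<zeta> (z + of_real r * cis t) \<partial>circ) \<partial>\<tau>)" for z r
    unfolding P_def log_pot_def
    using pair_sigma_finite.Fubini'[OF pairs, of "\<lambda>\<zeta> t. log_defect \<zeta> (z + of_real r * cis t)"] joint
    by (simp add: case_prod_beta')
  have inner_meas: "(\<lambda>\<zeta>. \<integral>\<^sup>+ t. log_defect \<zeta> (z + of_real r * cis t) \<partial>circ) \<in> borel_measurable \<tau>" for z r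
    using circ.borel_measurable_nn_integral[of "\<lambda>\<zeta> t. log_defect \<zeta> (z + of_real r * cis t)" \<tau>] joint by (simp add: case_prod_beta')
  have potm: "(\<lambda>t. log_pot \<tau> (z + of_real r * cis t)) \<in> borel_measurable circ" for z r
  proof -
    have "(\<lambda>p. log_defect (snd p) (z + of_real r * cis (fst p))) \<in> borel_measurable (circ \<Otimes>\<^sub>M \<tau>)"
      using measurable_compose[OF measurable_pair_swap' joint] by (simp add: case_prod_beta')
    then show ?thesis unfolding log_pot_def
      using borel_measurable_nn_integral[of "\<lambda>t \<zeta>. log_defect \<zeta> (z + of_real r * cis t)" circ] by (simp add: case_prod_beta')
  qed
  have Li: "integrable circ (\<lambda>t. L (z + of_real r * cis t))" for z r
    unfolding L_def by (intro circ_integrable_continuous continuous_intros) (auto simp: add_nonneg_eq_0_iff)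
  have K0: "K z r \<ge> 0" for z r unfolding K_def by (intro integral_nonneg_AE) (simp add: L0)
  \<comment> \<open>The submean inequality for u with the subtracted terms moved across, so that it
    makes sense when the potentials are infinite.\<close>
  have key: "P z r + ennreal (L z * m) \<le> ennreal (K z r * m) + log_pot \<tau> z" if r: "r > 0" for z r
  proof -
    have pt: "(\<integral>\<^sup>+ t. log_defect \<zeta> (z + of_real r * cis t) \<partial>circ) + ennreal (L z) \<le> ennreal (K z r) + log_defect \<zeta> z" for \<zeta>
    proof (cases "\<zeta> = z")
      case False
      note * = log_defect_circle_mean[OF r, where z = z and \<zeta> = \<zeta>, folded L_def, folded K_def]
      have "ln (cmod (\<zeta> - z)) \<le> ln (max (cmod (\<zeta> - z)) r)" using False by (intro ln_mono) auto
      then have 1: "K z r + ln (max 1 (cmod \<zeta>)) - ln (max (cmod (\<zeta> - z)) r) + L z \<le>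
          K z r + (L z + ln (max 1 (cmod \<zeta>)) - ln (cmod (\<zeta> - z)))" by simp
      have "(\<integral>\<^sup>+ t. log_defect \<zeta> (z + of_real r * cis t) \<partial>circ) + ennreal (L z) \<le>
          ennreal (K z r + ln (max 1 (cmod \<zeta>)) - ln (max (cmod (\<zeta> - z)) r)) + ennreal (L z)"
        by (intro add_right_mono *)
      also have "\<dots> = ennreal (K z r + ln (max 1 (cmod \<zeta>)) - ln (max (cmod (\<zeta> - z)) r) + L z)"
        using * L0 by (subst ennreal_plus) auto
      also have "\<dots> \<le> ennreal (K z r + (L z + ln (max 1 (cmod \<zeta>)) - ln (cmod (\<zeta> - z))))"
        using 1 by (rule ennreal_leI)
      also have "\<dots> = ennreal (K z r) + log_defect \<zeta> z"
        unfolding log_defect_def using False log_defect_nonneg[OF False] K0 by (subst ennreal_plus) (auto simp: L_def)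
      finally show ?thesis .
    qed (simp add: log_defect_def)
    have "P z r + ennreal (L z * m) = (\<integral>\<^sup>+ \<zeta>. (\<integral>\<^sup>+ t. log_defect \<zeta> (z + of_real r * cis t) \<partial>circ) + ennreal (L z) \<partial>\<tau>)"
      unfolding P_eq using inner_meas L0 m by (subst nn_integral_add) (auto simp: ennreal_mult)
    also have "\<dots> \<le> (\<integral>\<^sup>+ \<zeta>. ennreal (K z r) + log_defect \<zeta> z \<partial>\<tau>)" by (intro nn_integral_mono pt)
    also have "\<dots> = ennreal (K z r * m) + log_pot \<tau> z"
      unfolding log_pot_def using meas K0 m by (subst nn_integral_add) (auto simp: ennreal_mult)
    finally show ?thesis .
  qed
  have cm: "circle_mean u z r = ereal (K z r * m) - enn2ereal (P z r)" if "P z r \<noteq> \<infinity>" for z r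
  proof -
    define p where "p t = enn2real (log_pot \<tau> (z + of_real r * cis t))" for t
    have AE: "AE t in circ. log_pot \<tau> (z + of_real r * cis t) \<noteq> \<infinity>"
      using nn_integral_noteq_infinite[OF potm] that unfolding P_def by simp
    have AEp: "AE t in circ. log_pot \<tau> (z + of_real r * cis t) = ennreal (p t)"
      using AE by eventually_elim (simp add: p_def top.not_eq_extremum)
    have Pp: "P z r = (\<integral>\<^sup>+ t. ennreal (p t) \<partial>circ)" unfolding P_def using AEp by (rule nn_integral_cong_AE)
    have pi: "integrable circ p"
    proof (rule integrableI_bounded)
      show "p \<in> borel_measurable circ" unfolding p_def using potm by (rule borel_measurable_enn2real)
      show "(\<integral>\<^sup>+ t. ennreal (norm (p t)) \<partial>circ) < \<infinity>"
        using Pp that by (simp add: p_def top.not_eq_extremum)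
    qed
    have "circle_mean u z r = ereal_integral circ (\<lambda>t. ereal (L (z + of_real r * cis t) * m - p t))"
      unfolding circle_mean_circ
    proof (rule ereal_integral_cong_AE)
      show "AE t in circ. u (z + of_real r * cis t) = ereal (L (z + of_real r * cis t) * m - p t)"
        using AEp
      proof eventually_elim
        case (elim t)
        have "enn2ereal (log_pot \<tau> (z + of_real r * cis t)) = ereal (p t)"
          unfolding elim by (rule enn2ereal_ennreal) (simp add: p_def)
        then show ?case unfolding u_def by simp
      qed
    qed
    also have "\<dots> = ereal (K z r * m - (\<integral>t. p t \<partial>circ))"
      using Li[of z r] pi by (subst ereal_integral_ereal) (auto simp: K_def)
    also have "\<dots> = ereal (K z r * m) - enn2ereal (P z r)"
    proof -
      have p0: "0 \<le> p t" for t by (simp add: p_def)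
      then have "0 \<le> (\<integral>t. p t \<partial>circ)" by (intro integral_nonneg_AE) simp
      moreover have "P z r = ennreal (\<integral>t. p t \<partial>circ)"
        unfolding Pp by (rule nn_integral_eq_integral[OF pi]) (simp add: p0)
      ultimately show ?thesis by (simp add: enn2ereal_ennreal)
    qed
    finally show ?thesis .
  qed
  have "subharmonic_on UNIV u"
    unfolding subharmonic_on_def
  proof (intro conjI ballI)
    fix z
    show "u z < \<infinity>" by (rule u_top)
    show "Limsup (at z) u \<le> u z" by (rule usc)
    have "u z \<le> circle_mean u z r" if "0 \<le> r" for r
    proof (cases "r = 0")
      case True
      then show ?thesis by (simp add: circle_mean_circ ereal_integral_const_circ)
    next
      case False
      then have r: "r > 0" using that by simp
      show ?thesis
      proof (cases "P z r = \<infinity>")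
        case True
        then have "log_pot \<tau> z = \<infinity>" using key[OF r, of z] by (simp add: top_unique ennreal_add_eq_top)
        then have "u z = -\<infinity>" using u_inf[of z] by blast
        then show ?thesis by simp
      next
        case False
        show ?thesis
        proof (cases "log_pot \<tau> z")
          case (real x)
          obtain y where y: "P z r = ennreal y" "y \<ge> 0" using False by (cases "P z r") auto
          have "ennreal (y + L z * m) \<le> ennreal (K z r * m + x)"
            using key[OF r, of z] y real L0[of z] K0[of z r] m(1) by simp
          then have "y + L z * m \<le> K z r * m + x" using y real L0[of z] K0[of z r] m(1)
            by (subst (asm) ennreal_le_iff) auto
          then show ?thesis unfolding cm[OF False] using y real by (simp add: u_def enn2ereal_ennreal)
        next
          case top
          then have "u z = -\<infinity>" using u_inf[of z] by simp
          then show ?thesis by simp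
        qed
      qed
    qed
    then show "\<exists>\<rho>>0. ball z \<rho> \<subseteq> UNIV \<and> (\<forall>r. 0 \<le> r \<and> r < \<rho> \<longrightarrow> u z \<le> circle_mean u z r)"
      by (intro exI[of _ 1]) auto
  qed
  \<comment> \<open>On the unit circle the two maxima in \<open>log_defect_circle_mean\<close>
    cancel, so the mean of the defect is bounded uniformly in \<zeta>.\<close>
  moreover have "\<exists>z. u z \<noteq> -\<infinity>"
  proof -
    have "P 0 1 \<le> (\<integral>\<^sup>+ \<zeta>. ennreal (K 0 1) \<partial>\<tau>)"
      unfolding P_eq
    proof (rule nn_integral_mono)
      fix \<zeta> :: complex
      show "(\<integral>\<^sup>+ t. log_defect \<zeta> (0 + of_real 1 * cis t) \<partial>circ) \<le> ennreal (K 0 1)"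
        using log_defect_circle_mean(2)[of 1 \<zeta> 0, folded L_def, folded K_def] by (simp add: max.commute K_def)
    qed
    also have "\<dots> < \<infinity>" using m K0 by (simp add: ennreal_mult_less_top)
    finally have "P 0 1 \<noteq> \<infinity>" by simp
    have "\<exists>t. log_pot \<tau> (0 + of_real 1 * cis t) \<noteq> \<infinity>"
    proof (rule ccontr)
      assume "\<nexists>t. log_pot \<tau> (0 + of_real 1 * cis t) \<noteq> \<infinity>"
      then have "P 0 1 = (\<integral>\<^sup>+ t. \<infinity> \<partial>circ)" unfolding P_def by (intro nn_integral_cong) auto
      then show False using \<open>P 0 1 \<noteq> \<infinity>\<close> circ.emeasure_space_1 by simp
    qed
    then show ?thesis using u_inf by blast
  qed
  ultimately show ?thesis unfolding polar_def using u_inf by (intro exI[of _ u]) auto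
qed

section \<open>Dynamics of the unicritical family\<close>

definition logp :: "complex \<Rightarrow> real" where
  "logp z = ln (max 1 (cmod z))"

lemma logp_nonneg: "0 \<le> logp z"
  by (simp add: logp_def)

lemma logp_ge: "z \<noteq> 0 \<Longrightarrow> ln (cmod z) \<le> logp z"
  unfolding logp_def by (intro ln_mono) auto

lemma logp_continuous: "continuous_on UNIV logp"
  unfolding logp_def[abs_def] by (intro continuous_intros) (auto simp: max_def)

text \<open>The error of one iteration on the logarithmic scale: \<open>logp\<close> is multiplied
  by d up to this quantity, which does not depend on d.\<close>

definition step_bound :: "complex \<Rightarrow> real" where
  "step_bound c = ln (2 * (1 + cmod c))"

lemma step_bound_nonneg: "0 \<le> step_bound c"
  unfolding step_bound_def by (intro ln_ge_zero) (simp add: add_increasing)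

text \<open>The upper bound is immediate. For the lower one, either max(1, |z|)^d is at most 2 (1 +
  |c|) and there is nothing to gain, or z^d dominates c and the sum has modulus at least |z|^d /
  2.\<close>

lemma logp_power_add:
  "\<bar>logp (z ^ d + c) - real d * logp z\<bar> \<le> step_bound c"
proof -
  define m where "m = max 1 (cmod z)"
  have m: "m \<ge> 1" by (simp add: m_def)
  have md: "m ^ d \<ge> 1" using m by simp
  have dl: "real d * logp z = ln (m ^ d)" using m by (simp add: logp_def m_def[symmetric] ln_realpow)
  have c1: "1 + cmod c \<ge> 1" by simp
  have "logp (z ^ d + c) \<le> real d * logp z + step_bound c"
  proof -
    have "cmod (z ^ d + c) \<le> cmod z ^ d + cmod c" using norm_triangle_ineq[of "z ^ d" c] by (simp add: norm_power)
    also have "cmod z ^ d \<le> m ^ d" by (intro power_mono) (auto simp: m_def)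
    also have "cmod c \<le> cmod c * m ^ d" using mult_left_mono[OF md, of "cmod c"] by simp
    finally have "cmod (z ^ d + c) \<le> (1 + cmod c) * m ^ d" by (simp add: algebra_simps)
    moreover have "1 * 1 \<le> (1 + cmod c) * m ^ d" using c1 md by (intro mult_mono) auto
    ultimately have "max 1 (cmod (z ^ d + c)) \<le> (1 + cmod c) * m ^ d" by simp
    also have "\<dots> \<le> (2 * (1 + cmod c)) * m ^ d" using c1 md by (intro mult_right_mono) auto
    finally have "logp (z ^ d + c) \<le> ln ((2 * (1 + cmod c)) * m ^ d)"
      unfolding logp_def by (intro ln_mono) (auto simp: max_def)
    also have "\<dots> = step_bound c + ln (m ^ d)" unfolding step_bound_def
    proof (rule ln_mult_pos)
      show "0 < 2 * (1 + cmod c)" by (simp add: add_pos_nonneg)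
      show "0 < m ^ d" using m by simp
    qed
    finally show ?thesis using dl by simp
  qed
  moreover have "real d * logp z \<le> logp (z ^ d + c) + step_bound c"
  proof (cases "m ^ d \<le> 2 * (1 + cmod c)")
    case True
    then have "ln (m ^ d) \<le> step_bound c" unfolding step_bound_def using md by (intro ln_mono) auto
    then show ?thesis using dl logp_nonneg[of "z ^ d + c"] by simp
  next
    case False
    then have "m = cmod z" using c1 by (auto simp: m_def max_def split: if_splits)
    then have zd: "cmod (z ^ d) = m ^ d" by (simp add: norm_power)
    have "cmod (z ^ d + c) \<ge> m ^ d - cmod c" using norm_triangle_ineq2[of "z ^ d" "- c"] zd by simp
    then have h: "cmod (z ^ d + c) \<ge> m ^ d / 2" using False by simp
    have "ln (m ^ d / 2) \<le> logp (z ^ d + c)"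
      unfolding logp_def using h md by (intro ln_mono) auto
    moreover have "ln (m ^ d / 2) = ln (m ^ d) - ln 2" using md by (intro ln_divide_pos) auto
    moreover have "ln 2 \<le> step_bound c" unfolding step_bound_def by (intro ln_mono) auto
    ultimately show ?thesis using dl by linarith
  qed
  ultimately show ?thesis by linarith
qed

lemma sum_powers: "d > 1 \<Longrightarrow> (\<Sum>k<n. (real d - 1) * real d ^ k) = real d ^ n - 1"
  by (simp add: sum_distrib_left[symmetric] power_diff_1_eq[symmetric])

lemma norm_power_diff_le:
  fixes x y :: complex
  assumes "cmod x \<le> M" "cmod y \<le> M"
  shows "cmod (x ^ n - y ^ n) \<le> real n * M ^ (n - 1) * cmod (x - y)"
proof -
  have M: "M \<ge> 0" using assms norm_ge_zero order_trans by blast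
  have "cmod (\<Sum>i<n. y ^ (n - Suc i) * x ^ i) \<le> (\<Sum>i<n. M ^ (n - 1))"
  proof (rule sum_norm_le)
    fix i assume "i \<in> {..<n}"
    then have i: "n - 1 = (n - Suc i) + i" by auto
    have "cmod y ^ (n - Suc i) * cmod x ^ i \<le> M ^ (n - Suc i) * M ^ i"
      using assms M by (intro mult_mono power_mono) auto
    then show "cmod (y ^ (n - Suc i) * x ^ i) \<le> M ^ (n - 1)"
      unfolding i power_add by (simp add: norm_mult norm_power)
  qed
  then have "cmod (x - y) * cmod (\<Sum>i<n. y ^ (n - Suc i) * x ^ i) \<le> cmod (x - y) * (real n * M ^ (n - 1))"
    by (intro mult_left_mono) auto
  then show ?thesis unfolding power_diff_sumr2[of x n y] norm_mult by (simp add: mult_ac)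
qed

locale unicritical_family =
  fixes d :: nat
  assumes d: "d > 1"
begin

definition Q :: "nat \<Rightarrow> complex \<Rightarrow> complex" where
  "Q n c = poly (critical_value_poly d n) c"

abbreviation "M \<equiv> connectedness_locus d"

lemma Q_0: "Q 0 c = c" and Q_Suc: "Q (Suc n) c = Q n c ^ d + c"
  by (simp_all add: Q_def)

lemma Q_continuous: "continuous_on S (Q n)"
  unfolding Q_def[abs_def] by (intro continuous_intros)

lemma Q_iterate: "Q n c = (unicritical d c ^^ n) c"
  by (simp add: Q_def poly_critical_value_poly)

text \<open>The orbit of the critical point 0 runs one step ahead of that of the critical
  value.\<close>

lemma Q_critical: "(unicritical d c ^^ Suc n) 0 = Q n c"
proof -
  have "(0 :: complex) ^ d = 0" using d by (simp add: zero_power)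
  then have "unicritical d c 0 = c" by (simp add: unicritical_def)
  then show ?thesis by (simp add: Q_iterate funpow_Suc_right del: funpow.simps)
qed

subsection \<open>The Green function\<close>

text \<open>The escape rate of the critical value. As a function of the parameter it is the Green
  function with pole at infinity of the complement of M.\<close>

definition green :: "complex \<Rightarrow> real" where
  "green c = lim (\<lambda>n. logp (Q n c) / real d ^ n)"

text \<open>The increment of the normalised sequence x at step n + 1 is at most b_(n+1), where b_n =
  \<open>step_bound\<close> / d^n, and 2 b_(n+1) \<le> b_n because d \<ge> 2. So x - b increases, x
  + b decreases, and the nested intervals give limit and error bound together.\<close>

lemma green_tendsto: "(\<lambda>n. logp (Q n c) / real d ^ n) \<longlonglongrightarrow> green c"
  and green_bound: "\<bar>real d ^ n * green c - logp (Q n c)\<bar> \<le> step_bound c"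
proof -
  let ?x = "\<lambda>n. logp (Q n c) / real d ^ n"
  let ?b = "\<lambda>n. step_bound c / real d ^ n"
  have dp: "real d ^ n > 0" for n using d by simp
  have d2: "real d \<ge> 2" using d by simp
  have st: "\<bar>?x (Suc n) - ?x n\<bar> \<le> ?b (Suc n)" for n
  proof -
    have "?x (Suc n) - ?x n = (logp (Q n c ^ d + c) - real d * logp (Q n c)) / real d ^ Suc n"
      using d dp[of n] by (simp add: Q_Suc field_simps)
    then show ?thesis using logp_power_add[of "Q n c" d c] dp[of "Suc n"]
      by (simp only: abs_divide abs_of_pos divide_right_mono)
  qed
  have b2: "2 * ?b (Suc n) \<le> ?b n" for n
  proof -
    have "2 * step_bound c / (real d * real d ^ n) \<le> real d * step_bound c / (real d * real d ^ n)"
      using d2 step_bound_nonneg[of c] dp[of n] by (intro divide_right_mono mult_right_mono) auto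
    then show ?thesis using d2 by simp
  qed
  have "\<exists>l. ((\<forall>n. ?x n - ?b n \<le> l) \<and> (\<lambda>n. ?x n - ?b n) \<longlonglongrightarrow> l) \<and> ((\<forall>n. l \<le> ?x n + ?b n) \<and> (\<lambda>n. ?x n + ?b n) \<longlonglongrightarrow> l)"
  proof (rule nested_sequence_unique)
    show "\<forall>n. ?x n - ?b n \<le> ?x (Suc n) - ?b (Suc n)"
    proof
      fix n show "?x n - ?b n \<le> ?x (Suc n) - ?b (Suc n)" using st[of n] b2[of n] by linarith
    qed
    show "\<forall>n. ?x (Suc n) + ?b (Suc n) \<le> ?x n + ?b n"
    proof
      fix n show "?x (Suc n) + ?b (Suc n) \<le> ?x n + ?b n" using st[of n] b2[of n] by linarith
    qed
    show "\<forall>n. ?x n - ?b n \<le> ?x n + ?b n" using step_bound_nonneg[of c] by simp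
    have "(\<lambda>n. - 2 * step_bound c * (1 / real d) ^ n) \<longlonglongrightarrow> - 2 * step_bound c * 0"
      using d by (intro tendsto_mult tendsto_const LIMSEQ_realpow_zero) auto
    then show "(\<lambda>n. ?x n - ?b n - (?x n + ?b n)) \<longlonglongrightarrow> 0" by (simp add: power_divide)
  qed
  then obtain l where l: "\<And>n. ?x n - ?b n \<le> l" "\<And>n. l \<le> ?x n + ?b n"
    "(\<lambda>n. ?x n - ?b n) \<longlonglongrightarrow> l" "(\<lambda>n. ?x n + ?b n) \<longlonglongrightarrow> l" by blast
  have "(\<lambda>n. ((?x n - ?b n) + (?x n + ?b n)) / 2) \<longlonglongrightarrow> (l + l) / 2" by (intro tendsto_intros l) auto
  then have lim: "?x \<longlonglongrightarrow> l" by simp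
  then have gl: "green c = l" unfolding green_def by (rule limI)
  show "?x \<longlonglongrightarrow> green c" using lim gl by simp
  have "real d ^ n * (?x n - ?b n) \<le> real d ^ n * l" "real d ^ n * l \<le> real d ^ n * (?x n + ?b n)"
    using l(1,2)[of n] dp[of n] by (auto intro!: mult_left_mono)
  then have "logp (Q n c) - step_bound c \<le> real d ^ n * l" "real d ^ n * l \<le> logp (Q n c) + step_bound c"
    using dp[of n] by (auto simp: distrib_left right_diff_distrib)
  then show "\<bar>real d ^ n * green c - logp (Q n c)\<bar> \<le> step_bound c" using gl by simp
qed

lemma green_nonneg: "green c \<ge> 0"
  using green_tendsto[of c] by (rule LIMSEQ_le_const) (auto simp: logp_nonneg)

lemma green_le: "green c \<le> logp c + step_bound c"
  using green_bound[of 0 c] by (simp add: Q_0)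

lemma green_uniform: "uniform_limit (ball 0 R) (\<lambda>n c. logp (Q n c) / real d ^ n) green sequentially"
proof (rule uniform_limitI)
  fix e :: real assume e: "e > 0"
  have "(\<lambda>n. ln (2 * (1 + \<bar>R\<bar>)) * (1 / real d) ^ n) \<longlonglongrightarrow> ln (2 * (1 + \<bar>R\<bar>)) * 0"
    using d by (intro tendsto_mult tendsto_const LIMSEQ_realpow_zero) auto
  then have "eventually (\<lambda>n. ln (2 * (1 + \<bar>R\<bar>)) * (1 / real d) ^ n < e) sequentially"
    using e by (intro order_tendstoD(2)) auto
  then show "eventually (\<lambda>n. \<forall>c\<in>ball 0 R. dist (logp (Q n c) / real d ^ n) (green c) < e) sequentially"
  proof eventually_elim
    case (elim n)
    show ?case
    proof
      fix c :: complex assume "c \<in> ball 0 R"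
      then have "step_bound c \<le> ln (2 * (1 + \<bar>R\<bar>))" unfolding step_bound_def by (intro ln_mono) (auto intro: add_pos_nonneg)
      then have "\<bar>real d ^ n * green c - logp (Q n c)\<bar> \<le> ln (2 * (1 + \<bar>R\<bar>))" using green_bound[of n c] by linarith
      then have "\<bar>real d ^ n * green c - logp (Q n c)\<bar> / real d ^ n \<le> ln (2 * (1 + \<bar>R\<bar>)) / real d ^ n"
        using d by (intro divide_right_mono) auto
      moreover have "\<bar>real d ^ n * green c - logp (Q n c)\<bar> / real d ^ n = \<bar>green c - logp (Q n c) / real d ^ n\<bar>"
      proof -
        have "green c - logp (Q n c) / real d ^ n = (real d ^ n * green c - logp (Q n c)) / real d ^ n"
          using d by (simp add: diff_divide_distrib)
        then show ?thesis by (simp add: abs_divide)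
      qed
      ultimately show "dist (logp (Q n c) / real d ^ n) (green c) < e"
        using elim by (simp add: dist_real_def abs_minus_commute power_divide)
    qed
  qed
qed

lemma logp_Q_continuous: "continuous_on S (\<lambda>c. logp (Q n c))"
  by (rule continuous_on_compose2[OF logp_continuous Q_continuous]) auto

lemma green_continuous: "continuous_on UNIV green"
proof -
  have "continuous_on (ball 0 R) green" for R
    by (rule uniform_limit_theorem[OF _ green_uniform])
       (use d in \<open>auto intro!: always_eventually continuous_intros logp_Q_continuous\<close>)
  then have "isCont green c" for c
    using continuous_on_eq_continuous_at[OF open_ball, of 0 "cmod c + 1" green] by simp
  then show ?thesis by (simp add: continuous_at_imp_continuous_on)
qed

subsection \<open>Escape\<close>

text \<open>If w \<ge> q > 2 and |c| \<le> q, then w^d - |c| \<ge> w^2 - q \<ge> w (q - 1): from the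
  first large value on, the modulus grows by the factor q - 1 > 1 at each step.\<close>

lemma escape:
  assumes k: "2 < cmod (Q k c)" "cmod c \<le> cmod (Q k c)"
  shows "cmod (Q (k + m) c) \<ge> cmod (Q k c) * (cmod (Q k c) - 1) ^ m"
proof -
  define q where "q = cmod (Q k c)"
  have q: "q > 2" "cmod c \<le> q" using k by (auto simp: q_def)
  have "cmod (Q (k + m) c) \<ge> q * (q - 1) ^ m \<and> cmod (Q (k + m) c) \<ge> q"
  proof (induction m)
    case 0 show ?case by (simp add: q_def)
  next
    case (Suc m)
    define w where "w = cmod (Q (k + m) c)"
    have w: "w \<ge> q * (q - 1) ^ m" "w \<ge> q" using Suc by (auto simp: w_def)
    have w1: "w \<ge> 1" using w q by linarith
    have "w ^ 2 \<le> w ^ d" using d w1 by (intro power_increasing) auto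
    moreover have "cmod (Q (k + m) c ^ d + c) \<ge> w ^ d - cmod c"
      using norm_triangle_ineq2[of "Q (k + m) c ^ d" "- c"] by (simp add: w_def norm_power)
    ultimately have "cmod (Q (k + Suc m) c) \<ge> w ^ 2 - q" using q by (simp add: Q_Suc)
    also have "w ^ 2 - q \<ge> w * (q - 1)"
    proof -
      have "w * (w - q) \<ge> 0" using w w1 by (intro mult_nonneg_nonneg) auto
      then show ?thesis using w by (simp add: power2_eq_square algebra_simps)
    qed
    finally have 1: "w * (q - 1) \<le> cmod (Q (k + Suc m) c)" .
    have "q * (q - 1) ^ m * (q - 1) \<le> w * (q - 1)" using w q by (intro mult_right_mono) auto
    moreover have "q * 1 \<le> w * (q - 1)" using w q by (intro mult_mono) auto
    ultimately show ?case using 1 by (simp add: mult_ac)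
  qed
  then show ?thesis by (simp add: q_def)
qed

lemma escape_mono:
  assumes k: "2 < cmod (Q k c)" "cmod c \<le> cmod (Q k c)" "k \<le> n"
  shows "cmod (Q k c) \<le> cmod (Q n c)"
proof -
  have "cmod (Q k c) * 1 \<le> cmod (Q k c) * (cmod (Q k c) - 1) ^ (n - k)"
    using k by (intro mult_left_mono one_le_power) auto
  then show ?thesis using escape[OF k(1,2), of "n - k"] k(3) by simp
qed

lemma escape_at_top:
  assumes k: "2 < cmod (Q k c)" "cmod c \<le> cmod (Q k c)"
  shows "filterlim (\<lambda>n. cmod (Q n c)) at_top sequentially"
proof -
  have "filterlim (\<lambda>m. (cmod (Q k c) - 1) ^ m) at_top sequentially"
  proof (rule filterlim_at_infinity_imp_filterlim_at_top)
    show "filterlim (\<lambda>m. (cmod (Q k c) - 1) ^ m) at_infinity sequentially"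
      using k by (intro filterlim_realpow_sequentially_gt1) auto
    show "eventually (\<lambda>m. (cmod (Q k c) - 1) ^ m > 0) sequentially"
      using k by (intro always_eventually allI zero_less_power) auto
  qed
  then have "filterlim (\<lambda>m. cmod (Q k c) * (cmod (Q k c) - 1) ^ m) at_top sequentially"
    using k by (intro filterlim_tendsto_pos_mult_at_top[OF tendsto_const]) auto
  then have "filterlim (\<lambda>m. cmod (Q (k + m) c)) at_top sequentially"
    by (rule filterlim_at_top_mono) (intro always_eventually allI escape k)
  then have "filterlim (\<lambda>m. cmod (Q (m + k) c)) at_top sequentially" by (simp add: add.commute)
  then have *: "eventually (\<lambda>m. Z \<le> cmod (Q (m + k) c)) sequentially" for Z
    by (simp add: filterlim_at_top)
  show ?thesis unfolding filterlim_at_top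
    using * eventually_sequentially_seg[of "\<lambda>n. _ \<le> cmod (Q n c)" k] by blast
qed

text \<open>The escape radius 2: some orbit value exceeding 2 in modulus also yields one that is at
  least |c|, at time 0 if |c| > 2.\<close>

lemma mem_M_iff: "c \<in> M \<longleftrightarrow> (\<forall>n. cmod (Q n c) \<le> 2)"
proof
  assume c: "c \<in> M"
  show "\<forall>n. cmod (Q n c) \<le> 2"
  proof (rule ccontr)
    assume "\<not> ?thesis"
    then have "\<exists>k. 2 < cmod (Q k c) \<and> cmod c \<le> cmod (Q k c)"
      by (metis Q_0 linorder_not_le order.trans order_less_imp_le order_refl)
    then have "filterlim (\<lambda>n. cmod (Q n c)) at_top sequentially" using escape_at_top by blast
    then have "(\<lambda>n. ereal (cmod (Q n c))) \<longlonglongrightarrow> \<infinity>" by (simp add: tendsto_PInfty_eq_at_top)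
    then have "limsup (\<lambda>n. ereal (cmod (Q n c))) = \<infinity>" by (intro lim_imp_Limsup) auto
    then show False using c by (simp add: connectedness_locus_def filled_julia_def Q_iterate)
  qed
next
  assume "\<forall>n. cmod (Q n c) \<le> 2"
  then have "limsup (\<lambda>n. ereal (cmod (Q n c))) \<le> ereal 2" by (intro Limsup_bounded always_eventually) auto
  also have "\<dots> < \<infinity>" by simp
  finally show "c \<in> M" by (simp add: connectedness_locus_def filled_julia_def Q_iterate)
qed

lemma not_mem_M_escape: "c \<notin> M \<Longrightarrow> \<exists>k. 2 < cmod (Q k c) \<and> cmod c \<le> cmod (Q k c)"
  unfolding mem_M_iff by (metis Q_0 linorder_not_le order.trans order_less_imp_le order_refl)

lemma M_bounded: "c \<in> M \<Longrightarrow> cmod c \<le> 2"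
  using mem_M_iff[of c] Q_0[of c] by metis

lemma M_closed: "closed M"
proof -
  have "M = (\<Inter>n. {c. cmod (Q n c) \<le> 2})" using mem_M_iff by auto
  moreover have "closed {c. cmod (Q n c) \<le> 2}" for n by (intro closed_Collect_le continuous_intros Q_continuous)
  ultimately show ?thesis by auto
qed

lemma M_compact: "compact M"
  using M_closed M_bounded by (auto simp: compact_eq_bounded_closed bounded_iff)

text \<open>The disc of radius 1/2 is invariant, as (1/2)^2 + 1/4 = 1/2. An interior point at 0 is
  what makes the inversion send the escape region to a bounded set.\<close>

lemma M_contains_ball: "cball 0 (1/4) \<subseteq> M"
proof
  fix c :: complex assume "c \<in> cball 0 (1/4)"
  then have c: "cmod c \<le> 1/4" by simp
  have "cmod (Q n c) \<le> 1/2" for n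
  proof (induction n)
    case 0 show ?case using c by (simp add: Q_0)
  next
    case (Suc n)
    have "cmod (Q n c) ^ d \<le> cmod (Q n c) ^ 2" using d Suc by (intro power_decreasing) auto
    also have "\<dots> \<le> (1/2)^2" using Suc by (intro power_mono) auto
    finally show ?case using norm_triangle_ineq[of "Q n c ^ d" c] c by (simp add: Q_Suc norm_power power2_eq_square)
  qed
  then have "cmod (Q n c) \<le> 2" for n by (rule order_trans) simp
  then show "c \<in> M" unfolding mem_M_iff by blast
qed

lemma green_zero: "c \<in> M \<Longrightarrow> green c = 0"
proof -
  assume c: "c \<in> M"
  have "(\<lambda>n. (ln 2 + step_bound c) * (1 / real d) ^ n) \<longlonglongrightarrow> (ln 2 + step_bound c) * 0"
    using d by (intro tendsto_mult tendsto_const LIMSEQ_realpow_zero) auto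
  moreover have "green c \<le> (ln 2 + step_bound c) * (1 / real d) ^ n" for n
  proof -
    have "logp (Q n c) \<le> ln 2" unfolding logp_def using c mem_M_iff by (intro ln_mono) auto
    then have "real d ^ n * green c \<le> ln 2 + step_bound c" using green_bound[of n c] by linarith
    then show ?thesis using d by (simp add: field_simps power_divide)
  qed
  ultimately have "green c \<le> (ln 2 + step_bound c) * 0" by (intro LIMSEQ_le_const) auto
  then show ?thesis using green_nonneg[of c] by simp
qed

lemma green_pos: "c \<notin> M \<Longrightarrow> green c > 0"
proof -
  assume "c \<notin> M"
  then have "filterlim (\<lambda>n. cmod (Q n c)) at_top sequentially" using not_mem_M_escape escape_at_top by blast
  then have "eventually (\<lambda>n. cmod (Q n c) > exp (step_bound c)) sequentially" by (simp add: filterlim_at_top_dense)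
  then obtain n where n: "cmod (Q n c) > exp (step_bound c)" by (auto simp: eventually_sequentially)
  have "step_bound c = ln (exp (step_bound c))" by simp
  also have "\<dots> < ln (max 1 (cmod (Q n c)))" using n by (subst ln_less_cancel_iff) auto
  finally have "real d ^ n * green c > 0" using green_bound[of n c] by (simp add: logp_def)
  then show ?thesis using d by (simp add: zero_less_mult_iff)
qed

text \<open>The Lipschitz constant of z^d on the disc of radius 3, which leaves room 1 around an
  orbit that stays within radius 2.\<close>

definition expansion :: real where
  "expansion = real d * 3 ^ (d - 1)"

lemma expansion_ge_1: "expansion \<ge> 1"
proof -
  have "1 * 1 \<le> real d * 3 ^ (d - 1)" using d by (intro mult_mono) auto
  then show ?thesis by (simp add: expansion_def)
qed

text \<open>If the orbit of the critical value came too close to the critical point \<open>0\<close> at time \<open>k\<close>, then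
  \<open>f\<^sup>k\<^sup>+\<^sup>1\<close> would map a small disc around \<open>0\<close> into itself and the critical orbit could not escape.\<close>

lemma Q_lower_bound:
  assumes c: "c \<notin> M"
  shows "cmod (Q k c) \<ge> 1 / (4 * expansion ^ k)"
proof (rule ccontr)
  assume "\<not> ?thesis"
  then have small: "cmod (Q k c) < 1 / (4 * expansion ^ k)" by simp
  have Kk: "expansion ^ k \<ge> 1" using expansion_ge_1 by simp
  \<comment> \<open>With this radius, expansion^k r^2 = r/2, and the assumed smallness of
    \<open>Q k c\<close> is exactly r/2. The two halves add up to r in \<open>inv\<close>, which
    closes the trap.\<close>
  define r where "r = 1 / (2 * expansion ^ k)"
  have "1 / (2 * x) > 0" "1 / (2 * x) \<le> 1/2" "x * (1 / (2 * x)) = 1/2" if "x \<ge> 1" for x :: real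
    using that by (auto simp: field_simps)
  from this[OF Kk] have r: "r > 0" "r \<le> 1/2" "expansion ^ k * r = 1/2" by (simp_all only: r_def)
  have small': "cmod (Q k c) < r / 2" using small by (simp add: r_def)
  obtain k0 where k0: "2 < cmod (Q k0 c)" "cmod c \<le> cmod (Q k0 c)" using not_mem_M_escape[OF c] by blast
  \<comment> \<open>Moduli above the escape radius never come down again, so neither c nor an
    earlier orbit value can exceed 2 if \<open>Q k c\<close> is small.\<close>
  have c2: "cmod c \<le> 2"
  proof (rule ccontr)
    assume "\<not> ?thesis"
    then have "cmod c \<le> cmod (Q k c)" using escape_mono[of 0 c k] by (simp add: Q_0)
    then show False using \<open>\<not> cmod c \<le> 2\<close> small' r by linarith
  qed
  have Q2: "cmod (Q j c) \<le> 2" if "j \<le> k" for j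
  proof (rule ccontr)
    assume "\<not> ?thesis"
    then have "cmod (Q j c) \<le> cmod (Q k c)" using escape_mono[of j c k] c2 that by simp
    then show False using \<open>\<not> cmod (Q j c) \<le> 2\<close> small' r by linarith
  qed
  let ?f = "unicritical d c"
  have rd: "r ^ d \<le> r * r" using power_decreasing[of 2 d r] d r by (simp add: power2_eq_square)
  have near: "cmod ((?f ^^ j) (?f z) - Q j c) \<le> expansion ^ j * r ^ d" if z: "cmod z \<le> r" and "j \<le> k" for j z
    using \<open>j \<le> k\<close>
  proof (induction j)
    case 0
    have "cmod z ^ d \<le> r ^ d" using z by (intro power_mono) auto
    then show ?case by (simp add: Q_0 unicritical_def norm_power)
  next
    case (Suc j)
    define w where "w = (?f ^^ j) (?f z)"
    have w: "cmod (w - Q j c) \<le> expansion ^ j * r ^ d" using Suc by (simp add: w_def)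
    have "expansion ^ j * r ^ d \<le> expansion ^ k * (r * r)"
      using Suc rd r expansion_ge_1 by (intro mult_mono power_increasing) auto
    also have "\<dots> = r / 2" using r(3) by (simp add: mult.assoc[symmetric])
    finally have "cmod (w - Q j c) \<le> 1" using w r by linarith
    then have "cmod w \<le> 3" using Q2[of j] Suc norm_triangle_ineq2[of w "Q j c"] by simp
    moreover have "cmod (Q j c) \<le> 3" using Q2[of j] Suc by simp
    ultimately have "cmod (w ^ d - Q j c ^ d) \<le> expansion * cmod (w - Q j c)"
      unfolding expansion_def by (rule norm_power_diff_le)
    also have "\<dots> \<le> expansion * (expansion ^ j * r ^ d)" using w expansion_ge_1 by (intro mult_left_mono) auto
    finally show ?case by (simp add: Q_Suc unicritical_def w_def[unfolded unicritical_def] mult.assoc)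
  qed
  have inv: "cmod ((?f ^^ Suc k) z) \<le> r" if "cmod z \<le> r" for z
  proof -
    have "cmod ((?f ^^ k) (?f z)) \<le> cmod (Q k c) + expansion ^ k * r ^ d"
      using near[OF that order_refl] norm_triangle_ineq2[of "(?f ^^ k) (?f z)" "Q k c"] by linarith
    also have "expansion ^ k * r ^ d \<le> expansion ^ k * (r * r)" using rd Kk by (intro mult_left_mono) auto
    also have "\<dots> = r / 2" using r(3) by (simp add: mult.assoc[symmetric])
    finally show ?thesis using small' by (simp add: funpow_Suc_right del: funpow.simps)
  qed
  have "cmod ((?f ^^ (Suc k * m)) 0) \<le> r" for m
  proof (induction m)
    case (Suc m)
    have "(?f ^^ (Suc k * Suc m)) 0 = (?f ^^ Suc k) ((?f ^^ (Suc k * m)) 0)"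
      by (simp add: funpow_add[symmetric] flip: funpow_add[THEN fun_cong, unfolded o_def] del: funpow.simps)
    then show ?case using inv[OF Suc] by simp
  qed (use r in simp)
  \<comment> \<open>The multiple k0 + 1 of the period k + 1 is beyond the time k0 at which the orbit
    has already escaped.\<close>
  from this[of "Suc k0"] have "cmod ((?f ^^ Suc (k0 + k * Suc k0)) 0) \<le> r" by (simp add: algebra_simps del: funpow.simps)
  then have "cmod (Q (k0 + k * Suc k0) c) \<le> r" by (simp only: Q_critical)
  moreover have "cmod (Q k0 c) \<le> cmod (Q (k0 + k * Suc k0) c)" using escape_mono[OF k0] by simp
  ultimately show False using k0 r by linarith
qed

subsection \<open>The derivative at the critical value\<close>

definition P :: "nat \<Rightarrow> complex \<Rightarrow> complex" where
  "P n c = poly (deriv_at_critical_value d n) c"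

lemma P_prod: "P n c = (\<Prod>k<n. of_nat d * Q k c ^ (d - 1))"
  by (simp add: P_def Q_def deriv_at_critical_value_eq poly_prod)

text \<open>The factors of \<open>P n\<close> are d * Q_k^(d-1) by the chain rule, and (d - 1) d^k
  sums to d^n - 1. The upper bound follows from \<open>green_bound\<close>. Below, M is trivial
  since the Green function is 0 there; elsewhere \<open>Q_lower_bound\<close> limits the loss of a
  factor to order k.\<close>

theorem logp_P_bound:
  "\<bar>logp (P n c) - (real d ^ n - 1) * green c\<bar> \<le>
     real n * (ln d + (real d - 1) * (step_bound c + ln 4 + real n * ln expansion))"
proof -
  define g where "g = green c"
  have d1: "real d - 1 \<ge> 0" using d by simp
  have lnd: "ln (real d) \<ge> 0" using d by simp
  have lnK: "ln expansion \<ge> 0" using expansion_ge_1 by simp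
  have upper: "logp (P n c) \<le> (real d ^ n - 1) * g + real n * (ln d + (real d - 1) * step_bound c)"
  proof -
    have ge1: "1 \<le> real d * max 1 (cmod (Q k c)) ^ (d - 1)" for k
    proof -
      have "1 * 1 \<le> real d * max 1 (cmod (Q k c)) ^ (d - 1)" using d by (intro mult_mono one_le_power) auto
      then show ?thesis by simp
    qed
    have "cmod (P n c) \<le> (\<Prod>k<n. real d * max 1 (cmod (Q k c)) ^ (d - 1))"
      unfolding P_prod prod_norm[symmetric]
      by (intro prod_mono conjI) (auto simp: norm_mult norm_power intro!: mult_left_mono power_mono)
    moreover have "1 \<le> (\<Prod>k<n. real d * max 1 (cmod (Q k c)) ^ (d - 1))" by (intro prod_ge_1 ge1)
    ultimately have "logp (P n c) \<le> ln (\<Prod>k<n. real d * max 1 (cmod (Q k c)) ^ (d - 1))"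
      unfolding logp_def by (intro ln_mono) auto
    also have "\<dots> = (\<Sum>k<n. ln (real d * max 1 (cmod (Q k c)) ^ (d - 1)))"
      by (intro ln_prod finite_lessThan) (metis ge1 not_one_le_zero)
    also have "\<dots> = (\<Sum>k<n. ln d + (real d - 1) * logp (Q k c))"
    proof (intro sum.cong refl)
      fix k
      have "ln (real d * max 1 (cmod (Q k c)) ^ (d - 1)) = ln d + ln (max 1 (cmod (Q k c)) ^ (d - 1))"
        using d by (intro ln_mult_pos) auto
      then show "ln (real d * max 1 (cmod (Q k c)) ^ (d - 1)) = ln d + (real d - 1) * logp (Q k c)"
        using d by (simp add: ln_realpow logp_def of_nat_diff)
    qed
    also have "\<dots> \<le> (\<Sum>k<n. (ln d + (real d - 1) * step_bound c) + (real d - 1) * real d ^ k * g)"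
    proof (intro sum_mono)
      fix k
      have "(real d - 1) * logp (Q k c) \<le> (real d - 1) * (real d ^ k * g + step_bound c)"
        using d1 green_bound[of k c] by (intro mult_left_mono) (auto simp: g_def)
      then show "ln d + (real d - 1) * logp (Q k c) \<le> (ln d + (real d - 1) * step_bound c) + (real d - 1) * real d ^ k * g"
        by (simp add: algebra_simps)
    qed
    also have "\<dots> = real n * (ln d + (real d - 1) * step_bound c) + (\<Sum>k<n. (real d - 1) * real d ^ k) * g"
      by (simp add: sum.distrib sum_distrib_right)
    finally show ?thesis using sum_powers[OF d] by simp
  qed
  have lower: "(real d ^ n - 1) * g - real n * ((real d - 1) * (step_bound c + ln 4 + real n * ln expansion)) \<le> logp (P n c)"
  proof (cases "c \<in> M")
    case True
    have "0 \<le> real n * ((real d - 1) * (step_bound c + ln 4 + real n * ln expansion))"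
      using d1 lnK step_bound_nonneg[of c] by (intro mult_nonneg_nonneg add_nonneg_nonneg) auto
    then show ?thesis using green_zero[OF True] logp_nonneg[of "P n c"] by (simp add: g_def)
  next
    case False
    have nz: "Q k c \<noteq> 0" for k
    proof -
      have "1 / (4 * expansion ^ k) > 0" using expansion_ge_1 by simp
      then show ?thesis using Q_lower_bound[OF False, of k] by force
    qed
    have lnQ: "ln (cmod (Q k c)) \<ge> real d ^ k * g - (step_bound c + ln 4 + real n * ln expansion)" if "k < n" for k
    proof -
      have "ln (cmod (Q k c)) \<ge> logp (Q k c) - (ln 4 + real k * ln expansion)"
      proof (cases "cmod (Q k c) \<ge> 1")
        case True
        have "0 \<le> ln 4 + real k * ln expansion" using lnK by (intro add_nonneg_nonneg mult_nonneg_nonneg) auto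
        then show ?thesis using True by (simp add: logp_def max_def)
      next
        case F: False
        have "ln (1 / (4 * expansion ^ k)) \<le> ln (cmod (Q k c))"
          using Q_lower_bound[OF False, of k] expansion_ge_1 nz by (intro ln_mono) auto
        moreover have "ln (1 / (4 * expansion ^ k)) = - (ln 4 + real k * ln expansion)"
          using expansion_ge_1 by (simp add: ln_div ln_mult ln_realpow)
        ultimately show ?thesis using F by (simp add: logp_def max_def)
      qed
      moreover have "real k * ln expansion \<le> real n * ln expansion" using that lnK by (intro mult_right_mono) auto
      ultimately show ?thesis using green_bound[of k c] unfolding g_def by linarith
    qed
    have Pnz: "P n c \<noteq> 0" using nz d by (simp add: P_prod)
    have "ln (cmod (P n c)) = (\<Sum>k<n. ln (cmod (of_nat d * Q k c ^ (d - 1))))"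
      unfolding P_prod prod_norm[symmetric] using nz d by (intro ln_prod) auto
    also have "\<dots> = (\<Sum>k<n. ln d + (real d - 1) * ln (cmod (Q k c)))"
    proof (intro sum.cong refl)
      fix k
      show "ln (cmod (of_nat d * Q k c ^ (d - 1))) = ln d + (real d - 1) * ln (cmod (Q k c))"
        using d nz[of k] by (simp add: norm_mult norm_power ln_mult ln_realpow of_nat_diff)
    qed
    also have "\<dots> \<ge> (\<Sum>k<n. (real d - 1) * real d ^ k * g - (real d - 1) * (step_bound c + ln 4 + real n * ln expansion))"
    proof (intro sum_mono)
      fix k assume "k \<in> {..<n}"
      then have "(real d - 1) * (real d ^ k * g - (step_bound c + ln 4 + real n * ln expansion)) \<le> (real d - 1) * ln (cmod (Q k c))"
        using d1 lnQ[of k] by (intro mult_left_mono) auto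
      then show "(real d - 1) * real d ^ k * g - (real d - 1) * (step_bound c + ln 4 + real n * ln expansion) \<le> ln d + (real d - 1) * ln (cmod (Q k c))"
        using lnd by (simp add: right_diff_distrib mult.assoc)
    qed
    finally have "ln (cmod (P n c)) \<ge> (\<Sum>k<n. (real d - 1) * real d ^ k) * g - real n * ((real d - 1) * (step_bound c + ln 4 + real n * ln expansion))"
      by (simp add: sum_subtractf sum_distrib_right)
    then show ?thesis using logp_ge[OF Pnz] sum_powers[OF d, of n] by simp
  qed
  have "0 \<le> real n * ln d" "0 \<le> real n * ((real d - 1) * (ln 4 + real n * ln expansion))"
    using lnd d1 lnK by auto
  then show ?thesis using upper lower unfolding g_def[symmetric]
    by (simp add: abs_le_iff algebra_simps)
qed

end

section \<open>Weak compactness of planar probability measures\<close>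

text \<open>Interleaving binary digits, written in base three with digits \<open>0\<close> and \<open>2\<close>, gives a Borel map
  from a square to the line with uniformly continuous inverse. It transports Helly's selection
  theorem to the plane.\<close>

definition bit :: "nat \<Rightarrow> real \<Rightarrow> real" where
  "bit k x = real_of_int (\<lfloor>2 ^ Suc k * x\<rfloor> - 2 * \<lfloor>2 ^ k * x\<rfloor>)"

lemma bit_cases: "bit k x = 0 \<or> bit k x = 1"
proof -
  have "2 * \<lfloor>2 ^ k * x\<rfloor> \<le> \<lfloor>2 ^ Suc k * x\<rfloor>" "\<lfloor>2 ^ Suc k * x\<rfloor> < 2 * \<lfloor>2 ^ k * x\<rfloor> + 2"
    by (simp_all add: le_floor_iff floor_less_iff mult.assoc) linarith+
  then have "\<lfloor>2 ^ Suc k * x\<rfloor> - 2 * \<lfloor>2 ^ k * x\<rfloor> = 0 \<or> \<lfloor>2 ^ Suc k * x\<rfloor> - 2 * \<lfloor>2 ^ k * x\<rfloor> = 1" by linarith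
  then show ?thesis unfolding bit_def by (metis of_int_0 of_int_1)
qed

lemma bit_measurable [measurable]: "bit k \<in> borel_measurable borel"
  unfolding bit_def[abs_def] by measurable

lemma bits_determine:
  assumes "0 \<le> x" "x < 1" "0 \<le> y" "y < 1" "\<And>k. k < m \<Longrightarrow> bit k x = bit k y"
  shows "\<bar>x - y\<bar> < 1 / 2 ^ m"
proof -
  have "k \<le> m \<Longrightarrow> \<lfloor>2 ^ k * x\<rfloor> = \<lfloor>2 ^ k * y\<rfloor>" for k
  proof (induction k)
    case 0
    have "\<lfloor>x\<rfloor> = 0" "\<lfloor>y\<rfloor> = 0" using assms by (auto simp: floor_eq_iff)
    then show ?case by simp
  next
    case (Suc k)
    then show ?case using assms(5)[of k] by (simp add: bit_def)
  qed
  then have "\<lfloor>2 ^ m * x\<rfloor> = \<lfloor>2 ^ m * y\<rfloor>" by simp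
  then have "\<bar>2 ^ m * x - 2 ^ m * y\<bar> < 1" by linarith
  then have "2 ^ m * \<bar>x - y\<bar> < 1" by (simp add: abs_mult right_diff_distrib[symmetric])
  then show ?thesis by (simp add: field_simps)
qed

definition interleave :: "real \<Rightarrow> real \<Rightarrow> nat \<Rightarrow> real" where
  "interleave x y j = (if even j then bit (j div 2) x else bit (j div 2) y)"

lemma interleave_cases: "interleave x y j = 0 \<or> interleave x y j = 1"
  using bit_cases by (simp add: interleave_def)

definition encode :: "real \<Rightarrow> real \<Rightarrow> real" where
  "encode x y = (\<Sum>j. 2 * interleave x y j * (1 / 3) ^ Suc j)"

lemma third_sums: "(\<lambda>j. 2 * (1 / 3 :: real) ^ Suc j) sums 1"
proof -
  have "(\<lambda>j. (2 / 3) * (1 / 3 :: real) ^ j) sums ((2 / 3) * (1 / (1 - 1 / 3)))"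
    by (intro sums_mult geometric_sums) simp
  then show ?thesis by simp
qed

lemma encode_summable: "summable (\<lambda>j. 2 * interleave x y j * (1 / 3) ^ Suc j)"
proof (rule summable_comparison_test[OF _ sums_summable[OF third_sums]], intro exI[of _ 0] allI impI)
  fix j show "norm (2 * interleave x y j * (1 / 3) ^ Suc j) \<le> 2 * (1 / 3 :: real) ^ Suc j"
    using interleave_cases[of x y j] by auto
qed

lemma encode_bounds: "0 \<le> encode x y" "encode x y \<le> 1"
proof -
  have "0 \<le> 2 * interleave x y j * (1 / 3) ^ Suc j" for j using interleave_cases[of x y j] by auto
  then show "0 \<le> encode x y" unfolding encode_def by (intro suminf_nonneg encode_summable)
  have "encode x y \<le> (\<Sum>j. 2 * (1 / 3 :: real) ^ Suc j)" unfolding encode_def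
  proof (intro suminf_le encode_summable sums_summable[OF third_sums])
    fix j show "2 * interleave x y j * (1 / 3) ^ Suc j \<le> 2 * (1 / 3 :: real) ^ Suc j"
      using interleave_cases[of x y j] by auto
  qed
  then show "encode x y \<le> 1" using third_sums by (simp add: sums_iff)
qed

text \<open>At the first differing place k the digits 0 and 2 contribute 2 / 3^(k+1), and all later
  places together at most 1 / 3^(k+1). The missing digit 1 thus leaves a gap of 1 / 3^(k+1).\<close>

lemma encode_digits:
  assumes "\<bar>encode x y - encode x' y'\<bar> < (1 / 3) ^ n" "j < n"
  shows "interleave x y j = interleave x' y' j"
proof (rule ccontr)
  assume ne: "interleave x y j \<noteq> interleave x' y' j"
  define k where "k = (LEAST j. interleave x y j \<noteq> interleave x' y' j)"
  have k: "interleave x y k \<noteq> interleave x' y' k" unfolding k_def by (rule LeastI[of _ j]) (rule ne)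
  have kj: "k \<le> j" unfolding k_def by (rule Least_le) (rule ne)
  have lt: "interleave x y i = interleave x' y' i" if "i < k" for i
    using not_less_Least[of i "\<lambda>j. interleave x y j \<noteq> interleave x' y' j"] that by (auto simp: k_def)
  define a where "a i = 2 * (interleave x y i - interleave x' y' i) * (1 / 3 :: real) ^ Suc i" for i
  have as: "summable a"
    using summable_diff[OF encode_summable[of x y] encode_summable[of x' y']] by (simp add: a_def[abs_def] algebra_simps)
  have "encode x y - encode x' y' = suminf a"
    unfolding encode_def a_def using suminf_diff[OF encode_summable[of x y] encode_summable[of x' y']] by (simp add: algebra_simps)
  also have "\<dots> = (\<Sum>i. a (i + Suc k)) + (\<Sum>i<Suc k. a i)"
    by (rule suminf_split_initial_segment[OF as])
  also have "(\<Sum>i<Suc k. a i) = a k" using lt by (simp add: a_def)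
  finally have e: "encode x y - encode x' y' = (\<Sum>i. a (i + Suc k)) + a k" .
  have ak: "\<bar>a k\<bar> = 2 * (1 / 3) ^ Suc k"
    using k interleave_cases[of x y k] interleave_cases[of x' y' k] by (auto simp: a_def abs_mult)
  have b: "\<bar>a (i + Suc k)\<bar> \<le> (1 / 3) ^ Suc k * (2 * (1 / 3) ^ Suc i)" for i
    using interleave_cases[of x y "i + Suc k"] interleave_cases[of x' y' "i + Suc k"]
    by (auto simp: a_def abs_mult power_add)
  have ss: "(\<lambda>i. (1 / 3 :: real) ^ Suc k * (2 * (1 / 3) ^ Suc i)) sums ((1 / 3) ^ Suc k * 1)"
    by (intro sums_mult third_sums)
  have sa: "summable (\<lambda>i. \<bar>a (i + Suc k)\<bar>)"
    by (rule summable_comparison_test[OF _ sums_summable[OF ss]]) (intro exI[of _ 0] allI impI, simp only: real_norm_def abs_idempotent b)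
  have "\<bar>\<Sum>i. a (i + Suc k)\<bar> \<le> (\<Sum>i. \<bar>a (i + Suc k)\<bar>)" by (rule summable_rabs[OF sa])
  also have "\<dots> \<le> (\<Sum>i. (1 / 3 :: real) ^ Suc k * (2 * (1 / 3) ^ Suc i))"
    by (rule suminf_le[OF b sa sums_summable[OF ss]])
  also have "\<dots> = (1 / 3) ^ Suc k" using sums_unique[OF ss] by simp
  finally have "\<bar>encode x y - encode x' y'\<bar> \<ge> (1 / 3) ^ Suc k" unfolding e using ak by linarith
  moreover have "(1 / 3 :: real) ^ n \<le> (1 / 3) ^ Suc k" using kj assms(2) by (intro power_decreasing) auto
  ultimately show False using assms(1) by linarith
qed

text \<open>Interleaving spends 2 m ternary places on m bits of each coordinate.\<close>

lemma encode_inverse: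
  assumes "0 \<le> x" "x < 1" "0 \<le> y" "y < 1" "0 \<le> x'" "x' < 1" "0 \<le> y'" "y' < 1"
    and "\<bar>encode x y - encode x' y'\<bar> < (1 / 3) ^ (2 * m)"
  shows "\<bar>x - x'\<bar> < 1 / 2 ^ m" "\<bar>y - y'\<bar> < 1 / 2 ^ m"
proof -
  have "bit k x = bit k x'" if "k < m" for k
    using encode_digits[OF assms(9), of "2 * k"] that by (simp add: interleave_def)
  then show "\<bar>x - x'\<bar> < 1 / 2 ^ m" using assms by (intro bits_determine)
  have "bit k y = bit k y'" if "k < m" for k
    using encode_digits[OF assms(9), of "Suc (2 * k)"] that by (simp add: interleave_def)
  then show "\<bar>y - y'\<bar> < 1 / 2 ^ m" using assms by (intro bits_determine)
qed

text \<open>The code s is Borel but not continuous; its inverse is uniformly continuous. Helly's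
  theorem applies to the images under s, and the limit is carried back by a continuous extension
  \<beta> of the inverse, for which f \<circ> \<beta> is again a bounded continuous test
  function.\<close>

theorem bounded_measures_subconvergent:
  fixes \<mu> :: "nat \<Rightarrow> complex measure"
  assumes prob: "\<And>n. prob_space (\<mu> n)" and sets: "\<And>n. sets (\<mu> n) = sets borel"
    and bdd: "\<And>n. AE z in \<mu> n. cmod z < R"
  shows "\<exists>r N. strict_mono (r :: nat \<Rightarrow> nat) \<and> prob_space N \<and> sets N = sets borel \<and>
    (\<forall>f :: complex \<Rightarrow> real. continuous_on UNIV f \<longrightarrow> bounded (range f) \<longrightarrow>
       (\<lambda>n. \<integral>z. f z \<partial>\<mu> (r n)) \<longlonglongrightarrow> (\<integral>z. f z \<partial>N))"
proof -
  define q where "q t = (t + \<bar>R\<bar> + 1) / (2 * (\<bar>R\<bar> + 1))" for t :: real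
  have q: "0 \<le> q t" "q t < 1" if "\<bar>t\<bar> < \<bar>R\<bar> + 1" for t using that by (auto simp: q_def field_simps)
  have qd: "\<bar>t - t'\<bar> = 2 * (\<bar>R\<bar> + 1) * \<bar>q t - q t'\<bar>" for t t'
  proof -
    have "t - t' = 2 * (\<bar>R\<bar> + 1) * (q t - q t')" by (simp add: q_def diff_divide_distrib[symmetric])
    then show ?thesis by (simp add: abs_mult)
  qed
  define s where "s z = encode (q (Re z)) (q (Im z))" for z
  have s_meas: "s \<in> borel_measurable borel"
    unfolding s_def[abs_def] encode_def q_def interleave_def
    by (intro borel_measurable_suminf) auto
  define D where "D = {z :: complex. cmod z < R}"
  have D: "\<bar>Re z\<bar> < \<bar>R\<bar> + 1" "\<bar>Im z\<bar> < \<bar>R\<bar> + 1" if "z \<in> D" for z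
    using that abs_Re_le_cmod[of z] abs_Im_le_cmod[of z] by (auto simp: D_def)
  have close: "cmod (z - w) < 4 * (\<bar>R\<bar> + 1) / 2 ^ m" if "z \<in> D" "w \<in> D" "\<bar>s z - s w\<bar> < (1 / 3) ^ (2 * m)" for z w m
  proof -
    have "\<bar>q (Re z) - q (Re w)\<bar> < 1 / 2 ^ m" "\<bar>q (Im z) - q (Im w)\<bar> < 1 / 2 ^ m"
      using encode_inverse[OF q(1)[OF D(1)[OF that(1)]] q(2)[OF D(1)[OF that(1)]]
          q(1)[OF D(2)[OF that(1)]] q(2)[OF D(2)[OF that(1)]]
          q(1)[OF D(1)[OF that(2)]] q(2)[OF D(1)[OF that(2)]]
          q(1)[OF D(2)[OF that(2)]] q(2)[OF D(2)[OF that(2)]] that(3)[unfolded s_def]] by simp_all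
    note close_q = this
    have p: "2 * (\<bar>R\<bar> + 1) > 0" by simp
    have "\<bar>Re z - Re w\<bar> < 2 * (\<bar>R\<bar> + 1) * (1 / 2 ^ m)" "\<bar>Im z - Im w\<bar> < 2 * (\<bar>R\<bar> + 1) * (1 / 2 ^ m)"
      using mult_strict_left_mono[OF close_q(1) p] mult_strict_left_mono[OF close_q(2) p]
        qd[of "Re z" "Re w"] qd[of "Im z" "Im w"] by (simp_all only:)
    moreover have "cmod (z - w) \<le> \<bar>Re z - Re w\<bar> + \<bar>Im z - Im w\<bar>" using cmod_le[of "z - w"] by simp
    moreover have "x < 4 * b / 2 ^ m" if "u < 2 * b * (1 / 2 ^ m)" "v < 2 * b * (1 / 2 ^ m)" "x \<le> u + v" for b u v x :: real
    proof -
      have "2 * b * (1 / 2 ^ m) + 2 * b * (1 / 2 ^ m) = 4 * b / 2 ^ m" by simp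
      then show ?thesis using that by linarith
    qed
    ultimately show ?thesis by blast
  qed
  have inj: "z = w" if "z \<in> D" "w \<in> D" "s z = s w" for z w
  proof (rule ccontr)
    assume "z \<noteq> w"
    then have "cmod (z - w) / (4 * (\<bar>R\<bar> + 1)) > 0" by simp
    then obtain m where m: "(1 / 2) ^ m < cmod (z - w) / (4 * (\<bar>R\<bar> + 1))"
      using real_arch_pow_inv[of "cmod (z - w) / (4 * (\<bar>R\<bar> + 1))" "1/2"] by auto
    then have "4 * (\<bar>R\<bar> + 1) / 2 ^ m < cmod (z - w)" by (simp add: field_simps power_divide)
    moreover have "cmod (z - w) < 4 * (\<bar>R\<bar> + 1) / 2 ^ m" using close[OF that(1,2), of m] that(3) by simp
    ultimately show False by simp
  qed
  define g where "g = inv_into D s"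
  have gs: "g (s z) = z" if "z \<in> D" for z
    unfolding g_def using that inj by (intro inv_into_f_f) (auto simp: inj_on_def)
  have "uniformly_continuous_on (s ` D) g"
    unfolding uniformly_continuous_on_def
  proof (intro allI impI)
    fix e :: real assume e: "e > 0"
    then obtain m where m: "(1 / 2) ^ m < e / (4 * (\<bar>R\<bar> + 1))"
      using real_arch_pow_inv[of "e / (4 * (\<bar>R\<bar> + 1))" "1/2"] by auto
    then have "4 * (\<bar>R\<bar> + 1) / 2 ^ m < e" by (simp add: field_simps power_divide)
    then have "\<forall>x\<in>s ` D. \<forall>x'\<in>s ` D. dist x' x < (1 / 3) ^ (2 * m) \<longrightarrow> dist (g x') (g x) < e"
      using close[of _ _ m] gs by (fastforce simp: dist_real_def dist_norm)
    then show "\<exists>d>0. \<forall>x\<in>s ` D. \<forall>x'\<in>s ` D. dist x' x < d \<longrightarrow> dist (g x') (g x) < e"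
      by (intro exI[of _ "(1 / 3) ^ (2 * m)"]) auto
  qed
  then obtain g' where g': "uniformly_continuous_on (closure (s ` D)) g'" "\<And>x. x \<in> s ` D \<Longrightarrow> g x = g' x"
    by (rule uniformly_continuous_on_extension_on_closure) blast
  have cl: "closedin (top_of_set UNIV) (closure (s ` D))" by simp
  \<comment> \<open>The limit measure may charge points that are not codes, so the inverse is
    extended first to the closure and then, by Tietze, to the whole line.\<close>
  obtain \<beta> :: "real \<Rightarrow> complex" where \<beta>: "continuous_on UNIV \<beta>" "\<And>x. x \<in> closure (s ` D) \<Longrightarrow> \<beta> x = g' x"
    by (rule Tietze_unbounded[OF uniformly_continuous_imp_continuous[OF g'(1)] cl]) blast
  have \<beta>s: "\<beta> (s z) = z" if "z \<in> D" for z
  proof -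
    have "s z \<in> s ` D" using that by (rule imageI)
    then show ?thesis using \<beta>(2)[OF subsetD[OF closure_subset]] g'(2) gs[OF that] by metis
  qed
  have \<beta>m: "\<beta> \<in> borel_measurable borel" by (rule borel_measurable_continuous_onI[OF \<beta>(1)])
  define \<nu> where "\<nu> n = distr (\<mu> n) borel s" for n
  have sm: "s \<in> \<mu> n \<rightarrow>\<^sub>M borel" for n unfolding measurable_cong_sets[OF sets refl] by (rule s_meas)
  have rd: "real_distribution (\<nu> n)" for n
    unfolding \<nu>_def using prob_space.real_distribution_distr[OF prob sm] .
  have "tight \<nu>"
    unfolding tight_def
  proof (intro conjI allI impI)
    fix e :: real assume "e > 0"
    have "measure (\<nu> n) {-1<..2} = 1" for n
    proof -
      have "s z \<in> {-1<..2}" for z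
        using encode_bounds[of "q (Re z)" "q (Im z)"] unfolding s_def greaterThanAtMost_iff by linarith
      then have "s -` {-1<..2} = UNIV" by auto
      then show ?thesis unfolding \<nu>_def using prob_space.prob_space[OF prob, of n]
        by (simp add: measure_distr[OF sm])
    qed
    then show "\<exists>a b. a < b \<and> (\<forall>n. 1 - e < measure (\<nu> n) {a<..b})"
      using \<open>e > 0\<close> by (intro exI[of _ "-1"] exI[of _ 2]) auto
  qed (rule rd)
  from tight_imp_convergent_subsubsequence[OF this strict_mono_id]
  obtain r N' where r: "strict_mono r" and N': "real_distribution N'" and w: "weak_conv_m (\<nu> \<circ> id \<circ> r) N'" by blast
  define N where "N = distr N' borel \<beta>"
  have \<beta>m': "\<beta> \<in> N' \<rightarrow>\<^sub>M borel"
    using \<beta>m unfolding measurable_cong_sets[OF real_distribution.events_eq_borel[OF N'] refl] .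
  interpret N': prob_space N' using N' by (simp add: real_distribution_def)
  show ?thesis
  proof (intro exI[of _ r] exI[of _ N] conjI allI impI)
    show "strict_mono r" by fact
    show "prob_space N" unfolding N_def by (rule N'.prob_space_distr[OF \<beta>m'])
    show "sets N = sets borel" by (simp add: N_def)
    fix f :: "complex \<Rightarrow> real" assume f: "continuous_on UNIV f" "bounded (range f)"
    obtain B where B: "\<And>z. norm (f z) \<le> B" using f(2) unfolding bounded_iff by auto
    have fm: "f \<in> borel_measurable borel" by (rule borel_measurable_continuous_onI[OF f(1)])
    have c: "isCont (\<lambda>x. f (\<beta> x)) x" for x
      using continuous_on_compose2[OF f(1) \<beta>(1)] by (simp add: continuous_on_eq_continuous_at)
    have rd': "real_distribution ((\<nu> \<circ> id \<circ> r) n)" for n using rd by simp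
    have "(\<lambda>n. \<integral>x. f (\<beta> x) \<partial>((\<nu> \<circ> id \<circ> r) n)) \<longlonglongrightarrow> (\<integral>x. f (\<beta> x) \<partial>N')"
      by (rule weak_conv_imp_integral_bdd_continuous_conv[OF rd' N' w c B])
    moreover have "(\<integral>x. f (\<beta> x) \<partial>((\<nu> \<circ> id \<circ> r) n)) = (\<integral>z. f z \<partial>\<mu> (r n))" for n
    proof -
      have "(\<integral>x. f (\<beta> x) \<partial>((\<nu> \<circ> id \<circ> r) n)) = (\<integral>z. f (\<beta> (s z)) \<partial>\<mu> (r n))"
        unfolding \<nu>_def comp_def id_def by (rule integral_distr[OF sm]) (rule measurable_compose[OF \<beta>m fm])
      also have "\<dots> = (\<integral>z. f z \<partial>\<mu> (r n))"
      proof (rule integral_cong_AE)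
        show "(\<lambda>z. f (\<beta> (s z))) \<in> borel_measurable (\<mu> (r n))" "f \<in> borel_measurable (\<mu> (r n))"
          unfolding measurable_cong_sets[OF sets refl]
          using measurable_compose[OF s_meas measurable_compose[OF \<beta>m fm]] fm by auto
        show "AE z in \<mu> (r n). f (\<beta> (s z)) = f z"
          using bdd[of "r n"] by eventually_elim (simp add: \<beta>s D_def)
      qed
      finally show ?thesis .
    qed
    moreover have "(\<integral>x. f (\<beta> x) \<partial>N') = (\<integral>z. f z \<partial>N)"
      unfolding N_def by (rule integral_distr[OF \<beta>m' fm, symmetric])
    ultimately show "(\<lambda>n. \<integral>z. f z \<partial>\<mu> (r n)) \<longlonglongrightarrow> (\<integral>z. f z \<partial>N)" by simp
  qed
qed

section \<open>The escape region and its level measures\<close>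

lemma dird_unique: "dird f v a z \<Longrightarrow> dird f v b z \<Longrightarrow> a = b"
  unfolding dird_def by (rule DERIV_unique)

text \<open>A local holomorphic F is determined up to an imaginary constant, so its derivatives are
  intrinsic and patch together. The last clause exposes them, for decay estimates at infinity by a
  convenient choice of F.\<close>

lemma harmonic_C2:
  assumes h: "harmonic_on S h"
  obtains hx hy hxx hyy where "C2_on S h hx hy hxx hyy" "\<And>z. z \<in> S \<Longrightarrow> hxx z + hyy z = 0"
    "\<And>z F r. r > 0 \<Longrightarrow> F holomorphic_on ball z r \<Longrightarrow> (\<And>w. w \<in> ball z r \<Longrightarrow> h w = Re (F w)) \<Longrightarrow>
       hx z = Re (deriv F z) \<and> hy z = - Im (deriv F z)"
proof -
  define hx where "hx z = (THE d. dird h 1 d z)" for z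
  define hy where "hy z = (THE d. dird h \<i> d z)" for z
  define hxx where "hxx z = (THE d. dird hx 1 d z)" for z
  define hyy where "hyy z = (THE d. dird hy \<i> d z)" for z
  have the: "(THE d. dird f v d z) = e" if "dird f v e z" for f v e z
    using that dird_unique by blast
  have loc: "dird g v (Re (v * deriv G w)) w" if "open U" "w \<in> U" "G holomorphic_on U" "\<And>y. y \<in> U \<Longrightarrow> g y = Re (G y)" for U w G g v
  proof -
    have "(G has_field_derivative deriv G w) (at w)" using that(1-3) by (intro holomorphic_derivI)
    then have "dird (\<lambda>y. Re (G y)) v (Re (v * deriv G w)) w" by (rule dird_Re)
    moreover have "eventually (\<lambda>y. y \<in> U) (nhds w)" using that(1,2) by (rule eventually_nhds_in_open)
    then have "eventually (\<lambda>y. Re (G y) = g y) (nhds w)" by (rule eventually_mono) (simp add: that(4))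
    ultimately show ?thesis by (rule dird_local)
  qed
  have all: "dird h 1 (hx w) w \<and> dird h \<i> (hy w) w \<and> dird hx 1 (hxx w) w \<and> dird hy \<i> (hyy w) w \<and>
      hx w = Re (deriv F w) \<and> hy w = - Im (deriv F w) \<and>
      hxx w = Re (deriv (deriv F) w) \<and> hyy w = - Re (deriv (deriv F) w)"
    if w: "w \<in> ball z r" and F: "F holomorphic_on ball z r" "\<And>y. y \<in> ball z r \<Longrightarrow> h y = Re (F y)" for z r F w
  proof -
    have x: "dird h 1 (Re (1 * deriv F y)) y" "dird h \<i> (Re (\<i> * deriv F y)) y" if "y \<in> ball z r" for y
      using loc[OF open_ball that F(1), of h 1] loc[OF open_ball that F(1), of h \<i>] F(2) by simp_all
    have hx: "hx y = Re (deriv F y)" "hy y = Re (\<i> * deriv F y)" if "y \<in> ball z r" for y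
      unfolding hx_def hy_def using the[OF x(1)[OF that]] the[OF x(2)[OF that]] by auto
    have F': "deriv F holomorphic_on ball z r" using F(1) by (intro holomorphic_deriv) auto
    have F'i: "(\<lambda>y. \<i> * deriv F y) holomorphic_on ball z r" by (intro holomorphic_on_mult holomorphic_on_const F')
    have xx: "dird hx 1 (Re (1 * deriv (deriv F) w)) w"
      by (rule loc[OF open_ball w F']) (simp add: hx)
    have di: "deriv (\<lambda>y. \<i> * deriv F y) w = \<i> * deriv (deriv F) w"
      using holomorphic_on_imp_differentiable_at[OF F' open_ball w] by (rule deriv_cmult)
    have yy: "dird hy \<i> (Re (\<i> * deriv (\<lambda>y. \<i> * deriv F y) w)) w"
      by (rule loc[OF open_ball w F'i]) (rule hx(2))
    show ?thesis
      using x[OF w] hx[OF w] xx yy the[OF xx] the[OF yy] unfolding di by (simp add: hxx_def hyy_def)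
  qed
  have ex: "\<exists>r F. r > 0 \<and> ball z r \<subseteq> S \<and> F holomorphic_on ball z r \<and> (\<forall>y\<in>ball z r. h y = Re (F y))" if "z \<in> S" for z
    using h that unfolding harmonic_on_def by blast
  show ?thesis
  proof (rule that[of hx hy hxx hyy])
    have cont: "isCont hx z \<and> isCont hy z \<and> isCont hxx z \<and> isCont hyy z" if "z \<in> S" for z
    proof -
      obtain r F where rF: "r > 0 \<and> ball z r \<subseteq> S \<and> F holomorphic_on ball z r \<and> (\<forall>y\<in>ball z r. h y = Re (F y))"
        using ex[OF \<open>z \<in> S\<close>] by blast
      then have r: "r > 0" and F: "F holomorphic_on ball z r" "\<And>y. y \<in> ball z r \<Longrightarrow> h y = Re (F y)" by simp_all
      have z: "z \<in> ball z r" using r by simp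
      have ev: "eventually (\<lambda>y. y \<in> ball z r) (nhds z)" using eventually_nhds_in_open[OF open_ball z] .
      have "deriv F holomorphic_on ball z r" using F(1) by (intro holomorphic_deriv) auto
      moreover then have "deriv (deriv F) holomorphic_on ball z r" by (rule holomorphic_deriv) auto
      ultimately have c: "isCont (deriv F) z" "isCont (deriv (deriv F)) z"
        using holomorphic_on_imp_continuous_on continuous_on_eq_continuous_at[OF open_ball] z by blast+
      have e: "eventually (\<lambda>y. hx y = Re (deriv F y)) (nhds z)" "eventually (\<lambda>y. hy y = - Im (deriv F y)) (nhds z)"
        "eventually (\<lambda>y. hxx y = Re (deriv (deriv F) y)) (nhds z)" "eventually (\<lambda>y. hyy y = - Re (deriv (deriv F) y)) (nhds z)"
        using ev by (rule eventually_mono; use all[OF _ F] in blast)+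
      show ?thesis
        unfolding isCont_cong[OF e(1)] isCont_cong[OF e(2)] isCont_cong[OF e(3)] isCont_cong[OF e(4)]
        by (intro conjI isCont_Re isCont_Im isCont_minus c)
    qed
    have d: "dird h 1 (hx z) z \<and> dird h \<i> (hy z) z \<and> dird hx 1 (hxx z) z \<and> dird hy \<i> (hyy z) z \<and> hxx z + hyy z = 0" if "z \<in> S" for z
    proof -
      obtain r F where rF: "r > 0 \<and> ball z r \<subseteq> S \<and> F holomorphic_on ball z r \<and> (\<forall>y\<in>ball z r. h y = Re (F y))"
        using ex[OF \<open>z \<in> S\<close>] by blast
      then have r: "r > 0" and F: "F holomorphic_on ball z r" "\<And>y. y \<in> ball z r \<Longrightarrow> h y = Re (F y)" by simp_all
      have "z \<in> ball z r" using r by simp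
      then have "dird h 1 (hx z) z \<and> dird h \<i> (hy z) z \<and> dird hx 1 (hxx z) z \<and> dird hy \<i> (hyy z) z \<and>
          hx z = Re (deriv F z) \<and> hy z = - Im (deriv F z) \<and>
          hxx z = Re (deriv (deriv F) z) \<and> hyy z = - Re (deriv (deriv F) z)"
        by (rule all[OF _ F])
      moreover from this have "hxx z + hyy z = 0" by linarith
      ultimately show ?thesis by blast
    qed
    show "C2_on S h hx hy hxx hyy"
      unfolding C2_on_def using d cont harmonic_on_continuous[OF h] by (auto intro!: continuous_at_imp_continuous_on)
    show "hxx z + hyy z = 0" if "z \<in> S" for z using d[OF that] by blast
    show "hx z = Re (deriv F z) \<and> hy z = - Im (deriv F z)"
      if "r > 0" "F holomorphic_on ball z r" "\<And>w. w \<in> ball z r \<Longrightarrow> h w = Re (F w)" for z F r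
      using all[OF _ that(2,3), of z] that(1) by simp
  qed
qed

text \<open>Differentiability at 0 gives F(1/z) - F(0) = O(1/|z|), and the chain rule contributes
  the factor 1/z^2 to the derivative.\<close>

lemma inversion_flat:
  assumes F: "F holomorphic_on ball 0 r" "r > 0"
  obtains C where "eventually (\<lambda>z. cmod z * cmod (F (1 / z) - F 0) \<le> C \<and> (cmod z)\<^sup>2 * cmod (deriv (\<lambda>w. F (1 / w)) z) \<le> C) at_infinity"
proof -
  have z0: "0 \<in> ball 0 r" using F by simp
  have inv: "((\<lambda>z::complex. 1 / z) \<longlongrightarrow> 0) at_infinity"
    using tendsto_inverse_0[where 'a=complex] unfolding inverse_eq_divide .
  have invne: "filterlim (\<lambda>z::complex. 1 / z) (at 0) at_infinity"
    unfolding filterlim_at using inv eventually_not_equal_at_infinity[of "0::complex"] by (auto elim!: eventually_mono)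
  have "(F has_field_derivative deriv F 0) (at 0)" using F z0 by (intro holomorphic_derivI) auto
  then have "((\<lambda>u. (F u - F 0) / u) \<longlongrightarrow> deriv F 0) (at 0)" by (simp add: has_field_derivative_iff)
  then have "((\<lambda>z. (F (1 / z) - F 0) / (1 / z)) \<longlongrightarrow> deriv F 0) at_infinity" by (rule filterlim_compose[OF _ invne])
  then have "((\<lambda>z. cmod ((F (1 / z) - F 0) / (1 / z))) \<longlongrightarrow> cmod (deriv F 0)) at_infinity" by (rule tendsto_norm)
  then have 1: "eventually (\<lambda>z. cmod ((F (1 / z) - F 0) / (1 / z)) < cmod (deriv F 0) + 1) at_infinity"
    by (rule order_tendstoD(2)) simp
  have "deriv F holomorphic_on ball 0 r" using F by (intro holomorphic_deriv) auto
  then have "isCont (deriv F) 0" using z0 holomorphic_on_imp_continuous_on continuous_on_eq_continuous_at[OF open_ball] by blast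
  then have "((\<lambda>z. deriv F (1 / z)) \<longlongrightarrow> deriv F 0) at_infinity" using inv isCont_tendsto_compose by blast
  then have "((\<lambda>z. cmod (deriv F (1 / z))) \<longlongrightarrow> cmod (deriv F 0)) at_infinity" by (rule tendsto_norm)
  then have 2: "eventually (\<lambda>z. cmod (deriv F (1 / z)) < cmod (deriv F 0) + 1) at_infinity"
    by (rule order_tendstoD(2)) simp
  have 3: "eventually (\<lambda>z::complex. 1 / z \<in> ball 0 r) at_infinity"
    using tendstoD[OF inv F(2)] by (simp add: dist_norm)
  show ?thesis
  proof (rule that[of "cmod (deriv F 0) + 1"])
    show "eventually (\<lambda>z. cmod z * cmod (F (1 / z) - F 0) \<le> cmod (deriv F 0) + 1 \<and> (cmod z)\<^sup>2 * cmod (deriv (\<lambda>w. F (1 / w)) z) \<le> cmod (deriv F 0) + 1) at_infinity"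
      using 1 2 3 eventually_not_equal_at_infinity[of "0::complex"]
    proof eventually_elim
      case (elim z)
      have "(F has_field_derivative deriv F (1 / z)) (at (1 / z))" using F elim by (intro holomorphic_derivI) auto
      moreover have "((\<lambda>w. 1 / w) has_field_derivative - (1 / z\<^sup>2)) (at z)"
        using elim by (auto intro!: derivative_eq_intros simp: power2_eq_square)
      ultimately have "((\<lambda>w. F (1 / w)) has_field_derivative deriv F (1 / z) * - (1 / z\<^sup>2)) (at z)"
        by (rule DERIV_chain2)
      then have "deriv (\<lambda>w. F (1 / w)) z = deriv F (1 / z) * - (1 / z\<^sup>2)" by (rule DERIV_imp_deriv)
      then show ?case using elim by (simp add: norm_mult norm_divide norm_power mult.commute)
    qed
  qed
qed

text \<open>Combinations of real exponentials form an algebra that separates points, and generators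
  with c \<ge> 0 are subharmonic. So Stone-Weierstrass reduces continuous boundary data to
  differences of submean functions, the kind \<open>dirichlet_problem\<close> accepts.\<close>

inductive exp_span :: "(complex \<Rightarrow> real) \<Rightarrow> bool" where
  base: "exp_span (\<lambda>z. c * exp (a * Re z + b * Im z))"
| add: "exp_span f \<Longrightarrow> exp_span g \<Longrightarrow> exp_span (\<lambda>z. f z + g z)"

lemma exp_span_mult_base: "exp_span f \<Longrightarrow> exp_span (\<lambda>z. f z * (c * exp (a * Re z + b * Im z)))"
proof (induction rule: exp_span.induct)
  case (base c' a' b')
  have "(\<lambda>z. c' * exp (a' * Re z + b' * Im z) * (c * exp (a * Re z + b * Im z))) =
      (\<lambda>z. (c' * c) * exp ((a' + a) * Re z + (b' + b) * Im z))"
    by (auto simp: exp_add algebra_simps)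
  then show ?case using exp_span.base by simp
next
  case (add f g)
  then show ?case using exp_span.add by (simp add: distrib_right)
qed

lemma exp_span_mult: "exp_span g \<Longrightarrow> exp_span f \<Longrightarrow> exp_span (\<lambda>z. f z * g z)"
proof (induction rule: exp_span.induct)
  case (base c a b)
  then show ?case by (rule exp_span_mult_base)
next
  case (add g g')
  then show ?case using exp_span.add by (simp add: distrib_left)
qed

lemma exp_span_continuous: "exp_span f \<Longrightarrow> continuous_on S f"
  by (induction rule: exp_span.induct) (auto intro!: continuous_intros)

text \<open>Around z the exponent changes by a linear function l of mean zero, and exp l \<ge> 1 +
  l.\<close>

lemma exp_submean:
  assumes c: "c \<ge> 0" shows "submean_on S (\<lambda>z. c * exp (a * Re z + b * Im z))"
  unfolding submean_on_def
proof
  fix z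
  have "c * exp (a * Re z + b * Im z) \<le> (\<integral>t. c * exp (a * Re (z + of_real r * cis t) + b * Im (z + of_real r * cis t)) \<partial>circ)" if r: "r > 0" for r
  proof -
    define k where "k = c * exp (a * Re z + b * Im z)"
    have k: "k \<ge> 0" using c by (simp add: k_def)
    define l where "l t = Re (Complex a (- b) * (0 + of_real r * cis t))" for t
    have l: "c * exp (a * Re (z + of_real r * cis t) + b * Im (z + of_real r * cis t)) = k * exp (l t)" for t
      by (simp add: k_def l_def exp_add[symmetric] algebra_simps)
    have li: "integrable circ l" unfolding l_def by (intro circ_integrable_continuous continuous_intros)
    have "(\<integral>t. l t \<partial>circ) = Re (Complex a (- b) * 0)" unfolding l_def
      by (rule Re_holomorphic_mean_value[of "\<lambda>u. Complex a (- b) * u" 0 "r + 1"]) (use r in \<open>auto intro!: holomorphic_intros\<close>)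
    then have "k = (\<integral>t. k * (1 + l t) \<partial>circ)" using li circ.prob_space by simp
    also have "\<dots> \<le> (\<integral>t. k * exp (l t) \<partial>circ)"
    proof (intro integral_mono mult_left_mono k)
      show "integrable circ (\<lambda>t. k * (1 + l t))" using li by auto
      show "integrable circ (\<lambda>t. k * exp (l t))" unfolding l_def by (intro circ_integrable_continuous continuous_intros)
    qed auto
    finally show ?thesis unfolding l k_def[symmetric] .
  qed
  then show "\<exists>\<rho>>0. \<forall>r. 0 < r \<and> r < \<rho> \<longrightarrow> c * exp (a * Re z + b * Im z) \<le>
      (\<integral>t. c * exp (a * Re (z + of_real r * cis t) + b * Im (z + of_real r * cis t)) \<partial>circ)"
    by (intro exI[of _ 1]) auto
qed

lemma submean_on_add:
  assumes "continuous_on UNIV f" "continuous_on UNIV g" "submean_on S f" "submean_on S g"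
  shows "submean_on S (\<lambda>z. f z + g z)"
  unfolding submean_on_def
proof
  fix z assume "z \<in> S"
  obtain \<rho> where \<rho>: "\<rho> > 0" "\<And>r. 0 < r \<Longrightarrow> r < \<rho> \<Longrightarrow> f z \<le> (\<integral>t. f (z + of_real r * cis t) \<partial>circ)"
    using assms(3) \<open>z \<in> S\<close> unfolding submean_on_def by blast
  obtain \<sigma> where \<sigma>: "\<sigma> > 0" "\<And>r. 0 < r \<Longrightarrow> r < \<sigma> \<Longrightarrow> g z \<le> (\<integral>t. g (z + of_real r * cis t) \<partial>circ)"
    using assms(4) \<open>z \<in> S\<close> unfolding submean_on_def by blast
  have i: "integrable circ (\<lambda>t. f (z + of_real r * cis t))" "integrable circ (\<lambda>t. g (z + of_real r * cis t))" for r
    using assms(1,2) by (auto intro!: circ_integrable_continuous continuous_on_circle intro: continuous_on_subset)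
  have "f z + g z \<le> (\<integral>t. f (z + of_real r * cis t) + g (z + of_real r * cis t) \<partial>circ)" if "0 < r" "r < min \<rho> \<sigma>" for r
    using \<rho>(2)[of r] \<sigma>(2)[of r] that i[of r] by simp
  then show "\<exists>\<rho>>0. \<forall>r. 0 < r \<and> r < \<rho> \<longrightarrow> f z + g z \<le> (\<integral>t. f (z + of_real r * cis t) + g (z + of_real r * cis t) \<partial>circ)"
    using \<rho>(1) \<sigma>(1) by (intro exI[of _ "min \<rho> \<sigma>"]) auto
qed

lemma exp_span_diff:
  assumes "exp_span f"
  shows "\<exists>F G. continuous_on UNIV F \<and> continuous_on UNIV G \<and> submean_on S F \<and> submean_on S G \<and> f = (\<lambda>z. F z - G z)"
  using assms
proof (induction rule: exp_span.induct)
  case (base c a b)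
  define e where "e c z = c * exp (a * Re z + b * Im z)" for c z
  have e: "continuous_on UNIV (e c)" "c \<ge> 0 \<Longrightarrow> submean_on S (e c)" for c
    unfolding e_def by (auto intro!: continuous_intros exp_submean)
  have "e c = (\<lambda>z. e (max c 0) z - e (max (- c) 0) z)" by (auto simp: e_def max_def)
  then show ?case using e[of "max c 0"] e[of "max (- c) 0"] unfolding e_def by (intro exI conjI) auto
next
  case (add f g)
  then obtain F G F' G' where "continuous_on UNIV F" "continuous_on UNIV G" "submean_on S F" "submean_on S G" "f = (\<lambda>z. F z - G z)"
    "continuous_on UNIV F'" "continuous_on UNIV G'" "submean_on S F'" "submean_on S G'" "g = (\<lambda>z. F' z - G' z)" by blast
  then show ?case
    by (intro exI[of _ "\<lambda>z. F z + F' z"] exI[of _ "\<lambda>z. G z + G' z"]) (auto intro!: continuous_intros submean_on_add)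
qed

lemma exp_span_dense:
  assumes "compact K" "continuous_on K f" "\<epsilon> > 0"
  shows "\<exists>g. exp_span g \<and> (\<forall>z\<in>K. \<bar>f z - g z\<bar> < \<epsilon>)"
proof (rule Stone_Weierstrass_HOL[OF assms(1) _ _ _ _ _ assms(2,3)])
  show "exp_span (\<lambda>z. c)" for c using exp_span.base[of c 0 0] by simp
  show "continuous_on K f" if "exp_span f" for f using that by (rule exp_span_continuous)
  show "exp_span (\<lambda>z. f z + g z)" if "exp_span f \<and> exp_span g" for f g using that exp_span.add by blast
  show "exp_span (\<lambda>z. f z * g z)" if "exp_span f \<and> exp_span g" for f g using that exp_span_mult by blast
  fix x y assume "x \<in> K \<and> y \<in> K \<and> x \<noteq> y"
  then have "Re x \<noteq> Re y \<or> Im x \<noteq> Im y" by (simp add: complex_eq_iff)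
  then show "\<exists>f. exp_span f \<and> f x \<noteq> f y"
  proof
    assume "Re x \<noteq> Re y"
    then show ?thesis by (intro exI[of _ "\<lambda>z. 1 * exp (1 * Re z + 0 * Im z)"] conjI exp_span.base) simp
  next
    assume "Im x \<noteq> Im y"
    then show ?thesis by (intro exI[of _ "\<lambda>z. 1 * exp (0 * Re z + 1 * Im z)"] conjI exp_span.base) simp
  qed
qed

context unicritical_family
begin

text \<open>Near an escaping parameter all moduli |Q_n| exceed 2 from a common time on, so there
  \<open>logp\<close> of \<open>Q n\<close> is the real part of a holomorphic logarithm. Its mean
  values pass to the limit by dominated convergence. The map f is meant for the inversion.\<close>

lemma green_mean_value:
  assumes T: "open T" and f: "f holomorphic_on T" "\<And>w. w \<in> T \<Longrightarrow> f w \<notin> M"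
  shows "mean_value_on T (\<lambda>w. green (f w))"
  unfolding mean_value_on_def
proof (intro conjI ballI)
  have fc: "continuous_on T f" by (rule holomorphic_on_imp_continuous_on[OF f(1)])
  show gc: "continuous_on T (\<lambda>w. green (f w))"
    by (rule continuous_on_compose2[OF green_continuous fc]) auto
  fix w assume w: "w \<in> T"
  have "filterlim (\<lambda>n. cmod (Q n (f w))) at_top sequentially"
    using not_mem_M_escape[OF f(2)[OF w]] escape_at_top by blast
  then have "eventually (\<lambda>n. cmod (Q n (f w)) > max 2 (cmod (f w))) sequentially" unfolding filterlim_at_top_dense by blast
  then obtain k where k: "cmod (Q k (f w)) > max 2 (cmod (f w))" by (auto simp: eventually_sequentially)
  define V where "V = {c. max 2 (cmod c) < cmod (Q k c)}"
  have "open V" unfolding V_def by (intro open_Collect_less continuous_intros Q_continuous)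
  then have "open (T \<inter> f -` V)" by (intro continuous_open_preimage fc T)
  moreover have "w \<in> T \<inter> f -` V" using w k by (simp add: V_def)
  ultimately obtain \<rho> where \<rho>: "\<rho> > 0" "ball w \<rho> \<subseteq> T \<inter> f -` V" using open_contains_ball by metis
  have big: "cmod (Q n (f y)) > 2" if "y \<in> ball w \<rho>" "n \<ge> k" for y n
  proof -
    have "f y \<in> V" using that \<rho> by blast
    then have "2 < cmod (Q k (f y))" "cmod (f y) \<le> cmod (Q k (f y))" by (auto simp: V_def)
    then show ?thesis using escape_mono[of k "f y" n] that by linarith
  qed
  have "(\<integral>t. green (f (w + of_real r * cis t)) \<partial>circ) = green (f w)" if r: "0 < r" "r < \<rho>" for r
  proof -
    have inb: "w + of_real r * cis t \<in> ball w \<rho>" for t using r by (simp add: dist_norm norm_mult)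
    have inT: "w + of_real r * cis t \<in> T" for t using inb \<rho> by blast
    have sT: "sphere w \<bar>r\<bar> \<subseteq> T" using \<rho> r by auto
    define x where "x n y = logp (Q n (f y)) / real d ^ n" for n y
    have xm: "(\<integral>t. x n (w + of_real r * cis t) \<partial>circ) = x n w" if "n \<ge> k" for n
    proof -
      have "(\<lambda>y. Q n (f y)) holomorphic_on ball w \<rho>"
        unfolding Q_def using \<rho> by (intro holomorphic_intros holomorphic_on_subset[OF f(1)]) auto
      then have "harmonic_on (ball w \<rho>) (\<lambda>y. ln (cmod (Q n (f y))))"
        using big[OF _ that] by (intro harmonic_on_ln_norm) force+
      then have mv: "mean_value_on (ball w \<rho>) (\<lambda>y. ln (cmod (Q n (f y))))" by (rule harmonic_on_imp_mean_value)
      have contr: "contractible (ball w \<rho>)" by (intro convex_imp_contractible convex_ball)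
      obtain G where G: "G holomorphic_on ball w \<rho>" "\<And>y. y \<in> ball w \<rho> \<Longrightarrow> Q n (f y) = exp (G y)"
      proof (rule contractible_imp_holomorphic_log[of "\<lambda>y. Q n (f y)" "ball w \<rho>"])
        show "(\<lambda>y. Q n (f y)) holomorphic_on ball w \<rho>" by fact
        show "contractible (ball w \<rho>)" by fact
        show "Q n (f y) \<noteq> 0" if "y \<in> ball w \<rho>" for y using big[OF that \<open>n \<ge> k\<close>] by auto
      qed blast
      have lnQ: "logp (Q n (f y)) = ln (cmod (Q n (f y)))" if "y \<in> ball w \<rho>" for y
        using big[OF that \<open>n \<ge> k\<close>] by (simp add: logp_def max_def)
      have "(\<integral>t. logp (Q n (f (w + of_real r * cis t))) \<partial>circ) = logp (Q n (f w))"
        by (rule Re_holomorphic_mean_value[OF G(1) r, where h = "\<lambda>y. logp (Q n (f y))"]) (subst lnQ, assumption, subst G(2), assumption, simp)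
      then show ?thesis by (simp add: x_def)
    qed
    have step_c: "continuous_on UNIV step_bound" unfolding step_bound_def[abs_def]
      by (intro continuous_intros) (auto simp: add_nonneg_eq_0_iff)
    have cb: "continuous_on T (\<lambda>y. green (f y) + step_bound (f y))"
      by (intro continuous_intros gc continuous_on_compose2[OF step_c fc]) auto
    have lim: "(\<lambda>n. \<integral>t. x n (w + of_real r * cis t) \<partial>circ) \<longlonglongrightarrow> (\<integral>t. green (f (w + of_real r * cis t)) \<partial>circ)"
    proof (rule integral_dominated_convergence)
      show "integrable circ (\<lambda>t. green (f (w + of_real r * cis t)) + step_bound (f (w + of_real r * cis t)))"
        by (intro circ_integrable_continuous continuous_on_circle[of w r "\<lambda>y. green (f y) + step_bound (f y)"] continuous_on_subset[OF cb] sT)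
      have "integrable circ (\<lambda>t. green (f (w + of_real r * cis t)))"
        by (intro circ_integrable_continuous continuous_on_circle[of w r "\<lambda>y. green (f y)"] continuous_on_subset[OF gc] sT)
      then show "(\<lambda>t. green (f (w + of_real r * cis t))) \<in> borel_measurable circ" by (rule borel_measurable_integrable)
      have "continuous_on T (x n)" for n unfolding x_def
        by (intro continuous_intros continuous_on_compose2[OF logp_Q_continuous fc]) (use d in auto)
      then have "integrable circ (\<lambda>t. x n (w + of_real r * cis t))" for n
        by (intro circ_integrable_continuous continuous_on_circle[of w r "x n"] continuous_on_subset[OF _ sT])
      then show "(\<lambda>t. x n (w + of_real r * cis t)) \<in> borel_measurable circ" for n by (rule borel_measurable_integrable)
      show "AE t in circ. (\<lambda>n. x n (w + of_real r * cis t)) \<longlonglongrightarrow> green (f (w + of_real r * cis t))"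
        unfolding x_def by (intro always_eventually allI green_tendsto)
      have "norm (x n y) \<le> green (f y) + step_bound (f y)" for n y
      proof -
        have dn: "real d ^ n \<ge> 1" using d by simp
        have "logp (Q n (f y)) \<le> real d ^ n * green (f y) + step_bound (f y)" using green_bound[of n "f y"] by linarith
        also have "\<dots> \<le> real d ^ n * green (f y) + real d ^ n * step_bound (f y)"
          using mult_right_mono[OF dn step_bound_nonneg] by simp
        finally have "logp (Q n (f y)) \<le> real d ^ n * (green (f y) + step_bound (f y))" by (simp add: distrib_left)
        then have "x n y \<le> green (f y) + step_bound (f y)" unfolding x_def using d by (simp add: pos_divide_le_eq mult.commute)
        then show ?thesis using logp_nonneg[of "Q n (f y)"] dn by (simp add: x_def)
      qed
      then show "AE t in circ. norm (x n (w + of_real r * cis t)) \<le> green (f (w + of_real r * cis t)) + step_bound (f (w + of_real r * cis t))" for n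
        by simp
    qed
    have ev: "eventually (\<lambda>n. (\<integral>t. x n (w + of_real r * cis t) \<partial>circ) = x n w) sequentially"
      unfolding eventually_sequentially using xm by blast
    have "(\<lambda>n. x n w) \<longlonglongrightarrow> (\<integral>t. green (f (w + of_real r * cis t)) \<partial>circ)"
      using Lim_transform_eventually[OF lim ev] .
    moreover have "(\<lambda>n. x n w) \<longlonglongrightarrow> green (f w)" unfolding x_def by (rule green_tendsto)
    ultimately show ?thesis by (rule LIMSEQ_unique)
  qed
  then show "\<exists>\<rho>>0. ball w \<rho> \<subseteq> T \<and> (\<forall>r. 0 < r \<and> r < \<rho> \<longrightarrow> (\<integral>t. green (f (w + of_real r * cis t)) \<partial>circ) = green (f w))"
    using \<rho> by (intro exI[of _ \<rho>]) auto
qed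

text \<open>The escape region together with infinity, in the coordinate 1/z; infinity is the point w
  = 0.\<close>

definition W :: "complex set" where
  "W = {w. w = 0 \<or> 1 / w \<notin> M}"

lemma W_open: "open W"
proof -
  have "- W = {w. cmod w \<ge> 1/2} \<inter> (\<lambda>w. 1 / w) -` M"
  proof (intro set_eqI iffI)
    fix w assume "w \<in> - W"
    then have w: "w \<noteq> 0" "1 / w \<in> M" by (auto simp: W_def)
    have "1 / cmod w \<le> 2" using M_bounded[OF w(2)] by (simp add: norm_divide)
    then have "cmod w \<ge> 1/2" using w by (simp add: field_simps)
    then show "w \<in> {w. cmod w \<ge> 1/2} \<inter> (\<lambda>w. 1 / w) -` M" using w by simp
  next
    fix w assume "w \<in> {w. cmod w \<ge> 1/2} \<inter> (\<lambda>w. 1 / w) -` M"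
    then show "w \<in> - W" by (auto simp: W_def)
  qed
  moreover have "closed ({w. cmod w \<ge> 1/2} \<inter> (\<lambda>w. 1 / w) -` M)"
  proof (rule continuous_closed_preimage)
    show "continuous_on {w. cmod w \<ge> 1/2} (\<lambda>w. 1 / w)" by (intro continuous_intros) auto
    show "closed {w::complex. cmod w \<ge> 1/2}" by (intro closed_Collect_le continuous_intros)
  qed (rule M_closed)
  ultimately show ?thesis by (simp add: open_closed)
qed

lemma W_bounded: "bounded W"
proof -
  have "cmod w \<le> 4" if "w \<in> W" for w
  proof (rule ccontr)
    assume c: "\<not> cmod w \<le> 4"
    then have "w \<noteq> 0" by auto
    then have "1 / w \<notin> M" using that by (simp add: W_def)
    moreover have "1 / cmod w \<le> 1 / 4" using c by (intro divide_left_mono) auto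
    then have "1 / w \<in> cball 0 (1/4)" by (simp add: norm_divide)
    ultimately show False using M_contains_ball by blast
  qed
  then show ?thesis unfolding bounded_iff by blast
qed

lemma W_frontier: "\<zeta> \<in> frontier W \<Longrightarrow> \<zeta> \<noteq> 0 \<and> 1 / \<zeta> \<in> M"
  using W_open by (auto simp: frontier_def interior_open W_def)

text \<open>The Green function is positive off M, continuous, and zero on M: one function serves
  every boundary point.\<close>

lemma W_weak_barrier:
  assumes \<zeta>: "\<zeta> \<in> frontier W"
  shows "weak_barrier W \<zeta>"
proof -
  have z: "\<zeta> \<noteq> 0" "1 / \<zeta> \<in> M" using W_frontier[OF \<zeta>] by auto
  \<comment> \<open>The radius keeps w = 0 out of the disc; there \<open>1 / w\<close> is 0 and
    \<open>green\<close> would return 0 in place of its pole at infinity.\<close>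
  define T where "T = W \<inter> ball \<zeta> (cmod \<zeta>)"
  have T0: "w \<noteq> 0" "1 / w \<notin> M" if "w \<in> T" for w using that by (auto simp: T_def W_def)
  have "mean_value_on T (\<lambda>w. green (1 / w))"
  proof (rule green_mean_value)
    show "open T" using W_open by (auto simp: T_def)
    show "(\<lambda>w. 1 / w) holomorphic_on T" using T0 by (intro holomorphic_intros) auto
  qed (use T0 in auto)
  moreover have "green (1 / w) > 0" if "w \<in> T" for w using T0[OF that] by (intro green_pos)
  moreover have "((\<lambda>w. green (1 / w)) \<longlongrightarrow> 0) (at \<zeta> within W)"
  proof -
    have "isCont (\<lambda>w. green (1 / w)) \<zeta>"
    proof (rule isCont_o2[of \<zeta> "\<lambda>w. 1 / w"])
      show "isCont (\<lambda>w. 1 / w) \<zeta>" using z(1) by (intro continuous_intros)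
      show "isCont green (1 / \<zeta>)" using green_continuous by (simp add: continuous_on_eq_continuous_at)
    qed
    then have "((\<lambda>w. green (1 / w)) \<longlongrightarrow> 0) (at \<zeta>)" using green_zero[OF z(2)] unfolding isCont_def by simp
    then show ?thesis by (rule tendsto_within_subset) simp
  qed
  moreover have "cmod \<zeta> > 0" using z(1) by simp
  ultimately show ?thesis unfolding weak_barrier_def T_def
    by (intro exI[of _ "cmod \<zeta>"] conjI exI[of _ "\<lambda>w. green (1 / w)"] ballI) assumption+
qed

lemma W_dirichlet:
  assumes "exp_span \<psi>"
  obtains h where "harmonic_on W h" "\<And>\<zeta>. \<zeta> \<in> frontier W \<Longrightarrow> (h \<longlongrightarrow> \<psi> \<zeta>) (at \<zeta> within W)"
proof -
  obtain F G where FG: "continuous_on UNIV F" "continuous_on UNIV G" "submean_on W F" "submean_on W G" "\<psi> = (\<lambda>z. F z - G z)"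
    using exp_span_diff[OF assms] by blast
  obtain h where h: "harmonic_on W h" "\<forall>\<zeta>\<in>frontier W. (h \<longlongrightarrow> F \<zeta>) (at \<zeta> within W)"
    using dirichlet_problem[OF W_bounded W_open FG(1,3) W_weak_barrier] by blast
  obtain k where k: "harmonic_on W k" "\<forall>\<zeta>\<in>frontier W. (k \<longlongrightarrow> G \<zeta>) (at \<zeta> within W)"
    using dirichlet_problem[OF W_bounded W_open FG(2,4) W_weak_barrier] by blast
  show ?thesis
  proof (rule that[of "\<lambda>z. h z - k z"])
    show "harmonic_on W (\<lambda>z. h z - k z)" by (rule harmonic_on_diff[OF h(1) k(1)])
    show "((\<lambda>z. h z - k z) \<longlongrightarrow> \<psi> \<zeta>) (at \<zeta> within W)" if "\<zeta> \<in> frontier W" for \<zeta>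
      unfolding FG(5) using h(2) k(2) that by (intro tendsto_diff) auto
  qed
qed

section \<open>Smoothed equilibrium measures near level curves\<close>

abbreviation "QP n \<equiv> critical_value_poly d n"

lemma QP_nz: "QP n \<noteq> 0"
  using degree_critical_value_poly[OF d, of n] d by auto

lemma lap_Q_support:
  assumes "lap (QP n) 9 z \<noteq> 0"
  shows "z \<notin> M" "cmod z < 6" "cmod (Q n z) < 6"
proof -
  have l: "9 \<le> (cmod (Q n z))\<^sup>2" "(cmod (Q n z))\<^sup>2 \<le> exp 1 * 9" using lap_support[OF _ assms] by (auto simp: Q_def)
  have "(cmod (Q n z))\<^sup>2 < 6\<^sup>2" using l(2) exp_le by simp
  then show Q5: "cmod (Q n z) < 6" by (rule power2_less_imp_less) simp
  show "z \<notin> M"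
  proof
    assume "z \<in> M"
    then have "(cmod (Q n z))\<^sup>2 \<le> 2\<^sup>2" using mem_M_iff by (intro power_mono) auto
    then show False using l(1) by simp
  qed
  show "cmod z < 6"
  proof (rule ccontr)
    assume "\<not> ?thesis"
    then show False using escape_mono[of 0 z n] Q5 by (simp add: Q_0)
  qed
qed

text \<open>The Laplacian of the truncated ln |Q_n|, normalised by its mass. The threshold 9 = 3^2
  puts the support into 3 \<le> |Q_n| < 6, beyond the escape radius 2 and hence off M.\<close>

definition level_measure :: "nat \<Rightarrow> complex measure" where
  "level_measure n = density area (\<lambda>z. ennreal (lap (QP n) 9 z / (real d ^ n * lap_mass)))"

lemma sets_level_measure [simp]: "sets (level_measure n) = sets borel"
  by (simp add: level_measure_def)

lemma level_density:
  "(\<lambda>z. lap (QP n) 9 z / (real d ^ n * lap_mass)) \<in> borel_measurable borel"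
  "0 \<le> lap (QP n) 9 z / (real d ^ n * lap_mass)"
proof -
  show "(\<lambda>z. lap (QP n) 9 z / (real d ^ n * lap_mass)) \<in> borel_measurable borel"
    using borel_measurable_integrable[OF lap_integrable[OF _ QP_nz, of 9]] by simp
  show "0 \<le> lap (QP n) 9 z / (real d ^ n * lap_mass)" using lap_nonneg lap_mass_pos by simp
qed

lemma level_measure_integral:
  fixes f :: "complex \<Rightarrow> real"
  assumes "f \<in> borel_measurable borel"
  shows "(\<integral>z. f z \<partial>level_measure n) = (\<integral>z. f z * lap (QP n) 9 z \<partial>area) / (real d ^ n * lap_mass)"
proof -
  have "(\<integral>z. f z \<partial>level_measure n) = (\<integral>z. (lap (QP n) 9 z / (real d ^ n * lap_mass)) *\<^sub>R f z \<partial>area)"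
    unfolding level_measure_def using assms level_density by (intro integral_density) auto
  also have "\<dots> = (\<integral>z. (f z * lap (QP n) 9 z) / (real d ^ n * lap_mass) \<partial>area)"
    by (simp add: mult.commute)
  finally show ?thesis by simp
qed

lemma level_measure_prob: "prob_space (level_measure n)"
proof
  have "emeasure (level_measure n) (space (level_measure n)) = (\<integral>\<^sup>+ z. ennreal (lap (QP n) 9 z / (real d ^ n * lap_mass)) \<partial>area)"
    unfolding level_measure_def using level_density(1)[of n] by (subst emeasure_density) auto
  also have "\<dots> = ennreal (\<integral>z. lap (QP n) 9 z / (real d ^ n * lap_mass) \<partial>area)"
    using lap_integrable[OF _ QP_nz, of 9 n] level_density(2) by (intro nn_integral_eq_integral) auto
  also have "(\<integral>z. lap (QP n) 9 z / (real d ^ n * lap_mass) \<partial>area) = 1"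
    using lap_total_mass[OF QP_nz, of 9 n] degree_critical_value_poly[OF d, of n] lap_mass_pos d by simp
  finally show "emeasure (level_measure n) (space (level_measure n)) = 1" by simp
qed

lemma AE_level_measure:
  assumes "\<And>z. lap (QP n) 9 z \<noteq> 0 \<Longrightarrow> R z" "{z. R z} \<in> sets borel"
  shows "AE z in level_measure n. R z"
proof -
  have "AE z in area. 0 < ennreal (lap (QP n) 9 z / (real d ^ n * lap_mass)) \<longrightarrow> R z"
    using assms(1) by (intro always_eventually allI) (metis divide_eq_0_iff ennreal_0 less_irrefl)
  then show ?thesis unfolding level_measure_def
    by (subst AE_density) (use level_density(1)[of n] in auto)
qed

text \<open>Green's identity with h(1/z), which is harmonic where \<open>gam\<close> lives and has
  the value h 0 at infinity: the right-hand side vanishes.\<close>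

lemma level_measure_harmonic:
  assumes h: "harmonic_on W h"
  shows "(\<integral>z. (h (1 / z) - h 0) * lap (QP n) 9 z \<partial>area) = 0"
    and "integrable area (\<lambda>z. (h (1 / z) - h 0) * lap (QP n) 9 z)"
proof -
  have M0: "0 \<in> M" using M_contains_ball by auto
  have H: "harmonic_on (- M) (\<lambda>z. h (1 / z))"
  proof (rule harmonic_on_compose[OF h])
    show "(\<lambda>z. 1 / z) holomorphic_on - M" using M0 by (intro holomorphic_intros) auto
    show "open (- M)" using M_closed by (rule open_Compl)
    show "(\<lambda>z. 1 / z) ` (- M) \<subseteq> W" by (auto simp: W_def)
  qed
  obtain hx hy hxx hyy where C2: "C2_on (- M) (\<lambda>z. h (1 / z)) hx hy hxx hyy" "\<And>z. z \<in> - M \<Longrightarrow> hxx z + hyy z = 0"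
    "\<And>z F r. r > 0 \<Longrightarrow> F holomorphic_on ball z r \<Longrightarrow> (\<And>w. w \<in> ball z r \<Longrightarrow> h (1 / w) = Re (F w)) \<Longrightarrow>
       hx z = Re (deriv F z) \<and> hy z = - Im (deriv F z)"
    by (rule harmonic_C2[OF H]) blast
  have "0 \<in> W" by (simp add: W_def)
  then have "\<exists>r>0. \<exists>F. ball 0 r \<subseteq> W \<and> F holomorphic_on ball 0 r \<and> (\<forall>w\<in>ball 0 r. h w = Re (F w))"
    using h unfolding harmonic_on_def by blast
  then obtain r F where "r > 0 \<and> ball 0 r \<subseteq> W \<and> F holomorphic_on ball 0 r \<and> (\<forall>w\<in>ball 0 r. h w = Re (F w))"
    by (elim exE) blast
  then have r: "r > 0" "F holomorphic_on ball 0 r" "\<And>w. w \<in> ball 0 r \<Longrightarrow> h w = Re (F w)" by simp_all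
  obtain C where C: "eventually (\<lambda>z. cmod z * cmod (F (1 / z) - F 0) \<le> C \<and> (cmod z)\<^sup>2 * cmod (deriv (\<lambda>w. F (1 / w)) z) \<le> C) at_infinity"
    using inversion_flat[OF r(2,1)] by blast
  have far: "eventually (\<lambda>z::complex. cmod z > 1 / r) at_infinity"
    using filterlim_norm_at_top filterlim_at_top_dense by blast
  have flat: "flat_at_infinity (\<lambda>z. h (1 / z)) (h 0) hx hy"
    unfolding flat_at_infinity_def
  proof (rule exI[of _ C])
    show "eventually (\<lambda>z. cmod z * \<bar>h (1 / z) - h 0\<bar> \<le> C \<and> (cmod z)\<^sup>2 * \<bar>hx z\<bar> \<le> C \<and> (cmod z)\<^sup>2 * \<bar>hy z\<bar> \<le> C) at_infinity"
      using C far
    proof eventually_elim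
      case (elim z)
      define \<rho> where "\<rho> = cmod z - 1 / r"
      have \<rho>: "\<rho> > 0" using elim by (simp add: \<rho>_def)
      have inb: "w \<noteq> 0 \<and> 1 / w \<in> ball 0 r" if "w \<in> ball z \<rho>" for w
      proof -
        have "cmod z \<le> dist z w + cmod w" using norm_triangle_ineq[of "z - w" w] by (simp add: dist_norm)
        then have w: "cmod w > 1 / r" using that by (simp add: \<rho>_def)
        moreover have "1 / r > 0" using r by simp
        ultimately have "w \<noteq> 0" by auto
        moreover have "1 / cmod w < r" using w r \<open>w \<noteq> 0\<close> by (simp add: field_simps)
        ultimately show ?thesis by (simp add: norm_divide)
      qed
      have "(\<lambda>w. F (1 / w)) holomorphic_on ball z \<rho>"
      proof -
        have "(F \<circ> (\<lambda>w. 1 / w)) holomorphic_on ball z \<rho>"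
        proof (rule holomorphic_on_compose_gen[OF _ r(2)])
          show "(\<lambda>w. 1 / w) holomorphic_on ball z \<rho>" using inb by (intro holomorphic_intros) blast
          show "(\<lambda>w. 1 / w) ` ball z \<rho> \<subseteq> ball 0 r" using inb by blast
        qed
        then show ?thesis by (simp add: o_def)
      qed
      moreover have "h (1 / w) = Re (F (1 / w))" if "w \<in> ball z \<rho>" for w using inb[OF that] r(3) by blast
      ultimately have hxy: "hx z = Re (deriv (\<lambda>w. F (1 / w)) z)" "hy z = - Im (deriv (\<lambda>w. F (1 / w)) z)"
        using C2(3)[OF \<rho>, of "\<lambda>w. F (1 / w)"] by auto
      have "\<bar>h (1 / z) - h 0\<bar> \<le> cmod (F (1 / z) - F 0)"
        using inb[of z] \<rho> r abs_Re_le_cmod[of "F (1 / z) - F 0"] by simp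
      then have "cmod z * \<bar>h (1 / z) - h 0\<bar> \<le> cmod z * cmod (F (1 / z) - F 0)" by (intro mult_left_mono) auto
      moreover have "(cmod z)\<^sup>2 * \<bar>hx z\<bar> \<le> (cmod z)\<^sup>2 * cmod (deriv (\<lambda>w. F (1 / w)) z)"
        unfolding hxy by (intro mult_left_mono abs_Re_le_cmod) auto
      moreover have "(cmod z)\<^sup>2 * \<bar>hy z\<bar> \<le> (cmod z)\<^sup>2 * cmod (deriv (\<lambda>w. F (1 / w)) z)"
        unfolding hxy abs_minus_cancel by (intro mult_left_mono abs_Im_le_cmod) auto
      ultimately show ?case using elim by linarith
    qed
  qed
  have out: "(cmod (poly (QP n) z))\<^sup>2 < 9" if "z \<notin> - M" for z
  proof -
    have "(cmod (Q n z))\<^sup>2 \<le> 2\<^sup>2" using that mem_M_iff by (intro power_mono) auto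
    then show ?thesis by (simp add: Q_def)
  qed
  have zero: "gam (QP n) 9 z * (hxx z + hyy z) = 0" for z
  proof (cases "z \<in> M")
    case True
    have "eventually (\<lambda>w. gam (QP n) 9 w = 0) (nhds z)"
      using gam_support[OF _ out[of z]] True by (auto elim!: eventually_mono)
    then show ?thesis using eventually_nhds_x_imp_x by fastforce
  qed (simp add: C2(2))
  have op: "open (- M)" using M_closed by (rule open_Compl)
  have "integrable area (\<lambda>z. gam (QP n) 9 z * (hxx z + hyy z))" unfolding zero by simp
  from green_formula[OF _ QP_nz op out C2(1) flat this]
  show "(\<integral>z. (h (1 / z) - h 0) * lap (QP n) 9 z \<partial>area) = 0" "integrable area (\<lambda>z. (h (1 / z) - h 0) * lap (QP n) 9 z)"
    by (auto simp: zero)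
qed

text \<open>Otherwise points with Green function tending to 0 accumulate at a point of M, which is
  nonzero because M contains a disc about 0. Its inverse lies on the frontier of W, and the boundary
  values of h give a contradiction.\<close>

lemma near_boundary:
  fixes h \<phi> \<psi> :: "complex \<Rightarrow> real"
  assumes h: "\<And>\<zeta>. \<zeta> \<in> frontier W \<Longrightarrow> (h \<longlongrightarrow> \<psi> \<zeta>) (at \<zeta> within W)"
    and \<phi>: "continuous_on UNIV \<phi>" "\<And>\<zeta>. \<zeta> \<in> frontier W \<Longrightarrow> \<bar>\<phi> (1 / \<zeta>) - \<psi> \<zeta>\<bar> < \<epsilon>"
  shows "\<exists>\<delta>>0. \<forall>z. z \<notin> M \<longrightarrow> cmod z < 6 \<longrightarrow> green z < \<delta> \<longrightarrow> \<bar>\<phi> z - h (1 / z)\<bar> < \<epsilon>"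
proof (rule ccontr)
  assume neg: "\<not> ?thesis"
  have "\<exists>z. z \<notin> M \<and> cmod z < 6 \<and> green z < 1 / real (Suc k) \<and> \<not> \<bar>\<phi> z - h (1 / z)\<bar> < \<epsilon>" for k
  proof -
    have "1 / real (Suc k) > 0" by simp
    then show ?thesis using neg by blast
  qed
  then obtain z where z: "\<And>k. z k \<notin> M" "\<And>k. cmod (z k) < 6" "\<And>k. green (z k) < 1 / real (Suc k)" "\<And>k. \<not> \<bar>\<phi> (z k) - h (1 / z k)\<bar> < \<epsilon>"
    by metis
  have "\<forall>k. z k \<in> cball 0 6" using z(2) by (simp add: less_imp_le)
  then obtain l r where r: "strict_mono r" and l: "(z \<circ> r) \<longlonglongrightarrow> l"
    using compact_imp_seq_compact[OF compact_cball] unfolding seq_compact_def by blast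
  have gl: "(\<lambda>k. green (z (r k))) \<longlonglongrightarrow> green l"
  proof -
    have "isCont green l" using green_continuous by (simp add: continuous_on_eq_continuous_at)
    from isCont_tendsto_compose[OF this l] show ?thesis by (simp add: o_def)
  qed
  have inv0: "(\<lambda>k. 1 / real (Suc k)) \<longlonglongrightarrow> 0" using LIMSEQ_inverse_real_of_nat by (simp add: inverse_eq_divide)
  have "(\<lambda>k. 1 / real (Suc (r k))) \<longlonglongrightarrow> 0" using LIMSEQ_subseq_LIMSEQ[OF inv0 r] by (simp add: o_def)
  then have "green l \<le> 0" using gl z(3) by (intro LIMSEQ_le[OF gl]) (auto intro: less_imp_le)
  then have lM: "l \<in> M" using green_pos[of l] by linarith
  have l0: "l \<noteq> 0"
  proof
    assume "l = 0"
    then have "eventually (\<lambda>k. cmod ((z \<circ> r) k) < 1/4) sequentially" using tendstoD[OF l, of "1/4"] by simp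
    then obtain k where "cmod (z (r k)) < 1/4" by (auto simp: eventually_sequentially)
    then have "z (r k) \<in> cball 0 (1/4)" by simp
    then show False using M_contains_ball z(1) by blast
  qed
  define w where "w k = 1 / z (r k)" for k
  have wl: "w \<longlonglongrightarrow> 1 / l" unfolding w_def using l l0 by (intro tendsto_intros) (auto simp: o_def)
  have wW: "w k \<in> W" for k using z(1) by (simp add: w_def W_def)
  have lW: "1 / l \<notin> W" using lM l0 by (simp add: W_def)
  have "1 / l \<in> closure W" using wl wW closure_sequential by blast
  then have fr: "1 / l \<in> frontier W" using lW W_open by (simp add: frontier_def interior_open)
  have "filterlim w (at (1 / l) within W) sequentially"
    unfolding filterlim_at
  proof (intro conjI always_eventually allI wl)
    show "w k \<in> W" "w k \<noteq> 1 / l" for k using wW[of k] lW by auto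
  qed
  from filterlim_compose[OF h[OF fr] this] have "(\<lambda>k. h (w k)) \<longlonglongrightarrow> \<psi> (1 / l)" .
  moreover have "(\<lambda>k. \<phi> (z (r k))) \<longlonglongrightarrow> \<phi> l"
  proof -
    have "isCont \<phi> l" using \<phi>(1) by (simp add: continuous_on_eq_continuous_at)
    from isCont_tendsto_compose[OF this l] show ?thesis by (simp add: o_def)
  qed
  ultimately have "(\<lambda>k. \<bar>\<phi> (z (r k)) - h (w k)\<bar>) \<longlonglongrightarrow> \<bar>\<phi> l - \<psi> (1 / l)\<bar>" by (intro tendsto_rabs tendsto_diff)
  then have "\<epsilon> \<le> \<bar>\<phi> l - \<psi> (1 / l)\<bar>" using z(4) by (intro LIMSEQ_le_const) (auto simp: w_def not_less)
  then show False using \<phi>(2)[OF fr] by simp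
qed

text \<open>The support of the level measure has Green function of order d^(-n), so on it \<phi> is
  close to h(1/z), whose mean is exactly h 0.\<close>

lemma level_measure_approx:
  fixes h \<phi> \<psi> :: "complex \<Rightarrow> real"
  assumes h: "harmonic_on W h" "\<And>\<zeta>. \<zeta> \<in> frontier W \<Longrightarrow> (h \<longlongrightarrow> \<psi> \<zeta>) (at \<zeta> within W)"
    and \<phi>: "continuous_on UNIV \<phi>" "\<And>\<zeta>. \<zeta> \<in> frontier W \<Longrightarrow> \<bar>\<phi> (1 / \<zeta>) - \<psi> \<zeta>\<bar> < \<epsilon>"
  shows "eventually (\<lambda>n. \<bar>(\<integral>z. \<phi> z \<partial>level_measure n) - h 0\<bar> \<le> \<epsilon>) sequentially"
proof -
  obtain \<delta> where \<delta>: "\<delta> > 0" "\<And>z. z \<notin> M \<Longrightarrow> cmod z < 6 \<Longrightarrow> green z < \<delta> \<Longrightarrow> \<bar>\<phi> z - h (1 / z)\<bar> < \<epsilon>"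
    using near_boundary[OF h(2) \<phi>] by blast
  \<comment> \<open>On the support |Q_n| < 6 and |z| < 6, so \<open>logp\<close> is at most ln 6 and
    \<open>step_bound\<close> at most ln (2 * 7).\<close>
  have "(\<lambda>n. (ln 6 + ln 14) * (1 / real d) ^ n) \<longlonglongrightarrow> (ln 6 + ln 14) * 0"
    using d by (intro tendsto_mult tendsto_const LIMSEQ_realpow_zero) auto
  then have "eventually (\<lambda>n. (ln 6 + ln 14) * (1 / real d) ^ n < \<delta>) sequentially" using \<delta>(1) by (intro order_tendstoD(2)) auto
  then show ?thesis
  proof eventually_elim
    case (elim n)
    define D where "D = real d ^ n * lap_mass"
    have D: "D > 0" using d lap_mass_pos by (simp add: D_def)
    have pt: "\<bar>(\<phi> z - h 0) * lap (QP n) 9 z - (h (1 / z) - h 0) * lap (QP n) 9 z\<bar> \<le> \<epsilon> * lap (QP n) 9 z" for z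
    proof (cases "lap (QP n) 9 z = 0")
      case False
      note s = lap_Q_support[OF False]
      have "logp (Q n z) \<le> ln 6" unfolding logp_def using s(3) by (intro ln_mono) auto
      moreover have "step_bound z \<le> ln 14" unfolding step_bound_def using s(2) by (intro ln_mono) (auto intro: add_pos_nonneg)
      ultimately have "real d ^ n * green z \<le> ln 6 + ln 14" using green_bound[of n z] by linarith
      then have "green z \<le> (ln 6 + ln 14) * (1 / real d) ^ n" using d by (simp add: field_simps power_divide)
      then have "\<bar>\<phi> z - h (1 / z)\<bar> \<le> \<epsilon>" using \<delta>(2)[OF s(1,2)] elim by simp
      then have "\<bar>\<phi> z - h (1 / z)\<bar> * lap (QP n) 9 z \<le> \<epsilon> * lap (QP n) 9 z" using lap_nonneg by (intro mult_right_mono)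
      moreover have "(\<phi> z - h 0) * lap (QP n) 9 z - (h (1 / z) - h 0) * lap (QP n) 9 z = (\<phi> z - h (1 / z)) * lap (QP n) 9 z"
        by (simp add: left_diff_distrib)
      ultimately show ?thesis using lap_nonneg by (simp add: abs_mult)
    qed simp
    have li: "integrable area (lap (QP n) 9)" by (rule lap_integrable[OF _ QP_nz]) simp
    obtain R where R: "\<And>z. cmod z > R \<Longrightarrow> lap (QP n) 9 z = 0" using lap_compact[OF _ QP_nz, of 9 n] by auto
    have \<phi>i: "integrable area (\<lambda>z. \<phi> z * lap (QP n) 9 z)"
      by (rule area_integrable_compact_support[where R = R]) (use R \<phi>(1) in \<open>auto intro!: continuous_intros gam_continuous\<close>)
    have \<phi>i': "integrable area (\<lambda>z. (\<phi> z - h 0) * lap (QP n) 9 z)"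
      unfolding left_diff_distrib using \<phi>i li by (intro Bochner_Integration.integrable_diff integrable_mult_right)
    note hi = level_measure_harmonic[OF h(1), of n]
    have mass: "(\<integral>z. lap (QP n) 9 z \<partial>area) = D"
      using lap_total_mass[OF QP_nz, of 9 n] degree_critical_value_poly[OF d, of n] by (simp add: D_def)
    have "(\<integral>z. \<phi> z \<partial>level_measure n) - h 0 = (\<integral>z. (\<phi> z - h 0) * lap (QP n) 9 z \<partial>area) / D"
    proof -
      have "(\<integral>z. (\<phi> z - h 0) * lap (QP n) 9 z \<partial>area) = (\<integral>z. \<phi> z * lap (QP n) 9 z \<partial>area) - h 0 * D"
        unfolding left_diff_distrib using \<phi>i li mass by simp
      then show ?thesis
        using D unfolding level_measure_integral[OF borel_measurable_continuous_onI[OF \<phi>(1)], of n] D_def[symmetric] by (simp add: diff_divide_distrib)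
    qed
    also have "\<dots> = (\<integral>z. (\<phi> z - h 0) * lap (QP n) 9 z - (h (1 / z) - h 0) * lap (QP n) 9 z \<partial>area) / D"
      using \<phi>i' hi by simp
    also have "\<bar>\<dots>\<bar> \<le> (\<integral>z. \<epsilon> * lap (QP n) 9 z \<partial>area) / D"
    proof -
      have "\<bar>\<integral>z. (\<phi> z - h 0) * lap (QP n) 9 z - (h (1 / z) - h 0) * lap (QP n) 9 z \<partial>area\<bar> \<le> (\<integral>z. \<bar>(\<phi> z - h 0) * lap (QP n) 9 z - (h (1 / z) - h 0) * lap (QP n) 9 z\<bar> \<partial>area)"
        by (rule integral_abs_bound)
      also have "\<dots> \<le> (\<integral>z. \<epsilon> * lap (QP n) 9 z \<partial>area)"
        using \<phi>i' hi(2) li pt by (intro integral_mono) auto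
      finally show ?thesis using D by (simp add: abs_divide divide_right_mono)
    qed
    also have "\<dots> = \<epsilon>" using D mass by simp
    finally show ?case .
  qed
qed

end

section \<open>Harmonic measure of the escape region\<close>

lemma continuous_on_Fin: "continuous_on S Fin"
proof -
  have "continuous_on UNIV Fin"
    unfolding continuous_on_open_vimage[OF open_UNIV] by (auto simp: open_sphere_def)
  then show ?thesis by (rule continuous_on_subset) simp
qed

lemma continuous_on_chart_infty: "continuous_on S chart_infty"
proof -
  have "continuous_on UNIV chart_infty"
    unfolding continuous_on_open_vimage[OF open_UNIV] by (auto simp: open_sphere_def)
  then show ?thesis by (rule continuous_on_subset) simp
qed

lemma inj_chart_infty: "inj chart_infty"
  by (auto simp: inj_def chart_infty_def split: if_splits)

lemma open_vimage_inverse: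
  assumes "open (S :: complex set)" shows "open {z. z \<noteq> 0 \<and> 1 / z \<in> S}"
proof -
  have "{z. z \<noteq> 0 \<and> 1 / z \<in> S} = (- {0}) \<inter> (\<lambda>z. 1 / z) -` S" by auto
  moreover have "open ((- {0}) \<inter> (\<lambda>z. 1 / z) -` S)"
    by (rule continuous_open_preimage) (auto intro!: continuous_intros assms)
  ultimately show ?thesis by simp
qed

lemma open_image_Fin: assumes "open S" shows "open (Fin ` S)"
proof -
  have "Fin -` Fin ` S = S" "chart_infty -` Fin ` S = {z. z \<noteq> 0 \<and> 1 / z \<in> S}"
    by (auto simp: chart_infty_def split: if_splits)
  then show ?thesis unfolding open_sphere_def using open_vimage_inverse[OF assms] assms by simp
qed

lemma open_image_chart_infty: assumes "open S" shows "open (chart_infty ` S)"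
proof -
  have "chart_infty -` chart_infty ` S = S" using inj_chart_infty by (rule inj_vimage_image_eq)
  moreover have "Fin -` chart_infty ` S = {z. z \<noteq> 0 \<and> 1 / z \<in> S}"
  proof (intro set_eqI iffI)
    fix z assume "z \<in> {z. z \<noteq> 0 \<and> 1 / z \<in> S}"
    then have "Fin z = chart_infty (1 / z)" "1 / z \<in> S" by (auto simp: chart_infty_def)
    then show "z \<in> Fin -` chart_infty ` S" by auto
  qed (auto simp: chart_infty_def split: if_splits)
  ultimately show ?thesis unfolding open_sphere_def using open_vimage_inverse[OF assms] assms by simp
qed

text \<open>For the two charts this transports closures and frontiers from the sphere to the
  plane.\<close>

lemma vimage_closure_open_map:
  assumes c: "continuous_on UNIV f" and o: "\<And>S. open S \<Longrightarrow> open (f ` S)"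
  shows "f -` closure D = closure (f -` D)"
proof (intro set_eqI iffI)
  fix x assume x: "x \<in> f -` closure D"
  have "f -` D \<inter> A \<noteq> {}" if "S \<subseteq> A" "open S" "x \<in> S" for A S
  proof -
    have "D \<inter> f ` S \<noteq> {}" using x o[OF that(2)] that(3) closure_iff_nhds_not_empty[of "f x" D] by auto
    then show ?thesis using that(1) by auto
  qed
  then show "x \<in> closure (f -` D)" unfolding closure_iff_nhds_not_empty by blast
next
  fix x assume x: "x \<in> closure (f -` D)"
  have "D \<inter> A \<noteq> {}" if "S \<subseteq> A" "open S" "f x \<in> S" for A S
  proof -
    have "open (f -` S)" using c that(2) by (simp add: continuous_on_open_vimage[OF open_UNIV])
    then have "f -` D \<inter> f -` S \<noteq> {}" using x that(3) closure_iff_nhds_not_empty[of x "f -` D"] by auto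
    then show ?thesis using that(1) by auto
  qed
  then show "x \<in> f -` closure D" unfolding vimage_eq closure_iff_nhds_not_empty by blast
qed

lemma vimage_frontier_open_map:
  assumes "continuous_on UNIV f" "\<And>S. open S \<Longrightarrow> open (f ` S)"
  shows "f -` frontier D = frontier (f -` D)"
  unfolding frontier_closures using vimage_closure_open_map[OF assms] by (simp add: vimage_Int vimage_Compl)

lemma eventually_at_chart_infty:
  "eventually P (at (chart_infty w) within D) \<longleftrightarrow> eventually (\<lambda>w. P (chart_infty w)) (at w within chart_infty -` D)"
proof
  assume "eventually P (at (chart_infty w) within D)"
  then obtain S where "open S" "chart_infty w \<in> S" "\<forall>x\<in>S. x \<noteq> chart_infty w \<longrightarrow> x \<in> D \<longrightarrow> P x"
    unfolding eventually_at_topological by blast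
  then show "eventually (\<lambda>w. P (chart_infty w)) (at w within chart_infty -` D)"
    unfolding eventually_at_topological using inj_chart_infty
    by (intro exI[of _ "chart_infty -` S"]) (auto simp: open_sphere_def dest: injD)
next
  assume "eventually (\<lambda>w. P (chart_infty w)) (at w within chart_infty -` D)"
  then obtain S where S: "open S" "w \<in> S" "\<forall>x\<in>S. x \<noteq> w \<longrightarrow> x \<in> chart_infty -` D \<longrightarrow> P (chart_infty x)"
    unfolding eventually_at_topological by blast
  then show "eventually P (at (chart_infty w) within D)"
    unfolding eventually_at_topological
    by (intro exI[of _ "chart_infty ` S"]) (auto intro: open_image_chart_infty)
qed

lemma harmonic_imp_subharmonic:
  assumes h: "harmonic_on S h"
  shows "subharmonic_on S (\<lambda>z. ereal (h z - c))"
  unfolding subharmonic_on_def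
proof (intro conjI ballI)
  fix z assume z: "z \<in> S"
  have S: "open S" using h by (rule harmonic_on_open)
  have hc: "continuous_on S (\<lambda>z. h z - c)" using harmonic_on_continuous[OF h] by (intro continuous_intros)
  then show "Limsup (at z) (\<lambda>z. ereal (h z - c)) \<le> ereal (h z - c)"
    using S z by (intro Limsup_at_ereal[where f = "\<lambda>z. h z - c"]) (simp add: continuous_on_eq_continuous_at)
  obtain \<rho> where \<rho>: "\<rho> > 0" "ball z \<rho> \<subseteq> S" "\<forall>r. 0 < r \<and> r < \<rho> \<longrightarrow> (\<integral>t. h (z + of_real r * cis t) \<partial>circ) = h z"
    using harmonic_on_imp_mean_value[OF h] z unfolding mean_value_on_def by blast
  have "ereal (h z - c) \<le> circle_mean (\<lambda>z. ereal (h z - c)) z r" if "0 \<le> r \<and> r < \<rho>" for r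
  proof -
    have sph: "sphere z \<bar>r\<bar> \<subseteq> S" using \<rho>(2) that by auto
    have "circle_mean (\<lambda>z. ereal (h z - c)) z r = ereal (\<integral>t. h (z + of_real r * cis t) - c \<partial>circ)"
      by (rule circle_mean_ereal[OF continuous_on_subset[OF hc sph]])
    also have "(\<integral>t. h (z + of_real r * cis t) - c \<partial>circ) = h z - c"
    proof (cases "r = 0")
      case True
      then show ?thesis using circ.prob_space by simp
    next
      case False
      have "integrable circ (\<lambda>t. h (z + of_real r * cis t))"
        by (intro circ_integrable_continuous continuous_on_circle continuous_on_subset[OF harmonic_on_continuous[OF h] sph])
      then show ?thesis using \<rho>(3) that False circ.prob_space by simp
    qed
    finally show ?thesis by simp
  qed
  then show "\<exists>\<rho>>0. ball z \<rho> \<subseteq> S \<and> (\<forall>r. 0 \<le> r \<and> r < \<rho> \<longrightarrow> ereal (h z - c) \<le> circle_mean (\<lambda>z. ereal (h z - c)) z r)"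
    using \<rho> by blast
qed simp

primrec from_infty :: "sphere \<Rightarrow> complex" where
  "from_infty (Fin z) = 1 / z"
| "from_infty Infty = 0"

lemma from_infty_chart [simp]: "from_infty (chart_infty w) = w"
  by (simp add: chart_infty_def)

primrec to_plane :: "sphere \<Rightarrow> complex" where
  "to_plane (Fin z) = z"
| "to_plane Infty = 0"

lemma continuous_on_to_plane: "S \<subseteq> range Fin \<Longrightarrow> continuous_on S to_plane"
proof (rule continuous_on_subset)
  have o: "open (range Fin)" by (rule open_image_Fin) simp
  have "to_plane -` B \<inter> range Fin = Fin ` B" for B by auto
  then show "continuous_on (range Fin) to_plane"
    unfolding continuous_on_open_vimage[OF o] using open_image_Fin by simp
qed

text \<open>The functions max(0, 1 - k dist) decrease to the indicator function of F on the
  frontier. Perron values of continuous data therefore determine the measure on closed sets, an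
  intersection-stable generator; this makes the definite description in
  \<open>harmonic_measure\<close> meaningful.\<close>

lemma harmonic_measure_determines:
  assumes \<mu>: "is_harmonic_measure D z \<mu>" and fr: "frontier D \<subseteq> range Fin"
    and F: "closed F" "Fin -` F \<noteq> {}"
  shows "(\<lambda>k. real_of_ereal (perron D (\<lambda>x. max 0 (1 - real k * infdist (to_plane x) (Fin -` F))) z)) \<longlonglongrightarrow> measure \<mu> F"
proof -
  interpret \<mu>: prob_space \<mu> using \<mu> by (simp add: is_harmonic_measure_def)
  have sets [simp, measurable_cong]: "sets \<mu> = sets borel" and null: "emeasure \<mu> (- frontier D) = 0"
    using \<mu> by (auto simp: is_harmonic_measure_def)
  define f where "f k x = max 0 (1 - real k * infdist (to_plane x) (Fin -` F))" for k x
  have fc: "continuous_on (frontier D) (f k)" for k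
    unfolding f_def by (intro continuous_intros continuous_on_to_plane fr)
  have eq: "real_of_ereal (perron D (f k) z) = (LINT \<zeta>:frontier D|\<mu>. f k \<zeta>)" for k
    using \<mu> fc[of k] by (simp add: is_harmonic_measure_def)
  have AE: "AE x in \<mu>. x \<in> frontier D"
    by (rule AE_I[where N = "- frontier D"]) (use null in auto)
  have cF: "closed (Fin -` F)"
    using F(1) continuous_on_Fin[of UNIV] by (simp add: continuous_on_closed_vimage[OF closed_UNIV])
  have "(\<lambda>k. \<integral>\<zeta>. indicator (frontier D) \<zeta> *\<^sub>R f k \<zeta> \<partial>\<mu>) \<longlonglongrightarrow> (\<integral>\<zeta>. indicator F \<zeta> \<partial>\<mu>)"
  proof (rule integral_dominated_convergence[where w = "\<lambda>_. 1"])
    show "(\<lambda>\<zeta>. indicator F \<zeta> :: real) \<in> borel_measurable \<mu>"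
      using F(1) by (intro borel_measurable_indicator) simp
    show "(\<lambda>\<zeta>. indicator (frontier D) \<zeta> *\<^sub>R f k \<zeta>) \<in> borel_measurable \<mu>" for k
      using borel_measurable_continuous_on_indicator[OF _ fc[of k]] by simp
    show "AE x in \<mu>. (\<lambda>k. indicator (frontier D) x *\<^sub>R f k x) \<longlonglongrightarrow> indicator F x"
      using AE
    proof eventually_elim
      case (elim x)
      then obtain c where c: "x = Fin c" using fr by auto
      show ?case
      proof (cases "x \<in> F")
        case True
        then have "infdist c (Fin -` F) = 0" using c by (intro infdist_zero) simp
        then have "f k x = 1" for k using c by (simp add: f_def)
        then show ?thesis using True elim by simp
      next
        case False
        then have "infdist c (Fin -` F) > 0" using c by (intro infdist_pos_not_in_closed cF F(2)) simp
        then obtain K :: nat where K: "1 / infdist c (Fin -` F) < real K" using reals_Archimedean2 by blast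
        have "f k x = 0" if "k \<ge> K" for k
        proof -
          have "1 / infdist c (Fin -` F) < real k" using K that by simp
          then have "1 < real k * infdist c (Fin -` F)" using \<open>infdist c (Fin -` F) > 0\<close> by (simp add: field_simps)
          then show ?thesis using c by (simp add: f_def)
        qed
        then have "eventually (\<lambda>k. indicator (frontier D) x *\<^sub>R f k x = 0) sequentially"
          unfolding eventually_sequentially by auto
        then show ?thesis using False by (simp add: tendsto_eventually)
      qed
    qed
    show "AE x in \<mu>. norm (indicator (frontier D) x *\<^sub>R f k x) \<le> 1" for k
      by (intro always_eventually allI) (auto simp: f_def indicator_def infdist_nonneg)
  qed simp
  then show ?thesis
    using F(1) unfolding f_def[symmetric] eq set_lebesgue_integral_def by simp
qed

lemma harmonic_measure_unique:
  assumes \<mu>: "is_harmonic_measure D z \<mu>" and \<nu>: "is_harmonic_measure D z \<nu>" and fr: "frontier D \<subseteq> range Fin"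
  shows "\<mu> = \<nu>"
proof (rule measure_eqI_generator_eq[of "Collect closed" UNIV _ _ "\<lambda>_. UNIV"])
  interpret \<mu>: prob_space \<mu> using \<mu> by (simp add: is_harmonic_measure_def)
  interpret \<nu>: prob_space \<nu> using \<nu> by (simp add: is_harmonic_measure_def)
  show "sets \<mu> = sigma_sets UNIV (Collect closed)" "sets \<nu> = sigma_sets UNIV (Collect closed)"
    using \<mu> \<nu> by (auto simp: is_harmonic_measure_def borel_eq_closed)
  show "Int_stable (Collect closed :: sphere set set)" by (auto simp: Int_stable_def)
  show "emeasure \<mu> UNIV \<noteq> \<infinity>" using \<mu>.emeasure_finite[of UNIV] by simp
  fix F :: "sphere set" assume "F \<in> Collect closed"
  then have F: "closed F" by simp
  show "emeasure \<mu> F = emeasure \<nu> F"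
  \<comment> \<open>A closed set without finite points is treated apart: \<open>infdist\<close> to
    the empty set is 0, so the approximating functions would be constantly 1.\<close>
  proof (cases "Fin -` F = {}")
    case True
    have sub: "F \<subseteq> - frontier D"
    proof (intro subsetI ComplI)
      fix x assume x: "x \<in> F" "x \<in> frontier D"
      then have "x \<in> range Fin" using fr by (rule_tac subsetD)
      then obtain c where "x = Fin c" by (rule rangeE)
      then have "c \<in> Fin -` F" using x(1) by simp
      then show False using True by simp
    qed
    have "emeasure \<mu> (- frontier D) = 0" "emeasure \<nu> (- frontier D) = 0"
      "- frontier D \<in> sets \<mu>" "- frontier D \<in> sets \<nu>"
      using \<mu> \<nu> by (auto simp: is_harmonic_measure_def)
    then show ?thesis using emeasure_mono[OF sub, of \<mu>] emeasure_mono[OF sub, of \<nu>] by simp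
  next
    case False
    have "measure \<mu> F = measure \<nu> F"
      by (rule LIMSEQ_unique[OF harmonic_measure_determines[OF \<mu> fr F False] harmonic_measure_determines[OF \<nu> fr F False]])
    then show ?thesis by (simp add: \<mu>.emeasure_eq_measure \<nu>.emeasure_eq_measure)
  qed
qed auto

context unicritical_family
begin

section \<open>Perron solutions at infinity and harmonic measure\<close>

abbreviation "D \<equiv> - Fin ` M"

lemma vimage_D: "Fin -` D = - M" "chart_infty -` D = W"
  by (auto simp: chart_infty_def W_def split: if_splits)

lemma Fin_vimage_frontier: "Fin -` frontier D = frontier M"
  using vimage_frontier_open_map[OF continuous_on_Fin open_image_Fin, of D] by (simp only: vimage_D frontier_complement)

lemma chart_vimage_frontier: "chart_infty -` frontier D = frontier W"
  using vimage_frontier_open_map[OF continuous_on_chart_infty open_image_chart_infty, of D] by (simp only: vimage_D)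

lemma D_open: "open D"
  unfolding open_sphere_def vimage_D using open_Compl[OF M_closed] W_open by simp

lemma frontier_D_Fin: "frontier D \<subseteq> Fin ` M"
  using D_open by (auto simp: frontier_def interior_open)

lemma frontier_D_chart:
  assumes "\<zeta> \<in> frontier D"
  obtains w where "\<zeta> = chart_infty w" "w \<in> frontier W"
proof -
  obtain c where c: "\<zeta> = Fin c" using frontier_D_Fin assms by auto
  then have cf: "c \<in> frontier M" using assms Fin_vimage_frontier by auto
  have "c \<noteq> 0"
  proof
    assume "c = 0"
    have "ball 0 (1/4) \<subseteq> interior M" using M_contains_ball by (intro interior_maximal) auto
    then have "c \<in> interior M" using \<open>c = 0\<close> by auto
    then show False using cf by (simp add: frontier_def)
  qed
  then have "\<zeta> = chart_infty (1 / c)" using c by (simp add: chart_infty_def)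
  then show ?thesis using that[of "1 / c"] assms chart_vimage_frontier by auto
qed

text \<open>Every competitor of the Perron family is below h + \<epsilon> by the maximum principle
  in the chart at infinity, where the domain is the bounded set W.\<close>

lemma perron_upper:
  fixes h :: "complex \<Rightarrow> real"
  assumes h: "harmonic_on W h" "\<And>\<zeta>. \<zeta> \<in> frontier W \<Longrightarrow> (h \<longlongrightarrow> \<psi> \<zeta>) (at \<zeta> within W)"
    and \<phi>: "\<And>\<zeta>. \<zeta> \<in> frontier W \<Longrightarrow> \<bar>\<phi> (chart_infty \<zeta>) - \<psi> \<zeta>\<bar> \<le> \<epsilon>"
  shows "perron D \<phi> Infty \<le> ereal (h 0 + \<epsilon>)"
  unfolding perron_def
proof (rule SUP_least)
  fix u assume "u \<in> {u. subharmonic_on_sphere D u \<and> (\<forall>\<zeta>\<in>frontier D. Limsup (at \<zeta> within D) u \<le> ereal (\<phi> \<zeta>))}"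
  then have u: "subharmonic_on W (u \<circ> chart_infty)" and b: "\<And>\<zeta>. \<zeta> \<in> frontier D \<Longrightarrow> Limsup (at \<zeta> within D) u \<le> ereal (\<phi> \<zeta>)"
    by (auto simp: subharmonic_on_sphere_def vimage_D)
  have hc: "continuous_on W h" by (rule harmonic_on_continuous[OF h(1)])
  have "(u \<circ> chart_infty) 0 \<le> ereal (h 0 + \<epsilon>)"
  proof (rule maximum_principle[OF W_bounded W_open])
    show "(u \<circ> chart_infty) z < \<infinity>" "Limsup (at z) (u \<circ> chart_infty) \<le> (u \<circ> chart_infty) z" if "z \<in> W" for z
      using u that by (auto simp: subharmonic_on_def)
    show "\<exists>\<rho>>0. \<forall>r. 0 < r \<and> r < \<rho> \<longrightarrow> (u \<circ> chart_infty) z \<le> circle_mean (u \<circ> chart_infty) z r" if z: "z \<in> W" for z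
    proof -
      obtain \<rho> where "\<rho> > 0" "\<forall>r. 0 \<le> r \<and> r < \<rho> \<longrightarrow> (u \<circ> chart_infty) z \<le> circle_mean (u \<circ> chart_infty) z r"
        using u z unfolding subharmonic_on_def by blast
      then show ?thesis by (intro exI[of _ \<rho>]) auto
    qed
    show "continuous_on W (\<lambda>z. h z + \<epsilon>)" by (intro continuous_intros hc)
    show "0 \<in> W" by (simp add: W_def)
    show "\<exists>\<rho>>0. \<forall>r. 0 < r \<and> r < \<rho> \<longrightarrow> (\<integral>t. h (z + of_real r * cis t) + \<epsilon> \<partial>circ) \<le> h z + \<epsilon>" if z: "z \<in> W" for z
    proof -
      obtain \<rho> where \<rho>: "\<rho> > 0" "ball z \<rho> \<subseteq> W" "\<forall>r. 0 < r \<and> r < \<rho> \<longrightarrow> (\<integral>t. h (z + of_real r * cis t) \<partial>circ) = h z"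
        using harmonic_on_imp_mean_value[OF h(1)] z unfolding mean_value_on_def by blast
      have "(\<integral>t. h (z + of_real r * cis t) + \<epsilon> \<partial>circ) \<le> h z + \<epsilon>" if "0 < r \<and> r < \<rho>" for r
      proof -
        have "sphere z \<bar>r\<bar> \<subseteq> W" using \<rho>(2) that by auto
        then have "integrable circ (\<lambda>t. h (z + of_real r * cis t))"
          by (intro circ_integrable_continuous continuous_on_circle continuous_on_subset[OF hc])
        then show ?thesis using \<rho>(3) that circ.prob_space by simp
      qed
      then show ?thesis using \<rho>(1) by blast
    qed
    fix \<zeta> and e :: real assume \<zeta>: "\<zeta> \<in> frontier W" and e: "e > 0"
    have "chart_infty \<zeta> \<in> frontier D" using \<zeta> chart_vimage_frontier by auto
    from b[OF this] have "Limsup (at (chart_infty \<zeta>) within D) u < ereal (\<phi> (chart_infty \<zeta>) + e / 2)"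
      by (rule le_less_trans) (use e in simp)
    then have "eventually (\<lambda>x. u x < ereal (\<phi> (chart_infty \<zeta>) + e / 2)) (at (chart_infty \<zeta>) within D)"
      by (rule Limsup_lessD)
    then have 1: "eventually (\<lambda>z. u (chart_infty z) < ereal (\<phi> (chart_infty \<zeta>) + e / 2)) (at \<zeta> within W)"
      unfolding eventually_at_chart_infty vimage_D .
    have 2: "eventually (\<lambda>z. \<psi> \<zeta> - e / 2 < h z) (at \<zeta> within W)"
      by (rule order_tendstoD(1)[OF h(2)[OF \<zeta>]]) (use e in simp)
    show "eventually (\<lambda>z. (u \<circ> chart_infty) z \<le> ereal (h z + \<epsilon> + e)) (at \<zeta> within W)"
      using 1 2
    proof eventually_elim
      case (elim z)
      have "\<phi> (chart_infty \<zeta>) + e / 2 \<le> h z + \<epsilon> + e" using elim(2) \<phi>[OF \<zeta>] by linarith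
      then have "ereal (\<phi> (chart_infty \<zeta>) + e / 2) \<le> ereal (h z + \<epsilon> + e)" by simp
      with elim(1) show ?case unfolding comp_def by (meson less_imp_le order_trans)
    qed
  qed
  then show "u Infty \<le> ereal (h 0 + \<epsilon>)" by (simp add: chart_infty_def)
qed

text \<open>h - \<epsilon>, read on the sphere, is itself a competitor.\<close>

lemma perron_lower:
  fixes h :: "complex \<Rightarrow> real"
  assumes h: "harmonic_on W h" "\<And>\<zeta>. \<zeta> \<in> frontier W \<Longrightarrow> (h \<longlongrightarrow> \<psi> \<zeta>) (at \<zeta> within W)"
    and \<phi>: "\<And>\<zeta>. \<zeta> \<in> frontier W \<Longrightarrow> \<bar>\<phi> (chart_infty \<zeta>) - \<psi> \<zeta>\<bar> \<le> \<epsilon>"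
  shows "ereal (h 0 - \<epsilon>) \<le> perron D \<phi> Infty"
proof -
  define u where "u x = ereal (h (from_infty x) - \<epsilon>)" for x
  have M0: "0 \<in> M" using M_contains_ball by auto
  have H: "harmonic_on (- M) (\<lambda>z. h (1 / z))"
  proof (rule harmonic_on_compose[OF h(1)])
    show "(\<lambda>z. 1 / z) holomorphic_on - M" using M0 by (intro holomorphic_intros) auto
    show "open (- M)" using M_closed by (rule open_Compl)
    show "(\<lambda>z. 1 / z) ` (- M) \<subseteq> W" by (auto simp: W_def)
  qed
  have "subharmonic_on_sphere D u"
    unfolding subharmonic_on_sphere_def vimage_D
    using harmonic_imp_subharmonic[OF H, of \<epsilon>] harmonic_imp_subharmonic[OF h(1), of \<epsilon>] by (simp add: u_def comp_def)
  moreover have "Limsup (at x within D) u \<le> ereal (\<phi> x)" if x: "x \<in> frontier D" for x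
  proof -
    obtain \<zeta> where \<zeta>: "x = chart_infty \<zeta>" "\<zeta> \<in> frontier W" using frontier_D_chart[OF x] .
    have "eventually (\<lambda>y. u y < c) (at x within D)" if c: "ereal (\<phi> x) < c" for c
    proof -
      obtain e where e: "ereal e < c" "\<phi> x < e" using ereal_dense2[OF c] by auto
      have "\<psi> \<zeta> < e + \<epsilon>" using e(2) \<phi>[OF \<zeta>(2)] \<zeta>(1) by auto
      from order_tendstoD(2)[OF h(2)[OF \<zeta>(2)] this]
      have "eventually (\<lambda>w. u (chart_infty w) < c) (at \<zeta> within W)"
      proof (rule eventually_mono)
        fix w assume "h w < e + \<epsilon>"
        then have "u (chart_infty w) < ereal e" by (simp add: u_def)
        then show "u (chart_infty w) < c" using e(1) by (rule less_trans)
      qed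
      then show ?thesis unfolding \<zeta>(1) eventually_at_chart_infty vimage_D .
    qed
    then show ?thesis unfolding Limsup_le_iff by blast
  qed
  ultimately have "u Infty \<le> perron D \<phi> Infty"
    unfolding perron_def by (intro SUP_upper) auto
  then show ?thesis by (simp add: u_def)
qed

text \<open>For data close to an exponential sum on the frontier, the Perron value and the limit of
  the level integrals both lie within \<epsilon> of h 0, the value at infinity of the solution with
  the exponential sum as data; then \<epsilon> tends to 0.\<close>

lemma perron_limit:
  assumes N: "\<And>f :: complex \<Rightarrow> real. continuous_on UNIV f \<Longrightarrow> bounded (range f) \<Longrightarrow> (\<lambda>n. \<integral>z. f z \<partial>level_measure (r n)) \<longlonglongrightarrow> (\<integral>z. f z \<partial>N)"
    and r: "strict_mono (r :: nat \<Rightarrow> nat)"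
    and \<phi>: "continuous_on UNIV \<phi>" "bounded (range (\<phi> :: complex \<Rightarrow> real))" "\<And>z. z \<in> frontier M \<Longrightarrow> \<Phi> (Fin z) = \<phi> z"
  shows "perron D \<Phi> Infty = ereal (\<integral>z. \<phi> z \<partial>N)"
proof -
  define I where "I = (\<integral>z. \<phi> z \<partial>N)"
  have F: "\<zeta> \<noteq> 0 \<and> \<Phi> (chart_infty \<zeta>) = \<phi> (1 / \<zeta>)" if "\<zeta> \<in> frontier W" for \<zeta>
  proof -
    have z: "\<zeta> \<noteq> 0" using W_frontier[OF that] by simp
    then have c: "chart_infty \<zeta> = Fin (1 / \<zeta>)" by (simp add: chart_infty_def)
    have "chart_infty \<zeta> \<in> frontier D" using that chart_vimage_frontier by auto
    then have "1 / \<zeta> \<in> frontier M" unfolding c using Fin_vimage_frontier by auto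
    then show ?thesis using \<phi>(3) c z by simp
  qed
  have bd: "ereal (I - 2 * \<epsilon>) \<le> perron D \<Phi> Infty \<and> perron D \<Phi> Infty \<le> ereal (I + 2 * \<epsilon>)" if \<epsilon>: "\<epsilon> > 0" for \<epsilon>
  proof -
    have "compact (frontier W)" using W_bounded by (rule compact_frontier_bounded)
    moreover have "continuous_on (frontier W) (\<lambda>\<zeta>. \<phi> (1 / \<zeta>))"
      by (rule continuous_on_compose2[OF \<phi>(1)]) (use F in \<open>auto intro!: continuous_intros\<close>)
    ultimately obtain \<psi> where \<psi>: "exp_span \<psi>" "\<forall>\<zeta>\<in>frontier W. \<bar>\<phi> (1 / \<zeta>) - \<psi> \<zeta>\<bar> < \<epsilon>"
      using exp_span_dense[OF _ _ \<epsilon>] by blast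
    obtain h where h: "harmonic_on W h" "\<And>\<zeta>. \<zeta> \<in> frontier W \<Longrightarrow> (h \<longlongrightarrow> \<psi> \<zeta>) (at \<zeta> within W)"
      using W_dirichlet[OF \<psi>(1)] by blast
    have "eventually (\<lambda>n. \<bar>(\<integral>z. \<phi> z \<partial>level_measure n) - h 0\<bar> \<le> \<epsilon>) sequentially"
      by (rule level_measure_approx[OF h \<phi>(1)]) (use \<psi>(2) in blast)+
    then have ev: "eventually (\<lambda>n. \<bar>(\<integral>z. \<phi> z \<partial>level_measure (r n)) - h 0\<bar> \<le> \<epsilon>) sequentially"
      using filterlim_subseq[OF r] unfolding filterlim_iff by blast
    have "(\<lambda>n. \<bar>(\<integral>z. \<phi> z \<partial>level_measure (r n)) - h 0\<bar>) \<longlonglongrightarrow> \<bar>I - h 0\<bar>"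
      unfolding I_def by (intro tendsto_rabs tendsto_diff N \<phi> tendsto_const)
    then have "\<bar>I - h 0\<bar> \<le> \<epsilon>" using ev by (rule tendsto_upperbound) simp
    moreover have b: "\<bar>\<Phi> (chart_infty \<zeta>) - \<psi> \<zeta>\<bar> \<le> \<epsilon>" if "\<zeta> \<in> frontier W" for \<zeta>
      using \<psi>(2) F[OF that] that by (auto intro: less_imp_le)
    ultimately have "ereal (I - 2 * \<epsilon>) \<le> ereal (h 0 - \<epsilon>)" "ereal (h 0 + \<epsilon>) \<le> ereal (I + 2 * \<epsilon>)" by auto
    then show ?thesis using perron_lower[OF h b] perron_upper[OF h b] by (meson order_trans)
  qed
  then obtain p where p: "perron D \<Phi> Infty = ereal p" using bd[of 1] by (cases "perron D \<Phi> Infty") auto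
  have "\<bar>p - I\<bar> \<le> 0 + e" if "e > 0" for e using bd[of "e / 2"] that unfolding p by (simp add: abs_le_iff)
  then have "\<bar>p - I\<bar> \<le> 0" by (rule field_le_epsilon)
  then show ?thesis using p by (simp add: I_def)
qed

text \<open>A weak limit N of the level measures represents the Perron values at infinity, hence
  satisfies the definition of harmonic measure, and uniqueness identifies the two.\<close>

theorem harmonic_measure_level_limit:
  obtains r where "strict_mono (r :: nat \<Rightarrow> nat)"
    "\<And>\<phi> :: sphere \<Rightarrow> real. continuous_on UNIV \<phi> \<Longrightarrow> bounded (range (\<phi> \<circ> Fin)) \<Longrightarrow>
       (\<lambda>n. \<integral>z. \<phi> (Fin z) \<partial>level_measure (r n)) \<longlonglongrightarrow> (\<integral>w. \<phi> w \<partial>harmonic_measure D Infty)"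
proof -
  have "AE z in level_measure n. cmod z < 6" for n
  proof (rule AE_level_measure)
    show "{z::complex. cmod z < 6} \<in> sets borel" by measurable
  qed (rule lap_Q_support(2))
  from bounded_measures_subconvergent[of level_measure, OF level_measure_prob sets_level_measure this]
  obtain r N where r: "strict_mono (r :: nat \<Rightarrow> nat)" and N: "prob_space N" "sets N = sets borel"
    and lim: "\<forall>f :: complex \<Rightarrow> real. continuous_on UNIV f \<longrightarrow> bounded (range f) \<longrightarrow> (\<lambda>n. \<integral>z. f z \<partial>level_measure (r n)) \<longlonglongrightarrow> (\<integral>z. f z \<partial>N)"
    by blast
  interpret N: prob_space N by fact
  note [simp, measurable_cong] = N(2)
  have lim': "(\<lambda>n. \<integral>z. f z \<partial>level_measure (r n)) \<longlonglongrightarrow> (\<integral>z. f z \<partial>N)" if "continuous_on UNIV f" "bounded (range f)" for f :: "complex \<Rightarrow> real"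
    using lim that by blast
  have P: "perron D \<Phi> Infty = ereal (\<integral>z. \<phi> z \<partial>N)"
    if "continuous_on UNIV \<phi>" "bounded (range \<phi>)" "\<And>z. z \<in> frontier M \<Longrightarrow> \<Phi> (Fin z) = \<phi> z" for \<phi> \<Phi>
    by (rule perron_limit[OF lim' r that])
  have Fm: "Fin \<in> borel_measurable N"
    using borel_measurable_continuous_onI[OF continuous_on_Fin] by (simp cong: measurable_cong_sets)
  have fne: "frontier M \<noteq> {}"
  proof -
    have "M \<noteq> {}" using M_contains_ball by auto
    moreover have "M \<noteq> UNIV" using M_compact not_bounded_UNIV compact_imp_bounded by metis
    ultimately show ?thesis by (simp add: frontier_eq_empty)
  qed
  have AE: "AE z in N. z \<in> frontier M"
  proof -
    \<comment> \<open>g vanishes exactly on the frontier, so it has the same Perron value as the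
      zero function. Its integral is therefore 0, which confines N to the frontier.\<close>
    define g where "g z = min 1 (infdist z (frontier M))" for z
    have g: "continuous_on UNIV g" "\<And>z. 0 \<le> g z" "\<And>z. g z \<le> 1"
      by (auto simp: g_def infdist_nonneg intro!: continuous_intros)
    have gb: "bounded (range g)" unfolding bounded_iff using g(2,3) by (intro exI[of _ 1]) auto
    have gi: "integrable N g"
      using g by (intro N.integrable_const_bound[where B = 1]) (auto intro!: borel_measurable_continuous_onI cong: measurable_cong_sets)
    have "perron D (\<lambda>_. 0) Infty = ereal (\<integral>z. g z \<partial>N)"
      by (rule P[OF g(1) gb]) (simp add: g_def)
    moreover have "perron D (\<lambda>_. 0) Infty = ereal (\<integral>z. 0 \<partial>N)"
      by (rule P) auto
    ultimately have "(\<integral>z. g z \<partial>N) = 0" by simp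
    then have "AE z in N. g z = 0" using integral_nonneg_eq_0_iff_AE[OF gi] g(2) by simp
    then show ?thesis
    proof (rule AE_mp, intro always_eventually allI impI)
      fix z assume "g z = 0"
      then have "infdist z (frontier M) = 0" by (simp add: g_def min_def split: if_splits)
      then show "z \<in> frontier M" using in_closed_iff_infdist_zero[OF frontier_closed fne] by simp
    qed
  qed
  define \<mu> where "\<mu> = distr N borel Fin"
  have "is_harmonic_measure D Infty \<mu>"
    unfolding is_harmonic_measure_def
  proof (intro conjI allI impI)
    show "sets \<mu> = sets borel" by (simp add: \<mu>_def)
    show "prob_space \<mu>" unfolding \<mu>_def using Fm by (rule N.prob_space_distr)
    have "emeasure \<mu> (- frontier D) = emeasure N (- frontier M)"
      unfolding \<mu>_def using Fm Fin_vimage_frontier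
      by (subst emeasure_distr) (auto simp: vimage_Compl sets_eq_imp_space_eq[OF N(2)])
    also have "\<dots> = 0"
    proof -
      have "- frontier M \<in> sets N" by simp
      then have "- frontier M \<in> null_sets N" using AE AE_iff_null_sets[of "- frontier M" N] by simp
      then show ?thesis by (rule null_setsD1)
    qed
    finally show "emeasure \<mu> (- frontier D) = 0" .
    fix \<phi> :: "sphere \<Rightarrow> real" assume \<phi>: "continuous_on (frontier D) \<phi>"
    have fc: "continuous_on (frontier M) (\<lambda>z. \<phi> (Fin z))"
      by (rule continuous_on_compose2[OF \<phi> continuous_on_Fin]) (use Fin_vimage_frontier in auto)
    have cpt: "compact (frontier M)" using M_compact by (rule compact_frontier)
    obtain B where B: "0 \<le> B" "\<And>z. z \<in> frontier M \<Longrightarrow> norm (\<phi> (Fin z)) \<le> B"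
    proof -
      have "bounded ((\<lambda>z. \<phi> (Fin z)) ` frontier M)" using compact_continuous_image[OF fc cpt] compact_imp_bounded by blast
      then obtain B where "B > 0" "\<forall>x\<in>(\<lambda>z. \<phi> (Fin z)) ` frontier M. norm x \<le> B" unfolding bounded_pos by blast
      then show ?thesis using that[of B] by auto
    qed
    obtain g where g: "continuous_on UNIV g" "\<And>z. z \<in> frontier M \<Longrightarrow> g z = \<phi> (Fin z)" "\<And>z. norm (g z) \<le> B"
    proof (rule Tietze[OF fc, of UNIV B])
      show "closedin (top_of_set UNIV) (frontier M)" by simp
    qed (use B in auto)
    have "perron D \<phi> Infty = ereal (\<integral>z. g z \<partial>N)"
      by (rule P[OF g(1)]) (use g in \<open>auto simp: bounded_iff\<close>)
    also have "(\<integral>z. g z \<partial>N) = (\<integral>z. indicator (frontier D) (Fin z) *\<^sub>R \<phi> (Fin z) \<partial>N)"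
    proof (rule integral_cong_AE)
      have m: "(\<lambda>x. indicator (frontier D) x *\<^sub>R \<phi> x) \<in> borel_measurable borel"
        by (rule borel_measurable_continuous_on_indicator[OF _ \<phi>]) simp
      show "(\<lambda>z. indicator (frontier D) (Fin z) *\<^sub>R \<phi> (Fin z)) \<in> borel_measurable N"
        using measurable_compose[OF Fm m] .
      show "g \<in> borel_measurable N" using borel_measurable_continuous_onI[OF g(1)] by (simp cong: measurable_cong_sets)
      show "AE z in N. g z = indicator (frontier D) (Fin z) *\<^sub>R \<phi> (Fin z)"
        using AE
      proof eventually_elim
        case (elim z)
        then have "Fin z \<in> frontier D" using Fin_vimage_frontier by auto
        then show ?case using g(2)[OF elim] by simp
      qed
    qed
    also have "\<dots> = (LINT \<zeta>:frontier D|\<mu>. \<phi> \<zeta>)"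
      unfolding \<mu>_def set_lebesgue_integral_def
      by (rule integral_distr[symmetric, OF Fm]) (rule borel_measurable_continuous_on_indicator[OF _ \<phi>], simp)
    finally show "perron D \<phi> Infty = ereal (LINT \<zeta>:frontier D|\<mu>. \<phi> \<zeta>)" .
  qed
  have fr: "frontier D \<subseteq> range Fin" using frontier_D_Fin by blast
  have hm: "harmonic_measure D Infty = \<mu>"
    unfolding harmonic_measure_def
  proof (rule the_equality)
    show "is_harmonic_measure D Infty \<mu>" by fact
    show "\<nu> = \<mu>" if "is_harmonic_measure D Infty \<nu>" for \<nu>
      using that \<open>is_harmonic_measure D Infty \<mu>\<close> fr by (rule harmonic_measure_unique)
  qed
  show ?thesis
  proof (rule that[OF r])
    fix \<phi> :: "sphere \<Rightarrow> real" assume \<phi>: "continuous_on UNIV \<phi>" "bounded (range (\<phi> \<circ> Fin))"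
    have "continuous_on UNIV (\<lambda>z. \<phi> (Fin z))" by (rule continuous_on_compose2[OF \<phi>(1) continuous_on_Fin]) auto
    from lim'[OF this] \<phi>(2) have "(\<lambda>n. \<integral>z. \<phi> (Fin z) \<partial>level_measure (r n)) \<longlonglongrightarrow> (\<integral>z. \<phi> (Fin z) \<partial>N)" by (simp add: comp_def)
    also have "(\<integral>z. \<phi> (Fin z) \<partial>N) = (\<integral>w. \<phi> w \<partial>harmonic_measure D Infty)"
      unfolding hm \<mu>_def by (rule integral_distr[symmetric, OF Fm]) (rule borel_measurable_continuous_onI[OF \<phi>(1)])
    finally show "(\<lambda>n. \<integral>z. \<phi> (Fin z) \<partial>level_measure (r n)) \<longlonglongrightarrow> (\<integral>w. \<phi> w \<partial>harmonic_measure D Infty)" .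
  qed
qed

end

section \<open>Test functions\<close>

lemma dird_has_derivative:
  assumes "(p has_derivative p') (at z)"
  shows "dird p v (p' v) z"
proof -
  interpret bounded_linear p' using assms by (rule has_derivative_bounded_linear)
  have "((\<lambda>t::real. z + of_real t * v) has_derivative (\<lambda>t. of_real t * v)) (at 0)"
    by (auto intro!: derivative_eq_intros)
  from has_derivative_compose[OF this, of p p'] assms
  have "((\<lambda>t::real. p (z + of_real t * v)) has_derivative (\<lambda>t. p' (of_real t * v))) (at 0)" by simp
  then have "((\<lambda>t::real. p (z + of_real t * v)) has_derivative (\<lambda>t. p' v * t)) (at 0)"
    by (rule has_derivative_eq_rhs) (simp add: fun_eq_iff scaleR scaleR_conv_of_real[symmetric])
  then show ?thesis by (simp only: dird_def has_field_derivative_def)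
qed

lemma blinfun_apply_continuous:
  assumes "continuous_on S g" "continuous_on S h"
  shows "continuous_on S (\<lambda>z. blinfun_apply (g z) (h z))"
  by (rule bounded_bilinear.continuous_on[OF bounded_bilinear_blinfun_apply assms])

lemma C2_partials:
  fixes g :: "complex \<Rightarrow> real" and g' :: "complex \<Rightarrow> complex \<Rightarrow>\<^sub>L real" and g'' :: "complex \<Rightarrow> complex \<Rightarrow>\<^sub>L complex \<Rightarrow>\<^sub>L real"
  assumes g: "\<And>z. (g has_derivative blinfun_apply (g' z)) (at z)"
    "\<And>z. (g' has_derivative blinfun_apply (g'' z)) (at z)" "continuous_on UNIV g''"
  shows "C2_on UNIV g (\<lambda>z. g' z 1) (\<lambda>z. g' z \<i>) (\<lambda>z. g'' z 1 1) (\<lambda>z. g'' z \<i> \<i>)"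
    and "dird (\<lambda>z. g' z u) v (g'' z v u) z"
    and "continuous_on UNIV g" "continuous_on UNIV g'"
proof -
  show d: "dird (\<lambda>z. g' z u) v (g'' z v u) z" for u v z
    by (rule dird_has_derivative[OF bounded_linear.has_derivative[OF blinfun.bounded_linear_left g(2)]])
  show c: "continuous_on UNIV g" "continuous_on UNIV g'"
    using has_derivative_continuous[OF g(1)] has_derivative_continuous[OF g(2)]
    by (auto simp: continuous_on_eq_continuous_at)
  show "C2_on UNIV g (\<lambda>z. g' z 1) (\<lambda>z. g' z \<i>) (\<lambda>z. g'' z 1 1) (\<lambda>z. g'' z \<i> \<i>)"
    unfolding C2_on_def
    by (intro conjI ballI d dird_has_derivative g(1) c blinfun_apply_continuous continuous_on_const g(3))
qed

lemma continuous_bounded_cball: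
  fixes g :: "complex \<Rightarrow> 'a :: real_normed_vector"
  assumes "continuous_on UNIV g"
  obtains B where "B > 0" "\<And>z. cmod z \<le> 1 \<Longrightarrow> norm (g z) \<le> B"
proof -
  have "continuous_on (cball 0 1) g" using assms by (rule continuous_on_subset) simp
  then have "bounded (g ` cball 0 1)" using compact_continuous_image compact_imp_bounded compact_cball by blast
  then obtain B where B: "B > 0" "\<forall>x\<in>g ` cball 0 1. norm x \<le> B" unfolding bounded_pos by blast
  have "norm (g z) \<le> B" if "cmod z \<le> 1" for z
  proof -
    have "z \<in> cball 0 1" using that by simp
    then show ?thesis using B(2) by blast
  qed
  then show ?thesis using that B(1) by blast
qed

text \<open>Regularity in the chart at infinity becomes decay in the plane through the chain rule
  for 1/z: the gradient is of order |z|^(-2), the Laplacian of order |z|^(-4), hence bounded by a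
  multiple of \<open>cauchy\<close>.\<close>

lemma C2_sphere_plane:
  assumes "C2_sphere \<phi>"
  obtains fx fy fxx fyy C where "C2_on UNIV (\<phi> \<circ> Fin) fx fy fxx fyy"
    "flat_at_infinity (\<phi> \<circ> Fin) (\<phi> Infty) fx fy" "\<And>z. \<bar>fxx z + fyy z\<bar> \<le> C * cauchy z"
    "continuous_on UNIV \<phi>" "bounded (range (\<phi> \<circ> Fin))"
proof -
  define f where "f = \<phi> \<circ> Fin"
  define F where "F = \<phi> \<circ> chart_infty"
  obtain f' f'' where f: "\<And>z. (f has_derivative blinfun_apply (f' z)) (at z)"
    "\<And>z. (f' has_derivative blinfun_apply (f'' z)) (at z)" "continuous_on UNIV f''"
    using assms unfolding C2_sphere_def C2_def f_def by blast
  obtain F' F'' where F: "\<And>z. (F has_derivative blinfun_apply (F' z)) (at z)"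
    "\<And>z. (F' has_derivative blinfun_apply (F'' z)) (at z)" "continuous_on UNIV F''"
    using assms unfolding C2_sphere_def C2_def F_def by blast
  note fp = C2_partials[OF f] and Fp = C2_partials[OF F]
  have fF: "f z = F (1 / z)" if "z \<noteq> 0" for z using that by (simp add: f_def F_def chart_infty_def)
  have nz: "eventually (\<lambda>y. y \<noteq> 0) (nhds z)" if "z \<noteq> 0" for z :: complex
  proof -
    have "eventually (\<lambda>y. y \<in> - {0}) (nhds z)" by (rule eventually_nhds_in_open) (use that in auto)
    then show ?thesis by simp
  qed
  have inv: "((\<lambda>y. 1 / y) has_derivative (\<lambda>h. - h / z\<^sup>2)) (at z)" if "z \<noteq> 0" for z :: complex
  proof -
    have "((\<lambda>y. 1 / y) has_field_derivative - (1 / z\<^sup>2)) (at z)"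
      using that by (auto intro!: derivative_eq_intros simp: power2_eq_square)
    then show ?thesis
      unfolding has_field_derivative_def by (rule has_derivative_eq_rhs) (simp add: fun_eq_iff)
  qed
  have first: "f' z v = F' (1 / z) (- v / z\<^sup>2)" if z: "z \<noteq> 0" for z v
  proof (rule dird_unique)
    show "dird f v (f' z v) z" by (rule dird_has_derivative[OF f(1)])
    have "((\<lambda>y. F (1 / y)) has_derivative (\<lambda>h. F' (1 / z) (- h / z\<^sup>2))) (at z)"
      using has_derivative_compose[OF inv[OF z], of F "F' (1 / z)"] F(1) by simp
    then have "dird (\<lambda>y. F (1 / y)) v (F' (1 / z) (- v / z\<^sup>2)) z" by (rule dird_has_derivative)
    then show "dird f v (F' (1 / z) (- v / z\<^sup>2)) z"
    proof (rule dird_local)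
      show "eventually (\<lambda>y. F (1 / y) = f y) (nhds z)" using nz[OF z] by eventually_elim (simp add: fF)
    qed
  qed
  have second: "f'' z v v = F'' (1 / z) (- v / z\<^sup>2) (- v / z\<^sup>2) + F' (1 / z) (2 * v\<^sup>2 / z ^ 3)" if z: "z \<noteq> 0" for z v
  proof (rule dird_unique)
    show "dird (\<lambda>y. f' y v) v (f'' z v v) z" by (rule fp(2))
    have 1: "((\<lambda>y. F' (1 / y)) has_derivative (\<lambda>h. F'' (1 / z) (- h / z\<^sup>2))) (at z)"
      using has_derivative_compose[OF inv[OF z], of F' "F'' (1 / z)"] F(2) by simp
    have 2: "((\<lambda>y. - v / y\<^sup>2) has_derivative (\<lambda>h. 2 * v * h / z ^ 3)) (at z)"
    proof -
      have "((\<lambda>y. - v / y\<^sup>2) has_field_derivative 2 * v / z ^ 3) (at z)"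
        using z by (auto intro!: derivative_eq_intros simp: power2_eq_square power3_eq_cube field_simps)
      then show ?thesis
        unfolding has_field_derivative_def by (rule has_derivative_eq_rhs) (simp add: fun_eq_iff)
    qed
    have "((\<lambda>y. F' (1 / y) (- v / y\<^sup>2)) has_derivative
        (\<lambda>h. F' (1 / z) (2 * v * h / z ^ 3) + F'' (1 / z) (- h / z\<^sup>2) (- v / z\<^sup>2))) (at z)"
      by (rule blinfun.FDERIV[OF 1 2])
    from dird_has_derivative[OF this, of v]
    have "dird (\<lambda>y. F' (1 / y) (- v / y\<^sup>2)) v (F'' (1 / z) (- v / z\<^sup>2) (- v / z\<^sup>2) + F' (1 / z) (2 * v\<^sup>2 / z ^ 3)) z"
      by (simp add: power2_eq_square mult.assoc add.commute)
    then show "dird (\<lambda>y. f' y v) v (F'' (1 / z) (- v / z\<^sup>2) (- v / z\<^sup>2) + F' (1 / z) (2 * v\<^sup>2 / z ^ 3)) z"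
    proof (rule dird_local)
      show "eventually (\<lambda>y. F' (1 / y) (- v / y\<^sup>2) = f' y v) (nhds z)" using nz[OF z] by eventually_elim (simp add: first)
    qed
  qed
  obtain B1 where B1: "B1 > 0" "\<And>z. cmod z \<le> 1 \<Longrightarrow> norm (F' z) \<le> B1" using continuous_bounded_cball[OF Fp(4)] by blast
  obtain B2 where B2: "B2 > 0" "\<And>z. cmod z \<le> 1 \<Longrightarrow> norm (F'' z) \<le> B2" using continuous_bounded_cball[OF F(3)] by blast
  obtain b0 where b0: "b0 > 0" "\<And>z. cmod z \<le> 1 \<Longrightarrow> norm (f z) \<le> b0" using continuous_bounded_cball[OF fp(3)] by blast
  obtain B0 where B0: "B0 > 0" "\<And>z. cmod z \<le> 1 \<Longrightarrow> norm (F z) \<le> B0" using continuous_bounded_cball[OF Fp(3)] by blast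
  have lc: "continuous_on UNIV (\<lambda>z. f'' z 1 1 + f'' z \<i> \<i>)"
    by (intro continuous_on_add blinfun_apply_continuous f(3) continuous_on_const)
  obtain b2 where b2: "b2 > 0" "\<And>z. cmod z \<le> 1 \<Longrightarrow> norm (f'' z 1 1 + f'' z \<i> \<i>) \<le> b2" using continuous_bounded_cball[OF lc] by blast
  have far: "z \<noteq> 0 \<and> cmod (1 / z) \<le> 1" if "cmod z \<ge> 1" for z :: complex
    using that by (auto simp: norm_divide divide_le_eq)
  have flat: "flat_at_infinity f (\<phi> Infty) (\<lambda>z. f' z 1) (\<lambda>z. f' z \<i>)"
    unfolding flat_at_infinity_def
  proof (rule exI[of _ B1])
    have "eventually (\<lambda>z::complex. cmod z \<ge> 1) at_infinity" by (auto simp: eventually_at_infinity)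
    then show "eventually (\<lambda>z. cmod z * \<bar>f z - \<phi> Infty\<bar> \<le> B1 \<and> (cmod z)\<^sup>2 * \<bar>f' z 1\<bar> \<le> B1 \<and> (cmod z)\<^sup>2 * \<bar>f' z \<i>\<bar> \<le> B1) at_infinity"
    proof eventually_elim
      case (elim z)
      note z = far[OF elim]
      have "norm (F (1 / z) - F 0) \<le> B1 * norm (1 / z - 0)"
      proof (rule differentiable_bound[of "cball 0 1" F "\<lambda>w. blinfun_apply (F' w)"])
        show "(F has_derivative blinfun_apply (F' w)) (at w within cball 0 1)" for w
          using F(1) by (rule has_derivative_at_withinI)
        show "onorm (blinfun_apply (F' w)) \<le> B1" if "w \<in> cball 0 1" for w
          using B1(2)[of w] that by (simp add: norm_blinfun.rep_eq)
      qed (use z in auto)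
      moreover have "F 0 = \<phi> Infty" by (simp add: F_def chart_infty_def)
      ultimately have a: "cmod z * \<bar>f z - \<phi> Infty\<bar> \<le> B1" using z fF[of z] by (simp add: norm_divide field_simps)
      have "(cmod z)\<^sup>2 * \<bar>f' z v\<bar> \<le> B1" if v: "cmod v = 1" for v
      proof -
        have "\<bar>f' z v\<bar> \<le> norm (F' (1 / z)) * norm (- v / z\<^sup>2)"
          using first[of z v] z norm_blinfun[of "F' (1 / z)" "- v / z\<^sup>2"] by simp
        also have "\<dots> \<le> B1 * norm (- v / z\<^sup>2)" using B1(2)[of "1 / z"] z by (intro mult_right_mono) auto
        also have "norm (- v / z\<^sup>2) = 1 / (cmod z)\<^sup>2" using v by (simp add: norm_divide norm_power)
        finally show ?thesis using z by (simp add: field_simps)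
      qed
      from this[of 1] this[of \<i>] a show ?case by simp
    qed
  qed
  \<comment> \<open>On the unit disc \<open>cauchy\<close> is at least 1/4, whence 4 b2. Outside, 2
    B2 / |z|^4 is at most 8 B2 / (1 + |z|^2)^2.\<close>
  have bound: "\<bar>f'' z 1 1 + f'' z \<i> \<i>\<bar> \<le> (4 * b2 + 8 * B2) * cauchy z" for z
  proof (cases "cmod z \<le> 1")
    case True
    have "(1 + (cmod z)\<^sup>2)\<^sup>2 \<le> (1 + 1)\<^sup>2" using True by (intro power_mono add_mono) (auto simp: power_le_one)
    moreover have "1 / 4 \<le> 1 / q\<^sup>2" if "q\<^sup>2 \<le> (1 + 1)\<^sup>2" "q > 0" for q :: real
      using that by (simp add: divide_simps)
    moreover have "1 + (cmod z)\<^sup>2 > 0" by (simp add: add_pos_nonneg)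
    ultimately have "1 / 4 \<le> 1 / (1 + (cmod z)\<^sup>2)\<^sup>2" by blast
    then have "1 / 4 \<le> cauchy z" using cauchy_ge[of z] by linarith
    then have "4 * b2 * (1 / 4) \<le> 4 * b2 * cauchy z" using b2(1) by (intro mult_left_mono) auto
    moreover have "8 * B2 * cauchy z \<ge> 0" using B2(1) cauchy_pos[of z] by simp
    ultimately show ?thesis using b2(2)[OF True] by (simp add: distrib_right)
  next
    case False
    then have z1: "cmod z \<ge> 1" by simp
    note z = far[OF z1]
    define a where "a = - 1 / z\<^sup>2"
    have na: "cmod a = 1 / (cmod z)\<^sup>2" by (simp add: a_def norm_divide norm_power)
    \<comment> \<open>The first-order terms for the directions 1 and \<open>\<i>\<close> are
      opposite because \<i>^2 = -1: the inversion is conformal, so the Laplacian transforms without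
      lower-order terms.\<close>
    have l2: "f'' z 1 1 + f'' z \<i> \<i> = F'' (1 / z) a a + F'' (1 / z) (\<i> * a) (\<i> * a)"
    proof -
      have "f'' z 1 1 = F'' (1 / z) a a + F' (1 / z) (2 / z ^ 3)" using second[of z 1] z by (simp add: a_def)
      moreover have "f'' z \<i> \<i> = F'' (1 / z) (\<i> * a) (\<i> * a) + F' (1 / z) (- (2 / z ^ 3))"
        using second[of z \<i>] z by (simp add: a_def)
      ultimately show ?thesis by (simp add: blinfun.minus_right)
    qed
    have one: "\<bar>F'' (1 / z) v v\<bar> \<le> B2 * (1 / (cmod z)\<^sup>2)\<^sup>2" if "cmod v = 1 / (cmod z)\<^sup>2" for v
    proof -
      have "\<bar>F'' (1 / z) v v\<bar> \<le> norm (F'' (1 / z) v) * norm v" using norm_blinfun[of "F'' (1 / z) v" v] by simp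
      also have "\<dots> \<le> (norm (F'' (1 / z)) * norm v) * norm v" by (intro mult_right_mono norm_blinfun) auto
      also have "\<dots> \<le> (B2 * norm v) * norm v" using B2(2)[of "1 / z"] z by (intro mult_right_mono) auto
      finally show ?thesis using that by (simp add: power2_eq_square)
    qed
    have "\<bar>f'' z 1 1 + f'' z \<i> \<i>\<bar> \<le> 2 * B2 * (1 / (cmod z)\<^sup>2)\<^sup>2"
      unfolding l2 using one[OF na] one[of "\<i> * a"] na by (simp add: norm_mult)
    also have "(1 / (cmod z)\<^sup>2)\<^sup>2 \<le> 4 * (1 / (1 + (cmod z)\<^sup>2)\<^sup>2)"
    proof -
      have s: "(cmod z)\<^sup>2 \<ge> 1" using z1 by simp
      then have "(1 + (cmod z)\<^sup>2)\<^sup>2 \<le> (2 * (cmod z)\<^sup>2)\<^sup>2" by (intro power_mono) auto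
      then have "(1 + (cmod z)\<^sup>2)\<^sup>2 \<le> 4 * ((cmod z)\<^sup>2)\<^sup>2" by (simp add: power_mult_distrib)
      moreover have "(1 + (cmod z)\<^sup>2)\<^sup>2 > 0" "((cmod z)\<^sup>2)\<^sup>2 > 0" using s by (auto intro!: zero_less_power add_pos_nonneg)
      moreover have "(1 / p)\<^sup>2 \<le> 4 * (1 / q)" if "q \<le> 4 * p\<^sup>2" "q > 0" "p\<^sup>2 > 0" for p q :: real
        using that by (simp add: power_divide divide_simps)
      ultimately show ?thesis by blast
    qed
    then have "2 * B2 * (1 / (cmod z)\<^sup>2)\<^sup>2 \<le> 2 * B2 * (4 * (1 / (1 + (cmod z)\<^sup>2)\<^sup>2))" using B2(1) by (intro mult_left_mono) auto
    also have "\<dots> \<le> 2 * B2 * (4 * cauchy z)" using B2(1) cauchy_ge[of z] by (intro mult_left_mono) auto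
    also have "\<dots> \<le> (4 * b2 + 8 * B2) * cauchy z" using b2(1) cauchy_pos[of z] by (simp add: distrib_right)
    finally show ?thesis .
  qed
  have cont: "continuous_on UNIV \<phi>"
    unfolding continuous_on_open_vimage[OF open_UNIV]
  proof (intro allI impI)
    fix B :: "real set" assume B: "open B"
    have "open (f -` B)" "open (F -` B)" using fp(3) Fp(3) B by (simp_all add: continuous_on_open_vimage[OF open_UNIV])
    then show "open (\<phi> -` B \<inter> UNIV)" by (simp add: open_sphere_def f_def F_def vimage_comp)
  qed
  have "norm (f z) \<le> max b0 B0" for z
  proof (cases "cmod z \<le> 1")
    case False
    then have "z \<noteq> 0" "cmod (1 / z) \<le> 1" using far[of z] by auto
    then show ?thesis using B0(2)[of "1 / z"] fF by simp
  qed (use b0(2)[of z] in simp)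
  then have "bounded (range f)" unfolding bounded_iff by blast
  then show ?thesis
    using fp(1) flat bound cont unfolding f_def by (intro that)
qed

text \<open>Both functions are ln |A| up to bounded errors: the truncation level costs ln 3 < 2 and
  the cut-off at most 1/4 more.\<close>

lemma gam_logp:
  "\<bar>gam A 9 z - logp (poly A z)\<bar> \<le> 3" "0 \<le> gam A 9 z"
proof -
  define a where "a = cmod (poly A z)"
  have l3: "0 < ln (3::real)" "ln (3::real) \<le> 2" using ln_le_minus_one[of "3::real"] by simp_all
  note o = omega0_bounds[of "level A 9 z"]
  show "0 \<le> gam A 9 z" using o(1) by (simp add: gam_def)
  show "\<bar>gam A 9 z - logp (poly A z)\<bar> \<le> 3"
  proof (cases "a = 0")
    case True
    then have "level A 9 z = 0" "logp (poly A z) = 0" by (simp_all add: level_def logp_def a_def)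
    then show ?thesis using o by (simp add: gam_def)
  next
    case False
    then have a: "a > 0" by (simp add: a_def)
    have "(cmod (poly A z))\<^sup>2 / 9 = (a / 3)\<^sup>2" by (simp add: a_def power_divide)
    then have l: "level A 9 z = 2 * (ln a - ln 3)"
      using a ln_realpow[of "a / 3" 2] by (simp add: level_def ln_div)
    have lp: "logp (poly A z) = max 0 (ln a)"
    proof (cases "a \<ge> 1")
      case True
      then show ?thesis by (simp add: logp_def a_def[symmetric] max_def)
    next
      case False
      then show ?thesis using a by (simp add: logp_def a_def[symmetric] max_def)
    qed
    have "\<bar>w / 2 - max 0 x\<bar> \<le> 3" if "0 < t" "t \<le> 2" "0 \<le> w" "w \<le> max 0 (2 * (x - t))" "w \<ge> 2 * (x - t) - 1 / 2" for w x t :: real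
      using that unfolding max_def abs_le_iff by (simp split: if_splits)
    from this[OF l3 o[unfolded l]] show ?thesis unfolding gam_def l lp .
  qed
qed

lemma cauchy_step_bound_integrable: "integrable area (\<lambda>z. cauchy z * step_bound z)"
proof -
  have "step_bound z = ln 2 + ln (1 + cmod z)" for z
    unfolding step_bound_def by (rule ln_mult_pos) (auto intro: add_pos_nonneg)
  then have "(\<lambda>z. cauchy z * step_bound z) = (\<lambda>z. ln 2 * cauchy z + cauchy z * ln (1 + cmod z))"
    by (auto simp: distrib_left)
  then show ?thesis using cauchy_integrable cauchy_log_integrable by simp
qed

lemma cauchy_logp_integrable: "integrable area (\<lambda>z. cauchy z * logp z)"
proof (rule Bochner_Integration.integrable_bound[OF cauchy_log_integrable])
  show "(\<lambda>z. cauchy z * logp z) \<in> borel_measurable area"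
    using borel_measurable_continuous_onI[OF logp_continuous] by measurable
  have "logp z \<le> ln (1 + cmod z)" for z unfolding logp_def by (intro ln_mono) (auto intro: add_pos_nonneg)
  then show "AE z in area. norm (cauchy z * logp z) \<le> norm (cauchy z * ln (1 + cmod z))"
    using cauchy_pos logp_nonneg by (auto simp: abs_mult intro!: always_eventually mult_left_mono)
qed

context unicritical_family
begin

lemma cauchy_green_integrable: "integrable area (\<lambda>z. cauchy z * green z)"
proof (rule Bochner_Integration.integrable_bound)
  show "integrable area (\<lambda>z. cauchy z * logp z + cauchy z * step_bound z)"
    by (intro Bochner_Integration.integrable_add cauchy_logp_integrable cauchy_step_bound_integrable)
  show "(\<lambda>z. cauchy z * green z) \<in> borel_measurable area"
    using borel_measurable_continuous_onI[OF green_continuous] by measurable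
  show "AE z in area. norm (cauchy z * green z) \<le> norm (cauchy z * logp z + cauchy z * step_bound z)"
  proof (intro always_eventually allI)
    fix z
    have "cauchy z * green z \<le> cauchy z * (logp z + step_bound z)"
      using green_le[of z] cauchy_pos[of z] by (intro mult_left_mono) auto
    then show "norm (cauchy z * green z) \<le> norm (cauchy z * logp z + cauchy z * step_bound z)"
      using green_nonneg[of z] cauchy_pos[of z] by (simp add: distrib_left abs_of_nonneg)
  qed
qed

text \<open>By \<open>gam_logp\<close> and \<open>green_bound\<close>, gam of Q_n is d^n times the
  Green function up to 3 + \<open>step_bound\<close>, integrable against the weight uniformly in n.
  Green's identity divided by d^n passes to the limit, along the subsequence on which the level
  measures converge.\<close>

theorem harmonic_measure_laplacian:
  assumes f: "C2_on UNIV (\<phi> \<circ> Fin) fx fy fxx fyy" "flat_at_infinity (\<phi> \<circ> Fin) (\<phi> Infty) fx fy"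
    and C: "\<And>z. \<bar>fxx z + fyy z\<bar> \<le> C * cauchy z"
    and \<phi>: "continuous_on UNIV \<phi>" "bounded (range (\<phi> \<circ> Fin))"
  shows "lap_mass * ((\<integral>w. \<phi> w \<partial>harmonic_measure (- Fin ` M) Infty) - \<phi> Infty) = (\<integral>z. green z * (fxx z + fyy z) \<partial>area)"
proof -
  define \<Delta> where "\<Delta> z = fxx z + fyy z" for z
  have \<Delta>c: "continuous_on UNIV \<Delta>" using f(1) unfolding C2_on_def \<Delta>_def by (intro continuous_intros) auto
  have \<Delta>m [measurable]: "\<Delta> \<in> borel_measurable borel" using \<Delta>c by (rule borel_measurable_continuous_onI)
  have C': "\<bar>\<Delta> z\<bar> \<le> C * cauchy z" for z unfolding \<Delta>_def by (rule C)
  have gm [measurable]: "green \<in> borel_measurable borel" using green_continuous by (rule borel_measurable_continuous_onI)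
  have i\<Delta>: "integrable area (\<lambda>z. p z * \<Delta> z)"
    if p: "integrable area (\<lambda>z. cauchy z * q z)" "p \<in> borel_measurable borel" "\<And>z. \<bar>p z\<bar> \<le> q z" for p q
  proof (rule Bochner_Integration.integrable_bound)
    show "integrable area (\<lambda>z. C * (cauchy z * q z))" using p(1) by (rule integrable_mult_right)
    show "(\<lambda>z. p z * \<Delta> z) \<in> borel_measurable area" using p(2) by measurable
    have "\<bar>p z\<bar> * \<bar>\<Delta> z\<bar> \<le> q z * (C * cauchy z)" for z
      using p(3)[of z] C'[of z] by (intro mult_mono) auto
    moreover have "q z * (C * cauchy z) \<le> \<bar>C * (cauchy z * q z)\<bar>" for z
      by (rule order_trans[OF _ abs_ge_self]) (simp add: ac_simps)
    ultimately show "AE z in area. norm (p z * \<Delta> z) \<le> norm (C * (cauchy z * q z))"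
      by (intro always_eventually allI) (metis abs_mult order_trans real_norm_def)
  qed
  have gi: "integrable area (\<lambda>z. green z * \<Delta> z)"
    by (rule i\<Delta>[OF cauchy_green_integrable gm]) (simp add: green_nonneg)
  have i1: "integrable area (\<lambda>z. cauchy z * (3 + step_bound z))"
    unfolding distrib_left using cauchy_integrable cauchy_step_bound_integrable by simp
  define g where "g n z = gam (QP n) 9 z - real d ^ n * green z" for n z
  have gb: "\<bar>g n z\<bar> \<le> 3 + step_bound z" for n z
    using gam_logp(1)[of "QP n" z] green_bound[of n z] unfolding g_def Q_def by linarith
  have gmm: "g n \<in> borel_measurable borel" for n
    unfolding g_def using borel_measurable_continuous_onI[OF gam_continuous(1)[of 9 "QP n"]] by measurable
  have gi': "integrable area (\<lambda>z. g n z * \<Delta> z)" for n by (rule i\<Delta>[OF i1 gmm gb])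
  have split: "gam (QP n) 9 z * \<Delta> z = g n z * \<Delta> z + real d ^ n * (green z * \<Delta> z)" for n z
    by (simp add: g_def algebra_simps)
  have gami: "integrable area (\<lambda>z. gam (QP n) 9 z * \<Delta> z)" for n
    unfolding split using gi gi' by (intro Bochner_Integration.integrable_add integrable_mult_right)
  have gd: "(\<integral>z. gam (QP n) 9 z * \<Delta> z \<partial>area) = (\<integral>z. g n z * \<Delta> z \<partial>area) + real d ^ n * (\<integral>z. green z * \<Delta> z \<partial>area)" for n
    unfolding split using gi gi' by simp
  have m: "lap_mass * ((\<integral>z. \<phi> (Fin z) \<partial>level_measure n) - \<phi> Infty) = (\<integral>z. g n z * \<Delta> z \<partial>area) * (1 / real d) ^ n + (\<integral>z. green z * \<Delta> z \<partial>area)" for n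
  proof -
    have fc: "continuous_on UNIV (\<phi> \<circ> Fin)" using f(1) by (simp add: C2_on_def)
    have li: "integrable area (lap (QP n) 9)" by (rule lap_integrable[OF _ QP_nz]) simp
    obtain R where R: "\<And>z. cmod z > R \<Longrightarrow> lap (QP n) 9 z = 0" using lap_compact[OF _ QP_nz, of 9 n] by auto
    have \<phi>i: "integrable area (\<lambda>z. (\<phi> \<circ> Fin) z * lap (QP n) 9 z)"
      by (rule area_integrable_compact_support[where R = R])
         (use R in \<open>auto intro!: continuous_on_mult[OF fc] gam_continuous simp del: comp_apply\<close>)
    have mass: "(\<integral>z. lap (QP n) 9 z \<partial>area) = real d ^ n * lap_mass"
      using lap_total_mass[OF QP_nz, of 9 n] degree_critical_value_poly[OF d, of n] by simp
    have "(\<integral>z. ((\<phi> \<circ> Fin) z - \<phi> Infty) * lap (QP n) 9 z \<partial>area) = (\<integral>z. gam (QP n) 9 z * \<Delta> z \<partial>area)"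
      unfolding \<Delta>_def by (rule green_formula(1)[OF _ QP_nz open_UNIV _ f]) (use gami[of n] in \<open>auto simp: \<Delta>_def\<close>)
    also have "(\<integral>z. ((\<phi> \<circ> Fin) z - \<phi> Infty) * lap (QP n) 9 z \<partial>area) = (\<integral>z. (\<phi> \<circ> Fin) z * lap (QP n) 9 z \<partial>area) - \<phi> Infty * (real d ^ n * lap_mass)"
      unfolding left_diff_distrib using \<phi>i li mass by simp
    also have "(\<integral>z. (\<phi> \<circ> Fin) z * lap (QP n) 9 z \<partial>area) = (\<integral>z. \<phi> (Fin z) \<partial>level_measure n) * (real d ^ n * lap_mass)"
      using level_measure_integral[OF borel_measurable_continuous_onI[OF fc], of n] d lap_mass_pos by simp
    finally have eq: "((\<integral>z. \<phi> (Fin z) \<partial>level_measure n) - \<phi> Infty) * (real d ^ n * lap_mass) =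
        (\<integral>z. g n z * \<Delta> z \<partial>area) + real d ^ n * (\<integral>z. green z * \<Delta> z \<partial>area)"
      unfolding gd by (simp add: left_diff_distrib)
    have "l * x = y * (1 / e) ^ k + u" if "x * (e ^ k * l) = y + e ^ k * u" "e > 0" for l x y e u :: real and k
    proof -
      have "e ^ k > 0" using that by simp
      then have "l * x = (y + e ^ k * u) / e ^ k" unfolding that(1)[symmetric] using that(2) by simp
      then show ?thesis using that(2) by (simp add: add_divide_distrib power_divide)
    qed
    from this[OF eq] show ?thesis using d by simp
  qed
  obtain r where r: "strict_mono (r :: nat \<Rightarrow> nat)"
    "(\<lambda>n. \<integral>z. \<phi> (Fin z) \<partial>level_measure (r n)) \<longlonglongrightarrow> (\<integral>w. \<phi> w \<partial>harmonic_measure (- Fin ` M) Infty)"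
    using harmonic_measure_level_limit \<phi> by blast
  have 1: "(\<lambda>n. lap_mass * ((\<integral>z. \<phi> (Fin z) \<partial>level_measure (r n)) - \<phi> Infty)) \<longlonglongrightarrow>
      lap_mass * ((\<integral>w. \<phi> w \<partial>harmonic_measure (- Fin ` M) Infty) - \<phi> Infty)"
    by (intro tendsto_mult tendsto_diff r(2) tendsto_const)
  define K where "K = (\<integral>z. C * (cauchy z * (3 + step_bound z)) \<partial>area)"
  have "\<bar>(\<integral>z. g n z * \<Delta> z \<partial>area)\<bar> \<le> K" for n
  proof -
    have "\<bar>(\<integral>z. g n z * \<Delta> z \<partial>area)\<bar> \<le> (\<integral>z. \<bar>g n z * \<Delta> z\<bar> \<partial>area)" by (rule integral_abs_bound)
    also have "\<dots> \<le> K" unfolding K_def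
    proof (rule integral_mono)
      show "integrable area (\<lambda>z. \<bar>g n z * \<Delta> z\<bar>)" using gi' by (rule integrable_abs)
      show "integrable area (\<lambda>z. C * (cauchy z * (3 + step_bound z)))" using i1 by (rule integrable_mult_right)
      fix z
      have "\<bar>g n z\<bar> * \<bar>\<Delta> z\<bar> \<le> (3 + step_bound z) * (C * cauchy z)"
        using gb[of n z] C'[of z] step_bound_nonneg[of z] by (intro mult_mono) auto
      then show "\<bar>g n z * \<Delta> z\<bar> \<le> C * (cauchy z * (3 + step_bound z))" by (simp add: abs_mult mult.commute mult.left_commute)
    qed
    finally show ?thesis .
  qed
  then have nb: "norm ((\<integral>z. g n z * \<Delta> z \<partial>area) * (1 / real d) ^ n) \<le> K * (1 / real d) ^ n" for n
    by (auto simp: abs_mult intro!: mult_right_mono)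
  have "(\<lambda>n. K * (1 / real d) ^ n) \<longlonglongrightarrow> K * 0"
    using d by (intro tendsto_mult tendsto_const LIMSEQ_realpow_zero) auto
  then have "(\<lambda>n. K * (1 / real d) ^ n) \<longlonglongrightarrow> 0" by simp
  then have "(\<lambda>n. (\<integral>z. g n z * \<Delta> z \<partial>area) * (1 / real d) ^ n) \<longlonglongrightarrow> 0"
    by (rule Lim_null_comparison[OF always_eventually[OF allI[OF nb]]])
  from tendsto_add[OF this tendsto_const]
  have "(\<lambda>n. lap_mass * ((\<integral>z. \<phi> (Fin z) \<partial>level_measure n) - \<phi> Infty)) \<longlonglongrightarrow> (\<integral>z. green z * \<Delta> z \<partial>area)"
    unfolding m by simp
  from LIMSEQ_unique[OF 1 LIMSEQ_subseq_LIMSEQ[OF this r(1), unfolded comp_def]]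
  show ?thesis unfolding \<Delta>_def .
qed

end

section \<open>Equidistribution\<close>

lemma cauchy_mult_integrable:
  fixes p \<Delta> :: "complex \<Rightarrow> real"
  assumes p: "integrable area (\<lambda>z. cauchy z * p z)" "p \<in> borel_measurable borel"
    and \<Delta>: "\<Delta> \<in> borel_measurable borel" "\<And>z. \<bar>\<Delta> z\<bar> \<le> C * cauchy z"
  shows "integrable area (\<lambda>z. p z * \<Delta> z)" "\<bar>\<integral>z. p z * \<Delta> z \<partial>area\<bar> \<le> C * (\<integral>z. cauchy z * \<bar>p z\<bar> \<partial>area)"
proof -
  have i: "integrable area (\<lambda>z. C * (cauchy z * \<bar>p z\<bar>))"
    using integrable_abs[OF p(1)] cauchy_pos by (simp add: abs_mult less_imp_le)
  have b: "\<bar>p z * \<Delta> z\<bar> \<le> C * (cauchy z * \<bar>p z\<bar>)" for z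
  proof -
    have "\<bar>p z\<bar> * \<bar>\<Delta> z\<bar> \<le> \<bar>p z\<bar> * (C * cauchy z)" by (intro mult_left_mono \<Delta>(2)) auto
    then show ?thesis by (simp add: abs_mult ac_simps)
  qed
  show i': "integrable area (\<lambda>z. p z * \<Delta> z)"
  proof (rule Bochner_Integration.integrable_bound[OF i])
    show "(\<lambda>z. p z * \<Delta> z) \<in> borel_measurable area" using p(2) \<Delta>(1) by measurable
    show "AE z in area. norm (p z * \<Delta> z) \<le> norm (C * (cauchy z * \<bar>p z\<bar>))"
    proof (intro always_eventually allI)
      fix z show "norm (p z * \<Delta> z) \<le> norm (C * (cauchy z * \<bar>p z\<bar>))" using b[of z] unfolding real_norm_def by linarith
    qed
  qed
  have "\<bar>\<integral>z. p z * \<Delta> z \<partial>area\<bar> \<le> (\<integral>z. \<bar>p z * \<Delta> z\<bar> \<partial>area)" by (rule integral_abs_bound)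
  also have "\<dots> \<le> (\<integral>z. C * (cauchy z * \<bar>p z\<bar>) \<partial>area)"
    by (rule integral_mono[OF integrable_abs[OF i'] i b])
  finally show "\<bar>\<integral>z. p z * \<Delta> z \<partial>area\<bar> \<le> C * (\<integral>z. cauchy z * \<bar>p z\<bar> \<partial>area)" by simp
qed

lemma ln_norm_poly:
  fixes A :: "complex poly"
  assumes z: "poly A z \<noteq> 0"
  shows "ln (cmod (poly A z)) = ln (cmod (lead_coeff A)) + (\<Sum>w | poly A w = 0. real (order w A) * ln (cmod (z - w)))"
proof -
  have A: "A \<noteq> 0" using z by auto
  have fin: "finite {w. poly A w = 0}" using A by (rule poly_roots_finite)
  have nz: "w \<in> {w. poly A w = 0} \<Longrightarrow> z - w \<noteq> 0" for w using z by auto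
  have "poly A z = poly (smult (lead_coeff A) (\<Prod>w | poly A w = 0. [:-w, 1:] ^ order w A)) z"
    by (simp only: complex_poly_decompose)
  also have "\<dots> = lead_coeff A * (\<Prod>w | poly A w = 0. (z - w) ^ order w A)"
    by (simp add: poly_prod)
  finally have "cmod (poly A z) = cmod (lead_coeff A) * (\<Prod>w | poly A w = 0. cmod (z - w) ^ order w A)"
    by (simp add: norm_mult prod_norm[symmetric] norm_power)
  moreover have "(\<Prod>w | poly A w = 0. cmod (z - w) ^ order w A) > 0" using nz by (intro prod_pos) auto
  ultimately have "ln (cmod (poly A z)) = ln (cmod (lead_coeff A)) + ln (\<Prod>w | poly A w = 0. cmod (z - w) ^ order w A)"
    using A by (simp only:) (rule ln_mult_pos, auto)
  also have "ln (\<Prod>w | poly A w = 0. cmod (z - w) ^ order w A) = (\<Sum>w | poly A w = 0. ln (cmod (z - w) ^ order w A))"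
    using nz fin by (intro ln_prod) auto
  also have "\<dots> = (\<Sum>w | poly A w = 0. real (order w A) * ln (cmod (z - w)))"
    using nz by (intro sum.cong ln_realpow) auto
  finally show ?thesis .
qed

lemma sum_order_roots:
  fixes A :: "complex poly"
  assumes "A \<noteq> 0"
  shows "(\<Sum>w | poly A w = 0. order w A) = degree A"
proof -
  have "degree A = degree (smult (lead_coeff A) (\<Prod>w | poly A w = 0. [:-w, 1:] ^ order w A))"
    by (simp only: complex_poly_decompose)
  also have "\<dots> = degree (\<Prod>w | poly A w = 0. [:-w, 1:] ^ order w A)" using assms by simp
  also have "\<dots> = (\<Sum>w | poly A w = 0. degree ([:-w, 1:] ^ order w A))" by (rule degree_prod_eq_sum_degree) auto
  also have "\<dots> = (\<Sum>w | poly A w = 0. order w A)" by (intro sum.cong) (auto simp: degree_linear_power)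
  finally show ?thesis by simp
qed

lemma AE_area_poly_nonzero:
  assumes "A \<noteq> 0" shows "AE z in area. poly A z \<noteq> 0"
proof -
  have "AE z in area. \<forall>w\<in>{w. poly A w = 0}. Re z \<noteq> Re w"
    using poly_roots_finite[OF assms] by (intro AE_finite_allI AE_area_Re)
  then show ?thesis by eventually_elim auto
qed

text \<open>The logarithmic representation summed over the roots with multiplicity; the leading
  coefficient drops out because the total Laplacian is 0.\<close>

lemma root_sum_representation:
  assumes f: "C2_on UNIV f fx fy fxx fyy" and flat: "flat_at_infinity f L fx fy"
    and C: "\<And>z. \<bar>fxx z + fyy z\<bar> \<le> C * cauchy z" and A: "A \<noteq> 0"
  shows "lap_mass * ((\<Sum>w | poly A w = 0. real (order w A) * f w) - real (degree A) * L) =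
    (\<integral>z. ln (cmod (poly A z)) * (fxx z + fyy z) \<partial>area)"
proof -
  define \<Delta> where "\<Delta> z = fxx z + fyy z" for z
  have m [measurable]: "\<Delta> \<in> borel_measurable borel"
    using f unfolding C2_on_def \<Delta>_def by (intro borel_measurable_continuous_onI continuous_intros) auto
  have C': "\<bar>\<Delta> z\<bar> \<le> C * cauchy z" for z unfolding \<Delta>_def by (rule C)
  have i0: "integrable area \<Delta>"
    using cauchy_mult_integrable(1)[of "\<lambda>_. 1" \<Delta> C] m C' cauchy_integrable by simp
  have \<Delta>0: "(\<integral>z. \<Delta> z \<partial>area) = 0"
    unfolding \<Delta>_def by (rule laplacian_integral_zero[OF f flat]) (use i0 in \<open>simp add: \<Delta>_def[abs_def]\<close>)
  have i: "integrable area (\<lambda>z. ln (cmod (z - w)) * \<Delta> z)" for w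
  proof (rule cauchy_mult_integrable(1)[OF _ _ m C'])
    show "integrable area (\<lambda>z. cauchy z * ln (cmod (z - w)))"
      by (rule Bochner_Integration.integrable_bound[OF cauchy_log_dist_integrable[of w]]) (auto simp: abs_mult)
  qed measurable
  have "(\<integral>z. ln (cmod (poly A z)) * \<Delta> z \<partial>area) =
      (\<integral>z. ln (cmod (lead_coeff A)) * \<Delta> z + (\<Sum>w | poly A w = 0. real (order w A) * (ln (cmod (z - w)) * \<Delta> z)) \<partial>area)"
  proof (rule integral_cong_AE)
    show "AE z in area. ln (cmod (poly A z)) * \<Delta> z =
        ln (cmod (lead_coeff A)) * \<Delta> z + (\<Sum>w | poly A w = 0. real (order w A) * (ln (cmod (z - w)) * \<Delta> z))"
      using AE_area_poly_nonzero[OF A]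
      by eventually_elim (simp add: ln_norm_poly distrib_right sum_distrib_right mult.assoc)
    have "poly A \<in> borel_measurable borel" by (intro borel_measurable_continuous_onI continuous_intros)
    then show "(\<lambda>z. ln (cmod (poly A z)) * \<Delta> z) \<in> borel_measurable area" by measurable
  qed measurable
  also have "\<dots> = (\<Sum>w | poly A w = 0. real (order w A) * (\<integral>z. ln (cmod (z - w)) * \<Delta> z \<partial>area))"
    using i i0 \<Delta>0 by (subst Bochner_Integration.integral_add) (auto simp: Bochner_Integration.integral_sum)
  also have "\<dots> = (\<Sum>w | poly A w = 0. real (order w A) * (lap_mass * (f w - L)))"
    unfolding \<Delta>_def using logarithmic_representation[OF f flat C] by simp
  also have "\<dots> = lap_mass * ((\<Sum>w | poly A w = 0. real (order w A) * f w) - real (\<Sum>w | poly A w = 0. order w A) * L)"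
    by (simp add: algebra_simps sum_distrib_left sum_subtractf)
  finally show ?thesis unfolding sum_order_roots[OF A] \<Delta>_def by simp
qed

text \<open>A nonconstant polynomial fixes infinity, so the fibre over a finite point consists of
  the roots of p - a, and the local degree is the order of the root.\<close>

lemma pullback_dirac_integral:
  assumes \<phi>: "continuous_on UNIV (\<phi> :: sphere \<Rightarrow> real)" and p: "degree p > 0"
  shows "(\<integral>w. \<phi> w \<partial>pullback_dirac p (Fin a)) =
    (\<Sum>w | poly (p - [:a:]) w = 0. real (order w (p - [:a:])) * \<phi> (Fin w))"
proof -
  have nz: "p - [:a:] \<noteq> 0" using p by auto
  define m where "m w = (if sphere_map p w = Fin a then real (local_degree p w) else 0)" for w
  have ml: "m (Fin w) = (if poly (p - [:a:]) w = 0 then real (order w (p - [:a:])) else 0)" "m Infty = 0" for w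
    using p by (auto simp: m_def sphere_map_def local_degree_def)
  have fin: "finite (Fin ` {w. poly (p - [:a:]) w = 0})" using poly_roots_finite[OF nz] by simp
  have out: "m w = 0" if "w \<notin> Fin ` {w. poly (p - [:a:]) w = 0}" for w
    using that ml by (cases w) auto
  have "pullback_dirac p (Fin a) = distr (density (count_space UNIV) (\<lambda>w. ennreal (m w))) borel (\<lambda>w. w)"
    unfolding pullback_dirac_def m_def by (intro arg_cong3[where f = distr] arg_cong2[where f = density]) (auto simp: fun_eq_iff ennreal_of_nat_eq_real_of_nat)
  then have "(\<integral>w. \<phi> w \<partial>pullback_dirac p (Fin a)) = (\<integral>w. \<phi> w \<partial>density (count_space UNIV) (\<lambda>w. ennreal (m w)))"
    by (simp add: integral_distr borel_measurable_continuous_onI[OF \<phi>])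
  also have "\<dots> = (\<integral>w. m w *\<^sub>R \<phi> w \<partial>count_space UNIV)"
    by (rule integral_density) (auto simp: m_def)
  also have "\<dots> = (\<Sum>w | w \<in> UNIV \<and> m w *\<^sub>R \<phi> w \<noteq> 0. m w *\<^sub>R \<phi> w)"
    by (rule lebesgue_integral_count_space_finite_support, rule finite_subset[OF _ fin]) (use out in auto)
  also have "\<dots> = (\<Sum>w\<in>Fin ` {w. poly (p - [:a:]) w = 0}. m w *\<^sub>R \<phi> w)"
    by (rule sum.mono_neutral_left[OF fin]) (use out in auto)
  also have "\<dots> = (\<Sum>w | poly (p - [:a:]) w = 0. real (order w (p - [:a:])) * \<phi> (Fin w))"
    by (subst sum.reindex) (auto simp: inj_on_def ml intro!: sum.cong)
  finally show ?thesis .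
qed

context unicritical_family
begin

lemma P_measurable [measurable]: "P n \<in> borel_measurable borel"
  unfolding P_def by (intro borel_measurable_continuous_onI continuous_intros)

definition cauchy_measure :: "complex measure" where
  "cauchy_measure = density area (\<lambda>z. ennreal (cauchy z))"

lemma finite_cauchy_measure: "finite_measure cauchy_measure"
proof
  have "emeasure cauchy_measure (space cauchy_measure) = (\<integral>\<^sup>+ z. ennreal (cauchy z) \<partial>area)"
    unfolding cauchy_measure_def by (subst emeasure_density) auto
  also have "\<dots> = ennreal (\<integral>z. cauchy z \<partial>area)"
    using cauchy_integrable cauchy_pos by (intro nn_integral_eq_integral) (auto intro: less_imp_le)
  finally show "emeasure cauchy_measure (space cauchy_measure) \<noteq> \<infinity>" by simp
qed

text \<open>Where the logarithmic potential of this measure is finite, that of the \<open>n\<close>-th image measure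
  is \<open>O(\<eta>\<^sup>n)\<close>, because its weight is \<open>\<eta>\<^sup>-\<^sup>n\<close>.\<close>

definition weighted_images :: "real \<Rightarrow> complex measure" where
  "weighted_images \<eta> = distr (density (count_space UNIV) (\<lambda>n. ennreal ((1 / \<eta>) ^ n)) \<Otimes>\<^sub>M cauchy_measure) borel
     (\<lambda>p. P (fst p) (snd p))"

lemma weighted_images_integral:
  assumes g: "g \<in> borel_measurable borel"
  shows "(\<integral>\<^sup>+ \<zeta>. g \<zeta> \<partial>weighted_images \<eta>) = (\<Sum>n. ennreal ((1 / \<eta>) ^ n) * (\<integral>\<^sup>+ z. g (P n z) \<partial>cauchy_measure))"
proof -
  interpret \<nu>: finite_measure cauchy_measure by (rule finite_cauchy_measure)
  have s: "sets cauchy_measure = sets borel" by (simp add: cauchy_measure_def)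
  define \<rho> where "\<rho> = density (count_space UNIV) (\<lambda>n::nat. ennreal ((1 / \<eta>) ^ n))"
  have sr: "sets (\<rho> \<Otimes>\<^sub>M cauchy_measure) = sets (count_space UNIV \<Otimes>\<^sub>M borel)"
    by (intro sets_pair_measure_cong) (auto simp: \<rho>_def s)
  have "(\<lambda>p. P (fst p) (snd p)) \<in> measurable (count_space UNIV \<Otimes>\<^sub>M borel) borel"
    by (rule measurable_pair_measure_countable1) auto
  then have m: "(\<lambda>p. P (fst p) (snd p)) \<in> measurable (\<rho> \<Otimes>\<^sub>M cauchy_measure) borel"
    using sr by (simp cong: measurable_cong_sets)
  have "(\<integral>\<^sup>+ \<zeta>. g \<zeta> \<partial>weighted_images \<eta>) = (\<integral>\<^sup>+ p. g (P (fst p) (snd p)) \<partial>(\<rho> \<Otimes>\<^sub>M cauchy_measure))"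
    unfolding weighted_images_def \<rho>_def[symmetric] using m g by (intro nn_integral_distr) auto
  also have "\<dots> = (\<integral>\<^sup>+ n. \<integral>\<^sup>+ z. g (P n z) \<partial>cauchy_measure \<partial>\<rho>)"
    using \<nu>.nn_integral_fst[OF measurable_compose[OF m g], symmetric] by simp
  also have "\<dots> = (\<Sum>n. ennreal ((1 / \<eta>) ^ n) * (\<integral>\<^sup>+ z. g (P n z) \<partial>cauchy_measure))"
    unfolding \<rho>_def by (subst nn_integral_density) (auto simp: nn_integral_count_space_nat)
  finally show ?thesis .
qed

lemma finite_weighted_images:
  assumes "\<eta> > 1" shows "finite_measure (weighted_images \<eta>)"
proof
  interpret \<nu>: finite_measure cauchy_measure by (rule finite_cauchy_measure)
  have sum: "(\<Sum>n. ennreal ((1 / \<eta>) ^ n)) = ennreal (\<Sum>n. (1 / \<eta>) ^ n)"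
    using assms by (intro suminf_ennreal_eq summable_sums summable_geometric) auto
  have "emeasure (weighted_images \<eta>) (space (weighted_images \<eta>)) = (\<integral>\<^sup>+ \<zeta>. 1 \<partial>weighted_images \<eta>)" by simp
  also have "\<dots> = (\<Sum>n. ennreal ((1 / \<eta>) ^ n)) * emeasure cauchy_measure (space cauchy_measure)"
    by (subst weighted_images_integral) auto
  also have "\<dots> \<noteq> \<infinity>" unfolding sum using \<nu>.emeasure_finite by (simp add: ennreal_mult_eq_top_iff)
  finally show "emeasure (weighted_images \<eta>) (space (weighted_images \<eta>)) \<noteq> \<infinity>" .
qed

text \<open>The defect differs from ln max(1, |P_n|) - ln |P_n - a| by the constant ln (1 + |a|). So
  its integral controls the absolute value, including where |P_n - a| is large.\<close>

lemma log_distance_integral: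
  assumes \<eta>: "\<eta> > 1" and a: "log_pot (weighted_images \<eta>) a \<noteq> \<infinity>"
  obtains K where "\<And>n. integrable area (\<lambda>z. cauchy z * (ln (cmod (P n z - a)) - logp (P n z)))"
    "\<And>n. (\<integral>z. cauchy z * \<bar>ln (cmod (P n z - a)) - logp (P n z)\<bar> \<partial>area) \<le> K * \<eta> ^ n" "K \<ge> 0"
proof -
  define l where "l = ln (1 + cmod a)"
  have l: "l \<ge> 0" by (simp add: l_def)
  define S where "S = enn2real (log_pot (weighted_images \<eta>) a)"
  have S: "log_pot (weighted_images \<eta>) a = ennreal S" "S \<ge> 0"
    using a by (auto simp: S_def less_top ennreal_enn2real)
  define m where "m = (\<integral>z. cauchy z \<partial>area)"
  have m0: "m \<ge> 0" unfolding m_def using cauchy_pos by (intro integral_nonneg_AE) (auto intro: less_imp_le)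
  have dm: "(\<lambda>\<zeta>. log_defect \<zeta> a) \<in> borel_measurable borel" unfolding log_defect_def by measurable
  define h where "h n z = cauchy z * (ln (cmod (P n z - a)) - logp (P n z))" for n z
  have hm: "h n \<in> borel_measurable borel" for n
  proof -
    have [measurable]: "logp \<in> borel_measurable borel" using logp_continuous by (rule borel_measurable_continuous_onI)
    show ?thesis unfolding h_def[abs_def] by measurable
  qed
  have bd: "(\<integral>\<^sup>+ z. ennreal \<bar>h n z\<bar> \<partial>area) \<le> ennreal ((S + l * m) * \<eta> ^ n)" for n
  proof -
    define I where "I = (\<integral>\<^sup>+ z. log_defect (P n z) a \<partial>cauchy_measure)"
    \<comment> \<open>One term of a nonnegative series is at most its finite sum; multiplying by
      \<eta>^n gives the growth bound.\<close>
    have "ennreal ((1 / \<eta>) ^ n) * I \<le> (\<Sum>n. ennreal ((1 / \<eta>) ^ n) * (\<integral>\<^sup>+ z. log_defect (P n z) a \<partial>cauchy_measure))"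
      unfolding I_def by (rule order_trans[OF _ sum_le_suminf[of _ "{n}"]]) auto
    also have "\<dots> = ennreal S" unfolding S(1)[symmetric] log_pot_def by (rule weighted_images_integral[OF dm, symmetric])
    finally have "ennreal (\<eta> ^ n) * (ennreal ((1 / \<eta>) ^ n) * I) \<le> ennreal (\<eta> ^ n) * ennreal S" by (rule mult_left_mono) simp
    moreover have "ennreal (\<eta> ^ n) * ennreal ((1 / \<eta>) ^ n) = 1"
      using \<eta> by (simp add: ennreal_mult[symmetric] power_mult_distrib[symmetric])
    ultimately have I: "I \<le> ennreal (\<eta> ^ n * S)" using \<eta> S(2) by (simp add: mult.assoc[symmetric] ennreal_mult)
    have Ia: "I = (\<integral>\<^sup>+ z. ennreal (cauchy z) * log_defect (P n z) a \<partial>area)"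
      unfolding I_def cauchy_measure_def using measurable_compose[OF P_measurable dm] by (subst nn_integral_density) auto
    have "(\<integral>\<^sup>+ z. ennreal \<bar>h n z\<bar> \<partial>area) \<le> (\<integral>\<^sup>+ z. ennreal (cauchy z) * log_defect (P n z) a + ennreal (l * cauchy z) \<partial>area)"
    proof (rule nn_integral_mono)
      fix z
      show "ennreal \<bar>h n z\<bar> \<le> ennreal (cauchy z) * log_defect (P n z) a + ennreal (l * cauchy z)"
      proof (cases "P n z = a")
        case True
        then show ?thesis using cauchy_pos[of z] by (simp add: log_defect_def ennreal_mult_top)
      next
        case False
        define v where "v = ln (1 + cmod a) + ln (max 1 (cmod (P n z))) - ln (cmod (P n z - a))"
        have v: "v \<ge> 0" unfolding v_def by (rule log_defect_nonneg[OF False])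
        have "\<bar>ln (cmod (P n z - a)) - logp (P n z)\<bar> \<le> v + l"
          using v l unfolding v_def l_def logp_def by linarith
        then have "\<bar>h n z\<bar> \<le> cauchy z * (v + l)"
          unfolding h_def abs_mult using cauchy_pos[of z] by (auto intro!: mult_mono)
        then have "ennreal \<bar>h n z\<bar> \<le> ennreal (cauchy z * v + l * cauchy z)" by (intro ennreal_leI) (simp add: algebra_simps)
        also have "\<dots> = ennreal (cauchy z) * log_defect (P n z) a + ennreal (l * cauchy z)"
          using False v l cauchy_pos[of z] by (simp add: log_defect_def v_def[symmetric] ennreal_mult[symmetric] ennreal_plus[symmetric] del: ennreal_plus)
        finally show ?thesis .
      qed
    qed
    also have "\<dots> = I + (\<integral>\<^sup>+ z. ennreal (l * cauchy z) \<partial>area)"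
      unfolding Ia using measurable_compose[OF P_measurable dm] by (subst nn_integral_add) auto
    also have "(\<integral>\<^sup>+ z. ennreal (l * cauchy z) \<partial>area) = ennreal (l * m)"
      unfolding m_def using cauchy_integrable cauchy_pos l
      by (subst nn_integral_eq_integral) (auto intro!: always_eventually mult_nonneg_nonneg intro: less_imp_le)
    also have "I + ennreal (l * m) \<le> ennreal (\<eta> ^ n * S) + ennreal (l * m)" using I by (rule add_right_mono)
    also have "\<dots> = ennreal (\<eta> ^ n * S + l * m)" using \<eta> S l m0 by (simp add: ennreal_plus)
    also have "\<dots> \<le> ennreal ((S + l * m) * \<eta> ^ n)"
    proof (rule ennreal_leI)
      have "l * m * 1 \<le> l * m * \<eta> ^ n" using \<eta> l m0 by (intro mult_left_mono) auto
      then show "\<eta> ^ n * S + l * m \<le> (S + l * m) * \<eta> ^ n" by (simp add: algebra_simps)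
    qed
    finally show ?thesis .
  qed
  have hi: "integrable area (h n)" for n
  proof (rule integrableI_bounded)
    show "h n \<in> borel_measurable area" using hm by simp
    show "(\<integral>\<^sup>+ z. ennreal (norm (h n z)) \<partial>area) < \<infinity>" using le_less_trans[OF bd[of n] ennreal_less_top] by simp
  qed
  have K0: "S + l * m \<ge> 0" using S(2) l m0 by simp
  show ?thesis
  proof (rule that[of "S + l * m"])
    show "integrable area (\<lambda>z. cauchy z * (ln (cmod (P n z - a)) - logp (P n z)))" for n
      using hi[of n] by (simp add: h_def[abs_def])
    show "(\<integral>z. cauchy z * \<bar>ln (cmod (P n z - a)) - logp (P n z)\<bar> \<partial>area) \<le> (S + l * m) * \<eta> ^ n" for n
    proof -
      have "(\<integral>z. cauchy z * \<bar>ln (cmod (P n z - a)) - logp (P n z)\<bar> \<partial>area) = (\<integral>z. \<bar>h n z\<bar> \<partial>area)"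
        using cauchy_pos by (intro Bochner_Integration.integral_cong) (auto simp: h_def abs_mult less_imp_le)
      moreover have eq: "ennreal (\<integral>z. \<bar>h n z\<bar> \<partial>area) = (\<integral>\<^sup>+ z. ennreal \<bar>h n z\<bar> \<partial>area)"
        using hi by (intro nn_integral_eq_integral[symmetric] integrable_abs) auto
      have "(\<integral>z. \<bar>h n z\<bar> \<partial>area) \<le> (S + l * m) * \<eta> ^ n"
        using bd[of n] K0 \<eta> unfolding eq[symmetric] by (subst (asm) ennreal_le_iff) auto
      ultimately show ?thesis by linarith
    qed
  qed (use K0 in auto)
qed

text \<open>Bernoulli's inequality for sqrt \<eta>, then squared. It absorbs the n^2 of the escape
  estimate into \<eta>^n.\<close>

lemma square_le_power:
  assumes "\<eta> > (1::real)"
  shows "(real n)\<^sup>2 \<le> \<eta> ^ n / (sqrt \<eta> - 1)\<^sup>2"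
proof -
  define s where "s = sqrt \<eta> - 1"
  have s: "s > 0" using assms by (simp add: s_def)
  have "1 + real n * s \<le> (1 + s) ^ n" using s by (intro Bernoulli_inequality) auto
  then have "real n * s \<le> (1 + s) ^ n" by simp
  then have "(real n * s)\<^sup>2 \<le> ((1 + s) ^ n)\<^sup>2" using s by (intro power_mono) auto
  also have "((1 + s) ^ n)\<^sup>2 = ((1 + s)\<^sup>2) ^ n" by (simp add: power_mult[symmetric] mult.commute)
  also have "(1 + s)\<^sup>2 = \<eta>" using assms by (simp add: s_def)
  finally show ?thesis using s unfolding s_def[symmetric] by (simp add: power_mult_distrib pos_le_divide_eq)
qed

text \<open>Both the fibre of a and (d^n - 1) times harmonic measure have mass d^n - 1, so the terms
  at infinity cancel. What remains is the integral of \<open>u\<close>, the difference of the two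
  potentials, against the Laplacian of the test function.\<close>

theorem equidistribution:
  assumes \<eta>: "\<eta> > 1" and a: "log_pot (weighted_images \<eta>) a \<noteq> \<infinity>" and \<phi>: "C2_sphere \<phi>"
  shows "(\<lambda>n. (\<integral>w. \<phi> w \<partial>pullback_dirac (deriv_at_critical_value d n) (Fin a)) / (real d ^ n - 1)
      - (\<integral>w. \<phi> w \<partial>harmonic_measure (- Fin ` M) Infty)) \<in> O(\<lambda>n. (\<eta> / real d) ^ n)"
proof -
  obtain fx fy fxx fyy C where f: "C2_on UNIV (\<phi> \<circ> Fin) fx fy fxx fyy" "flat_at_infinity (\<phi> \<circ> Fin) (\<phi> Infty) fx fy"
    and C: "\<And>z. \<bar>fxx z + fyy z\<bar> \<le> C * cauchy z" and \<phi>c: "continuous_on UNIV \<phi>" "bounded (range (\<phi> \<circ> Fin))"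
    using C2_sphere_plane[OF \<phi>] by blast
  define \<Delta> where "\<Delta> z = fxx z + fyy z" for z
  have \<Delta>m [measurable]: "\<Delta> \<in> borel_measurable borel"
    using f(1) unfolding C2_on_def \<Delta>_def by (intro borel_measurable_continuous_onI continuous_intros) auto
  have C': "\<bar>\<Delta> z\<bar> \<le> C * cauchy z" for z unfolding \<Delta>_def by (rule C)
  have C0: "C \<ge> 0"
  proof -
    have "0 \<le> C * cauchy 0" using C'[of 0] by linarith
    then show ?thesis using cauchy_pos[of 0] by (simp add: zero_le_mult_iff)
  qed
  obtain K where K: "\<And>n. integrable area (\<lambda>z. cauchy z * (ln (cmod (P n z - a)) - logp (P n z)))"
    "\<And>n. (\<integral>z. cauchy z * \<bar>ln (cmod (P n z - a)) - logp (P n z)\<bar> \<partial>area) \<le> K * \<eta> ^ n" "K \<ge> 0"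
    using log_distance_integral[OF \<eta> a] by blast
  define H where "H = (\<integral>w. \<phi> w \<partial>harmonic_measure (- Fin ` M) Infty)"
  have HM: "lap_mass * (H - \<phi> Infty) = (\<integral>z. green z * \<Delta> z \<partial>area)"
    unfolding H_def \<Delta>_def by (rule harmonic_measure_laplacian[OF f C \<phi>c])
  have [measurable]: "logp \<in> borel_measurable borel" "green \<in> borel_measurable borel" "step_bound \<in> borel_measurable borel"
    using logp_continuous green_continuous by (auto intro: borel_measurable_continuous_onI simp: step_bound_def[abs_def])
  define b where "b z = ln (real d) + (real d - 1) * (step_bound z + ln 4 + ln expansion)" for z
  have b0: "b z \<ge> 0" for z
    unfolding b_def using d expansion_ge_1 step_bound_nonneg[of z] by (intro add_nonneg_nonneg mult_nonneg_nonneg) auto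
  have bi: "integrable area (\<lambda>z. cauchy z * b z)"
  proof -
    have "(\<lambda>z. cauchy z * b z) = (\<lambda>z. (ln (real d) + (real d - 1) * (ln 4 + ln expansion)) * cauchy z + (real d - 1) * (cauchy z * step_bound z))"
      by (auto simp: b_def algebra_simps)
    then show ?thesis using cauchy_integrable cauchy_step_bound_integrable by simp
  qed
  define B where "B = (\<integral>z. cauchy z * b z \<partial>area)"
  have B0: "B \<ge> 0" unfolding B_def using b0 cauchy_pos by (intro Bochner_Integration.integral_nonneg mult_nonneg_nonneg) (auto intro: less_imp_le)
  define T where "T n = (\<integral>w. \<phi> w \<partial>pullback_dirac (deriv_at_critical_value d n) (Fin a))" for n
  \<comment> \<open>For n = 0 the polynomial is constant and the denominator 0; the O-estimate
    concerns large n.\<close>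
  have main: "lap_mass * \<bar>T n / (real d ^ n - 1) - H\<bar> \<le> C * (K * \<eta> ^ n + B * (real n)\<^sup>2) / (real d ^ n - 1)" if n: "n \<ge> 1" for n
  proof -
    define p where "p = deriv_at_critical_value d n"
    define e where "e = real d ^ n - 1"
    have dn: "d ^ n \<ge> 2"
    proof -
      have "d ^ 1 \<le> d ^ n" using n d by (intro power_increasing) auto
      then show ?thesis using d by simp
    qed
    have e: "real (degree p) = e" unfolding p_def e_def degree_deriv_at_critical_value[OF d] using dn by (simp add: of_nat_diff)
    have "real (d ^ n) \<ge> real 2" using dn by (rule of_nat_mono)
    then have e0: "e > 0" by (simp add: e_def)
    then have dp: "degree p > 0" using e by simp
    define q where "q = p - [:a:]"
    have q0: "q \<noteq> 0" using dp by (auto simp: q_def)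
    have dq: "degree q = degree p"
    proof -
      have "q = p + [:-a:]" by (simp add: q_def)
      then show ?thesis using degree_add_eq_left[of "[:-a:]" p] dp by simp
    qed
    have qP: "poly q z = P n z - a" for z by (simp add: q_def P_def p_def)
    \<comment> \<open>The first bracket is controlled on average by the choice of a, the second
      pointwise by \<open>logp_P_bound\<close>.\<close>
    define u where "u z = (ln (cmod (P n z - a)) - logp (P n z)) + (logp (P n z) - e * green z)" for z
    have u: "u z = ln (cmod (poly q z)) - e * green z" for z by (simp add: u_def qP)
    have lb: "\<bar>logp (P n z) - e * green z\<bar> \<le> (real n)\<^sup>2 * b z" for z
    proof -
      have "real n * (ln (real d) + (real d - 1) * (step_bound z + ln 4 + real n * ln expansion)) \<le> real n * (real n * b z)"
      proof (rule mult_left_mono)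
        have n1: "real n \<ge> 1" using n by simp
        have s: "x \<le> real n * x" if "x \<ge> 0" for x using mult_right_mono[OF n1 that] by simp
        have "ln (real d) \<le> real n * ln (real d)" using d by (intro s) auto
        moreover have "(real d - 1) * (step_bound z + ln 4 + real n * ln expansion) \<le> (real d - 1) * (real n * (step_bound z + ln 4 + ln expansion))"
        proof (rule mult_left_mono)
          show "step_bound z + ln 4 + real n * ln expansion \<le> real n * (step_bound z + ln 4 + ln expansion)"
            using s[of "step_bound z + ln 4"] step_bound_nonneg[of z] by (simp add: distrib_left)
        qed (use d in simp)
        ultimately show "ln (real d) + (real d - 1) * (step_bound z + ln 4 + real n * ln expansion) \<le> real n * b z"
          by (simp add: b_def algebra_simps)
      qed simp
      then show ?thesis using logp_P_bound[of n z] by (simp add: e_def power2_eq_square mult.assoc)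
    qed
    have ui2: "integrable area (\<lambda>z. cauchy z * (logp (P n z) - e * green z))"
    proof (rule Bochner_Integration.integrable_bound)
      show "integrable area (\<lambda>z. (real n)\<^sup>2 * (cauchy z * b z))" using bi by (rule integrable_mult_right)
      show "(\<lambda>z. cauchy z * (logp (P n z) - e * green z)) \<in> borel_measurable area" by measurable
      show "AE z in area. norm (cauchy z * (logp (P n z) - e * green z)) \<le> norm ((real n)\<^sup>2 * (cauchy z * b z))"
      proof (intro always_eventually allI)
        fix z
        have "cauchy z * \<bar>logp (P n z) - e * green z\<bar> \<le> cauchy z * ((real n)\<^sup>2 * b z)"
          using lb[of z] cauchy_pos[of z] by (intro mult_left_mono) auto
        then show "norm (cauchy z * (logp (P n z) - e * green z)) \<le> norm ((real n)\<^sup>2 * (cauchy z * b z))"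
          using cauchy_pos[of z] b0[of z] by (simp add: abs_mult less_imp_le ac_simps)
      qed
    qed
    have ui: "integrable area (\<lambda>z. cauchy z * u z)"
      unfolding u_def distrib_left[where a = "cauchy _"] using K(1)[of n] ui2 by (rule Bochner_Integration.integrable_add)
    have um: "u \<in> borel_measurable borel" unfolding u_def[abs_def] by measurable
    have uint: "(\<integral>z. cauchy z * \<bar>u z\<bar> \<partial>area) \<le> K * \<eta> ^ n + B * (real n)\<^sup>2"
    proof -
      have iK: "integrable area (\<lambda>z. cauchy z * \<bar>ln (cmod (P n z - a)) - logp (P n z)\<bar>)"
        using integrable_abs[OF K(1)[of n]] cauchy_pos by (simp add: abs_mult less_imp_le)
      have "(\<integral>z. cauchy z * \<bar>u z\<bar> \<partial>area) \<le>
          (\<integral>z. cauchy z * \<bar>ln (cmod (P n z - a)) - logp (P n z)\<bar> + (real n)\<^sup>2 * (cauchy z * b z) \<partial>area)"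
      proof (rule integral_mono)
        show "integrable area (\<lambda>z. cauchy z * \<bar>u z\<bar>)"
          using integrable_abs[OF ui] cauchy_pos by (simp add: abs_mult less_imp_le)
        show "integrable area (\<lambda>z. cauchy z * \<bar>ln (cmod (P n z - a)) - logp (P n z)\<bar> + (real n)\<^sup>2 * (cauchy z * b z))"
          using iK bi by (intro Bochner_Integration.integrable_add integrable_mult_right)
        fix z
        have "\<bar>u z\<bar> \<le> \<bar>ln (cmod (P n z - a)) - logp (P n z)\<bar> + (real n)\<^sup>2 * b z"
          unfolding u_def using lb[of z] by linarith
        then have "cauchy z * \<bar>u z\<bar> \<le> cauchy z * (\<bar>ln (cmod (P n z - a)) - logp (P n z)\<bar> + (real n)\<^sup>2 * b z)"
          using cauchy_pos[of z] by (intro mult_left_mono) auto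
        then show "cauchy z * \<bar>u z\<bar> \<le> cauchy z * \<bar>ln (cmod (P n z - a)) - logp (P n z)\<bar> + (real n)\<^sup>2 * (cauchy z * b z)"
          by (simp only: distrib_left mult.left_commute)
      qed
      also have "\<dots> = (\<integral>z. cauchy z * \<bar>ln (cmod (P n z - a)) - logp (P n z)\<bar> \<partial>area) + (real n)\<^sup>2 * B"
        unfolding B_def using iK bi by simp
      finally show ?thesis using K(2)[of n] by (simp add: mult.commute)
    qed
    have "T n = (\<Sum>w | poly q w = 0. real (order w q) * (\<phi> \<circ> Fin) w)"
      unfolding T_def q_def p_def[symmetric] comp_def by (rule pullback_dirac_integral[OF \<phi>c(1) dp])
    then have TL: "lap_mass * (T n - e * \<phi> Infty) = (\<integral>z. ln (cmod (poly q z)) * \<Delta> z \<partial>area)"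
      using root_sum_representation[OF f C q0] unfolding dq e \<Delta>_def by simp
    have gi: "integrable area (\<lambda>z. green z * \<Delta> z)"
      by (rule cauchy_mult_integrable(1)[OF cauchy_green_integrable _ \<Delta>m C']) simp
    note un = cauchy_mult_integrable[OF ui um \<Delta>m C']
    have sp: "ln (cmod (poly q z)) * \<Delta> z = u z * \<Delta> z + e * (green z * \<Delta> z)" for z
      by (simp add: u algebra_simps)
    have dec: "(\<integral>z. ln (cmod (poly q z)) * \<Delta> z \<partial>area) = (\<integral>z. u z * \<Delta> z \<partial>area) + e * (\<integral>z. green z * \<Delta> z \<partial>area)"
      unfolding sp using un(1) gi by simp
    have "lap_mass * (T n - e * H) = lap_mass * (T n - e * \<phi> Infty) - e * (lap_mass * (H - \<phi> Infty))"
      by (simp add: algebra_simps)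
    also have "\<dots> = (\<integral>z. u z * \<Delta> z \<partial>area)" unfolding TL HM dec by simp
    finally have "lap_mass * (T n - e * H) = (\<integral>z. u z * \<Delta> z \<partial>area)" .
    then have "lap_mass * \<bar>T n - e * H\<bar> \<le> C * (\<integral>z. cauchy z * \<bar>u z\<bar> \<partial>area)"
      using un(2) lap_mass_pos by (metis abs_mult abs_of_pos)
    also have "\<dots> \<le> C * (K * \<eta> ^ n + B * (real n)\<^sup>2)" using uint C0 by (rule mult_left_mono)
    finally have "lap_mass * \<bar>T n - e * H\<bar> / e \<le> C * (K * \<eta> ^ n + B * (real n)\<^sup>2) / e"
      using e0 by (intro divide_right_mono) auto
    moreover have "\<bar>T n / e - H\<bar> = \<bar>T n - e * H\<bar> / e"
    proof -
      have "T n / e - H = (T n - e * H) / e" using e0 by (simp add: field_simps)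
      then show ?thesis using e0 by (simp add: abs_divide)
    qed
    ultimately show ?thesis unfolding e_def[symmetric] by simp
  qed
  \<comment> \<open>The factor 2 comes from 1 / (y - 1) \<le> 2 / y for y = d^n \<ge> 2.\<close>
  define c where "c = C * (K + B / (sqrt \<eta> - 1)\<^sup>2) * 2 / lap_mass"
  have "eventually (\<lambda>n. norm (T n / (real d ^ n - 1) - H) \<le> c * norm ((\<eta> / real d) ^ n)) sequentially"
    using eventually_ge_at_top[of 1]
  proof eventually_elim
    case (elim n)
    have d1: "real d ^ n \<ge> 2"
    proof -
      have "2 \<le> real d" using d by simp
      also have "real d \<le> real d ^ n" using elim d by (intro self_le_power) auto
      finally show ?thesis .
    qed
    have "B * (real n)\<^sup>2 \<le> B * (\<eta> ^ n / (sqrt \<eta> - 1)\<^sup>2)" using square_le_power[OF \<eta>] B0 by (rule mult_left_mono)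
    then have "K * \<eta> ^ n + B * (real n)\<^sup>2 \<le> (K + B / (sqrt \<eta> - 1)\<^sup>2) * \<eta> ^ n" by (simp add: distrib_right)
    then have 1: "C * (K * \<eta> ^ n + B * (real n)\<^sup>2) \<le> C * ((K + B / (sqrt \<eta> - 1)\<^sup>2) * \<eta> ^ n)" using C0 by (rule mult_left_mono)
    define X where "X = C * ((K + B / (sqrt \<eta> - 1)\<^sup>2) * \<eta> ^ n)"
    have X0: "X \<ge> 0" unfolding X_def using C0 K(3) B0 \<eta> by simp
    have "X / (y - 1) \<le> X * (2 / y)" if "y \<ge> 2" for y :: real
    proof -
      have "1 / (y - 1) \<le> 2 / y" using that by (simp add: divide_simps)
      from mult_left_mono[OF this X0] show ?thesis by simp
    qed
    from this[OF d1] have "C * (K * \<eta> ^ n + B * (real n)\<^sup>2) / (real d ^ n - 1) \<le> X * (2 / real d ^ n)"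
      using divide_right_mono[OF 1[folded X_def], of "real d ^ n - 1"] d1 by linarith
    then have "lap_mass * \<bar>T n / (real d ^ n - 1) - H\<bar> \<le> X * (2 / real d ^ n)" using main[OF elim] by linarith
    then have "\<bar>T n / (real d ^ n - 1) - H\<bar> * lap_mass \<le> X * (2 / real d ^ n)" by (subst mult.commute)
    then have "\<bar>T n / (real d ^ n - 1) - H\<bar> \<le> X * (2 / real d ^ n) / lap_mass"
      unfolding pos_le_divide_eq[OF lap_mass_pos] .
    also have "X * (2 / real d ^ n) / lap_mass = c * (\<eta> / real d) ^ n"
      unfolding X_def c_def power_divide by (simp add: mult.assoc mult.commute mult.left_commute)
    finally show ?case using \<eta> by (simp add: abs_of_nonneg)
  qed
  then have "(\<lambda>n. T n / (real d ^ n - 1) - H) \<in> O(\<lambda>n. (\<eta> / real d) ^ n)" by (rule bigoI)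
  then show ?thesis unfolding T_def H_def .
qed

end

theorem theorem3:
  fixes d :: nat
  assumes "d > 1"
  shows "\<forall>\<eta>::real. \<eta> > 1 \<longrightarrow>
    (\<exists>E :: complex set. polar E \<and>
      (\<forall>a. a \<notin> E \<longrightarrow> (\<forall>\<phi> :: sphere \<Rightarrow> real. C2_sphere \<phi> \<longrightarrow>
        (\<lambda>n. (\<integral>w. \<phi> w \<partial>pullback_dirac (deriv_at_critical_value d n) (Fin a)) / (real d ^ n - 1)
              - (\<integral>w. \<phi> w \<partial>harmonic_measure (- Fin ` connectedness_locus d) Infty))
          \<in> O(\<lambda>n. (\<eta> / real d) ^ n))))"
proof (intro allI impI)
  fix \<eta> :: real assume \<eta>: "\<eta> > 1"
  interpret unicritical_family d by unfold_locales (rule assms)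
  show "\<exists>E :: complex set. polar E \<and>
      (\<forall>a. a \<notin> E \<longrightarrow> (\<forall>\<phi> :: sphere \<Rightarrow> real. C2_sphere \<phi> \<longrightarrow>
        (\<lambda>n. (\<integral>w. \<phi> w \<partial>pullback_dirac (deriv_at_critical_value d n) (Fin a)) / (real d ^ n - 1)
              - (\<integral>w. \<phi> w \<partial>harmonic_measure (- Fin ` connectedness_locus d) Infty))
          \<in> O(\<lambda>n. (\<eta> / real d) ^ n)))"
  \<comment> \<open>The exceptional set is the pole set of a single potential, so it depends on d
    and \<eta> and not on the test function.\<close>
  proof (intro exI[of _ "{a. log_pot (weighted_images \<eta>) a = \<infinity>}"] conjI allI impI)
    show "polar {a. log_pot (weighted_images \<eta>) a = \<infinity>}"
      using finite_weighted_images[OF \<eta>] by (rule polar_log_pot) (simp add: weighted_images_def)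
  next
    fix a and \<phi> :: "sphere \<Rightarrow> real"
    assume "a \<notin> {a. log_pot (weighted_images \<eta>) a = \<infinity>}" "C2_sphere \<phi>"
    then show "(\<lambda>n. (\<integral>w. \<phi> w \<partial>pullback_dirac (deriv_at_critical_value d n) (Fin a)) / (real d ^ n - 1)
        - (\<integral>w. \<phi> w \<partial>harmonic_measure (- Fin ` connectedness_locus d) Infty)) \<in> O(\<lambda>n. (\<eta> / real d) ^ n)"
      by (intro equidistribution[OF \<eta>]) auto
  qed
qed

end
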